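(* A conformal structure $c$ on a manifold $M$ is a (local) conformal product structure if and only if it carries a Weyl structure with reducible holonomy. Moreover, the correspondence between the conformal product structures and the Weyl structures with reduced holonomy is one-to-one.
   Context: Manifolds are smooth. A conformal structure $c$ on $M$ is an equivalence class of Riemannian metrics modulo multiplication by positive functions. A Weyl structure on $(M,c)$ is a torsion-free linear connection $D$ on $TM$ preserving the conformal structure (i.e. a torsion-free connection on the bundle of conformal frames, with structure group $\mathrm{CO}(n)=\mathbb{R}^{+}\times \mathrm{O}(n)$). It has reducible (or reduced) holonomy if there is a non-trivial $D$-invariant orthogonal splitting $TM=H_1\oplus H_2$ of the tangent bundle. A submersion $p:(M,c)\to(N,c')$ between conformal manifolds is a conformal submersion if for every $x\in M$ the restriction of $dp_x$ to $(\ker dp_x)^{\perp}$ is a conformal isomorphism onto $T_{p(x)}N$. Given conformal manifolds $(M_1,c_1)$ and $(M_2,c_2)$, each of dimension at least $1$, a conformal structure on $M_1\times M_2$ is a conformal product of $(M_1,c_1)$ and $(M_2,c_2)$ if the canonical projections $p_i:M_1\times M_2\to M_i$ are orthogonal conformal submersions, i.e. both are conformal submersions and $\ker dp_1$ is orthogonal to $\ker dp_2$ at each point. "Local" means that the manifold with its conformal structure is locally of this form.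
   Formalization: A local conformal product structure is taken as a global pair of distributions tangent to the local factors (round S^4 is locally a product but its tangent bundle does not split), and a Weyl structure with reduced holonomy as a pair (D, invariant splitting), as flat D on R^3 has many splittings. *)

theory Defs
  imports "HOL-Analysis.Analysis"
begin

section \<open>Smooth maps between subsets of Euclidean spaces\<close>

text \<open>\<open>Ck_on k S f\<close> is used for \<open>S\<close> relatively open in a linear subspace \<open>E\<close>. The derivative
  within \<open>S\<close> is then determined exactly on \<open>E\<close>, and its values off \<open>E\<close> can always be chosen
  smoothly (compose with a projection onto \<open>E\<close>), so this is the usual notion on \<open>E\<close>.\<close>

primrec Ck_on ::
  "nat \<Rightarrow> 'e::real_normed_vector set \<Rightarrow> ('e \<Rightarrow> 'f::real_normed_vector) \<Rightarrow> bool" where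
  "Ck_on 0 S f \<longleftrightarrow> continuous_on S f"
| "Ck_on (Suc k) S f \<longleftrightarrow>
     (\<exists>f'. (\<forall>x\<in>S. (f has_derivative f' x) (at x within S)) \<and> (\<forall>v. Ck_on k S (\<lambda>x. f' x v)))"

definition smooth_on :: "'e::real_normed_vector set \<Rightarrow> ('e \<Rightarrow> 'f::real_normed_vector) \<Rightarrow> bool" where
  "smooth_on S f \<longleftrightarrow> (\<forall>k. Ck_on k S f)"

definition ddir :: "('e::real_normed_vector \<Rightarrow> 'f::real_normed_vector) \<Rightarrow> 'e \<Rightarrow> 'e \<Rightarrow> 'f" where
  "ddir f y e = vector_derivative (\<lambda>t. f (y + t *\<^sub>R e)) (at 0)"

section \<open>Smooth manifolds\<close>

text \<open>A chart is a domain together with a coordinate map, which is meaningful on the domain only.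
  The coordinates take values in a linear subspace \<open>model M\<close> of \<open>'e\<close>; the dimension
  of \<open>M\<close> is \<open>dim (model M)\<close>. (Subspaces are needed since the dimensions of the factors of a
  local product are existentially quantified.)\<close>

type_synonym ('a, 'e) chart = "'a set \<times> ('a \<Rightarrow> 'e)"

abbreviation cdom :: "('a, 'e) chart \<Rightarrow> 'a set" where "cdom \<equiv> fst"
abbreviation cmap :: "('a, 'e) chart \<Rightarrow> 'a \<Rightarrow> 'e" where "cmap \<equiv> snd"

definition cinv :: "('a, 'e) chart \<Rightarrow> 'e \<Rightarrow> 'a" where
  "cinv c = inv_into (cdom c) (cmap c)"

record ('a, 'e) mfd =
  mtop :: "'a topology"
  model :: "'e set"
  atlas :: "('a, 'e) chart set"

abbreviation points :: "('a, 'e) mfd \<Rightarrow> 'a set" where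
  "points M \<equiv> topspace (mtop M)"

definition smooth_manifold :: "('a, 'e::euclidean_space) mfd \<Rightarrow> bool" where
  "smooth_manifold M \<longleftrightarrow>
     Hausdorff_space (mtop M) \<and> second_countable (mtop M) \<and> subspace (model M) \<and>
     (\<forall>c\<in>atlas M. openin (mtop M) (cdom c) \<and>
        openin (top_of_set (model M)) (cmap c ` cdom c) \<and>
        homeomorphic_map (subtopology (mtop M) (cdom c)) (top_of_set (cmap c ` cdom c)) (cmap c)) \<and>
     (\<Union>c\<in>atlas M. cdom c) = points M \<and>
     (\<forall>c\<in>atlas M. \<forall>d\<in>atlas M. smooth_on (cmap c ` (cdom c \<inter> cdom d)) (cmap d \<circ> cinv c))"

definition charts_at :: "('a, 'e) mfd \<Rightarrow> 'a \<Rightarrow> ('a, 'e) chart set" where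
  "charts_at M x = {c \<in> atlas M. x \<in> cdom c}"

definition chart_at :: "('a, 'e) mfd \<Rightarrow> 'a \<Rightarrow> ('a, 'e) chart" where
  "chart_at M x = (SOME c. c \<in> charts_at M x)"

definition prod_mfd :: "('a, 'e) mfd \<Rightarrow> ('b, 'f) mfd \<Rightarrow> ('a \<times> 'b, 'e \<times> 'f) mfd" where
  "prod_mfd M N =
     \<lparr> mtop = prod_topology (mtop M) (mtop N),
       model = model M \<times> model N,
       atlas = {(cdom c \<times> cdom d, map_prod (cmap c) (cmap d)) | c d. c \<in> atlas M \<and> d \<in> atlas N} \<rparr>"

definition smooth_map_on ::
  "('a, 'e::euclidean_space) mfd \<Rightarrow> 'a set \<Rightarrow> ('b, 'f::euclidean_space) mfd \<Rightarrow> ('a \<Rightarrow> 'b) \<Rightarrow> bool" where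
  "smooth_map_on M U N p \<longleftrightarrow>
     openin (mtop M) U \<and> continuous_map (subtopology (mtop M) U) (mtop N) p \<and>
     (\<forall>c\<in>atlas M. \<forall>d\<in>atlas N.
        smooth_on (cmap c ` (cdom c \<inter> U \<inter> p -` cdom d)) (cmap d \<circ> p \<circ> cinv c))"

definition smooth_fun :: "('a, 'e::euclidean_space) mfd \<Rightarrow> ('a \<Rightarrow> real) \<Rightarrow> bool" where
  "smooth_fun M f \<longleftrightarrow> (\<forall>c\<in>atlas M. smooth_on (cmap c ` cdom c) (f \<circ> cinv c))"

definition open_embedding ::
  "('a, 'e::euclidean_space) mfd \<Rightarrow> ('b, 'f::euclidean_space) mfd \<Rightarrow> ('a \<Rightarrow> 'b) \<Rightarrow> bool" where
  "open_embedding N M \<Phi> \<longleftrightarrow>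
     smooth_map_on N (points N) M \<Phi> \<and> inj_on \<Phi> (points N) \<and>
     smooth_map_on M (\<Phi> ` points N) N (inv_into (points N) \<Phi>)"

section \<open>Tangent vectors, differentials, vector fields\<close>

text \<open>A tangent vector at \<open>x\<close> is the family of its components in the charts around \<open>x\<close>, related by
  the Jacobians of the coordinate changes; the family is \<open>0\<close> at all other arguments. The linear
  structure is pointwise.\<close>

type_synonym ('a, 'e) tvec = "('a, 'e) chart \<Rightarrow> 'e"

definition tangent_space :: "('a, 'e::euclidean_space) mfd \<Rightarrow> 'a \<Rightarrow> ('a, 'e) tvec set" where
  "tangent_space M x =
     {v. (\<forall>c. c \<notin> charts_at M x \<longrightarrow> v c = 0) \<and>
         (\<forall>c\<in>charts_at M x. v c \<in> model M) \<and>
         (\<forall>c\<in>charts_at M x. \<forall>d\<in>charts_at M x. v d = ddir (cmap d \<circ> cinv c) (cmap c x) (v c))}"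

abbreviation tzero :: "('a, 'e::euclidean_space) tvec" where
  "tzero \<equiv> (\<lambda>c. 0)"

abbreviation tadd :: "('a, 'e::euclidean_space) tvec \<Rightarrow> ('a, 'e) tvec \<Rightarrow> ('a, 'e) tvec" where
  "tadd v w \<equiv> (\<lambda>c. v c + w c)"

abbreviation tscale :: "real \<Rightarrow> ('a, 'e::euclidean_space) tvec \<Rightarrow> ('a, 'e) tvec" where
  "tscale r v \<equiv> (\<lambda>c. r *\<^sub>R v c)"

text \<open>The tangent vector at \<open>x\<close> with component \<open>e\<close> in the chart \<open>c\<close>.\<close>

definition coord_vec ::
  "('a, 'e::euclidean_space) mfd \<Rightarrow> ('a, 'e) chart \<Rightarrow> 'e \<Rightarrow> 'a \<Rightarrow> ('a, 'e) tvec" where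
  "coord_vec M c e x =
     (\<lambda>d. if d \<in> charts_at M x then ddir (cmap d \<circ> cinv c) (cmap c x) e else 0)"

definition differential ::
  "('a, 'e::euclidean_space) mfd \<Rightarrow> ('b, 'f::euclidean_space) mfd \<Rightarrow> ('a \<Rightarrow> 'b) \<Rightarrow> 'a \<Rightarrow>
     ('a, 'e) tvec \<Rightarrow> ('b, 'f) tvec" where
  "differential M N p x v =
     (let c = chart_at M x in
      (\<lambda>d. if d \<in> charts_at N (p x) then ddir (cmap d \<circ> p \<circ> cinv c) (cmap c x) (v c) else 0))"

definition ker_differential ::
  "('a, 'e::euclidean_space) mfd \<Rightarrow> ('b, 'f::euclidean_space) mfd \<Rightarrow> ('a \<Rightarrow> 'b) \<Rightarrow> 'a \<Rightarrow>
     ('a, 'e) tvec set" where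
  "ker_differential M N p x = {v \<in> tangent_space M x. differential M N p x v = tzero}"

definition vector_fields ::
  "('a, 'e::euclidean_space) mfd \<Rightarrow> ('a \<Rightarrow> ('a, 'e) tvec) set" where
  "vector_fields M =
     {X \<in> (\<Pi>\<^sub>E x\<in>points M. tangent_space M x).
        \<forall>c\<in>atlas M. smooth_on (cmap c ` cdom c) (\<lambda>y. X (cinv c y) c)}"

text \<open>\<open>deriv_along M X f\<close> is the function \<open>X(f)\<close>.\<close>

definition deriv_along ::
  "('a, 'e::euclidean_space) mfd \<Rightarrow> ('a \<Rightarrow> ('a, 'e) tvec) \<Rightarrow> ('a \<Rightarrow> real) \<Rightarrow> 'a \<Rightarrow> real" where
  "deriv_along M X f x = (let c = chart_at M x in ddir (f \<circ> cinv c) (cmap c x) (X x c))"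

definition bracket ::
  "('a, 'e::euclidean_space) mfd \<Rightarrow> ('a \<Rightarrow> ('a, 'e) tvec) \<Rightarrow> ('a \<Rightarrow> ('a, 'e) tvec) \<Rightarrow>
     'a \<Rightarrow> ('a, 'e) tvec" where
  "bracket M X Y x =
     (\<lambda>c. if c \<in> charts_at M x
          then ddir (\<lambda>y. Y (cinv c y) c) (cmap c x) (X x c)
             - ddir (\<lambda>y. X (cinv c y) c) (cmap c x) (Y x c)
          else 0)"

definition vf_add ::
  "('a, 'e::euclidean_space) mfd \<Rightarrow> ('a \<Rightarrow> ('a, 'e) tvec) \<Rightarrow> ('a \<Rightarrow> ('a, 'e) tvec) \<Rightarrow>
     'a \<Rightarrow> ('a, 'e) tvec" where
  "vf_add M X Y = (\<lambda>x\<in>points M. tadd (X x) (Y x))"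

definition vf_scale ::
  "('a, 'e::euclidean_space) mfd \<Rightarrow> ('a \<Rightarrow> real) \<Rightarrow> ('a \<Rightarrow> ('a, 'e) tvec) \<Rightarrow> 'a \<Rightarrow> ('a, 'e) tvec" where
  "vf_scale M f X = (\<lambda>x\<in>points M. tscale (f x) (X x))"

definition one_form ::
  "('a, 'e::euclidean_space) mfd \<Rightarrow> ('a \<Rightarrow> ('a, 'e) tvec \<Rightarrow> real) \<Rightarrow> bool" where
  "one_form M \<theta> \<longleftrightarrow>
     (\<forall>x\<in>points M. \<forall>v\<in>tangent_space M x. \<forall>w\<in>tangent_space M x. \<forall>r.
        \<theta> x (tadd v w) = \<theta> x v + \<theta> x w \<and> \<theta> x (tscale r v) = r * \<theta> x v) \<and>
     (\<forall>c\<in>atlas M. \<forall>e\<in>model M.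
        smooth_on (cmap c ` cdom c) (\<lambda>y. \<theta> (cinv c y) (coord_vec M c e (cinv c y))))"

section \<open>Conformal structures\<close>

type_synonym ('a, 'e) metric = "'a \<Rightarrow> ('a, 'e) tvec \<Rightarrow> ('a, 'e) tvec \<Rightarrow> real"

definition riemannian_metric :: "('a, 'e::euclidean_space) mfd \<Rightarrow> ('a, 'e) metric \<Rightarrow> bool" where
  "riemannian_metric M g \<longleftrightarrow>
     (\<forall>x\<in>points M. \<forall>u\<in>tangent_space M x. \<forall>v\<in>tangent_space M x. \<forall>w\<in>tangent_space M x. \<forall>r.
        g x (tadd u v) w = g x u w + g x v w \<and>
        g x (tscale r u) w = r * g x u w \<and>
        g x u v = g x v u \<and>
        (u \<noteq> tzero \<longrightarrow> g x u u > 0)) \<and>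
     (\<forall>c\<in>atlas M. \<forall>e\<in>model M. \<forall>e'\<in>model M.
        smooth_on (cmap c ` cdom c)
          (\<lambda>y. g (cinv c y) (coord_vec M c e (cinv c y)) (coord_vec M c e' (cinv c y))))"

text \<open>The factor relating two metrics is automatically smooth. Values of \<open>g\<close> outside the tangent
  spaces are irrelevant: functions differing only there lie in the same class.\<close>

definition conformal_rel ::
  "('a, 'e::euclidean_space) mfd \<Rightarrow> (('a, 'e) metric \<times> ('a, 'e) metric) set" where
  "conformal_rel M =
     {(g, g'). riemannian_metric M g \<and> riemannian_metric M g' \<and>
        (\<exists>f. \<forall>x\<in>points M. f x > 0 \<and>
           (\<forall>v\<in>tangent_space M x. \<forall>w\<in>tangent_space M x. g' x v w = f x * g x v w))}"

definition conformal_structures :: "('a, 'e::euclidean_space) mfd \<Rightarrow> ('a, 'e) metric set set" where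
  "conformal_structures M = {g. riemannian_metric M g} // conformal_rel M"

definition pullback ::
  "('a, 'e::euclidean_space) mfd \<Rightarrow> ('b, 'f::euclidean_space) mfd \<Rightarrow> ('a \<Rightarrow> 'b) \<Rightarrow>
     ('b, 'f) metric \<Rightarrow> ('a, 'e) metric" where
  "pullback N M \<Phi> g = (\<lambda>q v w. g (\<Phi> q) (differential N M \<Phi> q v) (differential N M \<Phi> q w))"

definition conformal_submersion ::
  "('a, 'e::euclidean_space) mfd \<Rightarrow> ('a, 'e) metric set \<Rightarrow>
   ('b, 'f::euclidean_space) mfd \<Rightarrow> ('b, 'f) metric set \<Rightarrow> ('a \<Rightarrow> 'b) \<Rightarrow> bool" where
  "conformal_submersion M c N c' p \<longleftrightarrow>
     smooth_map_on M (points M) N p \<and>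
     (\<forall>g\<in>c. \<forall>g'\<in>c'. \<forall>x\<in>points M.
        let hor = {v \<in> tangent_space M x. \<forall>w\<in>ker_differential M N p x. g x v w = 0} in
        bij_betw (differential M N p x) hor (tangent_space N (p x)) \<and>
        (\<exists>l>0. \<forall>v\<in>hor. \<forall>w\<in>hor.
           g' (p x) (differential M N p x v) (differential M N p x w) = l * g x v w))"

definition conformal_product ::
  "('a, 'e::euclidean_space) mfd \<Rightarrow> ('a, 'e) metric set \<Rightarrow>
   ('b, 'f::euclidean_space) mfd \<Rightarrow> ('b, 'f) metric set \<Rightarrow>
   ('a \<times> 'b, 'e \<times> 'f) metric set \<Rightarrow> bool" where
  "conformal_product M1 c1 M2 c2 c \<longleftrightarrow>
     smooth_manifold M1 \<and> smooth_manifold M2 \<and>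
     dim (model M1) \<ge> 1 \<and> dim (model M2) \<ge> 1 \<and>
     c1 \<in> conformal_structures M1 \<and> c2 \<in> conformal_structures M2 \<and>
     c \<in> conformal_structures (prod_mfd M1 M2) \<and>
     conformal_submersion (prod_mfd M1 M2) c M1 c1 fst \<and>
     conformal_submersion (prod_mfd M1 M2) c M2 c2 snd \<and>
     (\<forall>g\<in>c. \<forall>x\<in>points (prod_mfd M1 M2).
        \<forall>v\<in>ker_differential (prod_mfd M1 M2) M1 fst x.
        \<forall>w\<in>ker_differential (prod_mfd M1 M2) M2 snd x. g x v w = 0)"

text \<open>A local conformal product structure on \<open>(M, c)\<close> is recorded by the pair \<open>(H1, H2)\<close> of
  distributions tangent to the factors: around each point there is a conformal diffeomorphism from a
  conformal product onto an open subset, under which \<open>H1\<close> and \<open>H2\<close> are the tangent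
  spaces of the two factors. Recording the pair on all of \<open>M\<close> is what makes the various local
  product decompositions compatible. Taking the factors to be manifolds with points in \<open>'e\<close>
  is no restriction: a second countable manifold has at most the cardinality of the continuum, and
  its points can be renamed. The topology \<open>mtop\<close> need not be that of \<open>'e\<close>.\<close>

definition local_conformal_product ::
  "('a, 'e::euclidean_space) mfd \<Rightarrow> ('a, 'e) metric set \<Rightarrow>
   ('a \<Rightarrow> ('a, 'e) tvec set) \<times> ('a \<Rightarrow> ('a, 'e) tvec set) \<Rightarrow> bool" where
  "local_conformal_product M c = (\<lambda>(H1, H2).
     H1 \<in> extensional (points M) \<and> H2 \<in> extensional (points M) \<and>
     (\<forall>x\<in>points M. \<exists>(M1 :: ('e, 'e) mfd) c1 (M2 :: ('e, 'e) mfd) c2 c' \<Phi>.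
        conformal_product M1 c1 M2 c2 c' \<and>
        open_embedding (prod_mfd M1 M2) M \<Phi> \<and>
        x \<in> \<Phi> ` points (prod_mfd M1 M2) \<and>
        (\<forall>g\<in>c. pullback (prod_mfd M1 M2) M \<Phi> g \<in> c') \<and>
        (\<forall>q\<in>points (prod_mfd M1 M2).
           H1 (\<Phi> q) = differential (prod_mfd M1 M2) M \<Phi> q `
                         ker_differential (prod_mfd M1 M2) M2 snd q \<and>
           H2 (\<Phi> q) = differential (prod_mfd M1 M2) M \<Phi> q `
                         ker_differential (prod_mfd M1 M2) M1 fst q)))"

section \<open>Weyl structures\<close>

type_synonym ('a, 'e) connection =
  "('a \<Rightarrow> ('a, 'e) tvec) \<Rightarrow> ('a \<Rightarrow> ('a, 'e) tvec) \<Rightarrow> 'a \<Rightarrow> ('a, 'e) tvec"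

definition linear_connection ::
  "('a, 'e::euclidean_space) mfd \<Rightarrow> ('a, 'e) connection \<Rightarrow> bool" where
  "linear_connection M D \<longleftrightarrow>
     D \<in> vector_fields M \<rightarrow>\<^sub>E vector_fields M \<rightarrow>\<^sub>E vector_fields M \<and>
     (\<forall>X\<in>vector_fields M. \<forall>Y\<in>vector_fields M. \<forall>Z\<in>vector_fields M.
        D (vf_add M X Y) Z = vf_add M (D X Z) (D Y Z) \<and>
        D X (vf_add M Y Z) = vf_add M (D X Y) (D X Z)) \<and>
     (\<forall>X\<in>vector_fields M. \<forall>Y\<in>vector_fields M. \<forall>f. smooth_fun M f \<longrightarrow>
        D (vf_scale M f X) Y = vf_scale M f (D X Y) \<and>
        D X (vf_scale M f Y) =
          vf_add M (vf_scale M (deriv_along M X f) Y) (vf_scale M f (D X Y)))"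

definition torsion_free :: "('a, 'e::euclidean_space) mfd \<Rightarrow> ('a, 'e) connection \<Rightarrow> bool" where
  "torsion_free M D \<longleftrightarrow>
     (\<forall>X\<in>vector_fields M. \<forall>Y\<in>vector_fields M. \<forall>x\<in>points M.
        (\<lambda>c. D X Y x c - D Y X x c) = bracket M X Y x)"

text \<open>\<open>D\<close> preserves \<open>c\<close> iff \<open>D g = \<theta> \<otimes> g\<close> for some 1-form \<open>\<theta>\<close>, for each metric \<open>g\<close> in \<open>c\<close>.\<close>

definition preserves_conformal ::
  "('a, 'e::euclidean_space) mfd \<Rightarrow> ('a, 'e) metric set \<Rightarrow> ('a, 'e) connection \<Rightarrow> bool" where
  "preserves_conformal M c D \<longleftrightarrow>
     (\<forall>g\<in>c. \<exists>\<theta>. one_form M \<theta> \<and>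
        (\<forall>X\<in>vector_fields M. \<forall>Y\<in>vector_fields M. \<forall>Z\<in>vector_fields M. \<forall>x\<in>points M.
           deriv_along M X (\<lambda>z. g z (Y z) (Z z)) x
             - g x (D X Y x) (Z x) - g x (Y x) (D X Z x) = \<theta> x (X x) * g x (Y x) (Z x)))"

definition weyl_structure ::
  "('a, 'e::euclidean_space) mfd \<Rightarrow> ('a, 'e) metric set \<Rightarrow> ('a, 'e) connection \<Rightarrow> bool" where
  "weyl_structure M c D \<longleftrightarrow>
     linear_connection M D \<and> torsion_free M D \<and> preserves_conformal M c D"

text \<open>A smooth distribution (subbundle of the tangent bundle): locally spanned by a smooth frame,
  written in a chart.\<close>

definition smooth_distribution ::
  "('a, 'e::euclidean_space) mfd \<Rightarrow> ('a \<Rightarrow> ('a, 'e) tvec set) \<Rightarrow> bool" where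
  "smooth_distribution M H \<longleftrightarrow>
     H \<in> extensional (points M) \<and> (\<forall>x\<in>points M. H x \<subseteq> tangent_space M x) \<and>
     (\<forall>x\<in>points M. \<exists>c\<in>charts_at M x. \<exists>V k. \<exists>e :: nat \<Rightarrow> 'e \<Rightarrow> 'e.
        openin (mtop M) V \<and> x \<in> V \<and> V \<subseteq> cdom c \<and>
        (\<forall>i<k. smooth_on (cmap c ` V) (e i)) \<and>
        (\<forall>z\<in>V. inj_on (\<lambda>i. e i (cmap c z)) {..<k} \<and>
               independent ((\<lambda>i. e i (cmap c z)) ` {..<k}) \<and>
               (\<lambda>v. v c) ` H z = span ((\<lambda>i. e i (cmap c z)) ` {..<k})))"

text \<open>Non-triviality is required at every point; on a connected manifold this is the same as
  both subbundles being nonzero.\<close>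

definition orthogonal_splitting ::
  "('a, 'e::euclidean_space) mfd \<Rightarrow> ('a, 'e) metric set \<Rightarrow>
   ('a \<Rightarrow> ('a, 'e) tvec set) \<times> ('a \<Rightarrow> ('a, 'e) tvec set) \<Rightarrow> bool" where
  "orthogonal_splitting M c = (\<lambda>(H1, H2).
     smooth_distribution M H1 \<and> smooth_distribution M H2 \<and>
     (\<forall>x\<in>points M.
        H1 x \<noteq> {tzero} \<and> H2 x \<noteq> {tzero} \<and>
        tangent_space M x = {tadd v w | v w. v \<in> H1 x \<and> w \<in> H2 x} \<and>
        H1 x \<inter> H2 x = {tzero} \<and>
        (\<forall>g\<in>c. \<forall>v\<in>H1 x. \<forall>w\<in>H2 x. g x v w = 0)))"

definition invariant_distribution ::
  "('a, 'e::euclidean_space) mfd \<Rightarrow> ('a, 'e) connection \<Rightarrow> ('a \<Rightarrow> ('a, 'e) tvec set) \<Rightarrow> bool" where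
  "invariant_distribution M D H \<longleftrightarrow>
     (\<forall>X\<in>vector_fields M. \<forall>Y\<in>vector_fields M.
        (\<forall>x\<in>points M. Y x \<in> H x) \<longrightarrow> (\<forall>x\<in>points M. D X Y x \<in> H x))"

definition reduction ::
  "('a, 'e::euclidean_space) mfd \<Rightarrow> ('a, 'e) metric set \<Rightarrow> ('a, 'e) connection \<Rightarrow>
   ('a \<Rightarrow> ('a, 'e) tvec set) \<times> ('a \<Rightarrow> ('a, 'e) tvec set) \<Rightarrow> bool" where
  "reduction M c D = (\<lambda>(H1, H2).
     orthogonal_splitting M c (H1, H2) \<and>
     invariant_distribution M D H1 \<and> invariant_distribution M D H2)"

definition reducible_holonomy ::
  "('a, 'e::euclidean_space) mfd \<Rightarrow> ('a, 'e) metric set \<Rightarrow> ('a, 'e) connection \<Rightarrow> bool" where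
  "reducible_holonomy M c D \<longleftrightarrow> (\<exists>S. reduction M c D S)"

end

theory Submission
  imports Defs
begin

text \<open>A local conformal product structure amounts to a pair of complementary orthogonal foliations \<open>H\<close> and \<open>K\<close>
 whose flows act conformally on each other: there is a one-form \<open>\<theta>\<close> with \<open>L\<^sub>Z g = \<theta>(Z) g\<close> on \<open>H\<close> for \<open>Z\<close> in \<open>K\<close>, and on
 \<open>K\<close> for \<open>Z\<close> in \<open>H\<close>. The metric \<open>g\<close> determines \<open>\<theta>\<close>, and the Koszul formula for \<open>D g = \<theta> \<otimes> g\<close> determines a
 torsion-free connection \<open>D\<close>. The conditions on \<open>H\<close> and \<open>K\<close> say precisely that the mixed terms of this formula vanish,
 that is, that \<open>D\<close> preserves the splitting.

 Conversely, the Frobenius theorem straightens both foliations simultaneously, to the translates of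
 two complementary subspaces. In these coordinates \<open>L\<^sub>Z g = \<theta>(Z) g\<close> says that the ratios of the coefficients of \<open>g\<close> on
 \<open>H\<close> are constant along \<open>K\<close>, so that boxes in the two subspaces are the factors of a conformal product.\<close>

section \<open>Calculus of smooth maps\<close>

text \<open>Two obstacles shape the proof. Connections accept global vector fields only, whereas the
  geometric arguments are local; cut-off functions turn local fields into global ones
  (\<open>extend_field\<close>), and tensorial identities are tested on global fields through
  prescribed vectors. Moreover, the factors of a local product are modelled on subspaces of unknown
  dimension, so derivatives must make sense on relatively open subsets of subspaces;
  \<open>ddir\<close> looks at a line only, and in directions of the subspace a short piece of the
  line stays inside.

  The one-form carries the bijection. Both foliations have positive dimension, so each has a vector
  with g(X, X) > 0 and L_Z g = \<theta>(Z) g can be solved for \<theta>(Z). Hence the local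
  expressions of \<theta>, logarithmic differentials of conformal factors, glue without a partition
  of unity, and two Weyl structures that reduce to the same pair coincide.

  The analytic core is smooth dependence of flows on initial values: curves are fixed points in the
  Banach space of bounded continuous functions, for fields cut off to compact support.\<close>

lemma linear_on_Basis_sum:
 assumes "linear L" shows "L (w::'a::euclidean_space) = (\<Sum>b\<in>Basis. (w \<bullet> b) *\<^sub>R L b)"
proof -
 have "L w = L (\<Sum>b\<in>Basis. (w \<bullet> b) *\<^sub>R b)" by (simp only: euclidean_representation)
 then show ?thesis by (simp only: linear_sum[OF assms] linear_scale[OF assms])
qed

lemma Ck_on_SucE:
 assumes "Ck_on (Suc k) S f"
 obtains f' where "!!x. x \<in> S ==> (f has_derivative f' x) (at x within S)"
  "!!v. Ck_on k S (%x. f' x v)"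
 using assms by auto

lemma Ck_on_Suc_withinI:
 assumes "!!x. x \<in> S ==> (f has_derivative f' x) (at x within S)" "!!v. Ck_on k S (%x. f' x v)"
 shows "Ck_on (Suc k) S f"
 using assms by auto

lemma Ck_on_continuous_on: "Ck_on k S f ==> continuous_on S f"
 by (cases k) (auto simp: continuous_on_eq_continuous_within intro: has_derivative_continuous elim!: Ck_on_SucE simp del: Ck_on.simps(2))

lemma Ck_on_SucD: "Ck_on (Suc k) S f ==> Ck_on k S f"
proof (induction k arbitrary: f)
 case 0
 then show ?case using Ck_on_continuous_on[of "Suc 0" S f] by simp
next
 case (Suc k)
 from Ck_on_SucE[OF Suc.prems] obtain f'
  where f': "!!x. x \<in> S ==> (f has_derivative f' x) (at x within S)"
  and *: "!!v. Ck_on (Suc k) S (%x. f' x v)" by blast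
 show ?case by (rule Ck_on_Suc_withinI[OF f' Suc.IH[OF *]])
qed

lemma Ck_on_subset: "Ck_on k S f ==> T \<subseteq> S ==> Ck_on k T f"
proof (induction k arbitrary: f)
 case 0
 then show ?case using continuous_on_subset by auto
next
 case (Suc k)
 from Ck_on_SucE[OF Suc.prems(1)] obtain f'
  where f': "!!x. x \<in> S ==> (f has_derivative f' x) (at x within S)"
  and *: "!!v. Ck_on k S (%x. f' x v)" by blast
 show ?case
  by (rule Ck_on_Suc_withinI[where f' = f'])
   (use f' * Suc has_derivative_subset in blast)+
qed

lemma Ck_on_cong:
 assumes "!!x. x \<in> S ==> f x = g x" shows "Ck_on k S f \<longleftrightarrow> Ck_on k S g"
proof -
 have aux: "Ck_on k S g" if "!!x. x \<in> S ==> f x = g x" "Ck_on k S f" for f g :: "'a => 'b"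
 proof (cases k)
  case 0
  then show ?thesis using that continuous_on_eq by auto
 next
  case (Suc n)
  from Ck_on_SucE[OF that(2)[unfolded Suc]] obtain f'
   where f': "!!x. x \<in> S ==> (f has_derivative f' x) (at x within S)"
   and *: "!!v. Ck_on n S (%x. f' x v)" by blast
  have "(g has_derivative f' x) (at x within S)" if "x \<in> S" for x
   using has_derivative_transform[OF that _ f'[OF that], of g] \<open>!!x. x \<in> S ==> f x = g x\<close> by auto
  then show ?thesis using * Suc by auto
 qed
 show ?thesis using aux[of f g] aux[of g f] assms by auto
qed

lemma Ck_on_const: "Ck_on k S (%x. c)"
 by (induction k arbitrary: c) (auto intro!: exI[of _ "%x v. 0"])

lemma Ck_on_bounded_linear: "bounded_linear L ==> Ck_on k S L"
 by (cases k) (auto intro!: exI[of _ "%x. L"] Ck_on_const bounded_linear_imp_has_derivative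
   linear_continuous_on)

lemma Ck_on_linear_comp:
 assumes "bounded_linear L" "Ck_on k S f"
 shows "Ck_on k S (%x. L (f x))"
 using assms(2)
proof (induction k arbitrary: f)
 case 0
 then show ?case using assms(1) linear_continuous_on_compose by (auto simp: bounded_linear.continuous_on)
next
 case (Suc k)
 from Ck_on_SucE[OF Suc.prems(1)] obtain f'
  where f': "!!x. x \<in> S ==> (f has_derivative f' x) (at x within S)"
  and *: "!!v. Ck_on k S (%x. f' x v)" by blast
 show ?case
  by (rule Ck_on_Suc_withinI[where f' = "%x v. L (f' x v)"])
   (auto intro!: bounded_linear.has_derivative[OF assms(1)] f' Suc.IH *)
qed

lemma Ck_on_add:
 assumes "Ck_on k S f" "Ck_on k S g"
 shows "Ck_on k S (%x. f x + g x)"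
 using assms
proof (induction k arbitrary: f g)
 case 0
 then show ?case by (auto intro: continuous_intros)
next
 case (Suc k)
 from Ck_on_SucE[OF Suc.prems(1)] obtain f'
  where f': "!!x. x \<in> S ==> (f has_derivative f' x) (at x within S)"
  and *: "!!v. Ck_on k S (%x. f' x v)" by blast
 from Ck_on_SucE[OF Suc.prems(2)] obtain g'
  where g': "!!x. x \<in> S ==> (g has_derivative g' x) (at x within S)"
  and **: "!!v. Ck_on k S (%x. g' x v)" by blast
 show ?case
  by (rule Ck_on_Suc_withinI[where f' = "%x v. f' x v + g' x v"])
   (auto intro!: has_derivative_add f' g' Suc.IH * **)
qed

lemma Ck_on_sum:
 "(!!i. i \<in> I ==> Ck_on k S (f i)) ==> Ck_on k S (%x. \<Sum>i\<in>I. f i x)"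
 by (induction I rule: infinite_finite_induct) (auto intro: Ck_on_const Ck_on_add)

lemma Ck_on_bilinear:
 assumes b: "bounded_bilinear b" and "Ck_on k S f" "Ck_on k S g"
 shows "Ck_on k S (%x. b (f x) (g x))"
 using assms(2,3)
proof (induction k arbitrary: f g)
 case 0
 then show ?case using bounded_bilinear.continuous_on[OF b] by auto
next
 case (Suc k)
 from Ck_on_SucE[OF Suc.prems(1)] obtain f'
  where f': "!!x. x \<in> S ==> (f has_derivative f' x) (at x within S)"
  and *: "!!v. Ck_on k S (%x. f' x v)" by blast
 from Ck_on_SucE[OF Suc.prems(2)] obtain g'
  where g': "!!x. x \<in> S ==> (g has_derivative g' x) (at x within S)"
  and **: "!!v. Ck_on k S (%x. g' x v)" by blast
 have "Ck_on k S f" "Ck_on k S g" using Suc.prems Ck_on_SucD by blast+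
 then show ?case
  by (intro Ck_on_Suc_withinI[where f' = "%x v. b (f x) (g' x v) + b (f' x v) (g x)"])
   (auto intro!: bounded_bilinear.FDERIV[OF b] f' g' Ck_on_add Suc.IH * **)
qed

lemma Ck_on_compose:
 fixes f :: "'a::real_normed_vector => 'b::euclidean_space"
 assumes "Ck_on k S f" "Ck_on k T g" "f ` S \<subseteq> T"
 shows "Ck_on k S (%x. g (f x))"
 using assms
proof (induction k arbitrary: g)
 case 0
 then show ?case using continuous_on_compose2[of T g S f] by auto
next
 case (Suc k)
 from Ck_on_SucE[OF Suc.prems(1)] obtain f'
  where f': "!!x. x \<in> S ==> (f has_derivative f' x) (at x within S)"
  and *: "!!v. Ck_on k S (%x. f' x v)" by blast
 from Ck_on_SucE[OF Suc.prems(2)] obtain g'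
  where g': "!!x. x \<in> T ==> (g has_derivative g' x) (at x within T)"
  and **: "!!v. Ck_on k T (%x. g' x v)" by blast
 have fk: "Ck_on k S f" using Suc.prems Ck_on_SucD by blast
 \<comment> \<open>The chain rule produces \<open>g' (f x) (f' x v)\<close>, whose vector argument
   moves with \<open>x\<close>, while \<open>Ck_on\<close> controls derivatives in fixed directions
   only. Expanding \<open>f' x v\<close> in the basis leaves products of class k functions; this is
   why the intermediate space is Euclidean.\<close>
 let ?h = "%x v. \<Sum>b\<in>Basis. (f' x v \<bullet> b) *\<^sub>R g' (f x) b"
 have "((%x. g (f x)) has_derivative ?h x) (at x within S)" if x: "x \<in> S" for x
 proof -
  have fx: "f x \<in> T" using x Suc.prems(3) by auto
  have "(g has_derivative g' (f x)) (at (f x) within f ` S)"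
   using has_derivative_subset[OF g'[OF fx] Suc.prems(3)] .
  from has_derivative_in_compose[OF f'[OF x] this]
  have 1: "((%x. g (f x)) has_derivative (%v. g' (f x) (f' x v))) (at x within S)" .
  have lin: "linear (g' (f x))" using g'[OF fx] has_derivative_linear by blast
  have "g' (f x) w = (\<Sum>b\<in>Basis. (w \<bullet> b) *\<^sub>R g' (f x) b)" for w
   by (rule linear_on_Basis_sum[OF lin])
  then have "?h x = (%v. g' (f x) (f' x v))" by (intro ext) (rule sym)
  then show ?thesis using 1 by simp
 qed
 moreover have "Ck_on k S (%x. ?h x v)" for v
  by (intro Ck_on_sum Ck_on_bilinear[OF bounded_bilinear_scaleR] Suc.IH fk ** Suc.prems(3)
    Ck_on_linear_comp[OF bounded_linear_inner_left] *)
 ultimately show ?case by (rule Ck_on_Suc_withinI)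
qed

text \<open>The derivative is a polynomial in \<open>inverse\<close> itself, so one degree of
  smoothness gives the next. The same bootstrapping recurs for operator inverses, inverse functions
  and flows.\<close>

lemma Ck_on_inverse: "Ck_on k (-{0::real}) inverse"
proof (induction k)
 case 0
 then show ?case by (auto intro!: continuous_intros)
next
 case (Suc k)
 have "(inverse has_derivative (%v. - (inverse x * v * inverse x))) (at x within -{0})"
  if "x \<in> -{0}" for x :: real
  using that by (intro has_derivative_inverse') auto
 moreover have "Ck_on k (-{0::real}) (%x. - (inverse x * v * inverse x))" for v
  by (intro Ck_on_linear_comp[OF bounded_linear_minus[OF bounded_linear_ident]]
    Ck_on_bilinear[OF bounded_bilinear_mult] Suc Ck_on_const)
 ultimately show ?case by (rule Ck_on_Suc_withinI)
qed

lemma smooth_on_imp_Ck: "smooth_on S f ==> Ck_on k S f"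
 by (simp add: smooth_on_def)

lemma smooth_on_subset: "smooth_on S f ==> T \<subseteq> S ==> smooth_on T f"
 unfolding smooth_on_def using Ck_on_subset by blast

lemma smooth_on_cong:
 assumes "!!x. x \<in> S ==> f x = g x" shows "smooth_on S f \<longleftrightarrow> smooth_on S g"
 unfolding smooth_on_def using Ck_on_cong[of S f g] assms by blast

lemma smooth_on_const: "smooth_on S (%x. c)"
 by (simp add: smooth_on_def Ck_on_const)

lemma smooth_on_bounded_linear: "bounded_linear L ==> smooth_on S L"
 by (simp add: smooth_on_def Ck_on_bounded_linear)

lemma smooth_on_ident: "smooth_on S (%x. x)"
 by (intro smooth_on_bounded_linear bounded_linear_ident)

lemma smooth_on_linear_comp:
 "bounded_linear L ==> smooth_on S f ==> smooth_on S (%x. L (f x))"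
 by (simp add: smooth_on_def Ck_on_linear_comp)

lemma smooth_on_add: "smooth_on S f ==> smooth_on S g ==> smooth_on S (%x. f x + g x)"
 by (simp add: smooth_on_def Ck_on_add)

lemma smooth_on_minus: "smooth_on S f ==> smooth_on S (%x. - f x)"
 by (rule smooth_on_linear_comp[OF bounded_linear_minus[OF bounded_linear_ident]])

lemma smooth_on_diff: "smooth_on S f ==> smooth_on S g ==> smooth_on S (%x. f x - g x)"
 using smooth_on_add[of S f "%x. - g x"] smooth_on_minus[of S g] by simp

lemma smooth_on_sum:
 "(!!i. i \<in> I ==> smooth_on S (f i)) ==> smooth_on S (%x. \<Sum>i\<in>I. f i x)"
 by (simp add: smooth_on_def Ck_on_sum)

lemma smooth_on_bilinear:
 "bounded_bilinear b ==> smooth_on S f ==> smooth_on S g ==> smooth_on S (%x. b (f x) (g x))"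
 by (simp add: smooth_on_def Ck_on_bilinear)

lemmas smooth_on_scaleR = smooth_on_bilinear[OF bounded_bilinear_scaleR]
lemmas smooth_on_mult = smooth_on_bilinear[OF bounded_bilinear_mult]
lemmas smooth_on_inner = smooth_on_bilinear[OF bounded_bilinear_inner]

lemma smooth_on_compose:
 fixes f :: "'a::real_normed_vector => 'b::euclidean_space"
 shows "smooth_on S f ==> smooth_on T g ==> f ` S \<subseteq> T ==> smooth_on S (%x. g (f x))"
 unfolding smooth_on_def using Ck_on_compose[of _ S f T g] by auto

lemma smooth_on_inverse:
 fixes f :: "'a::real_normed_vector => real"
 shows "smooth_on S f ==> (!!x. x \<in> S ==> f x \<noteq> 0) ==> smooth_on S (%x. inverse (f x))"
 by (rule smooth_on_compose[where T = "-{0}"]) (auto simp: smooth_on_def Ck_on_inverse)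

lemma smooth_on_divide:
 fixes f :: "'a::real_normed_vector => real"
 shows "smooth_on S f ==> smooth_on S g ==> (!!x. x \<in> S ==> g x \<noteq> 0) ==> smooth_on S (%x. f x / g x)"
 unfolding divide_inverse by (intro smooth_on_mult smooth_on_inverse) auto

lemma smooth_on_Pair:
 assumes "smooth_on S f" "smooth_on S g"
 shows "smooth_on S (%x. (f x, g x))"
proof -
 have "bounded_linear (%x::'b. (x, 0::'c))" "bounded_linear (%x::'c. (0::'b, x))"
  by (intro bounded_linear_Pair bounded_linear_ident bounded_linear_zero)+
 from smooth_on_add[OF this[THEN smooth_on_linear_comp] ] assms
 have "smooth_on S (%x. (f x, 0) + (0, g x))" by blast
 then show ?thesis by simp
qed

lemma smooth_on_fst: "smooth_on S f ==> smooth_on S (%x. fst (f x))"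
 by (rule smooth_on_linear_comp[OF bounded_linear_fst])

lemma smooth_on_snd: "smooth_on S f ==> smooth_on S (%x. snd (f x))"
 by (rule smooth_on_linear_comp[OF bounded_linear_snd])

lemma smooth_on_continuous_on: "smooth_on S f ==> continuous_on S f"
 unfolding smooth_on_def using Ck_on_continuous_on by blast

section \<open>Directional derivatives\<close>

lemma ddir_eq:
 assumes "(f has_derivative f') (at y)"
 shows "ddir f y e = f' e"
proof -
 have "((%t. f (y + t *\<^sub>R e)) has_derivative (%t. f' (t *\<^sub>R e))) (at (0::real))"
  by (rule has_derivative_compose[of "%t::real. y + t *\<^sub>R e" "%t. t *\<^sub>R e" 0 UNIV f f'])
   (use assms in \<open>auto intro!: derivative_eq_intros\<close>)
 moreover have "linear f'" using assms has_derivative_linear by blast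
 ultimately have "((%t. f (y + t *\<^sub>R e)) has_vector_derivative f' e) (at 0)"
  unfolding has_vector_derivative_def by (simp add: linear_scale)
 then show ?thesis unfolding ddir_def by (rule vector_derivative_at)
qed

text \<open>The line through \<open>y\<close> in a direction of \<open>E\<close> stays in the
  relatively open set for small times, so the derivative along the line sees values of
  \<open>f\<close> on \<open>S\<close> only.\<close>

lemma ddir_eq_subspace:
 assumes f: "(f has_derivative f') (at y within S)" and E: "subspace E"
  and S: "openin (top_of_set E) S" and y: "y \<in> S" and e: "e \<in> E"
 shows "ddir f y e = f' e"
proof -
 obtain U where U: "open U" "S = E \<inter> U" using S by (auto simp: openin_open)
 let ?T = "(%t::real. y + t *\<^sub>R e) -` U"
 have T: "open ?T" by (intro open_vimage U continuous_intros)
 have 0: "0 \<in> ?T" using y U by auto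
 have im: "(%t::real. y + t *\<^sub>R e) ` ?T \<subseteq> S"
  using U y e E by (auto intro!: subspace_add subspace_scale)
 have "((%t. f (y + t *\<^sub>R e)) has_derivative (%t. f' (t *\<^sub>R e))) (at (0::real) within ?T)"
  by (rule has_derivative_in_compose[of "%t::real. y + t *\<^sub>R e" "%t. t *\<^sub>R e" 0 ?T f f'])
   (use has_derivative_subset[OF f im] in \<open>auto intro!: derivative_eq_intros simp del: image_vimage_eq\<close>)
 then have "((%t. f (y + t *\<^sub>R e)) has_derivative (%t. f' (t *\<^sub>R e))) (at (0::real))"
  using at_within_open[OF 0 T] by simp
 moreover have "linear f'" using f has_derivative_linear by blast
 ultimately have "((%t. f (y + t *\<^sub>R e)) has_vector_derivative f' e) (at 0)"
  unfolding has_vector_derivative_def by (simp add: linear_scale)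
 then show ?thesis unfolding ddir_def by (rule vector_derivative_at)
qed

lemma Ck_on_Suc_has_derivative:
 assumes "Ck_on (Suc k) S f" "open S" "x \<in> S"
 shows "(f has_derivative ddir f x) (at x)"
proof -
 from Ck_on_SucE[OF assms(1)] obtain f'
  where "!!x. x \<in> S ==> (f has_derivative f' x) (at x within S)"
  and "!!v. Ck_on k S (%x. f' x v)" by blast
 then have f': "(f has_derivative f' x) (at x)" using assms(3) at_within_open[OF assms(3,2)] by fastforce
 have "ddir f x = f' x" by (rule ext) (rule ddir_eq[OF f'])
 then show ?thesis using f' by simp
qed

lemma Ck_on_Suc_ddir:
 assumes "Ck_on (Suc k) S f" "open S"
 shows "Ck_on k S (%x. ddir f x v)"
proof -
 from Ck_on_SucE[OF assms(1)] obtain f'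
  where f': "!!x. x \<in> S ==> (f has_derivative f' x) (at x within S)"
  and *: "!!v. Ck_on k S (%x. f' x v)" by blast
 have "ddir f x v = f' x v" if "x \<in> S" for x
  using f'[OF that] by (simp add: at_within_open[OF that assms(2)] ddir_eq)
 then show ?thesis using *[of v] Ck_on_cong[of S "%x. ddir f x v" "%x. f' x v" k] by simp
qed

lemma Ck_on_SucI:
 assumes "open S" "!!x. x \<in> S ==> f differentiable (at x)" "!!v. Ck_on k S (%x. ddir f x v)"
 shows "Ck_on (Suc k) S f"
proof -
 have "(f has_derivative ddir f x) (at x)" if x: "x \<in> S" for x
 proof -
  obtain f' where f': "(f has_derivative f') (at x)" using assms(2)[OF x] by (auto simp: differentiable_def)
  have "ddir f x = f'" by (rule ext) (rule ddir_eq[OF f'])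
 then show ?thesis using f' by simp
 qed
 then show ?thesis using assms(3) has_derivative_at_withinI Ck_on_Suc_withinI by metis
qed

lemma smooth_on_has_derivative:
 "smooth_on S f ==> open S ==> x \<in> S ==> (f has_derivative ddir f x) (at x)"
 unfolding smooth_on_def using Ck_on_Suc_has_derivative by blast

lemma smooth_on_ddir: "smooth_on S f ==> open S ==> smooth_on S (%x. ddir f x v)"
 unfolding smooth_on_def using Ck_on_Suc_ddir by blast

lemma has_derivative_ddir:
 assumes "f differentiable (at x)" shows "(f has_derivative ddir f x) (at x)"
proof -
 obtain f' where f': "(f has_derivative f') (at x)" using assms by (auto simp: differentiable_def)
 have "ddir f x = f'" by (rule ext) (rule ddir_eq[OF f'])
 then show ?thesis using f' by simp
qed

lemma smooth_on_diffble: "smooth_on S f ==> open S ==> x \<in> S ==> f differentiable (at x)"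
 using smooth_on_has_derivative differentiable_def by blast

lemma bounded_linear_ddir: "f differentiable (at x) ==> bounded_linear (ddir f x)"
 using has_derivative_ddir has_derivative_bounded_linear by blast

lemma ddir_cong:
 assumes "open S" "x \<in> S" "!!y. y \<in> S ==> f y = g y"
 shows "ddir f x v = ddir g x v"
proof -
 have 0: "eventually (%t. x + t *\<^sub>R v \<in> S) (at (0::real))"
 proof -
  have "open ((%t::real. x + t *\<^sub>R v) -` S)" by (intro open_vimage assms continuous_intros)
  then show ?thesis using assms(2) by (auto simp: eventually_at_topological)
 qed
 have "((%t. f (x + t *\<^sub>R v)) has_vector_derivative D) (at 0) \<longleftrightarrow>
   ((%t. g (x + t *\<^sub>R v)) has_vector_derivative D) (at 0)" for D
  by (rule has_vector_derivative_cong_ev)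
   (use 0 assms in \<open>auto simp: eventually_at_filter elim!: eventually_mono\<close>)
 then show ?thesis unfolding ddir_def vector_derivative_def by simp
qed

text \<open>For open \<open>S\<close> the derivative can be taken to be \<open>ddir f x\<close>,
  which depends only on values near \<open>x\<close>; derivatives chosen on different neighbourhoods
  therefore fit together, and the induction passes to \<open>ddir f x v\<close>.\<close>

lemma Ck_on_local:
 assumes S: "open S" and loc: "!!x. x \<in> S ==> \<exists>U. open U \<and> x \<in> U \<and> Ck_on k (S \<inter> U) f"
 shows "Ck_on k S f"
 using loc
proof (induction k arbitrary: f)
 case 0
 have "continuous (at x within S) f" if x: "x \<in> S" for x
 proof -
  obtain U where U: "open U" "x \<in> U" "continuous_on (S \<inter> U) f" using 0[OF x] by auto
  then show ?thesis
   using x S by (metis IntI at_within_open continuous_on_eq_continuous_at continuous_at_imp_continuous_at_within open_Int)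
 qed
 then show ?case by (simp add: continuous_on_eq_continuous_within)
next
 case (Suc k)
 have loc': "\<exists>U. open U \<and> x \<in> U \<and> Ck_on (Suc k) (S \<inter> U) f" if "x \<in> S" for x
  using Suc.prems[OF that] .
 show ?case
 proof (rule Ck_on_SucI[OF S])
  fix x assume x: "x \<in> S"
  then obtain U where "open U" "x \<in> U" "Ck_on (Suc k) (S \<inter> U) f" using loc' by blast
  then show "f differentiable (at x)"
   using Ck_on_Suc_has_derivative[of k "S \<inter> U" f x] x S by (auto simp: differentiable_def)
 next
  fix v
  show "Ck_on k S (%x. ddir f x v)"
  proof (rule Suc.IH)
   fix x assume x: "x \<in> S"
   then obtain U where "open U" "x \<in> U" "Ck_on (Suc k) (S \<inter> U) f" using loc' by blast
   then show "\<exists>U. open U \<and> x \<in> U \<and> Ck_on k (S \<inter> U) (%x. ddir f x v)"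
    using Ck_on_Suc_ddir[of k "S \<inter> U"] S by auto
  qed
 qed
qed

lemma smooth_on_local:
 assumes S: "open S" and loc: "!!x. x \<in> S ==> \<exists>U. open U \<and> x \<in> U \<and> smooth_on (S \<inter> U) f"
 shows "smooth_on S f"
 unfolding smooth_on_def
proof
 fix k show "Ck_on k S f"
  by (rule Ck_on_local[OF S]) (meson loc smooth_on_imp_Ck)
qed

lemma ddir_compose:
 assumes "f differentiable (at x)" "g differentiable (at (f x))"
 shows "ddir (%x. g (f x)) x v = ddir g (f x) (ddir f x v)"
 by (rule ddir_eq) (rule has_derivative_compose[OF assms[THEN has_derivative_ddir]])

lemma ddir_bilinear:
 assumes "bounded_bilinear b" "f differentiable (at x)" "g differentiable (at x)"
 shows "ddir (%x. b (f x) (g x)) x v = b (f x) (ddir g x v) + b (ddir f x v) (g x)"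
 by (rule ddir_eq) (rule bounded_bilinear.FDERIV[OF assms(1) assms(2,3)[THEN has_derivative_ddir]])

lemma ddir_linear_comp:
 assumes "bounded_linear L" "f differentiable (at x)"
 shows "ddir (%x. L (f x)) x v = L (ddir f x v)"
 by (rule ddir_eq) (rule bounded_linear.has_derivative[OF assms(1) assms(2)[THEN has_derivative_ddir]])

lemma ddir_bounded_linear: "bounded_linear L ==> ddir L x v = L v"
 by (rule ddir_eq) (rule bounded_linear_imp_has_derivative)

lemma ddir_const: "ddir (%x. c) x v = 0"
 by (rule ddir_eq) simp

lemma ddir_add:
 assumes "f differentiable (at x)" "g differentiable (at x)"
 shows "ddir (%x. f x + g x) x v = ddir f x v + ddir g x v"
 by (rule ddir_eq) (rule has_derivative_add[OF assms[THEN has_derivative_ddir]])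

lemma ddir_diff:
 assumes "f differentiable (at x)" "g differentiable (at x)"
 shows "ddir (%x. f x - g x) x v = ddir f x v - ddir g x v"
 by (rule ddir_eq) (rule has_derivative_diff[OF assms[THEN has_derivative_ddir]])

text \<open>Basis expansion makes the evaluation a finite sum of products. Smoothness of
  \<open>F\<close> is asked for each fixed vector, the form in which Jacobians, metrics, projections
  and Christoffel symbols are known.\<close>

lemma smooth_on_apply:
 fixes u :: "'a::real_normed_vector => 'b::euclidean_space"
 assumes "!!v. smooth_on S (%x. F x v)" "smooth_on S u" "!!x. x \<in> S ==> linear (F x)"
 shows "smooth_on S (%x. F x (u x))"
proof -
 have "smooth_on S (%x. \<Sum>b\<in>Basis. (u x \<bullet> b) *\<^sub>R F x b)"
  by (intro smooth_on_sum smooth_on_scaleR smooth_on_inner assms smooth_on_const)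
 then show ?thesis
  using smooth_on_cong[of S "%x. F x (u x)", OF linear_on_Basis_sum[OF assms(3)]] by simp
qed

lemma smooth_on_ddir_apply:
 fixes u :: "'a::real_normed_vector => 'b::euclidean_space"
 assumes "smooth_on T f" "open T" "smooth_on S p" "p ` S \<subseteq> T" "smooth_on S u"
 shows "smooth_on S (%x. ddir f (p x) (u x))"
proof (rule smooth_on_apply)
 show "smooth_on S (%x. ddir f (p x) v)" for v
  by (rule smooth_on_compose[OF assms(3) smooth_on_ddir[OF assms(1,2)] assms(4)])
 show "linear (ddir f (p x))" if "x \<in> S" for x
  using smooth_on_has_derivative[OF assms(1,2), of "p x"] that assms(4) has_derivative_linear by blast
qed (fact assms)

text \<open>Both the linear map and its argument vary; after basis expansion the Leibniz rule
  applies to each product. Linearity on a neighbourhood makes the expansion valid for nearby points,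
  as differentiation requires.\<close>

lemma ddir_apply:
 fixes u :: "'a::real_normed_vector => 'b::euclidean_space"
 assumes F: "!!v. (%x. F x v) differentiable (at x)" and u: "u differentiable (at x)"
  and lin: "!!x. x \<in> S ==> linear (F x)" and S: "open S" "x \<in> S"
 shows "ddir (%x. F x (u x)) x v = ddir (%y. F y (u x)) x v + F x (ddir u x v)"
proof -
 have ub: "((%x. u x \<bullet> b) has_derivative (%v. ddir u x v \<bullet> b)) (at x)" for b
  by (rule has_derivative_inner_left[OF has_derivative_ddir[OF u]])
 have d: "((%x. \<Sum>b\<in>Basis. (u x \<bullet> b) *\<^sub>R F x b) has_derivative
   (%v. \<Sum>b\<in>Basis. (u x \<bullet> b) *\<^sub>R ddir (%y. F y b) x v + (ddir u x v \<bullet> b) *\<^sub>R F x b)) (at x)"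
  by (intro has_derivative_sum has_derivative_scaleR ub has_derivative_ddir F)
 have d2: "((%y. \<Sum>b\<in>Basis. (u x \<bullet> b) *\<^sub>R F y b) has_derivative
   (%v. \<Sum>b\<in>Basis. (u x \<bullet> b) *\<^sub>R ddir (%y. F y b) x v)) (at x)"
  by (intro has_derivative_sum has_derivative_scaleR_right has_derivative_ddir F)
 have e1: "ddir (%x. F x (u x)) x v = ddir (%x. \<Sum>b\<in>Basis. (u x \<bullet> b) *\<^sub>R F x b) x v"
  by (rule ddir_cong[OF S]) (use lin linear_on_Basis_sum in blast)
 have e2: "ddir (%y. F y (u x)) x v = ddir (%y. \<Sum>b\<in>Basis. (u x \<bullet> b) *\<^sub>R F y b) x v"
  by (rule ddir_cong[OF S]) (use lin linear_on_Basis_sum in blast)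
 have e3: "F x (ddir u x v) = (\<Sum>b\<in>Basis. (ddir u x v \<bullet> b) *\<^sub>R F x b)"
  using lin[OF S(2)] linear_on_Basis_sum by blast
 show ?thesis unfolding e1 e2 e3 ddir_eq[OF d] ddir_eq[OF d2] by (simp add: sum.distrib)
qed

section \<open>Inverses of smooth families of linear maps\<close>

text \<open>Resolvent identity: insert B A = 1 at \<open>x\<close> before B(y), and A B = 1 at
  \<open>y\<close> after B(x). It is the source of both the continuity and the derivative of the
  inverse.\<close>

lemma blinfun_inverse_diff:
 assumes "A y o\<^sub>L B y = id_blinfun" "B x o\<^sub>L A x = id_blinfun"
 shows "B y - B x = - (B x o\<^sub>L (A y - A x) o\<^sub>L B y)"
proof (rule blinfun_eqI)
 fix v
 have "blinfun_apply (A y o\<^sub>L B y) v = v" "!!w. blinfun_apply (B x o\<^sub>L A x) w = w"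
  by (simp_all only: assms blinfun_apply_id_blinfun)
 then show "(B y - B x) v = (- (B x o\<^sub>L (A y - A x) o\<^sub>L B y)) v"
  by (simp add: blinfun.bilinear_simps)
qed

lemma blinfun_inverse_diff':
 assumes "A x o\<^sub>L B x = id_blinfun" "B y o\<^sub>L A y = id_blinfun"
 shows "B y - B x = - (B y o\<^sub>L (A y - A x) o\<^sub>L B x)"
 using blinfun_inverse_diff[of A x B y] assms
 by (simp add: algebra_simps bounded_bilinear.diff_left[OF bounded_bilinear_blinfun_compose] bounded_bilinear.diff_right[OF bounded_bilinear_blinfun_compose])

text \<open>By the resolvent identity and the smallness hypothesis the difference is at most half of
  \<open>norm (B y)\<close>; hence \<open>norm (B y)\<close> is at most twice
  \<open>norm (B x)\<close>, and inserting this removes \<open>B y\<close> from the bound.\<close>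

lemma blinfun_inverse_norm_le:
 assumes "A x o\<^sub>L B x = id_blinfun" "B y o\<^sub>L A y = id_blinfun"
  and "norm (A y - A x) * norm (B x) \<le> 1 / 2"
 shows "norm (B y - B x) \<le> 2 * norm (B x) ^ 2 * norm (A y - A x)"
proof -
 have *: "norm (B y - B x) \<le> norm (B y) * norm (A y - A x) * norm (B x)"
  unfolding blinfun_inverse_diff'[of A x B y, OF assms(1,2)] norm_minus_cancel
  by (rule order_trans[OF norm_blinfun_compose] mult_right_mono norm_blinfun_compose norm_ge_zero)+
 also have "\<dots> = norm (B y) * (norm (A y - A x) * norm (B x))" by simp
 also have "\<dots> \<le> norm (B y) * (1 / 2)" by (rule mult_left_mono[OF assms(3)]) simp
 finally have "norm (B y) \<le> 2 * norm (B x)" using norm_triangle_ineq2[of "B y" "B x"] by simp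
 then have "norm (B y) * norm (A y - A x) * norm (B x) \<le> 2 * norm (B x) * norm (A y - A x) * norm (B x)"
  by (intro mult_right_mono) auto
 with * show ?thesis by (simp add: power2_eq_square algebra_simps)
qed

lemma has_derivative_blinfun_inverse:
 fixes A B :: "'a::real_normed_vector => 'f::real_normed_vector \<Rightarrow>\<^sub>L 'f"
 assumes inv: "!!x. x \<in> S ==> A x o\<^sub>L B x = id_blinfun" "!!x. x \<in> S ==> B x o\<^sub>L A x = id_blinfun"
  and A: "(A has_derivative A') (at x within S)" and x: "x \<in> S"
 shows "(B has_derivative (%h. - (B x o\<^sub>L A' h o\<^sub>L B x))) (at x within S)"
 unfolding has_derivative_within_alt2
proof (intro conjI allI impI)
 have bl: "bounded_linear A'" using A has_derivative_bounded_linear by blast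
 show "bounded_linear (%h. - (B x o\<^sub>L A' h o\<^sub>L B x))"
  by (intro bounded_linear_minus bounded_linear_compose[OF bounded_bilinear.bounded_linear_left[OF bounded_bilinear_blinfun_compose]]
    bounded_linear_compose[OF bounded_bilinear.bounded_linear_right[OF bounded_bilinear_blinfun_compose]] bl)
 fix e :: real assume e: "e > 0"
 define n where "n = norm (B x)"
 \<comment> \<open>A Lipschitz constant of \<open>A\<close> at \<open>x\<close>: the operator norm
   of the derivative, and 1 for the remainder.\<close>
 define C where "C = onorm A' + 1"
 have n: "n \<ge> 0" and C: "C > 0" using onorm_pos_le[OF bl] by (auto simp: n_def C_def)
 have A2: "\<forall>\<^sub>F y in at x within S. norm (A y - A x - A' (y - x)) \<le> d * norm (y - x)" if "d > 0" for d
  using A that unfolding has_derivative_within_alt2 by blast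
 define d where "d = e / (2 * (n ^ 2 + 1))"
 have n2: "n ^ 2 + 1 > 0" by (simp add: add_nonneg_pos)
 have d: "d > 0" unfolding d_def using e n2 by (intro divide_pos_pos) auto
 have d': "n ^ 2 * d \<le> e / 2"
 proof -
  have "n ^ 2 * d = (e / 2) * (n ^ 2 / (n ^ 2 + 1))" using n2 by (simp add: d_def)
  also have "\<dots> \<le> (e / 2) * 1" using e n2 by (intro mult_left_mono) (auto simp: divide_le_eq)
  finally show ?thesis by simp
 qed
 \<comment> \<open>The error consists of a part n^2 d from the remainder of \<open>A\<close> and a
   part 2 n^3 m C that is quadratic in \<open>A y - A x\<close>; \<open>d\<close> and
   \<open>m\<close> bound each by e/2. The first entry of the minimum provides
   \<open>m * n \<le> 1 / 2\<close> for the norm estimate. The summands 1 avoid division by zero for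
   \<open>n = 0\<close>.\<close>
 define m where "m = min (1 / (2 * (n + 1))) (e / (4 * C * (n ^ 3 + 1)))"
 have m: "m > 0" using e n C by (auto simp: m_def intro!: divide_pos_pos mult_pos_pos add_nonneg_pos)
 have mn: "m * n \<le> 1 / 2"
 proof -
  have "m * n \<le> 1 / (2 * (n + 1)) * n" using n by (intro mult_right_mono) (auto simp: m_def)
  also have "\<dots> \<le> 1 / 2" using n by (simp add: field_simps)
  finally show ?thesis .
 qed
 have mC: "2 * n ^ 3 * m * C \<le> e / 2"
 proof -
  have "2 * n ^ 3 * m * C \<le> 2 * n ^ 3 * (e / (4 * C * (n ^ 3 + 1))) * C"
   using n C by (intro mult_right_mono mult_left_mono) (auto simp: m_def)
  also have "\<dots> = (e / 2) * (n ^ 3 / (n ^ 3 + 1))"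
  proof -
   define N where "N = n ^ 3 + 1"
   have "N > 0" using n by (simp add: N_def add_nonneg_pos)
   then show ?thesis using C unfolding N_def[symmetric] by (simp add: field_simps)
  qed
  also have "\<dots> \<le> (e / 2) * 1" using n e by (intro mult_left_mono) (auto simp: divide_le_eq add_nonneg_pos)
  finally show ?thesis by simp
 qed
 have "(A \<longlongrightarrow> A x) (at x within S)" using has_derivative_continuous[OF A] by (simp add: continuous_within)
 then have "\<forall>\<^sub>F y in at x within S. dist (A y) (A x) < m" using m tendstoD by blast
 moreover have "\<forall>\<^sub>F y in at x within S. y \<in> S" by (auto simp: eventually_at_filter)
 ultimately show "\<forall>\<^sub>F y in at x within S. norm (B y - B x - (- (B x o\<^sub>L A' (y - x) o\<^sub>L B x))) \<le> e * norm (y - x)"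
  using A2[OF d] A2[of 1, OF zero_less_one]
 proof eventually_elim
  case (elim y)
  define D where "D = norm (A y - A x)"
  have Dm: "D \<le> m" using elim by (simp add: D_def dist_norm)
  have DC: "D \<le> C * norm (y - x)"
  proof -
   have "D \<le> norm (A y - A x - A' (y - x)) + norm (A' (y - x))"
    unfolding D_def by (metis norm_triangle_sub add.commute)
   also have "\<dots> \<le> 1 * norm (y - x) + onorm A' * norm (y - x)"
    using elim onorm[OF bl] by (intro add_mono) auto
   finally show ?thesis by (simp add: C_def algebra_simps)
  qed
  have Dn: "D * norm (B x) \<le> 1 / 2"
   using mult_right_mono[OF Dm n] mn unfolding n_def by linarith
  have By: "norm (B y - B x) \<le> 2 * n ^ 2 * D"
   using blinfun_inverse_norm_le[of A x B y] inv x elim Dn by (simp add: n_def D_def)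
  \<comment> \<open>Replacing \<open>B y\<close> by \<open>B x\<close> in the resolvent identity
    costs the first term, linearizing \<open>A\<close> the second.\<close>
  have "B y - B x - (- (B x o\<^sub>L A' (y - x) o\<^sub>L B x)) =
    - ((B y - B x) o\<^sub>L (A y - A x) o\<^sub>L B x) - (B x o\<^sub>L (A y - A x - A' (y - x)) o\<^sub>L B x)"
  proof -
   have 1: "(B y - B x) o\<^sub>L Q o\<^sub>L B x = (B y o\<^sub>L Q o\<^sub>L B x) - (B x o\<^sub>L Q o\<^sub>L B x)" for Q
    by (simp only: bounded_bilinear.diff_left[OF bounded_bilinear_blinfun_compose])
   have 2: "B x o\<^sub>L (Q - R) o\<^sub>L B x = (B x o\<^sub>L Q o\<^sub>L B x) - (B x o\<^sub>L R o\<^sub>L B x)" for Q R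
    by (simp only: bounded_bilinear.diff_left[OF bounded_bilinear_blinfun_compose]
      bounded_bilinear.diff_right[OF bounded_bilinear_blinfun_compose])
   have 3: "B y - B x = - (B y o\<^sub>L (A y - A x) o\<^sub>L B x)"
    by (rule blinfun_inverse_diff') (use inv x elim in auto)
   show ?thesis unfolding 1 2[of "A y - A x"] by (simp add: 3)
  qed
  then have "norm (B y - B x - (- (B x o\<^sub>L A' (y - x) o\<^sub>L B x)))
    \<le> norm ((B y - B x) o\<^sub>L (A y - A x) o\<^sub>L B x) + norm (B x o\<^sub>L (A y - A x - A' (y - x)) o\<^sub>L B x)"
   using norm_triangle_ineq4[of "- ((B y - B x) o\<^sub>L (A y - A x) o\<^sub>L B x)"] by simp
  also have "\<dots> \<le> norm (B y - B x) * D * n + n * norm (A y - A x - A' (y - x)) * n"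
   unfolding D_def n_def
   by (intro add_mono order_trans[OF norm_blinfun_compose] mult_right_mono norm_blinfun_compose norm_ge_zero)
  also have "\<dots> \<le> (2 * n ^ 2 * D) * D * n + n * (d * norm (y - x)) * n"
   using By elim n by (intro add_mono mult_right_mono mult_left_mono) (auto simp: D_def)
  also have "\<dots> = 2 * n ^ 3 * D * D + (n ^ 2 * d) * norm (y - x)"
   by (simp add: power2_eq_square power3_eq_cube algebra_simps)
  also have "\<dots> \<le> 2 * n ^ 3 * m * (C * norm (y - x)) + (e / 2) * norm (y - x)"
   using n m Dm DC d' by (intro add_mono mult_mono mult_right_mono mult_left_mono) (auto simp: D_def)
  also have "\<dots> = (2 * n ^ 3 * m * C) * norm (y - x) + (e / 2) * norm (y - x)" by simp
  also have "\<dots> \<le> (e / 2) * norm (y - x) + (e / 2) * norm (y - x)"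
   by (intro add_mono mult_right_mono mC) auto
  finally show ?case by simp
 qed
qed

text \<open>The derivative - B A' B is built from \<open>B\<close> itself, so class k of
  \<open>B\<close> yields class k + 1; the start is continuity, from the norm estimate.\<close>

lemma Ck_on_blinfun_inverse:
 fixes A B :: "'a::real_normed_vector => 'f::real_normed_vector \<Rightarrow>\<^sub>L 'f"
 assumes inv: "!!x. x \<in> S ==> A x o\<^sub>L B x = id_blinfun" "!!x. x \<in> S ==> B x o\<^sub>L A x = id_blinfun"
  and A: "Ck_on k S A"
 shows "Ck_on k S B"
 using A
proof (induction k)
 case 0
 then have A: "continuous_on S A" by simp
 have "(B \<longlongrightarrow> B x) (at x within S)" if x: "x \<in> S" for x
 proof -
  have "(A \<longlongrightarrow> A x) (at x within S)" using A x by (simp add: continuous_on_def)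
  then have lim: "((%y. norm (A y - A x)) \<longlongrightarrow> 0) (at x within S)"
   using tendsto_norm_zero LIM_zero by blast
  have l2: "((%y. 2 * norm (B x) ^ 2 * norm (A y - A x)) \<longlongrightarrow> 0) (at x within S)"
   using tendsto_mult[OF tendsto_const lim] by simp
  have "((%y. norm (A y - A x) * norm (B x)) \<longlongrightarrow> 0) (at x within S)"
   using tendsto_mult[OF lim tendsto_const] by simp
  then have "\<forall>\<^sub>F y in at x within S. norm (A y - A x) * norm (B x) < 1 / 2"
   by (rule order_tendstoD) simp
  moreover have "\<forall>\<^sub>F y in at x within S. y \<in> S" by (auto simp: eventually_at_filter)
  ultimately have "\<forall>\<^sub>F y in at x within S. norm (B y - B x) \<le> 2 * norm (B x) ^ 2 * norm (A y - A x)"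
   by eventually_elim (use blinfun_inverse_norm_le[of A x B] inv x in auto)
  then have "((%y. B y - B x) \<longlongrightarrow> 0) (at x within S)"
   by (rule Lim_null_comparison[OF _ l2])
  then show ?thesis using LIM_zero_cancel by blast
 qed
 then show ?case by (simp add: continuous_on_def)
next
 case (Suc k)
 from Ck_on_SucE[OF Suc.prems] obtain A'
  where A': "!!x. x \<in> S ==> (A has_derivative A' x) (at x within S)"
  and *: "!!v. Ck_on k S (%x. A' x v)" by blast
 have Bk: "Ck_on k S B" by (rule Suc.IH[OF Ck_on_SucD[OF Suc.prems]])
 show ?case
  by (rule Ck_on_Suc_withinI[where f' = "%x v. - (B x o\<^sub>L A' x v o\<^sub>L B x)"])
   (auto intro!: has_derivative_blinfun_inverse inv A' Bk *
    Ck_on_linear_comp[OF bounded_linear_minus[OF bounded_linear_ident]]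
    Ck_on_bilinear[OF bounded_bilinear_blinfun_compose])
qed

text \<open>Packs a map into a bounded operator to make operator norms available. Being built from
  the values on the basis, it inherits smoothness in a parameter from the values at single
  vectors.\<close>

definition blin :: "('e::euclidean_space => 'f::real_normed_vector) => 'e \<Rightarrow>\<^sub>L 'f" where
 "blin L = (\<Sum>b\<in>Basis. blinfun_scaleR_left (L b) o\<^sub>L blinfun_inner_left b)"

lemma blinfun_apply_blin:
 assumes "linear L" shows "blinfun_apply (blin L) v = L v"
 unfolding blin_def
 by (subst linear_on_Basis_sum[OF assms])
  (simp add: blinfun.sum_left blinfun_inner_left.rep_eq inner_commute)

lemma Ck_on_blin:
 assumes "!!v. Ck_on k S (%x. F x v)"
 shows "Ck_on k S (%x. blin (F x))"
 unfolding blin_def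
 by (intro Ck_on_sum Ck_on_bilinear[OF bounded_bilinear_blinfun_compose] Ck_on_const
   Ck_on_linear_comp[OF bounded_linear_blinfun_scaleR_left] assms)

text \<open>In finite dimension the right inverse \<open>G x\<close> of a linear \<open>F x\<close>
  is two-sided, hence linear; so both families can be packed into operators.\<close>

lemma Ck_on_inverse_family:
 fixes F G :: "'a::real_normed_vector => 'e::euclidean_space => 'e"
 assumes F: "!!v. Ck_on k S (%x. F x v)" and lin: "!!x. x \<in> S ==> linear (F x)"
  and inv: "!!x v. x \<in> S ==> F x (G x v) = v"
 shows "Ck_on k S (%x. G x v)"
proof -
 have GF: "G x (F x v) = v" and lG: "linear (G x)" if "x \<in> S" for x v
 proof -
  have "surj (F x)" using inv[OF that] by (metis surjI)
  then have inj: "inj (F x)" using lin[OF that] linear_surjective_imp_injective by blast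
  show GF: "G x (F x v) = v" for v using inj inv[OF that, of "F x v"] by (simp add: inj_eq)
  note linF = lin[OF that]
  obtain G' where G': "linear G'" "!!v. G' (F x v) = v"
   using linear_injective_left_inverse[OF linF inj] by (auto simp: fun_eq_iff)
  have "G' = G x"
  proof
   fix v show "G' v = G x v" using G'(2)[of "G x v"] inv[OF that] by simp
  qed
  then show "linear (G x)" using G' by simp
 qed
 have "Ck_on k S (%x. blin (G x))"
 proof (rule Ck_on_blinfun_inverse[where A = "%x. blin (F x)"])
  show "Ck_on k S (%x. blin (F x))" by (rule Ck_on_blin[OF F])
  show "blin (F x) o\<^sub>L blin (G x) = id_blinfun" if "x \<in> S" for x
   by (rule blinfun_eqI) (simp add: blinfun_apply_blin lin lG inv that)
  show "blin (G x) o\<^sub>L blin (F x) = id_blinfun" if "x \<in> S" for x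
   by (rule blinfun_eqI) (simp add: blinfun_apply_blin lin lG GF that)
 qed
 from Ck_on_linear_comp[OF blinfun.bounded_linear_left this]
 have "Ck_on k S (%x. blinfun_apply (blin (G x)) v)" .
 then show ?thesis using Ck_on_cong[of S "%x. G x v" "%x. blinfun_apply (blin (G x)) v" k]
  by (simp add: blinfun_apply_blin lG)
qed

lemma smooth_on_inverse_family:
 fixes F G :: "'a::real_normed_vector => 'e::euclidean_space => 'e"
 assumes "!!v. smooth_on S (%x. F x v)" and "!!x. x \<in> S ==> linear (F x)"
  and "!!x v. x \<in> S ==> F x (G x v) = v"
 shows "smooth_on S (%x. G x v)"
 unfolding smooth_on_def using Ck_on_inverse_family[of _ S F G] assms unfolding smooth_on_def by auto

text \<open>The C^1 theorem gives \<open>g\<close>, with derivative at \<open>y\<close> inverse to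
  that of \<open>f\<close> at \<open>g y\<close>. If \<open>g\<close> has class k, so has this
  family of inverses, whence \<open>g\<close> has class k + 1.\<close>

theorem smooth_inverse_function_theorem:
 fixes f :: "'e::euclidean_space => 'e"
 assumes U: "open U" "x0 \<in> U" and f: "smooth_on U f" and inj: "inj (ddir f x0)"
 obtains U' V g where "open U'" "U' \<subseteq> U" "x0 \<in> U'" "open V" "homeomorphism U' V f g"
  "smooth_on V g" "!!x. x \<in> U' ==> bij (ddir f x)"
proof -
 define f' where "f' x = blin (ddir f x)" for x
 have lin: "linear (ddir f x)" if "x \<in> U" for x
  using smooth_on_has_derivative[OF f U(1) that] has_derivative_linear by blast
 have f'a: "blinfun_apply (f' x) = ddir f x" if "x \<in> U" for x
  using lin[OF that] by (auto simp: f'_def blinfun_apply_blin)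
 have der: "(f has_derivative blinfun_apply (f' x)) (at x)" if "x \<in> U" for x
  using smooth_on_has_derivative[OF f U(1) that] f'a[OF that] by simp
 have cont: "continuous_on U f'"
  using Ck_on_blin[of 0 U "ddir f"] smooth_on_ddir[OF f U(1)] smooth_on_imp_Ck[of U _ 0]
  by (auto simp: f'_def)
 obtain L where L: "linear L" "!!v. L (ddir f x0 v) = v"
  using linear_injective_left_inverse[OF lin[OF U(2)] inj] by (auto simp: fun_eq_iff)
 have "blin L o\<^sub>L f' x0 = id_blinfun"
  by (rule blinfun_eqI) (simp add: f'a[OF U(2)] blinfun_apply_blin L)
 from inverse_function_theorem[OF U(1) der cont U(2) this]
 obtain U' V g g' where *: "open U'" "U' \<subseteq> U" "x0 \<in> U'" "open V" "homeomorphism U' V f g"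
  and g: "!!y. y \<in> V ==> (g has_derivative (g' y)) (at y)"
  and g': "!!y. y \<in> V ==> g' y = inv (blinfun_apply (f'(g y)))"
  and bij: "!!y. y \<in> V ==> bij (blinfun_apply (f'(g y)))" by metis
 have gU: "g y \<in> U" if "y \<in> V" for y using * that by (auto simp: homeomorphism_def)
 have gd: "ddir f (g y) (ddir g y v) = v" if "y \<in> V" for y v
  using bij[OF that] g'[OF that] f'a[OF gU[OF that]] ddir_eq[OF g[OF that]]
  by (simp add: bij_is_surj surj_f_inv_f)
 have "Ck_on k V g" for k
 proof (induction k)
  case 0
  then show ?case using *(5) by (simp add: homeomorphism_def)
 next
  case (Suc k)
  show ?case
  proof (rule Ck_on_SucI[OF *(4)])
   show "g differentiable (at y)" if "y \<in> V" for y using g[OF that] by (auto simp: differentiable_def)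
   show "Ck_on k V (%y. ddir g y v)" for v
   proof (rule Ck_on_inverse_family[where F = "%y. ddir f (g y)"])
    show "Ck_on k V (%y. ddir f (g y) v)" for v
     by (rule Ck_on_compose[OF Suc.IH smooth_on_imp_Ck[OF smooth_on_ddir[OF f U(1)]]])
      (use gU in auto)
   qed (use lin gU gd in auto)
  qed
 qed
 then have "smooth_on V g" by (simp add: smooth_on_def)
 moreover have "bij (ddir f x)" if "x \<in> U'" for x
 proof -
  have "f x \<in> V" "g (f x) = x" using * that by (auto simp: homeomorphism_def)
  then show ?thesis using bij[of "f x"] f'a[of x] *(2) that by auto
 qed
 ultimately show thesis using that * by blast
qed

section \<open>Bump functions\<close>

text \<open>The powers are carried along to obtain a family closed under differentiation: the
  derivative of member \<open>n\<close> is member \<open>n + 2\<close> minus \<open>n\<close> times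
  member \<open>n + 1\<close>.\<close>

definition flat_fun :: "nat => real => real" where
 "flat_fun n t = (if t > 0 then inverse t ^ n * exp (- inverse t) else 0)"

text \<open>With s = 1/t, the single term s^(n+2)/(n+2)! of the exponential series bounds exp s from
  below. A bound by t^2 forces the difference quotient at 0 to tend to 0, so every member has
  derivative 0 there.\<close>

lemma flat_fun_bound:
 obtains K where "K \<ge> 0" "!!t. \<bar>flat_fun n t\<bar> \<le> K * t\<^sup>2"
proof -
 define K :: real where "K = fact (n + 2)"
 have K: "K > 0" by (simp only: K_def fact_gt_zero)
 have "\<bar>flat_fun n t\<bar> \<le> K * t\<^sup>2" for t
 proof (cases "t > 0")
  case True
  define s where "s = inverse t"
  have s: "s > 0" using True by (simp add: s_def)
  have "(\<Sum>i\<in>{n+2}. s ^ i /\<^sub>R fact i) \<le> (\<Sum>i. s ^ i /\<^sub>R fact i)"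
   by (rule sum_le_suminf[OF summable_exp_generic]) (use s in auto)
  then have "s ^ (n + 2) / K \<le> exp s"
   by (simp add: exp_def K_def divide_inverse mult.commute del: fact_Suc add_2_eq_Suc')
  then have "s ^ (n + 2) \<le> exp s * K" by (simp only: pos_divide_le_eq[OF K])
  then have "s ^ (n + 2) * exp (- s) \<le> exp s * K * exp (- s)" by (rule mult_right_mono) simp
  also have "exp s * K * exp (- s) = K * (exp s * exp (- s))" by (simp only: mult_ac)
  finally have "s ^ (n + 2) * exp (- s) \<le> K" by (simp only: exp_minus_inverse mult_1_right)
  then have "s ^ n * exp (- s) * s\<^sup>2 \<le> K" by (simp only: power_add mult_ac)
  then have "s ^ n * exp (- s) \<le> K * t\<^sup>2"
   using True by (simp add: s_def field_simps power2_eq_square)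
  then show ?thesis using True s by (simp add: flat_fun_def s_def abs_mult)
 qed (use K in \<open>simp add: flat_fun_def\<close>)
 then show thesis using that K less_imp_le by blast
qed

lemma flat_fun_deriv:
 "(flat_fun n has_real_derivative (flat_fun (n + 2) t - real n * flat_fun (n + 1) t)) (at t)"
proof -
 consider "t > 0" | "t < 0" | "t = 0" by linarith
 then show ?thesis
 proof cases
  case 1
  have "((%t. inverse t ^ n * exp (- inverse t)) has_real_derivative
    (flat_fun (n + 2) t - real n * flat_fun (n + 1) t)) (at t)"
  proof -
   have d1: "((%t. inverse t ^ n) has_real_derivative (- (real n * inverse t ^ (n + 1)))) (at t)"
    using DERIV_power_Suc[OF DERIV_inverse[of t], of "n - 1"] 1
    by (cases n) (simp_all add: power2_eq_square algebra_simps)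
   have d2: "((%t. exp (- inverse t)) has_real_derivative (exp (- inverse t) * inverse t ^ 2)) (at t)"
    using 1 by (auto intro!: derivative_eq_intros simp: power2_eq_square)
   show ?thesis using DERIV_mult[OF d1 d2] 1
    by (simp add: flat_fun_def power2_eq_square algebra_simps)
  qed
  then show ?thesis
   by (rule has_field_derivative_transform_within_open[of _ _ _ "{0<..}"])
    (use 1 in \<open>auto simp: flat_fun_def\<close>)
 next
  case 2
  have "((%t::real. 0::real) has_real_derivative 0) (at t)" by simp
  then have "(flat_fun n has_real_derivative 0) (at t)"
   by (rule has_field_derivative_transform_within_open[of _ _ _ "{..<0}"])
    (use 2 in \<open>auto simp: flat_fun_def\<close>)
  then show ?thesis using 2 by (simp add: flat_fun_def)
 next
  case 3
  obtain K where K: "K \<ge> 0" "!!t. \<bar>flat_fun n t\<bar> \<le> K * t\<^sup>2" using flat_fun_bound by metis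
  have "((%h. flat_fun n h / h) \<longlongrightarrow> 0) (at 0)"
  proof (rule Lim_null_comparison)
   have "norm (flat_fun n h / h) \<le> K * \<bar>h\<bar>" if "h \<noteq> 0" for h
    using K(2)[of h] that by (simp add: divide_le_eq power2_eq_square abs_mult[symmetric] mult.assoc)
   then show "\<forall>\<^sub>F h in at 0. norm (flat_fun n h / h) \<le> K * \<bar>h\<bar>"
    by (auto simp: eventually_at_filter)
   show "((%h::real. K * \<bar>h\<bar>) \<longlongrightarrow> 0) (at 0)"
    by (auto intro!: tendsto_eq_intros)
  qed
  then show ?thesis unfolding 3 by (simp add: DERIV_def flat_fun_def)
 qed
qed

lemma Ck_on_flat_fun: "Ck_on k S (flat_fun n)"
proof (induction k arbitrary: n)
 case 0
 have "isCont (flat_fun n) t" for t using flat_fun_deriv DERIV_isCont by blast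
 then show ?case using continuous_at_imp_continuous_on by auto
next
 case (Suc k)
 show ?case
 proof (rule Ck_on_Suc_withinI)
  show "(flat_fun n has_derivative (%v. (flat_fun (n + 2) t - real n * flat_fun (n + 1) t) * v)) (at t within S)" for t
   using flat_fun_deriv[of n t] has_derivative_at_withinI unfolding has_field_derivative_def by blast
  have "Ck_on k S (%t. (flat_fun (n + 2) t + (- real n) * flat_fun (n + 1) t) * v)" for v
   by (intro Ck_on_bilinear[OF bounded_bilinear_mult] Ck_on_add Ck_on_const Suc.IH)
  then show "Ck_on k S (%t. (flat_fun (n + 2) t - real n * flat_fun (n + 1) t) * v)" for v
   by simp
 qed
qed

lemma smooth_bump:
 fixes x0 :: "'e::euclidean_space"
 assumes r: "r > 0"
 obtains bmp :: "'e => real" where "smooth_on UNIV bmp" "!!x. x \<in> ball x0 r ==> bmp x = 1"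
  "!!x. x \<notin> ball x0 (2 * r) ==> bmp x = 0" "!!x. 0 \<le> bmp x" "!!x. bmp x \<le> 1"
proof -
 define f where "f = flat_fun 0"
 have f: "smooth_on UNIV f" by (simp add: f_def smooth_on_def Ck_on_flat_fun)
 have f0: "f t \<ge> 0" "f t = 0 \<longleftrightarrow> t \<le> 0" for t by (auto simp: f_def flat_fun_def)
 \<comment> \<open>\<open>a\<close> is positive exactly inside the ball of radius 2r,
   \<open>b\<close> exactly outside the closed ball of radius r. At each point one of them is
   positive, so the denominator of \<open>bmp\<close> never vanishes.\<close>
 define a where "a x = 4 * r\<^sup>2 - (x - x0) \<bullet> (x - x0)" for x
 define b where "b x = (x - x0) \<bullet> (x - x0) - r\<^sup>2" for x
 define bmp where "bmp x = f (a x) / (f (a x) + f (b x))" for x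
 have pos: "f (a x) + f (b x) > 0" for x
 proof -
  have "a x > 0 \<or> b x > 0" using r by (simp add: a_def b_def) (smt (verit) zero_less_power2)
  then show ?thesis using f0(1)[of "a x"] f0(1)[of "b x"] f0(2)[of "a x"] f0(2)[of "b x"] by linarith
 qed
 have "smooth_on UNIV a" "smooth_on UNIV b" unfolding a_def b_def
  by (intro smooth_on_diff smooth_on_inner smooth_on_ident smooth_on_const)+
 then have fab: "smooth_on UNIV (%x. f (a x))" "smooth_on UNIV (%x. f (b x))"
  using smooth_on_compose[OF _ f] by auto
 have "smooth_on UNIV (%x. f (a x) / (f (a x) + f (b x)))"
  using smooth_on_divide[OF fab(1) smooth_on_add[OF fab]] pos by (metis less_irrefl)
 then have 1: "smooth_on UNIV bmp" unfolding bmp_def .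
 have nn: "(x - x0) \<bullet> (x - x0) = (dist x0 x)\<^sup>2" for x
  by (simp add: dist_norm power2_norm_eq_inner inner_diff_left inner_diff_right inner_commute)
 show thesis
 proof (rule that[OF 1])
  show "bmp x = 1" if "x \<in> ball x0 r" for x
  proof -
   have "(dist x0 x)\<^sup>2 \<le> r\<^sup>2" using that by (intro power_mono) auto
   then have "b x \<le> 0" by (simp add: b_def nn)
   then show ?thesis using pos[of x] f0(2)[of "b x"] by (simp add: bmp_def)
  qed
  show "bmp x = 0" if "x \<notin> ball x0 (2 * r)" for x
  proof -
   have "(2 * r)\<^sup>2 \<le> (dist x0 x)\<^sup>2" using that r by (intro power_mono) auto
   then have "a x \<le> 0" by (simp add: a_def nn power_mult_distrib)
   then show ?thesis using f0(2)[of "a x"] by (simp add: bmp_def)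
  qed
  show "0 \<le> bmp x" "bmp x \<le> 1" for x
   using pos[of x] f0(1)[of "a x"] f0(1)[of "b x"] by (auto simp: bmp_def)
 qed
qed

section \<open>Symmetry of second derivatives\<close>

lemma ddir_line:
 fixes f :: "'e::real_normed_vector => 'f::real_normed_vector"
 assumes "f differentiable (at (x + s *\<^sub>R u))"
 shows "((%s. f (x + s *\<^sub>R u)) has_vector_derivative ddir f (x + s *\<^sub>R u) u) (at s)"
proof -
 have "((%s. f (x + s *\<^sub>R u)) has_derivative (%t. ddir f (x + s *\<^sub>R u) (t *\<^sub>R u))) (at s)"
  by (rule has_derivative_compose[of "%s. x + s *\<^sub>R u" "%t. t *\<^sub>R u" s UNIV f "ddir f (x + s *\<^sub>R u)"])
   (use has_derivative_ddir[OF assms] in \<open>auto intro!: derivative_eq_intros\<close>)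
 then show ?thesis
  using bounded_linear_ddir[OF assms]
  by (simp add: has_vector_derivative_def linear_scale bounded_linear.linear)
qed

text \<open>The mean value theorem is used twice: in direction \<open>u\<close> for the difference
  of \<open>f\<close> along two parallel segments, then in direction \<open>v\<close>. The left-hand
  side is symmetric in \<open>u\<close> and \<open>v\<close>, the right-hand side is a derivative in
  one definite order.\<close>

lemma second_difference:
 fixes f :: "'e::real_normed_vector => real"
 assumes S: "open S" and f: "Ck_on 2 S f" and h: "h > 0"
  and in_S: "!!s t. 0 \<le> s ==> s \<le> h ==> 0 \<le> t ==> t \<le> h ==> x + s *\<^sub>R u + t *\<^sub>R v \<in> S"
 obtains s t where "0 < s" "s < h" "0 < t" "t < h"
  "f (x + h *\<^sub>R u + h *\<^sub>R v) - f (x + h *\<^sub>R u) - f (x + h *\<^sub>R v) + f x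
    = h\<^sup>2 * ddir (%y. ddir f y u) (x + s *\<^sub>R u + t *\<^sub>R v) v"
proof -
 have f2: "Ck_on (Suc (Suc 0)) S f" using f by (simp only: numeral_2_eq_2)
 have fd: "f differentiable (at y)" if "y \<in> S" for y
  using Ck_on_Suc_has_derivative[OF f2 S that] by (auto simp: differentiable_def)
 have fd2: "(%y. ddir f y u) differentiable (at y)" if "y \<in> S" for y
  using Ck_on_Suc_has_derivative[OF Ck_on_Suc_ddir[OF f2 S] S that] by (auto simp: differentiable_def)
 define g where "g s = f (x + h *\<^sub>R v + s *\<^sub>R u) - f (x + s *\<^sub>R u)" for s
 have "DERIV g s :> ddir f (x + h *\<^sub>R v + s *\<^sub>R u) u - ddir f (x + s *\<^sub>R u) u"
  if "0 \<le> s" "s \<le> h" for s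
 proof -
  have 1: "x + h *\<^sub>R v + s *\<^sub>R u \<in> S" using in_S[OF that, of h] h by (simp add: add_ac)
  have 2: "x + s *\<^sub>R u \<in> S" using in_S[OF that, of 0] h by simp
  show ?thesis unfolding g_def
   by (rule DERIV_diff[OF ddir_line[OF fd[OF 1], unfolded has_real_derivative_iff_has_vector_derivative[symmetric]]
      ddir_line[OF fd[OF 2], unfolded has_real_derivative_iff_has_vector_derivative[symmetric]]])
 qed
 then obtain s where s: "0 < s" "s < h"
  "g h - g 0 = (h - 0) * (ddir f (x + h *\<^sub>R v + s *\<^sub>R u) u - ddir f (x + s *\<^sub>R u) u)"
  using MVT2[OF h, of g "%s. ddir f (x + h *\<^sub>R v + s *\<^sub>R u) u - ddir f (x + s *\<^sub>R u) u"] by blast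
 define k where "k t = ddir f (x + s *\<^sub>R u + t *\<^sub>R v) u" for t
 have "DERIV k t :> ddir (%y. ddir f y u) (x + s *\<^sub>R u + t *\<^sub>R v) v" if "0 \<le> t" "t \<le> h" for t
  unfolding k_def
  by (rule ddir_line[where f = "%y. ddir f y u", unfolded has_real_derivative_iff_has_vector_derivative[symmetric]])
   (use fd2 in_S s that in auto)
 then obtain t where t: "0 < t" "t < h"
  "k h - k 0 = (h - 0) * ddir (%y. ddir f y u) (x + s *\<^sub>R u + t *\<^sub>R v) v"
  using MVT2[OF h, of k "%t. ddir (%y. ddir f y u) (x + s *\<^sub>R u + t *\<^sub>R v) v"] by blast
 show thesis
 proof (rule that[OF s(1,2) t(1,2)])
  have "f (x + h *\<^sub>R u + h *\<^sub>R v) - f (x + h *\<^sub>R u) - f (x + h *\<^sub>R v) + f x = g h - g 0"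
   by (simp add: g_def add_ac)
  also have "\<dots> = h * (k h - k 0)" using s(3) by (simp add: k_def add_ac)
  also have "\<dots> = h\<^sup>2 * ddir (%y. ddir f y u) (x + s *\<^sub>R u + t *\<^sub>R v) v"
   using t(3) by (simp add: power2_eq_square)
  finally show "f (x + h *\<^sub>R u + h *\<^sub>R v) - f (x + h *\<^sub>R u) - f (x + h *\<^sub>R v) + f x
    = h\<^sup>2 * ddir (%y. ddir f y u) (x + s *\<^sub>R u + t *\<^sub>R v) v" .
 qed
qed

text \<open>Writing the symmetric second difference in both orders equates the two second
  derivatives at points close to \<open>x\<close>; by continuity their values at \<open>x\<close>
  cannot then be 2e apart.\<close>

lemma ddir_commute_real:
 fixes f :: "'e::real_normed_vector => real"
 assumes S: "open S" and f: "Ck_on 2 S f" and x: "x \<in> S"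
 shows "ddir (%y. ddir f y u) x v = ddir (%y. ddir f y v) x u"
proof (rule ccontr)
 let ?a = "%y. ddir (%y. ddir f y u) y v" and ?b = "%y. ddir (%y. ddir f y v) y u"
 assume "?a x \<noteq> ?b x"
 define e where "e = \<bar>?a x - ?b x\<bar> / 2"
 have e: "e > 0" using \<open>?a x \<noteq> ?b x\<close> by (simp add: e_def)
 have f2: "Ck_on (Suc (Suc 0)) S f" using f by (simp only: numeral_2_eq_2)
 have "continuous_on S ?a" "continuous_on S ?b"
  using Ck_on_Suc_ddir[OF Ck_on_Suc_ddir[OF f2 S] S] by auto
 then have "isCont ?a x" "isCont ?b x" using S x by (auto simp: continuous_on_eq_continuous_at)
 then have "(?a \<longlongrightarrow> ?a x) (nhds x)" "(?b \<longlongrightarrow> ?b x) (nhds x)"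
  unfolding isCont_def using tendsto_at_iff_tendsto_nhds[of ?a x] tendsto_at_iff_tendsto_nhds[of ?b x] by blast+
 then have "\<forall>\<^sub>F y in nhds x. dist (?a y) (?a x) < e" "\<forall>\<^sub>F y in nhds x. dist (?b y) (?b x) < e"
  using e tendstoD by blast+
 moreover have "\<forall>\<^sub>F y in nhds x. y \<in> S" using S x eventually_nhds_in_open by blast
 ultimately have "\<forall>\<^sub>F y in nhds x. y \<in> S \<and> dist (?a y) (?a x) < e \<and> dist (?b y) (?b x) < e"
  by eventually_elim auto
 then obtain d where d: "d > 0" "!!y. dist y x < d ==> y \<in> S \<and> dist (?a y) (?a x) < e \<and> dist (?b y) (?b x) < e"
  by (auto simp: eventually_nhds_metric)
 \<comment> \<open>Small enough for the parallelogram spanned by \<open>h u\<close> and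
   \<open>h v\<close> to lie within distance \<open>d\<close>; the 1 covers the case that both
   vectors are 0.\<close>
 define h where "h = d / (2 * (norm u + norm v + 1))"
 have h: "h > 0" using d by (auto simp: h_def intro!: divide_pos_pos add_nonneg_pos)
 have near: "dist (x + s *\<^sub>R u + t *\<^sub>R v) x < d" if "0 \<le> s" "s \<le> h" "0 \<le> t" "t \<le> h" for s t
 proof -
  have "dist (x + s *\<^sub>R u + t *\<^sub>R v) x = norm (s *\<^sub>R u + t *\<^sub>R v)" by (simp add: dist_norm add.assoc)
  also have "\<dots> \<le> s * norm u + t * norm v" using that norm_triangle_ineq[of "s *\<^sub>R u" "t *\<^sub>R v"] by simp
  also have "\<dots> \<le> h * norm u + h * norm v" using that by (intro add_mono mult_right_mono) auto
  also have "\<dots> < 2 * h * (norm u + norm v + 1)"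
  proof -
   have "h * norm u \<ge> 0" "h * norm v \<ge> 0" using h by auto
   then have "h * norm u + h * norm v < 2 * (h * norm u) + 2 * (h * norm v) + 2 * h" using h by linarith
   then show ?thesis by (simp add: algebra_simps)
  qed
  also have "\<dots> = d" using add_nonneg_pos[of "norm u + norm v" 1] by (simp add: h_def field_simps)
  finally show ?thesis .
 qed
 have near': "dist (x + s *\<^sub>R v + t *\<^sub>R u) x < d" if "0 \<le> s" "s \<le> h" "0 \<le> t" "t \<le> h" for s t
  using near[OF that(3,4,1,2)] by (simp add: add_ac)
 define \<Delta> where "\<Delta> = f (x + h *\<^sub>R u + h *\<^sub>R v) - f (x + h *\<^sub>R u) - f (x + h *\<^sub>R v) + f x"
 obtain s t where "0 < s" "s < h" "0 < t" "t < h" and 1: "\<Delta> = h\<^sup>2 * ?a (x + s *\<^sub>R u + t *\<^sub>R v)"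
  using second_difference[OF S f h, of x u v] near d(2) unfolding \<Delta>_def by metis
 then have a: "dist (?a (x + s *\<^sub>R u + t *\<^sub>R v)) (?a x) < e" using near[of s t] d(2) by auto
 obtain s' t' where "0 < s'" "s' < h" "0 < t'" "t' < h"
  and 2: "f (x + h *\<^sub>R v + h *\<^sub>R u) - f (x + h *\<^sub>R v) - f (x + h *\<^sub>R u) + f x = h\<^sup>2 * ?b (x + s' *\<^sub>R v + t' *\<^sub>R u)"
  using second_difference[OF S f h, of x v u] near' d(2) by metis
 then have b: "dist (?b (x + s' *\<^sub>R v + t' *\<^sub>R u)) (?b x) < e" using near'[of s' t'] d(2) by auto
 have "\<Delta> = f (x + h *\<^sub>R v + h *\<^sub>R u) - f (x + h *\<^sub>R v) - f (x + h *\<^sub>R u) + f x"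
  by (simp add: \<Delta>_def add_ac)
 then have "?a (x + s *\<^sub>R u + t *\<^sub>R v) = ?b (x + s' *\<^sub>R v + t' *\<^sub>R u)" using 1 2 h by simp
 then show False using a b unfolding e_def dist_real_def by argo
qed

lemma ddir_commute:
 fixes f :: "'e::real_normed_vector => 'f::euclidean_space"
 assumes f: "smooth_on S f" and S: "open S" and x: "x \<in> S"
 shows "ddir (%y. ddir f y u) x v = ddir (%y. ddir f y v) x u"
proof (rule euclidean_eqI)
 fix b :: 'f
 have bl: "bounded_linear (%x::'f. x \<bullet> b)" by (rule bounded_linear_inner_left)
 have "ddir (%y. ddir (%y. f y \<bullet> b) y u) x v = ddir (%y. ddir f y u) x v \<bullet> b" for u v
 proof -
  have "ddir (%y. ddir (%y. f y \<bullet> b) y u) x v = ddir (%y. ddir f y u \<bullet> b) x v"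
   by (rule ddir_cong[OF S x]) (rule ddir_linear_comp[OF bl smooth_on_diffble[OF f S]])
  also have "\<dots> = ddir (%y. ddir f y u) x v \<bullet> b"
   by (rule ddir_linear_comp[OF bl smooth_on_diffble[OF smooth_on_ddir[OF f S] S x]])
  finally show ?thesis .
 qed
 moreover have "ddir (%y. ddir (%y. f y \<bullet> b) y u) x v = ddir (%y. ddir (%y. f y \<bullet> b) y v) x u"
  by (rule ddir_commute_real[OF S smooth_on_imp_Ck[OF smooth_on_linear_comp[OF bl f]] x])
 ultimately show "ddir (%y. ddir f y u) x v \<bullet> b = ddir (%y. ddir f y v) x u \<bullet> b" by simp
qed

section \<open>Smooth dependence of fixed points\<close>

text \<open>Banach's fixed point theorem replaces the Neumann series: z = w + K z has a unique
  solution, linear in \<open>w\<close> by uniqueness and bounded by twice the norm of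
  \<open>w\<close>.\<close>

lemma blinfun_id_minus_inverse:
 fixes K :: "'y::{real_normed_vector,complete_space} \<Rightarrow>\<^sub>L 'y"
 assumes K: "norm K \<le> 1 / 2"
 obtains B where "(id_blinfun - K) o\<^sub>L B = id_blinfun" "B o\<^sub>L (id_blinfun - K) = id_blinfun"
proof -
 have nK: "norm (K x) \<le> 1 / 2 * norm x" for x
  using order_trans[OF norm_blinfun[of K x] mult_right_mono[OF K norm_ge_zero]] .
 have ex: "\<exists>!z. w + K z = z" for w
 proof (rule banach_fix_type[of "1 / 2"])
  show "\<forall>x y. dist (w + blinfun_apply K x) (w + blinfun_apply K y) \<le> 1 / 2 * dist x y"
   using nK by (simp add: dist_norm blinfun.diff_right[symmetric])
 qed auto
 define b where "b w = (THE z. w + K z = z)" for w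
 have b: "w + K (b w) = b w" for w
  unfolding b_def using theI'[OF ex] .
 have b_eq: "b w = z" if "w + K z = z" for w z using ex b that by blast
 have lin: "linear b"
 proof (rule linearI)
  show "b (v + w) = b v + b w" for v w
   by (rule b_eq) (metis (no_types) b blinfun.add_right add.assoc add.left_commute)
  show "b (r *\<^sub>R v) = r *\<^sub>R b v" for r v
   by (rule b_eq) (metis b blinfun.scaleR_right scaleR_add_right)
 qed
 have "norm (b w) \<le> norm w * 2" for w
  using norm_triangle_ineq[of w "K (b w)"] b[of w] nK[of "b w"] by simp
 then have bl: "bounded_linear b"
  using lin unfolding bounded_linear_def bounded_linear_axioms_def by blast
 show thesis
 proof (rule that[of "Blinfun b"])
  show "(id_blinfun - K) o\<^sub>L Blinfun b = id_blinfun"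
  proof (rule blinfun_eqI)
   fix v show "((id_blinfun - K) o\<^sub>L Blinfun b) v = id_blinfun v"
    using b[of v] by (simp add: bounded_linear_Blinfun_apply[OF bl] blinfun.diff_left algebra_simps)
  qed
  show "Blinfun b o\<^sub>L (id_blinfun - K) = id_blinfun"
  proof (rule blinfun_eqI)
   fix v show "(Blinfun b o\<^sub>L (id_blinfun - K)) v = id_blinfun v"
    using b_eq[of "v - K v" v] by (simp add: bounded_linear_Blinfun_apply[OF bl] blinfun.diff_left)
  qed
 qed
qed

text \<open>The fixed point \<open>Y x = J x + N (Y x)\<close> of a contraction: its derivative solves the linearized
 fixed point equation, so that each degree of smoothness of \<open>Y\<close> yields the next one.\<close>

lemma smooth_fixed_point:
 fixes J :: "'e::real_normed_vector \<Rightarrow>\<^sub>L 'y::{real_normed_vector,complete_space}"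
  and N :: "'y => 'y" and N' :: "'y => 'y \<Rightarrow>\<^sub>L 'y"
 assumes contr: "!!y z. norm (N y - N z) \<le> 1 / 2 * norm (y - z)"
  and N': "!!y. norm (N' y) \<le> 1 / 2"
  and quad: "!!y k. norm (N (y + k) - N y - N' y k) \<le> C * norm k ^ 2"
  and Ck: "!!k g. Ck_on k (UNIV :: 'e set) g ==> Ck_on k UNIV (%x. N' (g x))"
 shows "\<exists>Y. (\<forall>x. Y x = J x + N (Y x)) \<and> (\<forall>x y. y = J x + N y \<longrightarrow> y = Y x) \<and>
  smooth_on UNIV Y \<and> (\<forall>x h. ddir Y x h = J h + N' (Y x) (ddir Y x h))"
proof -
 have ex: "\<exists>!y. J x + N y = y" for x
  by (rule banach_fix_type[of "1 / 2"]) (use contr in \<open>auto simp: dist_norm\<close>)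
 define Y where "Y x = (THE y. J x + N y = y)" for x
 have Y: "J x + N (Y x) = Y x" for x unfolding Y_def using theI'[OF ex] .
 have Yu: "y = Y x" if "y = J x + N y" for x y using ex Y that by metis
 \<comment> \<open>The contribution of \<open>N\<close> is at most half of the difference itself and
   is absorbed on the left.\<close>
 have lip: "norm (Y (x + h) - Y x) \<le> 2 * norm (J h)" for x h
 proof -
  have "Y (x + h) - Y x = J h + (N (Y (x + h)) - N (Y x))"
  proof -
   have "Y (x + h) - Y x = (J (x + h) + N (Y (x + h))) - (J x + N (Y x))" by (simp only: Y)
   then show ?thesis by (simp add: blinfun.add_right)
  qed
  then have "norm (Y (x + h) - Y x) \<le> norm (J h) + 1 / 2 * norm (Y (x + h) - Y x)"
   using norm_triangle_ineq[of "J h" "N (Y (x + h)) - N (Y x)"] contr[of "Y (x + h)" "Y x"] by simp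
  then show ?thesis by simp
 qed
 obtain B where B: "!!x. (id_blinfun - N' (Y x)) o\<^sub>L B x = id_blinfun"
  "!!x. B x o\<^sub>L (id_blinfun - N' (Y x)) = id_blinfun"
 proof -
  have "\<exists>B. (id_blinfun - N' (Y x)) o\<^sub>L B = id_blinfun \<and> B o\<^sub>L (id_blinfun - N' (Y x)) = id_blinfun" for x
   by (rule blinfun_id_minus_inverse[OF N'[of "Y x"]]) blast
  then show thesis using that by metis
 qed
 \<comment> \<open>The solution of the linearized equation, and the candidate for the derivative of
   \<open>Y\<close>.\<close>
 define Z where "Z x = B x o\<^sub>L J" for x
 have Z: "Z x h = J h + N' (Y x) (Z x h)" for x h
 proof -
  have "blinfun_apply ((id_blinfun - N' (Y x)) o\<^sub>L B x) (J h) = J h" by (simp only: B blinfun_apply_id_blinfun)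
  then show ?thesis by (simp add: Z_def blinfun.diff_left algebra_simps)
 qed
 define C' where "C' = \<bar>C\<bar> * 8 * norm J ^ 2"
 have C': "C' \<ge> 0" by (simp add: C'_def)
 have est: "norm (Y (x + h) - Y x - Z x h) \<le> C' * norm h ^ 2" for x h
 proof -
  let ?D = "Y (x + h) - Y x" and ?e = "Y (x + h) - Y x - Z x h"
  \<comment> \<open>The error solves the homogeneous linearized equation up to the Taylor remainder
    of \<open>N\<close>. Since \<open>N'\<close> has norm at most 1/2, its term is absorbed, and
    \<open>lip\<close> makes the error quadratic in \<open>h\<close>.\<close>
  have "?e = (N (Y x + ?D) - N (Y x) - N' (Y x) ?D) + N' (Y x) ?e"
  proof -
   have "?e = (J (x + h) + N (Y (x + h))) - (J x + N (Y x)) - (J h + N' (Y x) (Z x h))"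
    by (simp only: Y Z[symmetric])
   then have A: "?e = N (Y (x + h)) - N (Y x) - N' (Y x) (Z x h)"
    by (simp add: blinfun.add_right)
   have B: "N' (Y x) ?e = N' (Y x) ?D - N' (Y x) (Z x h)" by (simp only: blinfun.diff_right)
   have C: "Y x + ?D = Y (x + h)" by simp
   show ?thesis unfolding C B by (rule trans[OF A]) (simp only: add_diff_eq diff_add_cancel)
  qed
  then have "norm ?e \<le> norm (N (Y x + ?D) - N (Y x) - N' (Y x) ?D) + norm (N' (Y x) ?e)"
   by (metis norm_triangle_ineq)
  also have "\<dots> \<le> C * norm ?D ^ 2 + 1 / 2 * norm ?e"
   by (intro add_mono quad order_trans[OF norm_blinfun mult_right_mono[OF N' norm_ge_zero]])
  finally have 1: "norm ?e \<le> 2 * C * norm ?D ^ 2" by simp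
  have "norm ?D \<le> 2 * (norm J * norm h)" using lip[of x h] norm_blinfun[of J h] by linarith
  then have "norm ?D ^ 2 \<le> (2 * (norm J * norm h)) ^ 2" by (intro power_mono) auto
  then have "2 * \<bar>C\<bar> * norm ?D ^ 2 \<le> 2 * \<bar>C\<bar> * (2 * (norm J * norm h)) ^ 2"
   by (rule mult_left_mono) simp
  moreover have "2 * C * norm ?D ^ 2 \<le> 2 * \<bar>C\<bar> * norm ?D ^ 2" by (intro mult_right_mono) auto
  moreover have "2 * \<bar>C\<bar> * (2 * (norm J * norm h)) ^ 2 = C' * norm h ^ 2"
   by (simp add: C'_def power_mult_distrib)
  ultimately show ?thesis using 1 by linarith
 qed
 have der: "(Y has_derivative blinfun_apply (Z x)) (at x)" for x
  unfolding has_derivative_at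
 proof (intro conjI)
  show "bounded_linear (blinfun_apply (Z x))" by (rule blinfun.bounded_linear_right)
  show "(%h. norm (Y (x + h) - Y x - Z x h) / norm h) \<midarrow>0\<rightarrow> 0"
  proof (rule Lim_null_comparison)
   have "norm (norm (Y (x + h) - Y x - Z x h) / norm h) \<le> C' * norm h" if "h \<noteq> 0" for h
    using est[of x h] that by (simp add: divide_le_eq power2_eq_square mult.assoc)
   then show "\<forall>\<^sub>F h in at 0. norm (norm (Y (x + h) - Y x - Z x h) / norm h) \<le> C' * norm h"
    by (auto simp: eventually_at_filter)
   show "(%h::'e. C' * norm h) \<midarrow>0\<rightarrow> 0" by (auto intro!: tendsto_eq_intros)
  qed
 qed
 have dd: "ddir Y x h = Z x h" for x h by (rule ddir_eq[OF der])
 have "Ck_on k UNIV Y" for k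
 proof (induction k)
  case 0
  then show ?case using has_derivative_continuous[OF der] continuous_at_imp_continuous_on by auto
 next
  case (Suc k)
  have "Ck_on k UNIV B"
  proof (rule Ck_on_blinfun_inverse[where A = "%x. id_blinfun - N' (Y x)"])
   have "Ck_on k UNIV (%x. id_blinfun + - N' (Y x))"
    by (intro Ck_on_add Ck_on_const Ck_on_linear_comp[OF bounded_linear_minus[OF bounded_linear_ident]]
      Ck Suc.IH)
   then show "Ck_on k UNIV (%x. id_blinfun - N' (Y x))" by simp
  qed (use B in auto)
  then have "Ck_on k UNIV (%x. Z x h)" for h
   unfolding Z_def blinfun_apply_blinfun_compose
   by (rule Ck_on_linear_comp[OF blinfun.bounded_linear_left])
  then show ?case using der has_derivative_at_withinI
   by (intro Ck_on_Suc_withinI[where f' = "%x. blinfun_apply (Z x)"]) auto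
 qed
 then have "smooth_on UNIV Y" by (simp add: smooth_on_def)
 moreover have "Y x = J x + N (Y x)" for x using Y by simp
 ultimately show ?thesis using Yu Z dd by (intro exI[of _ Y]) auto
qed

section \<open>Compactly supported maps and composition operators\<close>

text \<open>Bounded support makes all derivatives bounded on the whole space, so composition with
  \<open>f\<close> is defined and smooth on all bounded curves, without restricting their
  range.\<close>

definition csmooth :: "('e::euclidean_space => 'f::real_normed_vector) => bool" where
 "csmooth f \<longleftrightarrow> smooth_on UNIV f \<and> (\<exists>R. \<forall>x. norm x > R \<longrightarrow> f x = 0)"

lemma csmooth_ddir:
 assumes "csmooth f" shows "csmooth (%x. ddir f x v)"
proof -
 obtain R where R: "!!x. norm x > R ==> f x = 0" using assms by (auto simp: csmooth_def)
 have "ddir f x v = 0" if "norm x > R" for x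
 proof -
  have "open {x::'a. norm x > R}" by (intro open_Collect_less continuous_intros)
  then have "ddir f x v = ddir (%x. 0) x v" by (rule ddir_cong) (use that R in auto)
  then show ?thesis by (simp add: ddir_const)
 qed
 then show ?thesis using assms by (auto simp: csmooth_def intro!: smooth_on_ddir)
qed

lemma csmooth_bounded:
 assumes "csmooth f"
 obtains K where "K \<ge> 0" "!!x. norm (f x) \<le> K"
proof -
 obtain R where R: "!!x. norm x > R ==> f x = 0" using assms by (auto simp: csmooth_def)
 have "continuous_on (cball 0 R) f"
  using assms continuous_on_subset[OF smooth_on_continuous_on, of UNIV f] by (auto simp: csmooth_def)
 then have "bounded (f ` cball 0 R)"
  using compact_continuous_image compact_imp_bounded compact_cball by blast
 then obtain K where "!!y. y \<in> f ` cball 0 R ==> norm y \<le> K" unfolding bounded_iff by metis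
 then have K: "norm x \<le> R ==> norm (f x) \<le> K" for x by simp
 have "norm (f x) \<le> max K 0" for x using K[of x] R[of x] by (cases "norm x \<le> R") auto
 then show thesis using that[of "max K 0"] by auto
qed

lemma csmooth_linear_ddir: "csmooth f ==> linear (ddir f x)"
 using smooth_on_has_derivative[of UNIV f x] has_derivative_linear by (auto simp: csmooth_def)

lemma csmooth_ddir_bound:
 fixes f :: "'e::euclidean_space => 'f::real_normed_vector"
 assumes "csmooth f"
 obtains L where "L \<ge> 0" "!!x v. norm (ddir f x v) \<le> L * norm v"
proof -
 have "\<exists>K. K \<ge> 0 \<and> (\<forall>x. norm (ddir f x b) \<le> K)" for b
  using csmooth_bounded[OF csmooth_ddir[OF assms]] by metis
 then obtain K where K: "!!b. K b \<ge> 0" "!!b x. norm (ddir f x b) \<le> K b" by metis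
 have "norm (ddir f x v) \<le> (\<Sum>b\<in>Basis. K b) * norm v" for x v
 proof -
  have "norm (ddir f x v) \<le> (\<Sum>b\<in>Basis. norm ((v \<bullet> b) *\<^sub>R ddir f x b))"
   unfolding linear_on_Basis_sum[OF csmooth_linear_ddir[OF assms], of x v] by (rule norm_sum)
  also have "\<dots> \<le> (\<Sum>b\<in>Basis. norm v * K b)"
   by (auto intro!: sum_mono mult_mono K Basis_le_norm)
  finally show ?thesis by (simp add: sum_distrib_left mult.commute)
 qed
 moreover have "(\<Sum>b\<in>Basis. K b) \<ge> 0" using K by (intro sum_nonneg) auto
 ultimately show thesis using that by blast
qed

lemma csmooth_lipschitz:
 assumes f: "csmooth f" and L: "!!x v. norm (ddir f x v) \<le> L * norm v"
 shows "norm (f x - f y) \<le> L * norm (x - y)"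
proof (rule differentiable_bound[OF convex_UNIV, of f "ddir f"])
 show "(f has_derivative ddir f x) (at x within UNIV)" for x
  using f smooth_on_has_derivative[of UNIV f x] by (simp add: csmooth_def)
 show "onorm (ddir f x) \<le> L" for x using L by (rule onorm_le)
qed auto

text \<open>Second derivatives are bounded, hence the first derivative is Lipschitz with one
  constant everywhere. This uniformity in \<open>x\<close> is what lifts the Taylor estimate from
  points to curves.\<close>

lemma csmooth_quadratic:
 fixes f :: "'e::euclidean_space => 'f::real_normed_vector"
 assumes f: "csmooth f"
 obtains C where "C \<ge> 0" "!!x h. norm (f (x + h) - f x - ddir f x h) \<le> C * norm h ^ 2"
proof -
 have "\<exists>K. K \<ge> 0 \<and> (\<forall>x y. norm (ddir f x b - ddir f y b) \<le> K * norm (x - y))" for b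
  using csmooth_ddir_bound[OF csmooth_ddir[OF f, of b]] csmooth_lipschitz[OF csmooth_ddir[OF f, of b]] by metis
 then obtain K where K: "!!b. K b \<ge> 0" "!!b x y. norm (ddir f x b - ddir f y b) \<le> K b * norm (x - y)" by metis
 define C where "C = (\<Sum>b\<in>Basis. K b)"
 have C: "C \<ge> 0" using K by (auto simp: C_def intro!: sum_nonneg)
 have d: "norm (ddir f x v - ddir f y v) \<le> C * norm (x - y) * norm v" for x y v
 proof -
  have "norm (ddir f x v - ddir f y v) = norm (\<Sum>b\<in>Basis. (v \<bullet> b) *\<^sub>R (ddir f x b - ddir f y b))"
   unfolding linear_on_Basis_sum[OF csmooth_linear_ddir[OF f], of _ v]
   by (simp add: sum_subtractf scaleR_diff_right)
  also have "\<dots> \<le> (\<Sum>b\<in>Basis. norm ((v \<bullet> b) *\<^sub>R (ddir f x b - ddir f y b)))" by (rule norm_sum)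
  also have "\<dots> \<le> (\<Sum>b\<in>Basis. norm v * (K b * norm (x - y)))"
   by (auto intro!: sum_mono mult_mono K Basis_le_norm)
  finally show ?thesis by (simp add: C_def sum_distrib_left sum_distrib_right mult_ac)
 qed
 have "norm (f (x + h) - f x - ddir f x h) \<le> C * norm h ^ 2" for x h
 proof -
  have "norm (f (x + h) - f x - ddir f x (x + h - x)) \<le> norm (x + h - x) * (C * norm h)"
  proof (rule differentiable_bound_linearization[where S = "cball x (norm h)"])
   show "x + t *\<^sub>R (x + h - x) \<in> cball x (norm h)" if "t \<in> {0..1}" for t
    using that by (simp add: dist_norm mult_left_le_one_le)
   show "(f has_derivative ddir f y) (at y within cball x (norm h))" for y
    using f smooth_on_has_derivative[of UNIV f y] has_derivative_at_withinI by (auto simp: csmooth_def)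
   show "onorm (ddir f y - ddir f x) \<le> C * norm h" if "y \<in> cball x (norm h)" for y
   proof (rule onorm_le)
    fix v
    have "norm ((ddir f y - ddir f x) v) \<le> C * norm (y - x) * norm v" using d by simp
    also have "\<dots> \<le> C * norm h * norm v"
     using that C by (intro mult_right_mono mult_left_mono) (auto simp: dist_norm norm_minus_commute)
    finally show "norm ((ddir f y - ddir f x) v) \<le> C * norm h * norm v" .
   qed
  qed simp
  then show ?thesis by (simp add: power2_eq_square mult_ac)
 qed
 then show thesis using that C by blast
qed

text \<open>The composition (Nemytskii) operator on bounded continuous curves.\<close>

definition nem :: "('e::euclidean_space => 'f::real_normed_vector) => (real \<Rightarrow>\<^sub>C 'e) => (real \<Rightarrow>\<^sub>C 'f)" where
 "nem f u = Bcontfun (%t. f (u t))"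

lemma nem_apply: "csmooth f ==> nem f u t = f (u t)"
proof -
 assume f: "csmooth f"
 obtain K where "!!x. norm (f x) \<le> K" using csmooth_bounded[OF f] by metis
 moreover have "continuous_on UNIV (%t. f (u t))"
  using f smooth_on_continuous_on[of UNIV f] continuous_on_compose2[of UNIV f UNIV u] by (auto simp: csmooth_def)
 ultimately have "(%t. f (u t)) \<in> bcontfun" by (intro bcontfun_normI) auto
 then show ?thesis by (simp add: nem_def Bcontfun_inverse)
qed

definition bmul :: "(real \<Rightarrow>\<^sub>C real) => (real \<Rightarrow>\<^sub>C 'f::real_normed_vector) => (real \<Rightarrow>\<^sub>C 'f)" where
 "bmul a w = Bcontfun (%t. a t *\<^sub>R w t)"

lemma bmul_apply: "bmul a w t = a t *\<^sub>R w t"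
proof -
 have "(%t. a t *\<^sub>R w t) \<in> bcontfun"
  by (rule bcontfun_normI[where b = "norm a * norm w"])
   (auto intro!: continuous_intros mult_mono norm_bounded[of a, simplified] norm_bounded)
 then show ?thesis by (simp add: bmul_def Bcontfun_inverse)
qed

lemma bounded_bilinear_bmul: "bounded_bilinear bmul"
proof
 show "\<exists>K. \<forall>a b. norm (bmul a b) \<le> norm a * norm b * K"
 proof (intro exI[of _ 1] allI norm_bound)
  fix a :: "real \<Rightarrow>\<^sub>C real" and b :: "real \<Rightarrow>\<^sub>C 'f::real_normed_vector" and t
  have "norm (bmul a b t) = norm (a t) * norm (b t)" by (simp add: bmul_apply)
  also have "\<dots> \<le> norm a * norm b" by (intro mult_mono norm_bounded) auto
  finally show "norm (bmul a b t) \<le> norm a * norm b * 1" by simp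
 qed
qed (auto intro!: bcontfun_eqI simp: bmul_apply algebra_simps)

interpretation bmul: bounded_bilinear bmul by (rule bounded_bilinear_bmul)

definition bcoord :: "'e::euclidean_space => (real \<Rightarrow>\<^sub>C 'e) => (real \<Rightarrow>\<^sub>C real)" where
 "bcoord b w = Bcontfun (%t. w t \<bullet> b)"

lemma bcoord_apply: "bcoord b w t = w t \<bullet> b"
proof -
 have "norm (w t \<bullet> b) \<le> norm w * norm b" for t
  using order_trans[OF Cauchy_Schwarz_ineq2 mult_right_mono[OF norm_bounded[of w t] norm_ge_zero]] by simp
 then have "(%t. w t \<bullet> b) \<in> bcontfun"
  by (intro bcontfun_normI[where b = "norm w * norm b"]) (auto intro!: continuous_intros)
 then show ?thesis by (simp add: bcoord_def Bcontfun_inverse)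
qed

lemma bounded_linear_bcoord: "bounded_linear (bcoord b)"
proof
 show "\<exists>K. \<forall>x. norm (bcoord b x) \<le> norm x * K"
  by (intro exI[of _ "norm b"] allI norm_bound)
   (auto simp: bcoord_apply intro: order_trans[OF Cauchy_Schwarz_ineq2 mult_right_mono[OF norm_bounded norm_ge_zero]])
qed (auto intro!: bcontfun_eqI simp: bcoord_apply inner_add_left)

text \<open>The derivative h -> df(u) h of \<open>nem f\<close>, written as multiplication by the
  partial derivatives of \<open>f\<close> along \<open>u\<close>. In this form it consists of
  operators \<open>nem\<close> again, for functions that are still compactly supported.\<close>

definition Dnem :: "('e::euclidean_space => 'f::real_normed_vector) => (real \<Rightarrow>\<^sub>C 'e) =>
  (real \<Rightarrow>\<^sub>C 'e) \<Rightarrow>\<^sub>L (real \<Rightarrow>\<^sub>C 'f)" where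
 "Dnem f u = (\<Sum>b\<in>Basis. bmul.prod_left (nem (%x. ddir f x b) u) o\<^sub>L Blinfun (bcoord b))"

lemma bcontfun_sum_apply: "apply_bcontfun (\<Sum>i\<in>I. f i) t = (\<Sum>i\<in>I. apply_bcontfun (f i) t)"
 by (induction I rule: infinite_finite_induct) auto

lemma Dnem_apply:
 assumes "csmooth f" shows "Dnem f u h t = ddir f (u t) (h t)"
 unfolding linear_on_Basis_sum[OF csmooth_linear_ddir[OF assms], of _ "h t"]
 by (simp add: Dnem_def blinfun.sum_left bcontfun_sum_apply bmul.prod_left.rep_eq bmul_apply
   bounded_linear_Blinfun_apply bounded_linear_bcoord bcoord_apply nem_apply csmooth_ddir[OF assms])

lemma Dnem_norm:
 assumes "csmooth f" "L \<ge> 0" "!!x v. norm (ddir f x v) \<le> L * norm v"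
 shows "norm (Dnem f u) \<le> L"
proof (intro norm_blinfun_bound assms(2) norm_bound)
 fix h t
 have "norm (Dnem f u h t) \<le> L * norm (h t)" using assms by (simp add: Dnem_apply)
 also have "\<dots> \<le> L * norm h" by (intro mult_left_mono norm_bounded assms)
 finally show "norm (Dnem f u h t) \<le> L * norm h" .
qed

lemma nem_lipschitz:
 assumes "csmooth f" "L \<ge> 0" "!!x v. norm (ddir f x v) \<le> L * norm v"
 shows "norm (nem f u - nem f w) \<le> L * norm (u - w)"
proof (rule norm_bound)
 fix t
 have "norm ((nem f u - nem f w) t) \<le> L * norm ((u - w) t)"
  using csmooth_lipschitz[OF assms(1,3)] by (simp add: nem_apply assms(1))
 also have "\<dots> \<le> L * norm (u - w)" by (intro mult_left_mono norm_bounded assms)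
 finally show "norm ((nem f u - nem f w) t) \<le> L * norm (u - w)" .
qed

lemma nem_quadratic:
 assumes "csmooth f" "C \<ge> 0" "!!x h. norm (f (x + h) - f x - ddir f x h) \<le> C * norm h ^ 2"
 shows "norm (nem f (u + k) - nem f u - Dnem f u k) \<le> C * norm k ^ 2"
proof (rule norm_bound)
 fix t
 have "norm ((nem f (u + k) - nem f u - Dnem f u k) t) \<le> C * norm (k t) ^ 2"
  using assms by (simp add: nem_apply Dnem_apply)
 also have "\<dots> \<le> C * norm k ^ 2" by (intro mult_left_mono power_mono norm_bounded assms) auto
 finally show "norm ((nem f (u + k) - nem f u - Dnem f u k) t) \<le> C * norm k ^ 2" .
qed

lemma has_derivative_nem:
 fixes f :: "'e::euclidean_space => 'f::real_normed_vector"
 assumes f: "csmooth f" shows "(nem f has_derivative Dnem f u) (at u)"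
 unfolding has_derivative_at
proof (intro conjI)
 show "bounded_linear (blinfun_apply (Dnem f u))" by (rule blinfun.bounded_linear_right)
 obtain C where C: "C \<ge> 0" "!!x h. norm (f (x + h) - f x - ddir f x h) \<le> C * norm h ^ 2"
  using csmooth_quadratic[OF f] by metis
 show "(%h. norm (nem f (u + h) - nem f u - Dnem f u h) / norm h) \<midarrow>0\<rightarrow> 0"
 proof (rule Lim_null_comparison)
  have "norm (norm (nem f (u + h) - nem f u - Dnem f u h) / norm h) \<le> C * norm h" if "h \<noteq> 0" for h
   using nem_quadratic[OF f C, of u h] that by (simp add: divide_le_eq power2_eq_square mult.assoc)
  then show "\<forall>\<^sub>F h in at 0. norm (norm (nem f (u + h) - nem f u - Dnem f u h) / norm h) \<le> C * norm h"
   by (auto simp: eventually_at_filter)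
  show "(%h::real \<Rightarrow>\<^sub>C 'e. C * norm h) \<midarrow>0\<rightarrow> 0" by (auto intro!: tendsto_eq_intros)
 qed
qed

text \<open>The derivative involves \<open>nem\<close> for partial derivatives of \<open>f\<close>
  only, so the induction runs over all compactly supported \<open>f\<close> at once.\<close>

lemma Ck_on_nem:
 fixes f :: "'e::euclidean_space => 'f::real_normed_vector"
 assumes "csmooth f" "Ck_on k S u"
 shows "Ck_on k S (%x. nem f (u x))"
 using assms
proof (induction k arbitrary: f)
 case 0
 have "continuous_on UNIV (nem f)"
  using has_derivative_continuous[OF has_derivative_nem[OF 0(1)]] continuous_at_imp_continuous_on by blast
 then show ?case using 0(2) continuous_on_compose2[of UNIV "nem f" S u] by auto
next
 case (Suc k)
 from Ck_on_SucE[OF Suc.prems(2)] obtain u'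
  where u': "!!x. x \<in> S ==> (u has_derivative u' x) (at x within S)"
  and *: "!!v. Ck_on k S (%x. u' x v)" by blast
 have uk: "Ck_on k S u" by (rule Ck_on_SucD[OF Suc.prems(2)])
 show ?case
 proof (rule Ck_on_Suc_withinI)
  show "((%x. nem f (u x)) has_derivative (%v. Dnem f (u x) (u' x v))) (at x within S)" if "x \<in> S" for x
   by (rule has_derivative_compose[OF u'[OF that] has_derivative_nem[OF Suc.prems(1)]])
  have "Ck_on k S (%x. Dnem f (u x))" unfolding Dnem_def
   by (intro Ck_on_sum Ck_on_bilinear[OF bounded_bilinear_blinfun_compose] Ck_on_const
     Ck_on_linear_comp[OF bmul.bounded_linear_prod_left] Suc.IH csmooth_ddir Suc.prems uk)
  then show "Ck_on k S (%x. Dnem f (u x) (u' x v))" for v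
   by (rule Ck_on_bilinear[OF bounded_bilinear_blinfun_apply _ *])
 qed
qed

lemma Ck_on_Dnem:
 fixes f :: "'e::euclidean_space => 'f::real_normed_vector"
 assumes "csmooth f" "Ck_on k S u"
 shows "Ck_on k S (%x. Dnem f (u x))"
 unfolding Dnem_def
 by (intro Ck_on_sum Ck_on_bilinear[OF bounded_bilinear_blinfun_compose] Ck_on_const
   Ck_on_linear_comp[OF bmul.bounded_linear_prod_left] Ck_on_nem csmooth_ddir assms)

section \<open>The flow of a compactly supported vector field\<close>

text \<open>The upper limit is clamped to the unit interval, so that the integral is a bounded
  continuous function on the whole line and stays in the space where the fixed point is
  sought.\<close>

definition bint :: "(real \<Rightarrow>\<^sub>C 'e::euclidean_space) => (real \<Rightarrow>\<^sub>C 'e)" where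
 "bint u = Bcontfun (%t. integral {0..max 0 (min 1 t)} u)"

lemma bint_bound:
 fixes u :: "real \<Rightarrow>\<^sub>C 'e::euclidean_space"
 shows "norm (integral {0..max 0 (min 1 (t::real))} (apply_bcontfun u)) \<le> norm u"
proof -
 have "norm (integral {0..max 0 (min 1 t)} (apply_bcontfun u)) \<le> norm u * (max 0 (min 1 t) - 0)"
  by (rule integral_bound) (auto intro!: norm_bounded)
 also have "\<dots> \<le> norm u * 1" by (intro mult_left_mono) auto
 finally show ?thesis by simp
qed

lemma bint_apply: "bint u t = integral {0..max 0 (min 1 t)} u"
proof -
 have "continuous_on {0..1} (%x. integral {0..x} (apply_bcontfun u))"
  by (intro indefinite_integral_continuous_1 integrable_continuous_real) auto
 then have "continuous_on UNIV (%t. integral {0..max 0 (min 1 t)} (apply_bcontfun u))"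
  by (rule continuous_on_compose2) (auto intro!: continuous_intros)
 then have "(%t. integral {0..max 0 (min 1 t)} (apply_bcontfun u)) \<in> bcontfun"
  using bint_bound by (intro bcontfun_normI)
 then show ?thesis by (simp add: bint_def Bcontfun_inverse)
qed

lemma bounded_linear_bint: "bounded_linear bint"
proof
 have i: "(apply_bcontfun u) integrable_on {0..a}" for u :: "real \<Rightarrow>\<^sub>C 'a" and a
  by (intro integrable_continuous_real) auto
 show "bint (u + w) = bint u + bint w" for u w :: "real \<Rightarrow>\<^sub>C 'a"
  by (rule bcontfun_eqI) (simp add: bint_apply integral_add[OF i i])
 show "bint (r *\<^sub>R u) = r *\<^sub>R bint u" for r and u :: "real \<Rightarrow>\<^sub>C 'a"
  by (rule bcontfun_eqI) (simp add: bint_apply)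
 show "\<exists>K. \<forall>x::real \<Rightarrow>\<^sub>C 'a. norm (bint x) \<le> norm x * K"
  by (intro exI[of _ 1] allI norm_bound) (simp add: bint_apply bint_bound)
qed

lemma norm_bint: "norm (bint u) \<le> norm u"
 by (rule norm_bound) (simp add: bint_apply bint_bound)

lemma bounded_linear_const_bcontfun: "bounded_linear (const_bcontfun :: 'e::real_normed_vector => (real \<Rightarrow>\<^sub>C 'e))"
proof
 show "\<exists>K. \<forall>x. norm (const_bcontfun x :: real \<Rightarrow>\<^sub>C 'e) \<le> norm x * K"
  by (intro exI[of _ 1] allI norm_bound) simp
qed (auto intro!: bcontfun_eqI)

lemma bint_has_vector_derivative:
 assumes "t \<in> {0..1}"
 shows "(bint u has_vector_derivative u t) (at t within {0..1})"
proof -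
 have "((%t. integral {0..t} (apply_bcontfun u)) has_vector_derivative u t) (at t within {0..1})"
  by (rule integral_has_vector_derivative) (use assms in auto)
 then show ?thesis
  by (rule has_vector_derivative_transform[OF assms, rotated]) (auto simp: bint_apply)
qed

lemma bint_0: "bint u 0 = 0"
 by (simp add: bint_apply)

text \<open>Picard's integral equation is a fixed point equation for the whole curve. The curve
  depends smoothly on \<open>x\<close> as an element of the function space, and differentiating the
  equation there gives the variational equation for \<open>ddir Y x h\<close>. At a zero of
  \<open>f\<close> the constant curve is a solution, so it is \<open>Y x\<close> by
  uniqueness.\<close>

theorem csmooth_flow:
 fixes f :: "'e::euclidean_space => 'e"
 assumes f: "csmooth f"
 obtains \<epsilon> :: real and Y :: "'e => real \<Rightarrow>\<^sub>C 'e" where "\<epsilon> > 0" "smooth_on UNIV Y"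
  "!!x. Y x 0 = x" "!!x h. ddir Y x h 0 = h"
  "!!x t. t \<in> {0..1} ==> (Y x has_vector_derivative \<epsilon> *\<^sub>R f (Y x t)) (at t within {0..1})"
  "!!x h t. t \<in> {0..1} ==>
    (ddir Y x h has_vector_derivative \<epsilon> *\<^sub>R ddir f (Y x t) (ddir Y x h t)) (at t within {0..1})"
  "!!x. f x = 0 ==> Y x = const_bcontfun x"
proof -
 obtain L where L: "L \<ge> 0" "!!x v. norm (ddir f x v) \<le> L * norm v"
  using csmooth_ddir_bound[OF f] by metis
 obtain C where C: "C \<ge> 0" "!!x h. norm (f (x + h) - f x - ddir f x h) \<le> C * norm h ^ 2"
  using csmooth_quadratic[OF f] by metis
 \<comment> \<open>The field is scaled instead of shortening the time interval: the integral
   operator then contracts by 1/2 over unit time. The 1 covers \<open>L = 0\<close>.\<close>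
 define \<epsilon> where "\<epsilon> = 1 / (2 * (L + 1))"
 have \<epsilon>: "\<epsilon> > 0" "\<epsilon> * L \<le> 1 / 2" using L by (auto simp: \<epsilon>_def field_simps)
 define I where "I = \<epsilon> *\<^sub>R Blinfun (bint :: (real \<Rightarrow>\<^sub>C 'e) => _)"
 have I: "I u = \<epsilon> *\<^sub>R bint u" for u
  by (simp add: I_def blinfun.scaleR_left bounded_linear_Blinfun_apply bounded_linear_bint)
 have nI: "norm (I u) \<le> \<epsilon> * norm u" for u using norm_bint[of u] \<epsilon> by (simp add: I)
 have nI': "norm I \<le> \<epsilon>" by (rule norm_blinfun_bound) (use \<epsilon> nI in auto)
 define J where "J = Blinfun (const_bcontfun :: 'e => (real \<Rightarrow>\<^sub>C 'e))"
 have J: "J x = const_bcontfun x" for x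
  by (simp add: J_def bounded_linear_Blinfun_apply bounded_linear_const_bcontfun)
 have c1: "norm (I (nem f y) - I (nem f z)) \<le> 1 / 2 * norm (y - z)" for y z
 proof -
  have "norm (I (nem f y - nem f z)) \<le> \<epsilon> * (L * norm (y - z))"
   using order_trans[OF nI mult_left_mono[OF nem_lipschitz[OF f L]]] \<epsilon> by simp
  also have "\<dots> \<le> 1 / 2 * norm (y - z)" using mult_right_mono[OF \<epsilon>(2) norm_ge_zero] by (simp add: mult.assoc)
  finally show ?thesis by (simp add: blinfun.diff_right)
 qed
 have c2: "norm (I o\<^sub>L Dnem f y) \<le> 1 / 2" for y
 proof -
  have "norm (I o\<^sub>L Dnem f y) \<le> norm I * norm (Dnem f y)" by (rule norm_blinfun_compose)
  also have "\<dots> \<le> \<epsilon> * L" using nI' Dnem_norm[OF f L] \<epsilon> by (intro mult_mono) auto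
  finally show ?thesis using \<epsilon> by simp
 qed
 have c3: "norm (I (nem f (y + k)) - I (nem f y) - (I o\<^sub>L Dnem f y) k) \<le> \<epsilon> * C * norm k ^ 2" for y k
  using order_trans[OF nI[of "nem f (y + k) - nem f y - Dnem f y k"] mult_left_mono[OF nem_quadratic[OF f C]]] \<epsilon>
  by (simp add: blinfun.diff_right mult.assoc)
 have c4: "Ck_on k UNIV (%x. I o\<^sub>L Dnem f (g x))" if "Ck_on k UNIV g" for k and g :: "'e => real \<Rightarrow>\<^sub>C 'e"
  by (intro Ck_on_bilinear[OF bounded_bilinear_blinfun_compose] Ck_on_const Ck_on_Dnem f that)
 have "\<exists>Y. (\<forall>x. Y x = J x + I (nem f (Y x))) \<and> (\<forall>x y. y = J x + I (nem f y) \<longrightarrow> y = Y x) \<and>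
  smooth_on UNIV Y \<and> (\<forall>x h. ddir Y x h = J h + (I o\<^sub>L Dnem f (Y x)) (ddir Y x h))"
  by (rule smooth_fixed_point[of "%y. I (nem f y)" "%y. I o\<^sub>L Dnem f y" "\<epsilon> * C" J, OF c1 c2 c3]) (rule c4)
 then obtain Y where Y: "!!x. Y x = J x + I (nem f (Y x))" and Yu: "!!x y. y = J x + I (nem f y) ==> y = Y x"
  and sm: "smooth_on UNIV Y"
  and dY: "!!x h. ddir Y x h = J h + (I o\<^sub>L Dnem f (Y x)) (ddir Y x h)"
  by metis
 have Y_at: "Y x t = x + \<epsilon> *\<^sub>R bint (nem f (Y x)) t" for x t
  by (subst Y) (simp add: J I)
 have dY_at: "ddir Y x h t = h + \<epsilon> *\<^sub>R bint (Dnem f (Y x) (ddir Y x h)) t" for x h t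
  by (subst dY) (simp add: J I)
 show thesis
 proof (rule that[OF \<epsilon>(1) sm])
  show "Y x 0 = x" "ddir Y x h 0 = h" for x h
   by (simp_all add: Y_at[of x 0] dY_at[of x h 0] bint_0)
  fix x h and t :: real assume t: "t \<in> {0..1}"
  have "((%t. x + \<epsilon> *\<^sub>R bint (nem f (Y x)) t) has_vector_derivative 0 + \<epsilon> *\<^sub>R nem f (Y x) t) (at t within {0..1})"
   by (intro has_vector_derivative_add has_vector_derivative_const
     bounded_linear.has_vector_derivative[OF bounded_linear_scaleR_right] bint_has_vector_derivative t)
  then show "(Y x has_vector_derivative \<epsilon> *\<^sub>R f (Y x t)) (at t within {0..1})"
   unfolding Y_at[symmetric] by (simp add: nem_apply[OF f])
  have "((%t. h + \<epsilon> *\<^sub>R bint (Dnem f (Y x) (ddir Y x h)) t) has_vector_derivative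
    0 + \<epsilon> *\<^sub>R Dnem f (Y x) (ddir Y x h) t) (at t within {0..1})"
   by (intro has_vector_derivative_add has_vector_derivative_const
     bounded_linear.has_vector_derivative[OF bounded_linear_scaleR_right] bint_has_vector_derivative t)
  then show "(ddir Y x h has_vector_derivative \<epsilon> *\<^sub>R ddir f (Y x t) (ddir Y x h t)) (at t within {0..1})"
   unfolding dY_at[symmetric] by (simp add: Dnem_apply[OF f])
 next
  fix x assume "f x = 0"
  then have "nem f (const_bcontfun x) = 0" by (intro bcontfun_eqI) (simp add: nem_apply[OF f])
  then have "const_bcontfun x = J x + I (nem f (const_bcontfun x))" by (simp add: J blinfun.zero_right)
  then show "Y x = const_bcontfun x" using Yu by metis
 qed
qed

text \<open>Gronwall's argument: exp (- 2 C t) times the squared norm does not increase, and it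
  starts at 0.\<close>

lemma linear_ode_unique:
 fixes K :: "real => 'e::euclidean_space"
 assumes K: "!!t. t \<in> {0..1} ==> (K has_vector_derivative K' t) (at t within {0..1})"
  and bound: "!!t. t \<in> {0..1} ==> norm (K' t) \<le> C * norm (K t)" and 0: "K 0 = 0"
  and t: "t \<in> {0..1}"
 shows "K t = 0"
proof -
 define h where "h t = exp (- 2 * C * t) * (K t \<bullet> K t)" for t
 have "continuous_on {0..1} K"
  unfolding continuous_on_eq_continuous_within using has_vector_derivative_continuous[OF K] by blast
 then have ch: "continuous_on {0..1} h" unfolding h_def by (intro continuous_intros)
 have "h t \<le> h 0"
 proof (rule DERIV_nonpos_imp_decreasing_open[where f = h and a = 0 and b = t])
  show "0 \<le> t" using t by simp
  show "continuous_on {0..t} h" using ch t continuous_on_subset[of "{0..1}" h "{0..t}"] by auto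
  fix s assume s: "0 < s" "s < t"
  have Ks: "(K has_vector_derivative K' s) (at s)"
   using K[of s] s t at_within_interior[of s "{0..1}"] by simp
  then have "((%t. K t \<bullet> K t) has_real_derivative (2 * (K s \<bullet> K' s))) (at s)"
   unfolding has_real_derivative_iff_has_vector_derivative has_vector_derivative_def
   by (auto intro!: derivative_eq_intros simp: inner_commute algebra_simps)
  then have "(h has_real_derivative (exp (- 2 * C * s) * (2 * (K s \<bullet> K' s)) + (exp (- 2 * C * s) * (- 2 * C)) * (K s \<bullet> K s))) (at s)"
   unfolding h_def by (auto intro!: derivative_eq_intros)
  moreover have "K s \<bullet> K' s \<le> C * (K s \<bullet> K s)"
  proof -
   have "K s \<bullet> K' s \<le> norm (K s) * norm (K' s)" by (rule norm_cauchy_schwarz)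
   also have "\<dots> \<le> norm (K s) * (C * norm (K s))" using bound[of s] s t by (intro mult_left_mono) auto
   finally show ?thesis by (simp add: dot_square_norm power2_eq_square mult_ac)
  qed
  then have "exp (- 2 * C * s) * (2 * (K s \<bullet> K' s) - 2 * C * (K s \<bullet> K s)) \<le> 0"
   by (intro mult_nonneg_nonpos) auto
  ultimately show "\<exists>y. DERIV h s :> y \<and> y \<le> 0"
   by (intro exI conjI) (auto simp: algebra_simps)
 qed
 then have "K t \<bullet> K t \<le> 0" using 0 by (simp add: h_def mult_le_0_iff)
 then have "K t \<bullet> K t = 0" using inner_ge_zero[of "K t"] by linarith
 then show ?thesis by simp
qed

section \<open>The Frobenius theorem\<close>

text \<open>Near a point outside \<open>W\<close> the product is identically 0, because
  \<open>K\<close> is closed and contained in \<open>W\<close>; inside \<open>W\<close> both factors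
  are smooth.\<close>

lemma smooth_on_cutoff:
 fixes f :: "'e::real_normed_vector => 'f::real_normed_vector" and h :: "'e => real"
 assumes "open W" "smooth_on W f" "open S" "smooth_on S h" "closed K" "K \<subseteq> W" "!!x. x \<notin> K ==> h x = 0"
 shows "smooth_on S (%x. h x *\<^sub>R f x)"
proof (rule smooth_on_local[OF \<open>open S\<close>])
 fix x assume x: "x \<in> S"
 show "\<exists>U. open U \<and> x \<in> U \<and> smooth_on (S \<inter> U) (%x. h x *\<^sub>R f x)"
 proof (cases "x \<in> W")
  case True
  have "smooth_on (S \<inter> W) (%x. h x *\<^sub>R f x)"
   by (intro smooth_on_scaleR smooth_on_subset[OF assms(4)] smooth_on_subset[OF assms(2)]) auto
  then show ?thesis using True assms(1) by blast
 next
  case False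
  have "smooth_on (S \<inter> - K) (%x. 0 :: 'f)" by (rule smooth_on_const)
  then have "smooth_on (S \<inter> - K) (%x. h x *\<^sub>R f x)"
   using smooth_on_cong[of "S \<inter> - K" "%x. h x *\<^sub>R f x" "%x. 0"] assms(7) by auto
  then show ?thesis using False assms(5,6) by (intro exI[of _ "- K"]) auto
 qed
qed

lemma norm_fst: "norm (fst z) \<le> norm z"
 by (metis norm_fst_le prod.collapse)

lemma constant_of_zero_derivative:
 fixes K :: "real => 'e::euclidean_space"
 assumes "!!t. t \<in> {0..1} ==> (K has_vector_derivative 0) (at t within {0..1})" and "t \<in> {0..1}"
 shows "K t = K 0"
proof -
 have "K t - K 0 = 0"
  by (rule linear_ode_unique[where K = "%t. K t - K 0" and K' = "%t. 0" and C = 0])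
   (use assms in \<open>auto intro!: derivative_eq_intros\<close>)
 then show ?thesis by simp
qed

text \<open>\<open>S y\<close> parametrizes the distribution \<open>range (S y)\<close> as a graph over \<open>range P\<close>. For \<open>u\<close> in
 \<open>range P\<close> the curve \<open>p' = S p u\<close> runs in a leaf, and by \<open>comm\<close> the variation \<open>J\<close> of this curve in the
 direction \<open>w\<close> satisfies the same linear equation as \<open>t S p w\<close>. Hence the time one map is
 constant on \<open>u + ker P\<close> up to leaves.\<close>

theorem frobenius:
 fixes S :: "'e::euclidean_space => 'e => 'e" and P :: "'e => 'e"
 assumes V: "open V" "x0 \<in> V" and P: "linear P" "!!v. P (P v) = P v"
  and S: "!!v. smooth_on V (%y. S y v)" and lin: "!!y. y \<in> V ==> linear (S y)"
  and PS: "!!y v. y \<in> V ==> P (S y v) = P v" and SP: "!!y v. y \<in> V ==> S y (P v) = S y v"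
  and comm: "!!y v w. y \<in> V ==> ddir (%z. S z w) y (S y v) = ddir (%z. S z v) y (S y w)"
 obtains V' F where "open V'" "x0 \<in> V'" "V' \<subseteq> V" "smooth_on V' F" "!!y. P (F y) = 0"
  "!!y u. y \<in> V' ==> ddir F y u = 0 \<longleftrightarrow> S y u = u"
proof -
 have bP: "bounded_linear P" using P(1) linear_linear by blast
 note P_diff = linear_diff[OF P(1)] and P_add = linear_add[OF P(1)] and P_scale = linear_scale[OF P(1)]
 have SS: "S y (S y v) = S y v" if "y \<in> V" for y v
  by (metis PS SP that)
 \<comment> \<open>The flow is taken on pairs (p, v) in which \<open>v\<close> is a constant
   parameter. Smooth dependence on the parameter thereby becomes smooth dependence on the initial
   value.\<close>
 let ?W = "V \<times> (UNIV :: 'e set)"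
 have W: "open ?W" "(x0, 0) \<in> ?W" using V by (auto intro: open_Times)
 then obtain r0 where r0: "r0 > 0" "ball (x0, 0) r0 \<subseteq> ?W" by (meson openE)
 define r where "r = r0 / 3"
 have "2 * r < r0" using r0(1) by (simp add: r_def)
 then have "z \<in> ball (x0, 0 :: 'e) r0" if "z \<in> cball (x0, 0 :: 'e) (2 * r)" for z
  using that unfolding mem_ball mem_cball by linarith
 then have "cball (x0, 0 :: 'e) (2 * r) \<subseteq> ball (x0, 0 :: 'e) r0" by blast
 then have r: "r > 0" "cball (x0, 0 :: 'e) (2 * r) \<subseteq> ?W" using r0 by (simp_all add: r_def)
 obtain h :: "'e \<times> 'e => real" where h: "smooth_on UNIV h" "!!x. x \<in> ball (x0, 0) r ==> h x = 1"
  "!!x. x \<notin> ball (x0, 0) (2 * r) ==> h x = 0"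
  using smooth_bump[OF r(1), of "(x0, 0)"] by metis
 define f where "f z = h z *\<^sub>R (S (fst z) (snd z), 0 :: 'e)" for z
 have S2: "smooth_on ?W (%z. S (fst z) (snd z))"
 proof (rule smooth_on_apply[where F = "%z. S (fst z)" and u = snd])
  show "smooth_on ?W (%z. S (fst z) v)" for v
   by (rule smooth_on_compose[OF smooth_on_fst[OF smooth_on_ident] S]) auto
  show "smooth_on ?W (snd :: 'e \<times> 'e => 'e)" by (rule smooth_on_bounded_linear[OF bounded_linear_snd])
 qed (use lin in auto)
 have f: "csmooth f"
  unfolding csmooth_def
 proof
  show "smooth_on UNIV f" unfolding f_def
   by (rule smooth_on_cutoff[OF W(1) smooth_on_Pair[OF S2 smooth_on_const] open_UNIV h(1) closed_cball r(2)])
    (use h(3) in auto)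
  have "f z = 0" if "norm z > norm (x0, 0 :: 'e) + 2 * r" for z
  proof -
   have "dist (x0, 0) z \<ge> norm z - norm (x0, 0 :: 'e)" by (metis dist_norm norm_minus_commute norm_triangle_ineq2)
   then show ?thesis using that h(3)[of z] by (auto simp: f_def zero_prod_def)
  qed
  then show "\<exists>R. \<forall>x. R < norm x \<longrightarrow> f x = 0" by blast
 qed
 have snd_f: "snd (f z) = 0" for z by (simp add: f_def)
 have fdiff: "f differentiable (at z)" for z
  using f smooth_on_diffble[of UNIV f z] by (simp add: csmooth_def)
 have snd_df: "snd (ddir f z k) = 0" for z k
  using ddir_linear_comp[OF bounded_linear_snd fdiff[of z], of k] by (simp add: snd_f ddir_const)
 have f_in: "f (p, v) = (S p v, 0)" if "(p, v) \<in> ball (x0, 0) r" for p v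
  using h(2)[OF that] by (simp add: f_def)
 have ballV: "p \<in> V" if "(p, v) \<in> ball (x0, 0) r" for p v :: 'e
 proof -
  have "(p, v) \<in> cball (x0, 0) (2 * r)" using that r(1) by auto
  then show ?thesis using r(2) by blast
 qed
 have Sdiff: "(%z. S z v) differentiable (at p)" if "p \<in> V" for v p
  using smooth_on_diffble[OF S V(1) that] .
 have df_in: "ddir f (p, v) (a, b) = (ddir (%z. S z v) p a + S p b, 0)" if z: "(p, v) \<in> ball (x0, 0) r" for p v a b
 proof -
  have pV: "p \<in> V" by (rule ballV[OF z])
  have "ddir (%z. fst (f z)) (p, v) (a, b) = ddir (%z. S (fst z) (snd z)) (p, v) (a, b)"
   by (rule ddir_cong[OF open_ball z]) (use f_in in auto)
  also have "\<dots> = ddir (%z. S (fst z) (snd (p, v))) (p, v) (a, b) + S (fst (p, v)) (ddir snd (p, v) (a, b))"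
  proof (rule ddir_apply[where S = ?W and F = "%z. S (fst z)" and u = snd])
   show "(%z::'e \<times> 'e. S (fst z) w) differentiable (at (p, v))" for w
    using smooth_on_diffble[OF smooth_on_compose[OF smooth_on_fst[OF smooth_on_ident] S, of ?W] W(1), of "(p, v)" w] pV by auto
   show "snd differentiable (at (p, v))" by (rule bounded_linear_imp_differentiable[OF bounded_linear_snd])
  qed (use lin pV W in auto)
  also have "ddir (%z. S (fst z) (snd (p, v))) (p, v) (a, b) = ddir (%z. S z v) p a"
  proof -
   have "(fst :: 'e \<times> 'e => 'e) differentiable (at (p, v))"
    by (rule bounded_linear_imp_differentiable[OF bounded_linear_fst])
   from ddir_compose[OF this, of "%z. S z v" "(a, b)"] show ?thesis
    using Sdiff[OF pV] by (simp add: ddir_bounded_linear[OF bounded_linear_fst])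
  qed
  finally have "fst (ddir f (p, v) (a, b)) = ddir (%z. S z v) p a + S p b"
   using ddir_linear_comp[OF bounded_linear_fst fdiff[of "(p, v)"], of "(a, b)"]
   by (simp add: ddir_bounded_linear[OF bounded_linear_snd])
  then show ?thesis using snd_df[of "(p, v)" "(a, b)"] by (simp add: prod_eq_iff)
 qed
 obtain L where L: "L \<ge> 0" "!!x v. norm (ddir f x v) \<le> L * norm v"
  using csmooth_ddir_bound[OF f] by metis
 obtain \<epsilon> :: real and Y :: "'e \<times> 'e => real \<Rightarrow>\<^sub>C ('e \<times> 'e)" where \<epsilon>: "\<epsilon> > 0" and Y: "smooth_on UNIV Y"
  and Y0: "!!x. Y x 0 = x" and dY0: "!!x k. ddir Y x k 0 = k"
  and Yt: "!!x t. t \<in> {0..1} ==> (Y x has_vector_derivative \<epsilon> *\<^sub>R f (Y x t)) (at t within {0..1})"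
  and dYt: "!!x k t. t \<in> {0..1} ==>
    (ddir Y x k has_vector_derivative \<epsilon> *\<^sub>R ddir f (Y x t) (ddir Y x k t)) (at t within {0..1})"
  and Yc: "!!x. f x = 0 ==> Y x = const_bcontfun x"
  using csmooth_flow[OF f] by metis
 \<comment> \<open>The curve for \<open>u\<close> starts at x0 + (u - P u) with parameter P u /
   \<epsilon>. The division compensates the factor by which \<open>csmooth_flow\<close> scales the
   field, so the curve has velocity \<open>S p u\<close>.\<close>
 define q' where "q' u = (u - P u, P u /\<^sub>R \<epsilon>)" for u
 define q where "q u = (x0, 0) + q' u" for u
 have bq': "bounded_linear q'" unfolding q'_def
  by (intro bounded_linear_Pair bounded_linear_sub bounded_linear_ident bP
    bounded_linear_compose[OF bounded_linear_scaleR_right])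
 have q: "smooth_on UNIV q" unfolding q_def
  by (intro smooth_on_add smooth_on_const smooth_on_bounded_linear bq')
 have qd: "q differentiable (at u)" for u using smooth_on_diffble[OF q] by auto
 have dq: "ddir q u w = q' w" for u w
  unfolding q_def[abs_def] using ddir_add[of "%u. (x0, 0)" u q' w] bounded_linear_imp_differentiable[OF bq']
  by (simp add: ddir_const ddir_bounded_linear[OF bq'])
 have q0: "q 0 = (x0, 0)" by (simp add: q_def q'_def linear_0[OF P(1)])
 define E1 where "E1 z = fst (apply_bcontfun z 1)" for z :: "real \<Rightarrow>\<^sub>C ('e \<times> 'e)"
 have bE1: "bounded_linear E1"
 proof
  show "\<exists>K. \<forall>x. norm (E1 x) \<le> norm x * K"
   by (intro exI[of _ 1] allI) (simp add: E1_def order_trans[OF norm_fst norm_bounded])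
 qed (auto simp: E1_def)
 have Yq: "smooth_on UNIV (%u. Y (q u))" by (rule smooth_on_compose[OF q Y]) auto
 define \<Psi> where "\<Psi> u = E1 (Y (q u))" for u
 have \<Psi>: "smooth_on UNIV \<Psi>" unfolding \<Psi>_def by (rule smooth_on_linear_comp[OF bE1 Yq])
 have d\<Psi>: "ddir \<Psi> u w = fst (ddir Y (q u) (q' w) 1)" for u w
 proof -
  have "ddir \<Psi> u w = E1 (ddir (%u. Y (q u)) u w)" unfolding \<Psi>_def[abs_def]
   by (rule ddir_linear_comp[OF bE1 smooth_on_diffble[OF Yq]]) auto
  also have "ddir (%u. Y (q u)) u w = ddir Y (q u) (ddir q u w)"
   by (rule ddir_compose[OF qd smooth_on_diffble[OF Y]]) auto
  finally show ?thesis by (simp add: E1_def dq)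
 qed
 \<comment> \<open>For \<open>u = 0\<close> the initial pair is a rest point. By continuity in the
   uniform norm, the curves for small \<open>u\<close> stay, at all times, in the ball where the
   cut-off is 1 and the field is the intended one.\<close>
 have "Y (q 0) = const_bcontfun (x0, 0)"
  using Yc[of "(x0, 0)"] f_in[of x0 0] r(1) lin[OF V(2)] by (simp add: q0 linear_0 zero_prod_def)
 moreover have "continuous_on UNIV (%u. Y (q u))" by (rule smooth_on_continuous_on[OF Yq])
 then have "isCont (%u. Y (q u)) 0" by (simp add: continuous_on_eq_continuous_at)
 ultimately obtain \<delta> where \<delta>: "\<delta> > 0" "!!u. dist u 0 < \<delta> ==> dist (Y (q u)) (const_bcontfun (x0, 0)) < r"
  using r(1) unfolding continuous_at_eps_delta by metis
 have in_ball: "Y (q u) t \<in> ball (x0, 0) r" if "u \<in> ball 0 \<delta>" for u t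
  using dist_fun_lt_imp_dist_val_lt[OF \<delta>(2), of u t] that by (simp add: dist_commute)
 have traj: "snd (Y (q u) t) = P u /\<^sub>R \<epsilon>" if "t \<in> {0..1}" for u t
 proof -
  have "snd (Y (q u) t) = snd (Y (q u) 0)"
   by (rule constant_of_zero_derivative[where K = "%t. snd (Y (q u) t)", OF _ that])
    (use bounded_linear.has_vector_derivative[OF bounded_linear_snd Yt[of _ "q u"]] in \<open>simp add: snd_f\<close>)
  then show ?thesis by (simp add: Y0 q_def q'_def)
 qed
 have dtraj: "snd (ddir Y (q u) (q' w) t) = P w /\<^sub>R \<epsilon>" if "t \<in> {0..1}" for u w t
 proof -
  have "snd (ddir Y (q u) (q' w) t) = snd (ddir Y (q u) (q' w) 0)"
   by (rule constant_of_zero_derivative[where K = "%t. snd (ddir Y (q u) (q' w) t)", OF _ that])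
    (use bounded_linear.has_vector_derivative[OF bounded_linear_snd dYt[of _ "q u" "q' w"]] in \<open>simp add: snd_df\<close>)
  then show ?thesis by (simp add: dY0 q'_def)
 qed
 have S_scale: "\<epsilon> *\<^sub>R S p (P u /\<^sub>R \<epsilon>) = S p u" if "p \<in> V" for p u
  using \<epsilon> linear_scale[OF lin[OF that]] SP[OF that] by simp
 have dS_scale: "\<epsilon> *\<^sub>R ddir (%z. S z (P u /\<^sub>R \<epsilon>)) p k = ddir (%z. S z u) p k" if "p \<in> V" for p u k
 proof -
  have "ddir (%z. S z u) p k = ddir (%z. \<epsilon> *\<^sub>R S z (P u /\<^sub>R \<epsilon>)) p k"
   by (rule ddir_cong[OF V(1) that]) (simp add: S_scale)
  also have "\<dots> = \<epsilon> *\<^sub>R ddir (%z. S z (P u /\<^sub>R \<epsilon>)) p k"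
   by (rule ddir_linear_comp[OF bounded_linear_scaleR_right Sdiff[OF that]])
  finally show ?thesis by simp
 qed
 define p where "p u t = fst (Y (q u) t)" for u t
 define J where "J u w t = fst (ddir Y (q u) (q' w) t)" for u w t
 have pV: "p u t \<in> V" if "u \<in> ball 0 \<delta>" for u t
  using in_ball[OF that, of t] ballV[of "p u t" "snd (Y (q u) t)"] by (simp add: p_def)
 have Ypair: "Y (q u) t = (p u t, P u /\<^sub>R \<epsilon>)" if "t \<in> {0..1}" for u t
  using traj[OF that] by (simp add: p_def prod_eq_iff)
 have dYpair: "ddir Y (q u) (q' w) t = (J u w t, P w /\<^sub>R \<epsilon>)" if "t \<in> {0..1}" for u w t
  using dtraj[OF that] by (simp add: J_def prod_eq_iff)
 have p': "(p u has_vector_derivative S (p u t) u) (at t within {0..1})" if "u \<in> ball 0 \<delta>" "t \<in> {0..1}" for u t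
 proof -
  have "(p u has_vector_derivative fst (\<epsilon> *\<^sub>R f (Y (q u) t))) (at t within {0..1})"
   unfolding p_def by (rule bounded_linear.has_vector_derivative[OF bounded_linear_fst Yt[OF that(2)]])
  then show ?thesis
   using f_in[OF in_ball[OF that(1), of t, unfolded Ypair[OF that(2)]]] S_scale[OF pV[OF that(1)]]
   by (simp add: Ypair[OF that(2)])
 qed
 have J': "(J u w has_vector_derivative ddir (%z. S z u) (p u t) (J u w t) + S (p u t) w) (at t within {0..1})"
  if "u \<in> ball 0 \<delta>" "t \<in> {0..1}" for u w t
 proof -
  have "(J u w has_vector_derivative fst (\<epsilon> *\<^sub>R ddir f (Y (q u) t) (ddir Y (q u) (q' w) t))) (at t within {0..1})"
   unfolding J_def by (rule bounded_linear.has_vector_derivative[OF bounded_linear_fst dYt[OF that(2)]])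
  then show ?thesis
   using df_in[OF in_ball[OF that(1), of t, unfolded Ypair[OF that(2)]]] S_scale[OF pV[OF that(1)]]
    dS_scale[OF pV[OF that(1)]]
   by (simp add: Ypair[OF that(2)] dYpair[OF that(2)] scaleR_add_right)
 qed
 have dS_bound: "norm (ddir (%z. S z u) (p u t) k) \<le> (\<epsilon> * L) * norm k" if "u \<in> ball 0 \<delta>" "t \<in> {0..1}" for u t k
 proof -
  have "ddir (%z. S z u) (p u t) k = \<epsilon> *\<^sub>R fst (ddir f (Y (q u) t) (k, 0))"
   using df_in[OF in_ball[OF that(1), of t, unfolded Ypair[OF that(2)]]] dS_scale[OF pV[OF that(1)]]
    linear_0[OF lin[OF pV[OF that(1)]]]
   by (simp add: Ypair[OF that(2)])
  moreover have "norm (fst (ddir f (Y (q u) t) (k, 0))) \<le> L * norm k"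
   using order_trans[OF norm_fst L(2)[of "Y (q u) t" "(k, 0)"]] by (simp add: norm_Pair)
  ultimately show ?thesis using \<epsilon> by (simp add: mult.assoc)
 qed
 have one: "(1::real) \<in> {0..1}" by simp
 have d\<Psi>S: "ddir \<Psi> u w = S (\<Psi> u) w" if u: "u \<in> ball 0 \<delta>" and w: "P w = w" for u w
 proof -
  \<comment> \<open>By \<open>comm\<close>, the derivative of \<open>S p w\<close> along the curve
    is \<open>ddir (%z. S z u)\<close> applied to \<open>S p w\<close>; hence \<open>K\<close>
    solves a homogeneous linear equation. \<open>P w = w\<close> means that \<open>w\<close> does
    not move the starting point, so \<open>K 0 = 0\<close>.\<close>
  define K where "K t = J u w t - t *\<^sub>R S (p u t) w" for t
  have K': "(K has_vector_derivative ddir (%z. S z u) (p u t) (K t)) (at t within {0..1})" if t: "t \<in> {0..1}" for t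
  proof -
   have pt: "p u t \<in> V" by (rule pV[OF u])
   have "((%t. S (p u t) w) has_vector_derivative ddir (%z. S z w) (p u t) (S (p u t) u)) (at t within {0..1})"
    using vector_derivative_diff_chain_within[OF p'[OF u t]
      has_derivative_at_withinI[OF has_derivative_ddir[OF Sdiff[OF pt]]]] by (simp add: o_def)
   then have "(K has_vector_derivative (ddir (%z. S z u) (p u t) (J u w t) + S (p u t) w)
     - (t *\<^sub>R ddir (%z. S z w) (p u t) (S (p u t) u) + 1 *\<^sub>R S (p u t) w)) (at t within {0..1})"
    unfolding K_def[abs_def]
    by (intro has_vector_derivative_diff has_vector_derivative_scaleR J'[OF u t] DERIV_ident)
   moreover have "linear (ddir (%z. S z u) (p u t))"
    using bounded_linear_ddir[OF Sdiff[OF pt]] bounded_linear.linear by blast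
   ultimately show ?thesis unfolding K_def
    by (simp add: comm[OF pt, of w u] linear_diff linear_scale)
  qed
  have "J u w 0 = 0" using w by (simp add: J_def dY0 q'_def)
  then have "K 1 = 0"
   by (intro linear_ode_unique[OF K' dS_bound[OF u] _ one]) (auto simp: K_def)
  then show ?thesis by (simp add: K_def d\<Psi> J_def p_def \<Psi>_def E1_def)
 qed
 have \<Psi>0: "\<Psi> 0 = x0"
  using \<open>Y (q 0) = const_bcontfun (x0, 0)\<close> by (simp add: \<Psi>_def E1_def)
 have zero: "(0::'e) \<in> ball 0 \<delta>" using \<delta> by simp
 have inj0: "inj (ddir \<Psi> 0)"
 proof -
  \<comment> \<open>For \<open>u = 0\<close> the curve rests at \<open>x0\<close>, so the variation
    has the constant velocity \<open>S x0 w\<close>. Applying \<open>P\<close> to the resulting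
    formula returns \<open>P w\<close>, which gives injectivity.\<close>
  have d0: "ddir \<Psi> 0 w = (w - P w) + S x0 w" for w
  proof -
   have d: "(J 0 w has_vector_derivative S x0 w) (at t within {0..1})" if "t \<in> {0..1}" for t
   proof -
    have p0: "p 0 t = x0" using \<open>Y (q 0) = const_bcontfun (x0, 0)\<close> by (simp add: p_def)
    have "ddir (%z. S z 0) x0 k = ddir (%z. 0) x0 k" for k
     by (rule ddir_cong[OF V]) (simp add: linear_0 lin)
    then show ?thesis using J'[OF zero that, of w] by (simp add: p0 ddir_const)
   qed
   have "J 0 w 1 - 1 *\<^sub>R S x0 w = J 0 w 0 - 0 *\<^sub>R S x0 w"
   proof (rule constant_of_zero_derivative[where K = "%t. J 0 w t - t *\<^sub>R S x0 w", OF _ one])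
    fix t :: real assume t: "t \<in> {0..1}"
    show "((%t. J 0 w t - t *\<^sub>R S x0 w) has_vector_derivative 0) (at t within {0..1})"
     using has_vector_derivative_diff[OF d[OF t]
       has_vector_derivative_scaleR[OF DERIV_ident has_vector_derivative_const[of "S x0 w"]]] by simp
   qed
   then have "J 0 w 1 = J 0 w 0 + S x0 w" by (simp add: diff_eq_eq)
   then show ?thesis by (simp add: d\<Psi> J_def dY0 q'_def)
  qed
  have l0: "linear (ddir \<Psi> 0)"
   using bounded_linear_ddir[OF smooth_on_diffble[OF \<Psi>]] bounded_linear.linear by auto
  have "w = 0" if "ddir \<Psi> 0 w = 0" for w
  proof -
   have "P ((w - P w) + S x0 w) = 0" using that linear_0[OF P(1)] by (simp add: d0)
   then have "P w = 0" by (simp add: P_add P_diff P(2) PS[OF V(2)])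
   then have "S x0 w = 0" using SP[OF V(2), of w] linear_0[OF lin[OF V(2)]] by simp
   with \<open>P w = 0\<close> that show ?thesis by (simp add: d0)
  qed
  then show ?thesis using linear_injective_0[OF l0] by blast
 qed
 obtain U' V' g where U': "open U'" "U' \<subseteq> ball 0 \<delta>" "0 \<in> U'" "open V'" and hom: "homeomorphism U' V' \<Psi> g"
  and g: "smooth_on V' g"
  using smooth_inverse_function_theorem[OF open_ball zero smooth_on_subset[OF \<Psi>] inj0] by (metis subset_UNIV)
 have gV: "g y \<in> U'" "\<Psi> (g y) = y" if "y \<in> V'" for y using hom that by (auto simp: homeomorphism_def)
 have gU: "\<Psi> u \<in> V'" "g (\<Psi> u) = u" if "u \<in> U'" for u using hom that by (auto simp: homeomorphism_def)
 have gd: "g differentiable (at y)" if "y \<in> V'" for y by (rule smooth_on_diffble[OF g U'(4) that])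
 have \<Psi>d: "\<Psi> differentiable (at y)" for y using smooth_on_diffble[OF \<Psi>] by auto
 have dg1: "ddir \<Psi> (g y) (ddir g y k) = k" if "y \<in> V'" for y k
 proof -
  have "ddir (%y. \<Psi> (g y)) y k = ddir (%y. y) y k"
   by (rule ddir_cong[OF U'(4) that]) (rule gV(2))
  then show ?thesis by (simp add: ddir_compose gd[OF that] \<Psi>d ddir_bounded_linear[OF bounded_linear_ident])
 qed
 have dg2: "ddir g y (ddir \<Psi> (g y) k) = k" if "y \<in> V'" for y k
 proof -
  have "ddir (%u. g (\<Psi> u)) (g y) k = ddir (%y. y) (g y) k"
   by (rule ddir_cong[OF U'(1) gV(1)[OF that]]) (rule gU(2))
  then show ?thesis using gd[OF that] gV(2)[OF that]
   by (simp add: ddir_compose \<Psi>d ddir_bounded_linear[OF bounded_linear_ident])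
 qed
 \<comment> \<open>In the coordinates \<open>g\<close> the leaves are translates of the range of
   \<open>P\<close>; the function sought forgets the component along them.\<close>
 show thesis
 proof (rule that[of V' "%y. g y - P (g y)"])
  show "open V'" by fact
  show "x0 \<in> V'" using gU(1)[OF U'(3)] \<Psi>0 by simp
  show V'V: "V' \<subseteq> V"
  proof
   fix y assume "y \<in> V'"
   then have "g y \<in> ball 0 \<delta>" "\<Psi> (g y) = y" using subsetD[OF U'(2) gV(1)] gV(2) by blast+
   then show "y \<in> V" using pV[of "g y" 1] by (simp add: \<Psi>_def E1_def p_def)
  qed
  show "smooth_on V' (%y. g y - P (g y))"
   by (intro smooth_on_diff g smooth_on_linear_comp[OF bP])
  show "P (g y - P (g y)) = 0" for y by (simp add: P_diff P(2))
  fix y u assume y: "y \<in> V'"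
  have yV: "y \<in> V" using V'V y by blast
  have gb: "g y \<in> ball 0 \<delta>" using gV(1)[OF y] U'(2) by blast
  have dF: "ddir (%y. g y - P (g y)) y u = ddir g y u - P (ddir g y u)"
  proof -
   have "(%y. P (g y)) differentiable (at y)"
    by (rule smooth_on_diffble[OF smooth_on_linear_comp[OF bP g] U'(4) y])
   then show ?thesis by (simp add: ddir_diff gd[OF y] ddir_linear_comp[OF bP gd[OF y]])
  qed
  show "ddir (%y. g y - P (g y)) y u = 0 \<longleftrightarrow> S y u = u"
  proof
   assume "ddir (%y. g y - P (g y)) y u = 0"
   then have "P (ddir g y u) = ddir g y u" by (simp add: dF)
   from d\<Psi>S[OF gb this] have "u = S y (ddir g y u)" using dg1[OF y] gV(2)[OF y] by simp
   then show "S y u = u" using SS[OF yV] by metis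
  next
   assume Su: "S y u = u"
   have "ddir \<Psi> (g y) (P u) = S y (P u)" using d\<Psi>S[OF gb P(2)] gV(2)[OF y] by simp
   then have "ddir \<Psi> (g y) (P u) = u" using Su SP[OF yV] by simp
   then have "ddir g y u = P u" using dg2[OF y, of "P u"] by simp
   then show "ddir (%y. g y - P (g y)) y u = 0" by (simp add: dF P(2))
  qed
 qed
qed

text \<open>Here the distribution is the range of a varying projection. Near \<open>x0\<close> it is
  a graph over the range of \<open>P x0\<close>, which supplies the family \<open>S\<close> of
  \<open>frobenius\<close>; involutivity supplies the commutation.\<close>

lemma frobenius_projection:
 fixes P :: "'e::euclidean_space => 'e => 'e"
 assumes V: "open V" "x0 \<in> V" and P: "!!v. smooth_on V (%y. P y v)"
  and lin: "!!y. y \<in> V ==> linear (P y)" and PP: "!!y v. y \<in> V ==> P y (P y v) = P y v"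
  and invol: "!!W X Y y. open W ==> W \<subseteq> V ==> smooth_on W X ==> smooth_on W Y ==>
   (!!z. z \<in> W ==> P z (X z) = X z) ==> (!!z. z \<in> W ==> P z (Y z) = Y z) ==> y \<in> W ==>
   P y (ddir Y y (X y) - ddir X y (Y y)) = ddir Y y (X y) - ddir X y (Y y)"
 obtains V' F where "open V'" "x0 \<in> V'" "V' \<subseteq> V" "smooth_on V' F" "!!y. P x0 (F y) = 0"
  "!!y u. y \<in> V' ==> ddir F y u = 0 \<longleftrightarrow> P y u = u"
proof -
 note lin0 = lin[OF V(2)]
 have bP0: "bounded_linear (P x0)" using lin0 linear_linear by blast
 \<comment> \<open>\<open>B\<close> is the identity at \<open>x0\<close> and intertwines the
   projections: \<open>P x0 (B y v)\<close> and \<open>B y (P y v)\<close> both equal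
   \<open>P x0 (P y v)\<close>. Its inverse therefore carries the range of \<open>P x0\<close> onto
   that of \<open>P y\<close>.\<close>
 define B where "B y v = P x0 (P y v) + ((v - P y v) - P x0 (v - P y v))" for y v
 have B: "smooth_on V (%y. B y v)" for v unfolding B_def
  by (intro smooth_on_add smooth_on_diff smooth_on_linear_comp[OF bP0] P smooth_on_const)
 have linB: "linear (B y)" if "y \<in> V" for y
 proof -
  have 1: "linear (%v. v - P y v)" by (rule linear_compose_sub[OF linear_id[unfolded id_def] lin[OF that]])
  have 2: "linear (%v. P x0 (P y v))" "linear (%v. P x0 (v - P y v))"
   using linear_compose[OF lin[OF that] lin0] linear_compose[OF 1 lin0] by (simp_all add: o_def)
  have "B y = (%v. P x0 (P y v) + ((v - P y v) - P x0 (v - P y v)))" by (simp add: B_def fun_eq_iff)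
  then show ?thesis using linear_compose_add[OF 2(1) linear_compose_sub[OF 1 2(2)]] by simp
 qed
 have contB: "continuous_on V (%y. blin (B y))"
  using Ck_on_blin[of 0 V B] smooth_on_imp_Ck[OF B, of 0] by simp
 have "B x0 v = v" for v by (simp add: B_def PP[OF V(2)] linear_diff[OF lin0])
 then have Bx0: "blin (B x0) = id_blinfun" by (intro blinfun_eqI) (simp add: blinfun_apply_blin linB V)
 \<comment> \<open>Closeness to the identity makes \<open>B y\<close> invertible by
   \<open>blinfun_id_minus_inverse\<close>.\<close>
 define V1 where "V1 = {y \<in> V. norm (id_blinfun - blin (B y)) < 1 / 2}"
 have V1V: "V1 \<subseteq> V" by (auto simp: V1_def)
 have V1: "open V1" "x0 \<in> V1"
 proof -
  have "continuous_on V (%y. norm (id_blinfun - blin (B y)))" by (intro continuous_intros contB)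
  then have "open (V \<inter> (%y. norm (id_blinfun - blin (B y))) -` {..<1 / 2})"
   by (rule continuous_open_preimage[OF _ V(1) open_lessThan])
  moreover have "V1 = V \<inter> (%y. norm (id_blinfun - blin (B y))) -` {..<1 / 2}" by (auto simp: V1_def)
  ultimately show "open V1" by simp
  show "x0 \<in> V1" using V(2) by (simp add: V1_def Bx0)
 qed
 have "\<exists>R. linear R \<and> (\<forall>v. B y (R v) = v) \<and> (\<forall>v. R (B y v) = v)" if y: "y \<in> V1" for y
 proof -
  have "norm (id_blinfun - blin (B y)) \<le> 1 / 2" using y by (simp add: V1_def)
  from blinfun_id_minus_inverse[OF this] obtain R
   where R: "blin (B y) o\<^sub>L R = id_blinfun" "R o\<^sub>L blin (B y) = id_blinfun" by (metis diff_diff_eq2 add_diff_cancel_left')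
  have Ba: "blinfun_apply (blin (B y)) v = B y v" for v using blinfun_apply_blin linB y by (auto simp: V1_def)
  have "blinfun_apply (blin (B y) o\<^sub>L R) v = v" "blinfun_apply (R o\<^sub>L blin (B y)) v = v" for v
   by (simp_all only: R blinfun_apply_id_blinfun)
  then show ?thesis using Ba bounded_linear.linear[OF blinfun.bounded_linear_right[of R]]
   by (intro exI[of _ "blinfun_apply R"]) simp
 qed
 then obtain R where linR: "!!y. y \<in> V1 ==> linear (R y)" and BR: "!!y v. y \<in> V1 ==> B y (R y v) = v"
  and RB: "!!y v. y \<in> V1 ==> R y (B y v) = v" by metis
 have R: "smooth_on V1 (%y. R y v)" for v
  by (rule smooth_on_inverse_family[where F = B, OF smooth_on_subset[OF B V1V]]) (use linB BR V1V in auto)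
 define S where "S y v = R y (P x0 v)" for y v
 have BP: "B y (P y v) = P x0 (P y v)" if "y \<in> V1" for y v
  using PP[of y v] V1V that by (auto simp: B_def linear_0[OF lin0])
 have PB: "P x0 (B y v) = P x0 (P y v)" for y v
  by (simp add: B_def linear_add[OF lin0] linear_diff[OF lin0] PP[OF V(2)])
 have PR: "P y (R y w) = S y w" if "y \<in> V1" for y w
  using BP[OF that, of "R y w"] PB[of y "R y w"] BR[OF that, of w] RB[OF that, of "P y (R y w)"]
  by (simp add: S_def)
 have PS': "P y (S y w) = S y w" if "y \<in> V1" for y w
  using PR[OF that, of w] PP[of y "R y w"] V1V that by auto
 have PS: "P x0 (S y v) = P x0 v" if "y \<in> V1" for y v
  using BP[OF that, of "S y v"] BR[OF that, of "P x0 v"] PS'[OF that, of v] by (simp add: S_def)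
 have SP: "S y (P x0 v) = S y v" for y v by (simp add: S_def PP[OF V(2)])
 have iff: "S y u = u \<longleftrightarrow> P y u = u" if "y \<in> V1" for y u
  using PS'[OF that, of u] BP[OF that, of u] RB[OF that, of u] by (auto simp: S_def)
 have smS: "smooth_on V1 (%y. S y v)" for v unfolding S_def by (rule R)
 have linS: "linear (S y)" if "y \<in> V1" for y
  unfolding S_def using linear_compose[OF lin0 linR[OF that]] by (simp add: o_def)
 have diffS: "(%z. S z v) differentiable (at y)" if "y \<in> V1" for y v
  by (rule smooth_on_diffble[OF smS V1(1) that])
 have PdS: "P x0 (ddir (%z. S z w) y v) = 0" if y: "y \<in> V1" for y v w
 proof -
  have "P x0 (ddir (%z. S z w) y v) = ddir (%z. P x0 (S z w)) y v"
   by (rule ddir_linear_comp[OF bP0 diffS[OF y], symmetric])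
  also have "\<dots> = ddir (%z. P x0 w) y v" by (rule ddir_cong[OF V1(1) y]) (rule PS)
  finally show ?thesis by (simp add: ddir_const)
 qed
 \<comment> \<open>The bracket of the fields \<open>S z v\<close> and \<open>S z w\<close> lies in
   the range of \<open>P y\<close> by involutivity. Its image under \<open>P x0\<close> is 0,
   because \<open>P x0 (S z w)\<close> is constant in \<open>z\<close>; but \<open>S y\<close>
   recovers a vector of that range from its image under \<open>P x0\<close>.\<close>
 have comm: "ddir (%z. S z w) y (S y v) = ddir (%z. S z v) y (S y w)" if y: "y \<in> V1" for y v w
 proof -
  let ?Z = "ddir (%z. S z w) y (S y v) - ddir (%z. S z v) y (S y w)"
  have "P y ?Z = ?Z" by (rule invol[OF V1(1) V1V smS smS _ _ y]) (rule PS', assumption)+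
  then have "S y ?Z = ?Z" by (simp only: iff[OF y])
  then have "?Z = S y ?Z" by (rule sym)
  also have "\<dots> = S y (P x0 ?Z)" by (simp only: SP)
  also have "P x0 ?Z = 0" by (simp add: linear_diff[OF lin0] PdS[OF y])
  also have "S y 0 = 0" by (rule linear_0[OF linS[OF y]])
  finally show ?thesis by simp
 qed
 show thesis
 proof (rule frobenius[OF V1 lin0 PP[OF V(2)] smS linS PS SP comm])
  fix V' F
  assume *: "open V'" "x0 \<in> V'" "V' \<subseteq> V1" "smooth_on V' F" "!!y. P x0 (F y) = 0"
   "!!y u. y \<in> V' ==> ddir F y u = 0 \<longleftrightarrow> S y u = u"
  have "V' \<subseteq> V" using *(3) V1V by blast
  moreover have "ddir F y u = 0 \<longleftrightarrow> P y u = u" if "y \<in> V'" for y u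
   using *(6)[OF that] iff[of y] *(3) that by blast
  ultimately show thesis using that[of V' F] *(1,2,4,5) by simp
 qed
qed

text \<open>\<open>F1\<close> is constant along the leaves of the ranges and takes values in the
  kernel of \<open>P x0\<close>; \<open>F2\<close> is constant along the leaves of the kernels and
  takes values in the range of \<open>P x0\<close>. Each is thus recovered from the sum
  \<open>G\<close> by a projection. A vector killed by the derivative of \<open>G\<close> lies in
  both distributions, so the inverse function theorem applies.\<close>

theorem frobenius_pair:
 fixes P :: "'e::euclidean_space => 'e => 'e"
 assumes V: "open V" "x0 \<in> V" and P: "!!v. smooth_on V (%y. P y v)"
  and lin: "!!y. y \<in> V ==> linear (P y)" and PP: "!!y v. y \<in> V ==> P y (P y v) = P y v"
  and invol1: "!!W X Y y. open W ==> W \<subseteq> V ==> smooth_on W X ==> smooth_on W Y ==>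
   (!!z. z \<in> W ==> P z (X z) = X z) ==> (!!z. z \<in> W ==> P z (Y z) = Y z) ==> y \<in> W ==>
   P y (ddir Y y (X y) - ddir X y (Y y)) = ddir Y y (X y) - ddir X y (Y y)"
  and invol2: "!!W X Y y. open W ==> W \<subseteq> V ==> smooth_on W X ==> smooth_on W Y ==>
   (!!z. z \<in> W ==> P z (X z) = 0) ==> (!!z. z \<in> W ==> P z (Y z) = 0) ==> y \<in> W ==>
   P y (ddir Y y (X y) - ddir X y (Y y)) = 0"
 obtains V' W G g where "open V'" "x0 \<in> V'" "V' \<subseteq> V" "open W" "homeomorphism V' W G g"
  "smooth_on V' G" "smooth_on W g"
  "!!y u. y \<in> V' ==> P y u = u \<longleftrightarrow> P x0 (ddir G y u) = ddir G y u"
  "!!y u. y \<in> V' ==> P y u = 0 \<longleftrightarrow> P x0 (ddir G y u) = 0"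
proof -
 note lin0 = lin[OF V(2)]
 have bP0: "bounded_linear (P x0)" using lin0 linear_linear by blast
 have "\<exists>V' F. open V' \<and> x0 \<in> V' \<and> V' \<subseteq> V \<and> smooth_on V' F \<and> (\<forall>y. P x0 (F y) = 0) \<and>
   (\<forall>y\<in>V'. \<forall>u. ddir F y u = 0 \<longleftrightarrow> P y u = u)"
  by (rule frobenius_projection[of V x0 P]) (fact V P lin PP invol1 | (intro exI conjI ballI allI, assumption, assumption, assumption, assumption, simp, simp))+
 then obtain V1 F1 where V1: "open V1" "x0 \<in> V1" "V1 \<subseteq> V" "smooth_on V1 F1" "!!y. P x0 (F1 y) = 0"
  and F1: "!!y u. y \<in> V1 ==> ddir F1 y u = 0 \<longleftrightarrow> P y u = u"
  by metis
 define Q where "Q y v = v - P y v" for y v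
 have Qs: "smooth_on V (%y. Q y v)" for v unfolding Q_def by (intro smooth_on_diff smooth_on_const P)
 have Ql: "linear (Q y)" if "y \<in> V" for y
  unfolding Q_def by (intro linear_compose_sub linear_id[unfolded id_def] lin that)
 have QQ: "Q y (Q y v) = Q y v" if "y \<in> V" for y v
  by (simp add: Q_def linear_diff[OF lin[OF that]] PP[OF that])
 have Q0: "Q y v = v \<longleftrightarrow> P y v = 0" for y v by (simp add: Q_def)
 have Qi: "Q y (ddir Y y (X y) - ddir X y (Y y)) = ddir Y y (X y) - ddir X y (Y y)"
  if "open W" "W \<subseteq> V" "smooth_on W X" "smooth_on W Y" "!!z. z \<in> W ==> Q z (X z) = X z"
   "!!z. z \<in> W ==> Q z (Y z) = Y z" "y \<in> W" for W X Y y
  using that invol2[of W X Y y] unfolding Q0 by blast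
 have "\<exists>V' F. open V' \<and> x0 \<in> V' \<and> V' \<subseteq> V \<and> smooth_on V' F \<and> (\<forall>y. Q x0 (F y) = 0) \<and>
   (\<forall>y\<in>V'. \<forall>u. ddir F y u = 0 \<longleftrightarrow> Q y u = u)"
  by (rule frobenius_projection[of V x0 Q]) (fact V Qs Ql QQ Qi | (intro exI conjI ballI allI, assumption, assumption, assumption, assumption, simp, simp))+
 then obtain V2 F2 where V2: "open V2" "x0 \<in> V2" "V2 \<subseteq> V" "smooth_on V2 F2" "!!y. Q x0 (F2 y) = 0"
  and F2: "!!y u. y \<in> V2 ==> ddir F2 y u = 0 \<longleftrightarrow> Q y u = u"
  by metis
 define G where "G y = F1 y + F2 y" for y
 let ?V = "V1 \<inter> V2"
 have V12: "open ?V" "x0 \<in> ?V" using V1 V2 by auto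
 have G: "smooth_on ?V G" unfolding G_def
  by (intro smooth_on_add smooth_on_subset[OF V1(4)] smooth_on_subset[OF V2(4)]) auto
 have PF2: "P x0 (F2 y) = F2 y" for y using V2(5)[of y] by (simp add: Q_def)
 have d: "ddir F1 y u = ddir G y u - P x0 (ddir G y u)" "ddir F2 y u = P x0 (ddir G y u)"
  if y: "y \<in> ?V" for y u
 proof -
  have Gd: "G differentiable (at y)" by (rule smooth_on_diffble[OF G V12(1) y])
  have F2': "F2 y = P x0 (G y)" for y by (simp add: G_def linear_add[OF lin0] V1(5) PF2)
  then show 2: "ddir F2 y u = P x0 (ddir G y u)"
   using ddir_linear_comp[OF bP0 Gd, of u] by (simp add: F2'[abs_def])
  have "F2 differentiable (at y)" by (rule smooth_on_diffble[OF V2(4,1)]) (use y in auto)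
  then have "ddir (%y. G y - F2 y) y u = ddir G y u - ddir F2 y u" by (rule ddir_diff[OF Gd])
  then show "ddir F1 y u = ddir G y u - P x0 (ddir G y u)" by (simp add: G_def 2)
 qed
 have k1: "P y u = u \<longleftrightarrow> P x0 (ddir G y u) = ddir G y u" if "y \<in> ?V" for y u
  using F1[of y u] d(1)[OF that, of u] that by auto
 have k2: "P y u = 0 \<longleftrightarrow> P x0 (ddir G y u) = 0" if "y \<in> ?V" for y u
  using F2[of y u] d(2)[OF that, of u] that Q0 by auto
 have "inj (ddir G x0)"
 proof -
  have l: "linear (ddir G x0)"
   using bounded_linear_ddir[OF smooth_on_diffble[OF G V12]] bounded_linear.linear by blast
  have "u = 0" if "ddir G x0 u = 0" for u
   using k1[OF V12(2), of u] k2[OF V12(2), of u] that linear_0[OF lin0] by simp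
  then show ?thesis using linear_injective_0[OF l] by blast
 qed
 from smooth_inverse_function_theorem[OF V12 G this] obtain U' W g
  where U': "open U'" "U' \<subseteq> ?V" "x0 \<in> U'" "open W" "homeomorphism U' W G g" "smooth_on W g" by metis
 show thesis
  by (rule that[of U' W G g])
   (use U' V1(3) k1 k2 smooth_on_subset[OF G U'(2)] in blast)+
qed

section \<open>Calculus on relatively open subsets of subspaces\<close>

lemma eventually_subspace_line:
 assumes E: "subspace E" and S: "openin (top_of_set E) S" and y: "y \<in> S" and e: "e \<in> E"
 shows "\<forall>\<^sub>F t in nhds (0::real). y + t *\<^sub>R (e::'e::real_normed_vector) \<in> S"
proof -
 obtain U where U: "open U" "S = E \<inter> U" using S by (auto simp: openin_open)
 have "open ((%t::real. y + t *\<^sub>R e) -` U)" by (intro open_vimage U continuous_intros)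
 moreover have "0 \<in> (%t::real. y + t *\<^sub>R e) -` U" using y U by auto
 ultimately have "\<forall>\<^sub>F t in nhds (0::real). t \<in> (%t::real. y + t *\<^sub>R e) -` U"
  using eventually_nhds_in_open by blast
 then show ?thesis
 proof eventually_elim
  case (elim t)
  have "y \<in> E" using y U by auto
  then show ?case using elim e E U by (auto intro!: subspace_add subspace_scale)
 qed
qed

lemma ddir_cong_subspace:
 fixes f g :: "'e::real_normed_vector => 'f::real_normed_vector"
 assumes E: "subspace E" and S: "openin (top_of_set E) S" and y: "y \<in> S" and e: "e \<in> E"
  and eq: "!!z. z \<in> S ==> f z = g z"
 shows "ddir f y e = ddir g y e"
proof -
 have ev: "\<forall>\<^sub>F t in nhds (0::real). y + t *\<^sub>R e \<in> S" by (rule eventually_subspace_line[OF E S y e])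
 have "((%t. f (y + t *\<^sub>R e)) has_vector_derivative D) (at 0) \<longleftrightarrow>
   ((%t. g (y + t *\<^sub>R e)) has_vector_derivative D) (at 0)" for D
  by (rule has_vector_derivative_cong_ev) (use ev eq y in \<open>auto elim!: eventually_mono\<close>)
 then show ?thesis unfolding ddir_def vector_derivative_def by simp
qed

lemma smooth_on_within_derivative:
 assumes "smooth_on S f" "y \<in> S" obtains f' where "(f has_derivative f') (at y within S)"
proof -
 have "Ck_on (Suc 0) S f" using assms(1) smooth_on_imp_Ck by blast
 from Ck_on_SucE[OF this] obtain f' where "!!x. x \<in> S ==> (f has_derivative f' x) (at x within S)" by metis
 then show thesis using that assms(2) by blast
qed

lemma ddir_add_subspace:
 assumes "subspace E" "openin (top_of_set E) S" "smooth_on S f" "y \<in> S" "u \<in> E" "v \<in> E"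
 shows "ddir f y (u + v) = ddir f y u + ddir f y v"
proof -
 obtain f' where f': "(f has_derivative f') (at y within S)"
  using smooth_on_within_derivative assms(3,4) by blast
 have "linear f'" using f' has_derivative_linear by blast
 then show ?thesis
  using ddir_eq_subspace[OF f' assms(1,2,4)] assms(1,5,6) by (simp add: subspace_add linear_add)
qed

lemma ddir_scale_subspace:
 assumes "subspace E" "openin (top_of_set E) S" "smooth_on S f" "y \<in> S" "u \<in> E"
 shows "ddir f y (r *\<^sub>R u) = r *\<^sub>R ddir f y u"
proof -
 obtain f' where f': "(f has_derivative f') (at y within S)"
  using smooth_on_within_derivative assms(3,4) by blast
 have "linear f'" using f' has_derivative_linear by blast
 then show ?thesis
  using ddir_eq_subspace[OF f' assms(1,2,4)] assms(1,5) by (simp add: subspace_scale linear_scale)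
qed

text \<open>Membership in \<open>F\<close> is tested by inner products with its orthogonal
  complement: they vanish along \<open>f\<close>, and so do their derivatives.\<close>

lemma ddir_mem_subspace:
 fixes f :: "'e::real_normed_vector => 'f::euclidean_space"
 assumes E: "subspace E" and S: "openin (top_of_set E) S" and f: "smooth_on S f" and y: "y \<in> S" and e: "e \<in> E"
  and F: "subspace F" and fF: "f ` S \<subseteq> F"
 shows "ddir f y e \<in> F"
proof -
 obtain f' where f': "(f has_derivative f') (at y within S)"
  using smooth_on_within_derivative f y by blast
 have "ddir f y e \<bullet> z = 0" if z: "z \<in> F\<^sup>\<bottom>" for z
 proof -
  have 1: "((%x. f x \<bullet> z) has_derivative (%v. f' v \<bullet> z)) (at y within S)"
   by (rule has_derivative_inner_left[OF f'])
  have "ddir f y e \<bullet> z = ddir (%x. f x \<bullet> z) y e"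
   by (simp add: ddir_eq_subspace[OF 1 E S y e] ddir_eq_subspace[OF f' E S y e])
  also have "\<dots> = ddir (%x. 0) y e"
  proof (rule ddir_cong_subspace[OF E S y e])
   fix x assume "x \<in> S"
   then have "f x \<in> F" using fF by blast
   then show "f x \<bullet> z = 0" using z by (simp add: orthogonal_comp_def orthogonal_def)
  qed
  finally show ?thesis by (simp add: ddir_const)
 qed
 then have "ddir f y e \<in> F\<^sup>\<bottom>\<^sup>\<bottom>" by (auto simp: orthogonal_comp_def orthogonal_def inner_commute)
 then show ?thesis using F by (simp add: orthogonal_comp_self)
qed

lemma ddir_chain_subspace:
 fixes f :: "'e::real_normed_vector => 'f::euclidean_space" and g :: "'f => 'g::real_normed_vector"
 assumes E: "subspace E" and S: "openin (top_of_set E) S" and f: "smooth_on S f" and y: "y \<in> S" and e: "e \<in> E"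
  and F: "subspace F" and T: "openin (top_of_set F) T" and g: "smooth_on T g" and fT: "f ` S \<subseteq> T"
 shows "ddir (%x. g (f x)) y e = ddir g (f y) (ddir f y e)"
proof -
 obtain f' where f': "(f has_derivative f') (at y within S)"
  using smooth_on_within_derivative f y by blast
 have fy: "f y \<in> T" using fT y by auto
 obtain g' where g': "(g has_derivative g') (at (f y) within T)"
  using smooth_on_within_derivative g fy by blast
 have "((%x. g (f x)) has_derivative (%v. g' (f' v))) (at y within S)"
  by (rule has_derivative_in_compose[OF f' has_derivative_subset[OF g' fT]])
 then have "ddir (%x. g (f x)) y e = g' (f' e)" by (rule ddir_eq_subspace[OF _ E S y e])
 moreover have "ddir f y e \<in> F"
  using ddir_mem_subspace[OF E S f y e F] fT openin_imp_subset[OF T] by auto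
 ultimately show ?thesis
  by (simp add: ddir_eq_subspace[OF f' E S y e] ddir_eq_subspace[OF g' F T fy])
qed

section \<open>Charts and tangent spaces\<close>

text \<open>The chart axioms of \<open>smooth_manifold\<close> in isolation: the tangent calculus is
  developed from them, and \<open>charted_prod\<close> transfers them to products.\<close>

definition charted :: "('a, 'e::euclidean_space) mfd => bool" where
 "charted M \<longleftrightarrow> subspace (model M) \<and>
   (\<forall>c\<in>atlas M. openin (mtop M) (cdom c) \<and>
    openin (top_of_set (model M)) (cmap c ` cdom c) \<and>
    homeomorphic_map (subtopology (mtop M) (cdom c)) (top_of_set (cmap c ` cdom c)) (cmap c)) \<and>
   (\<Union>c\<in>atlas M. cdom c) = points M \<and>
   (\<forall>c\<in>atlas M. \<forall>d\<in>atlas M. smooth_on (cmap c ` (cdom c \<inter> cdom d)) (cmap d \<circ> cinv c))"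

lemma smooth_manifold_charted: "smooth_manifold M ==> charted M"
 by (simp add: smooth_manifold_def charted_def)

lemma charts_atD [dest]: "c \<in> charts_at M x ==> c \<in> atlas M" "c \<in> charts_at M x ==> x \<in> cdom c"
 by (auto simp: charts_at_def)

lemma charts_atI: "c \<in> atlas M ==> x \<in> cdom c ==> c \<in> charts_at M x"
 by (simp add: charts_at_def)

locale charted_space =
 fixes M :: "('a, 'e::euclidean_space) mfd"
 assumes charted: "charted M"
begin

lemma model: "subspace (model M)"
 using charted by (simp add: charted_def)

lemma cdom_open: "c \<in> atlas M ==> openin (mtop M) (cdom c)"
 using charted by (auto simp: charted_def)

lemma cdom_points: "c \<in> atlas M ==> cdom c \<subseteq> points M"
 using cdom_open openin_subset by blast

lemma cimage_open: "c \<in> atlas M ==> openin (top_of_set (model M)) (cmap c ` cdom c)"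
 using charted by (auto simp: charted_def)

lemma chart_homeo:
 "c \<in> atlas M ==> homeomorphic_map (subtopology (mtop M) (cdom c)) (top_of_set (cmap c ` cdom c)) (cmap c)"
 using charted by (auto simp: charted_def)

lemma topspace_cdom: "c \<in> atlas M ==> topspace (subtopology (mtop M) (cdom c)) = cdom c"
 using cdom_points[of c] by auto

lemma cmap_inj: "c \<in> atlas M ==> inj_on (cmap c) (cdom c)"
 using homeomorphic_imp_injective_map[OF chart_homeo] topspace_cdom by simp

lemma cinv_cmap [simp]: "c \<in> atlas M ==> x \<in> cdom c ==> cinv c (cmap c x) = x"
 by (simp add: cinv_def cmap_inj)

lemma cmap_cinv [simp]: "y \<in> cmap c ` cdom c ==> cmap c (cinv c y) = y"
 by (simp add: cinv_def f_inv_into_f)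

lemma cinv_cdom: "y \<in> cmap c ` cdom c ==> cinv c y \<in> cdom c"
 by (simp add: cinv_def inv_into_into)

lemma chart_exists: "x \<in> points M ==> \<exists>c. c \<in> charts_at M x"
 using charted unfolding charted_def charts_at_def by blast

lemma charts_at_points: "c \<in> charts_at M x ==> x \<in> points M"
 using charts_atD cdom_points by blast

lemma chart_at: "x \<in> points M ==> chart_at M x \<in> charts_at M x"
 unfolding chart_at_def using chart_exists someI_ex by metis

lemma cmap_model: "c \<in> charts_at M x ==> cmap c x \<in> model M"
 using openin_imp_subset[OF cimage_open] charts_atD by blast

lemma cmap_open_image:
 assumes c: "c \<in> atlas M" and U: "openin (mtop M) U"
 shows "openin (top_of_set (model M)) (cmap c ` (cdom c \<inter> U))"
proof -
 have "openin (subtopology (mtop M) (cdom c)) (cdom c \<inter> U)"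
  using U by (auto simp: openin_subtopology)
 then have "openin (top_of_set (cmap c ` cdom c)) (cmap c ` (cdom c \<inter> U))"
  using homeomorphic_imp_open_map[OF chart_homeo[OF c]] by (auto simp: open_map_def)
 then show ?thesis using cimage_open[OF c] openin_trans by blast
qed

lemma cinv_open_image:
 assumes c: "c \<in> atlas M" and V: "openin (top_of_set (model M)) V" "V \<subseteq> cmap c ` cdom c"
 shows "openin (mtop M) (cinv c ` V)"
proof -
 have "openin (top_of_set (cmap c ` cdom c)) V"
  using V openin_subset_trans[OF V(1) V(2)] openin_imp_subset[OF cimage_open[OF c]] by blast
 then have "openin (subtopology (mtop M) (cdom c)) {x \<in> cdom c. cmap c x \<in> V}"
  using homeomorphic_imp_continuous_map[OF chart_homeo[OF c]]
  unfolding continuous_map_def topspace_cdom[OF c] by blast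
 then have "openin (mtop M) {x \<in> cdom c. cmap c x \<in> V}"
  using openin_open_subtopology[OF cdom_open[OF c]] by blast
 moreover have "{x \<in> cdom c. cmap c x \<in> V} = cinv c ` V"
 proof safe
  fix x assume "x \<in> cdom c" "cmap c x \<in> V"
  then show "x \<in> cinv c ` V" using c by (metis cinv_cmap image_eqI)
 qed (use V cinv_cdom[of _ c] cmap_cinv[of _ c] in auto)
 ultimately show ?thesis by simp
qed

lemma overlap_open:
 assumes "c \<in> atlas M" "d \<in> atlas M"
 shows "openin (top_of_set (model M)) (cmap c ` (cdom c \<inter> cdom d))"
 using cmap_open_image cdom_open assms by blast

lemma transition_smooth:
 "c \<in> atlas M ==> d \<in> atlas M ==> smooth_on (cmap c ` (cdom c \<inter> cdom d)) (%y. cmap d (cinv c y))"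
 using charted by (auto simp: charted_def o_def)

lemma transition_model:
 "c \<in> atlas M ==> d \<in> atlas M ==> y \<in> cmap c ` (cdom c \<inter> cdom d) ==> cmap d (cinv c y) \<in> model M"
 using cmap_model[OF charts_atI[of d M "cinv c y"]] by auto

definition jac :: "('a, 'e) chart => ('a, 'e) chart => 'a => 'e => 'e" where
 "jac c d x u = ddir (%y. cmap d (cinv c y)) (cmap c x) u"

context
 fixes x c d
 assumes c: "c \<in> charts_at M x" and d: "d \<in> charts_at M x"
begin

lemma jac_mem: "u \<in> model M ==> jac c d x u \<in> model M"
 unfolding jac_def
 by (rule ddir_mem_subspace[OF model overlap_open[of c d] transition_smooth[of c d]])
  (use c d transition_model[of c d] model in auto)

lemma jac_add: "u \<in> model M ==> v \<in> model M ==> jac c d x (u + v) = jac c d x u + jac c d x v"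
 unfolding jac_def
 by (rule ddir_add_subspace[OF model overlap_open[of c d] transition_smooth[of c d]])
  (use c d in auto)

lemma jac_scale: "u \<in> model M ==> jac c d x (r *\<^sub>R u) = r *\<^sub>R jac c d x u"
 unfolding jac_def
 by (rule ddir_scale_subspace[OF model overlap_open[of c d] transition_smooth[of c d]])
  (use c d in auto)

lemma jac_self: "u \<in> model M ==> jac c c x u = u"
proof -
 assume u: "u \<in> model M"
 have "jac c c x u = ddir (%y. y) (cmap c x) u" unfolding jac_def
  by (rule ddir_cong_subspace[OF model cimage_open[of c] _ u]) (use c in auto)
 then show ?thesis by (simp add: ddir_bounded_linear[OF bounded_linear_ident])
qed

text \<open>The cocycle rule, by the chain rule on the triple overlap. It is what makes the family
  \<open>coord_vec\<close>, prescribed by one component, consistent in all charts.\<close>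

lemma jac_jac:
 assumes e: "e \<in> charts_at M x" and u: "u \<in> model M"
 shows "jac d e x (jac c d x u) = jac c e x u"
proof -
 have ce: "c \<in> atlas M" "d \<in> atlas M" "e \<in> atlas M" "x \<in> cdom c" "x \<in> cdom d" "x \<in> cdom e"
  using c d e by auto
 let ?S = "cmap c ` (cdom c \<inter> (cdom d \<inter> cdom e))"
 have S: "openin (top_of_set (model M)) ?S"
  using cmap_open_image ce cdom_open by blast
 have y: "cmap c x \<in> ?S" using ce by auto
 have "ddir (%y. cmap e (cinv d (cmap d (cinv c y)))) (cmap c x) u =
   ddir (%y. cmap e (cinv d y)) (cmap d (cinv c (cmap c x))) (ddir (%y. cmap d (cinv c y)) (cmap c x) u)"
  by (rule ddir_chain_subspace[OF model S smooth_on_subset[OF transition_smooth[OF ce(1,2)]] y u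
     model overlap_open[OF ce(2,3)] transition_smooth[OF ce(2,3)]]) (use ce in auto)
 moreover have "ddir (%y. cmap e (cinv d (cmap d (cinv c y)))) (cmap c x) u = ddir (%y. cmap e (cinv c y)) (cmap c x) u"
  by (rule ddir_cong_subspace[OF model S y u]) (use ce in auto)
 ultimately show ?thesis using ce by (simp add: jac_def)
qed

end

lemma coord_vec_eq: "coord_vec M c e x = (%d. if d \<in> charts_at M x then jac c d x e else 0)"
 unfolding coord_vec_def jac_def o_def ..

lemma coord_vec_component: "d \<in> charts_at M x ==> coord_vec M c e x d = jac c d x e"
 by (simp add: coord_vec_eq)

lemma coord_vec_self: "c \<in> charts_at M x ==> e \<in> model M ==> coord_vec M c e x c = e"
 by (simp add: coord_vec_eq jac_self)

lemma tangent_space_iff: "v \<in> tangent_space M x \<longleftrightarrow> (\<forall>c. c \<notin> charts_at M x \<longrightarrow> v c = 0) \<and>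
  (\<forall>c\<in>charts_at M x. v c \<in> model M) \<and> (\<forall>c\<in>charts_at M x. \<forall>d\<in>charts_at M x. v d = jac c d x (v c))"
 unfolding tangent_space_def jac_def o_def mem_Collect_eq ..

lemma tangentI:
 assumes "!!c. c \<notin> charts_at M x ==> v c = 0" "!!c. c \<in> charts_at M x ==> v c \<in> model M"
  and "!!c d. c \<in> charts_at M x ==> d \<in> charts_at M x ==> v d = jac c d x (v c)"
 shows "v \<in> tangent_space M x"
 unfolding tangent_space_iff using assms by blast

lemma tangent_jac: "v \<in> tangent_space M x ==> c \<in> charts_at M x ==> d \<in> charts_at M x ==> v d = jac c d x (v c)"
 unfolding tangent_space_iff by blast

lemma tangent_model: "v \<in> tangent_space M x ==> c \<in> charts_at M x ==> v c \<in> model M"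
 unfolding tangent_space_iff by blast

lemma tangent_off: "v \<in> tangent_space M x ==> c \<notin> charts_at M x ==> v c = 0"
 unfolding tangent_space_iff by blast

lemma coord_vec_tangent:
 assumes "c \<in> charts_at M x" "e \<in> model M" shows "coord_vec M c e x \<in> tangent_space M x"
proof (rule tangentI)
 fix d assume d: "d \<in> charts_at M x"
 show "coord_vec M c e x d \<in> model M" using assms d by (simp add: coord_vec_eq jac_mem)
 fix d' assume d': "d' \<in> charts_at M x"
 show "coord_vec M c e x d' = jac d d' x (coord_vec M c e x d)"
  using assms d d' by (simp add: coord_vec_eq jac_jac)
qed (simp add: coord_vec_eq)

lemma tangent_coord_vec:
 assumes "v \<in> tangent_space M x" "c \<in> charts_at M x" shows "coord_vec M c (v c) x = v"
proof
 fix d show "coord_vec M c (v c) x d = v d"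
  using tangent_jac[OF assms, of d] tangent_off[OF assms(1), of d] by (simp add: coord_vec_eq)
qed

lemma tangent_eqI: "v \<in> tangent_space M x ==> w \<in> tangent_space M x ==> c \<in> charts_at M x ==> v c = w c ==> v = w"
 using tangent_coord_vec by metis

lemma tangent_add:
 assumes "v \<in> tangent_space M x" "w \<in> tangent_space M x" shows "tadd v w \<in> tangent_space M x"
proof (rule tangentI)
 fix c assume c: "c \<in> charts_at M x"
 show "v c + w c \<in> model M" by (intro subspace_add[OF model] assms[THEN tangent_model, OF c])
 fix d assume d: "d \<in> charts_at M x"
 show "v d + w d = jac c d x (v c + w c)"
  using assms[THEN tangent_jac, OF c d] assms[THEN tangent_model, OF c] by (simp add: jac_add[OF c d])
qed (simp add: assms[THEN tangent_off])

lemma tangent_scale: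
 assumes "v \<in> tangent_space M x" shows "tscale r v \<in> tangent_space M x"
proof (rule tangentI)
 fix c assume c: "c \<in> charts_at M x"
 show "r *\<^sub>R v c \<in> model M" by (intro subspace_scale[OF model] tangent_model[OF assms c])
 fix d assume d: "d \<in> charts_at M x"
 show "r *\<^sub>R v d = jac c d x (r *\<^sub>R v c)"
  using tangent_jac[OF assms c d] tangent_model[OF assms c] by (simp add: jac_scale[OF c d])
qed (simp add: tangent_off[OF assms])

lemma tangent_zero: "tzero \<in> tangent_space M x"
proof (rule tangentI)
 show "0 = jac c d x 0" if "c \<in> charts_at M x" "d \<in> charts_at M x" for c d
  using jac_scale[OF that subspace_0[OF model], of 0] by simp
qed (simp_all add: subspace_0[OF model])

lemma coord_vec_add:
 "c \<in> charts_at M x ==> u \<in> model M ==> v \<in> model M ==> coord_vec M c (u + v) x = tadd (coord_vec M c u x) (coord_vec M c v x)"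
 by (rule ext) (simp add: coord_vec_eq jac_add)

lemma coord_vec_scale:
 "c \<in> charts_at M x ==> u \<in> model M ==> coord_vec M c (r *\<^sub>R u) x = tscale r (coord_vec M c u x)"
 by (rule ext) (simp add: coord_vec_eq jac_scale)

end

section \<open>Differentials of smooth maps\<close>

locale charted_map = M: charted_space M + N: charted_space N
 for M :: "('a, 'e::euclidean_space) mfd" and N :: "('b, 'f::euclidean_space) mfd" +
 fixes U p
 assumes smooth_map: "smooth_map_on M U N p"
begin

lemma U_open: "openin (mtop M) U"
 using smooth_map by (simp add: smooth_map_on_def)

lemma map_points: "x \<in> U ==> p x \<in> points N"
 using smooth_map openin_subset[OF U_open] by (auto simp: smooth_map_on_def continuous_map_def)

definition rdom where "rdom c d = cmap c ` (cdom c \<inter> U \<inter> p -` cdom d)"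

lemma rdom_open:
 assumes "c \<in> atlas M" "d \<in> atlas N" shows "openin (top_of_set (model M)) (rdom c d)"
proof -
 have "openin (subtopology (mtop M) U) {x \<in> topspace (subtopology (mtop M) U). p x \<in> cdom d}"
  using smooth_map N.cdom_open[OF assms(2)] openin_continuous_map_preimage by (fastforce simp: smooth_map_on_def)
 then have "openin (mtop M) {x \<in> topspace (subtopology (mtop M) U). p x \<in> cdom d}"
  using openin_open_subtopology[OF U_open] by blast
 moreover have "{x \<in> topspace (subtopology (mtop M) U). p x \<in> cdom d} = U \<inter> p -` cdom d"
  using openin_subset[OF U_open] by auto
 ultimately show ?thesis using M.cmap_open_image[OF assms(1)] by (simp add: rdom_def Int_assoc)
qed

lemma rep_smooth:
 "c \<in> atlas M ==> d \<in> atlas N ==> smooth_on (rdom c d) (%y. cmap d (p (cinv c y)))"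
 using smooth_map by (auto simp: smooth_map_on_def rdom_def o_def)

lemma rdom_cinv: "c \<in> atlas M ==> y \<in> rdom c d ==> cinv c y \<in> cdom c \<and> cinv c y \<in> U \<and> p (cinv c y) \<in> cdom d \<and> cmap c (cinv c y) = y"
 by (auto simp: rdom_def)

lemma cmap_rdom: "x \<in> cdom c ==> x \<in> U ==> p x \<in> cdom d ==> cmap c x \<in> rdom c d"
 by (auto simp: rdom_def)

text \<open>Chain rule through a change of chart on both sides. It frees \<open>differential\<close>
  from the chart selected by \<open>chart_at\<close>.\<close>

lemma rep_change:
 assumes x: "x \<in> U" and c: "c \<in> charts_at M x" "c' \<in> charts_at M x"
  and d: "d \<in> charts_at N (p x)" "d' \<in> charts_at N (p x)" and u: "u \<in> model M"
 shows "ddir (%y. cmap d' (p (cinv c' y))) (cmap c' x) (M.jac c c' x u) =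
   N.jac d d' (p x) (ddir (%y. cmap d (p (cinv c y))) (cmap c x) u)"
proof -
 note cs = c[THEN charts_atD(1)] c[THEN charts_atD(2)] d[THEN charts_atD(1)] d[THEN charts_atD(2)]
 let ?S = "rdom c d \<inter> rdom c d' \<inter> cmap c ` (cdom c \<inter> cdom c')"
 have S: "openin (top_of_set (model M)) ?S"
  by (intro openin_Int rdom_open M.overlap_open cs)
 have y: "cmap c x \<in> ?S" using cs x cmap_rdom[of x c d] cmap_rdom[of x c d'] by auto
 have 1: "ddir (%y. cmap d' (p (cinv c' (cmap c' (cinv c y))))) (cmap c x) u =
   ddir (%y. cmap d' (p (cinv c' y))) (cmap c' (cinv c (cmap c x))) (ddir (%y. cmap c' (cinv c y)) (cmap c x) u)"
 proof (rule ddir_chain_subspace[OF M.model S _ y u M.model rdom_open[OF cs(2,6)] rep_smooth[OF cs(2,6)]])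
  show "smooth_on ?S (%y. cmap c' (cinv c y))"
   by (rule smooth_on_subset[OF M.transition_smooth[OF cs(1,2)]]) auto
  show "(%y. cmap c' (cinv c y)) ` ?S \<subseteq> rdom c' d'"
   using rdom_cinv[OF cs(1), of _ d'] cs by (auto intro!: cmap_rdom)
 qed
 have 2: "ddir (%y. cmap d' (cinv d (cmap d (p (cinv c y))))) (cmap c x) u =
   ddir (%y. cmap d' (cinv d y)) (cmap d (p (cinv c (cmap c x)))) (ddir (%y. cmap d (p (cinv c y))) (cmap c x) u)"
 proof (rule ddir_chain_subspace[OF M.model S _ y u N.model N.overlap_open[OF cs(5,6)] N.transition_smooth[OF cs(5,6)]])
  show "smooth_on ?S (%y. cmap d (p (cinv c y)))"
   by (rule smooth_on_subset[OF rep_smooth[OF cs(1,5)]]) auto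
  show "(%y. cmap d (p (cinv c y))) ` ?S \<subseteq> cmap d ` (cdom d \<inter> cdom d')"
   using rdom_cinv[OF cs(1), of _ d] rdom_cinv[OF cs(1), of _ d'] by fastforce
 qed
 have 3: "ddir (%y. cmap d' (p (cinv c' (cmap c' (cinv c y))))) (cmap c x) u =
   ddir (%y. cmap d' (cinv d (cmap d (p (cinv c y))))) (cmap c x) u"
 proof (rule ddir_cong_subspace[OF M.model S y u])
  fix z assume "z \<in> ?S"
  then show "cmap d' (p (cinv c' (cmap c' (cinv c z)))) = cmap d' (cinv d (cmap d (p (cinv c z))))"
   using rdom_cinv[OF cs(1), of z d] cs by auto
 qed
 show ?thesis using 1 2 3 cs by (simp add: M.jac_def N.jac_def)
qed

lemma differential_component:
 assumes x: "x \<in> U" and v: "v \<in> tangent_space M x" and c: "c \<in> charts_at M x" and d: "d \<in> charts_at N (p x)"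
 shows "differential M N p x v d = ddir (%y. cmap d (p (cinv c y))) (cmap c x) (v c)"
proof -
 have cc: "chart_at M x \<in> charts_at M x" by (rule M.chart_at[OF M.charts_at_points[OF c]])
 have m: "v (chart_at M x) \<in> model M" by (rule M.tangent_model[OF v cc])
 have "ddir (%y. cmap d (p (cinv c y))) (cmap c x) (M.jac (chart_at M x) c x (v (chart_at M x))) =
   N.jac d d (p x) (ddir (%y. cmap d (p (cinv (chart_at M x) y))) (cmap (chart_at M x) x) (v (chart_at M x)))"
  by (rule rep_change[OF x cc c d d m])
 also have "\<dots> = ddir (%y. cmap d (p (cinv (chart_at M x) y))) (cmap (chart_at M x) x) (v (chart_at M x))"
 proof (rule N.jac_self[OF d d])
  have a: "chart_at M x \<in> atlas M" "d \<in> atlas N" using cc d by auto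
  show "ddir (%y. cmap d (p (cinv (chart_at M x) y))) (cmap (chart_at M x) x) (v (chart_at M x)) \<in> model N"
  proof (rule ddir_mem_subspace[OF M.model rdom_open[OF a] rep_smooth[OF a] _ m N.model])
   show "cmap (chart_at M x) x \<in> rdom (chart_at M x) d" using x cc d cmap_rdom by blast
   show "(%y. cmap d (p (cinv (chart_at M x) y))) ` rdom (chart_at M x) d \<subseteq> model N"
    using rdom_cinv[OF a(1)] N.cmap_model charts_atI[OF a(2)] by blast
  qed
 qed
 finally show ?thesis
  using d by (simp add: differential_def Let_def o_def M.tangent_jac[OF v cc c, symmetric])
qed

lemma differential_tangent:
 assumes x: "x \<in> U" and v: "v \<in> tangent_space M x"
 shows "differential M N p x v \<in> tangent_space N (p x)"
proof (rule N.tangentI)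
 have xM: "x \<in> points M" using x openin_subset[OF U_open] by blast
 obtain c where c: "c \<in> charts_at M x" using M.chart_exists[OF xM] by blast
 have m: "v c \<in> model M" by (rule M.tangent_model[OF v c])
 show "differential M N p x v d = 0" if "d \<notin> charts_at N (p x)" for d
  using that by (simp add: differential_def Let_def)
 fix d assume d: "d \<in> charts_at N (p x)"
 have a: "c \<in> atlas M" "d \<in> atlas N" using c d by auto
 have "ddir (%y. cmap d (p (cinv c y))) (cmap c x) (v c) \<in> model N"
 proof (rule ddir_mem_subspace[OF M.model rdom_open[OF a] rep_smooth[OF a] _ m N.model])
  show "cmap c x \<in> rdom c d" using x c d cmap_rdom by blast
  show "(%y. cmap d (p (cinv c y))) ` rdom c d \<subseteq> model N"
   using rdom_cinv[OF a(1)] N.cmap_model charts_atI[OF a(2)] by blast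
 qed
 then show "differential M N p x v d \<in> model N" by (simp add: differential_component[OF x v c d])
 fix d' assume d': "d' \<in> charts_at N (p x)"
 show "differential M N p x v d' = N.jac d d' (p x) (differential M N p x v d)"
  using rep_change[OF x c c d d' m] M.jac_self[OF c c m]
  by (simp add: differential_component[OF x v c d] differential_component[OF x v c d'])
qed

lemma differential_scale:
 assumes x: "x \<in> U" and v: "v \<in> tangent_space M x"
 shows "differential M N p x (tscale r v) = tscale r (differential M N p x v)"
proof -
 have xM: "x \<in> points M" using x openin_subset[OF U_open] by blast
 obtain c where c: "c \<in> charts_at M x" using M.chart_exists[OF xM] by blast
 obtain d where d: "d \<in> charts_at N (p x)" using N.chart_exists[OF map_points[OF x]] by blast
 have a: "c \<in> atlas M" "d \<in> atlas N" using c d by auto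
 show ?thesis
 proof (rule N.tangent_eqI[OF differential_tangent[OF x M.tangent_scale[OF v]]
    N.tangent_scale[OF differential_tangent[OF x v]] d])
  show "differential M N p x (tscale r v) d = r *\<^sub>R differential M N p x v d"
   unfolding differential_component[OF x v c d] differential_component[OF x M.tangent_scale[OF v] c d]
   by (rule ddir_scale_subspace[OF M.model rdom_open[OF a] rep_smooth[OF a]])
    (use x c d M.tangent_model[OF v c] in \<open>auto intro!: cmap_rdom\<close>)
 qed
qed

end

text \<open>Chain rule for the composite in charts. The identity \<open>q (p z) = z\<close> is
  available only where the composite is defined, so the main point is that this is an open set of
  coordinates.\<close>

lemma differential_inverse:
 assumes M: "charted M" and N: "charted N"
  and p: "smooth_map_on M U N p" and q: "smooth_map_on N V M q"
  and x: "x \<in> U" "p x \<in> V" and inv: "!!z. z \<in> U ==> p z \<in> V ==> q (p z) = z"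
  and v: "v \<in> tangent_space M x"
 shows "differential N M q (p x) (differential M N p x v) = v"
proof -
 interpret p: charted_map M N U p using M N p by unfold_locales
 interpret q: charted_map N M V q using M N q by unfold_locales
 have qpx: "q (p x) = x" using inv x by blast
 have xM: "x \<in> points M" using x openin_subset[OF p.U_open] by blast
 obtain c where c: "c \<in> charts_at M x" using p.M.chart_exists[OF xM] by blast
 obtain d where d: "d \<in> charts_at N (p x)" using p.N.chart_exists[OF p.map_points[OF x(1)]] by blast
 have a: "c \<in> atlas M" "d \<in> atlas N" "x \<in> cdom c" "p x \<in> cdom d" using c d by auto
 have vc: "v c \<in> model M" by (rule p.M.tangent_model[OF v c])
 have dv: "differential M N p x v \<in> tangent_space N (p x)" by (rule p.differential_tangent[OF x(1) v])
 have cq: "c \<in> charts_at M (q (p x))" using c qpx by simp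
 let ?S = "p.rdom c d \<inter> (%y. cmap d (p (cinv c y))) -` q.rdom d c"
 have S: "openin (top_of_set (model M)) ?S"
 proof -
  have "continuous_map (top_of_set (p.rdom c d)) (top_of_set (model N)) (%y. cmap d (p (cinv c y)))"
   using smooth_on_continuous_on[OF p.rep_smooth[OF a(1,2)]] p.rdom_cinv[OF a(1), of _ d]
    p.N.cmap_model[OF charts_atI[OF a(2)]] by auto
  then have "openin (top_of_set (p.rdom c d)) {y \<in> topspace (top_of_set (p.rdom c d)). cmap d (p (cinv c y)) \<in> q.rdom d c}"
   using q.rdom_open[OF a(2,1)] openin_continuous_map_preimage by blast
  then have "openin (top_of_set (p.rdom c d)) ?S" by (simp add: Int_def vimage_def)
  then show ?thesis using p.rdom_open[OF a(1,2)] openin_trans by blast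
 qed
 have y: "cmap c x \<in> ?S" using a x qpx p.cmap_rdom[of x c d] q.cmap_rdom[of "p x" d c] by auto
 have "differential N M q (p x) (differential M N p x v) c
  = ddir (%y. cmap c (q (cinv d y))) (cmap d (p (cinv c (cmap c x)))) (ddir (%y. cmap d (p (cinv c y))) (cmap c x) (v c))"
  using q.differential_component[OF x(2) dv d cq] p.differential_component[OF x(1) v c d] a by simp
 also have "\<dots> = ddir (%y. cmap c (q (cinv d (cmap d (p (cinv c y)))))) (cmap c x) (v c)"
  by (rule ddir_chain_subspace[symmetric, OF p.M.model S smooth_on_subset[OF p.rep_smooth[OF a(1,2)]] y vc
     p.N.model q.rdom_open[OF a(2,1)] q.rep_smooth[OF a(2,1)]]) auto
 also have "\<dots> = ddir (%y. y) (cmap c x) (v c)"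
 proof (rule ddir_cong_subspace[OF p.M.model S y vc])
  fix z assume z: "z \<in> ?S"
  then have 1: "cinv c z \<in> cdom c" "cinv c z \<in> U" "p (cinv c z) \<in> cdom d" "cmap c (cinv c z) = z"
   using p.rdom_cinv[OF a(1), of z d] by auto
  have "p (cinv c z) \<in> V" using z q.rdom_cinv[OF a(2), of "cmap d (p (cinv c z))" c] 1 a by auto
  then show "cmap c (q (cinv d (cmap d (p (cinv c z))))) = z" using 1 a inv by simp
 qed
 finally have "differential N M q (p x) (differential M N p x v) c = v c"
  by (simp add: ddir_bounded_linear[OF bounded_linear_ident])
 moreover have "differential N M q (p x) (differential M N p x v) \<in> tangent_space M x"
  using q.differential_tangent[OF x(2) dv] qpx by simp
 ultimately show ?thesis using p.M.tangent_eqI[OF _ v c] by blast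
qed

section \<open>Vector fields and metrics on a manifold\<close>

lemma smooth_on_apply2:
 fixes u v :: "'x::real_normed_vector => 'e::euclidean_space"
 assumes B: "!!a b. smooth_on S (%x. B x a b)" and u: "smooth_on S u" and v: "smooth_on S v"
  and lin1: "!!x b. x \<in> S ==> linear (%a. B x a b)" and lin2: "!!x a. x \<in> S ==> linear (B x a)"
 shows "smooth_on S (%x. B x (u x) (v x))"
proof (rule smooth_on_apply[where F = "%x. B x (u x)", OF _ v])
 show "smooth_on S (%x. B x (u x) b)" for b
  by (rule smooth_on_apply[where F = "%x a. B x a b", OF B u lin1])
qed (rule lin2)

lemma ddir_apply2:
 fixes u v :: "'x::real_normed_vector => 'e::euclidean_space"
 assumes S: "open S" "x \<in> S" and B: "!!a b. smooth_on S (%x. B x a b)" and u: "smooth_on S u" and v: "smooth_on S v"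
  and lin1: "!!x b. x \<in> S ==> linear (%a. B x a b)" and lin2: "!!x a. x \<in> S ==> linear (B x a)"
 shows "ddir (%x. B x (u x) (v x)) x w =
  ddir (%y. B y (u x) (v x)) x w + B x (ddir u x w) (v x) + B x (u x) (ddir v x w)"
proof -
 have Bu: "smooth_on S (%x. B x (u x) b)" for b
  by (rule smooth_on_apply[where F = "%x a. B x a b", OF B u lin1])
 have "ddir (%x. B x (u x) (v x)) x w = ddir (%y. B y (u y) (v x)) x w + B x (u x) (ddir v x w)"
  by (rule ddir_apply[where F = "%x. B x (u x)" and S = S])
   (use smooth_on_diffble[OF Bu S] smooth_on_diffble[OF v S] lin2 S in auto)
 also have "ddir (%y. B y (u y) (v x)) x w = ddir (%y. B y (u x) (v x)) x w + B x (ddir u x w) (v x)"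
  by (rule ddir_apply[where F = "%z a. B z a (v x)" and S = S])
   (use smooth_on_diffble[OF B S] smooth_on_diffble[OF u S] lin1 S in auto)
 finally show ?thesis by simp
qed

locale manifold = charted_space M for M :: "('a, 'e::euclidean_space) mfd" +
 assumes hausdorff: "Hausdorff_space (mtop M)" and model_UNIV: "model M = UNIV"
begin

lemma model_mem [simp]: "u \<in> model M"
 by (simp add: model_UNIV)

definition cimg :: "('a, 'e) chart => 'e set" where "cimg c = cmap c ` cdom c"

lemma cimg_open: "c \<in> atlas M ==> open (cimg c)"
 using cimage_open[of c] by (simp add: model_UNIV cimg_def)

lemma cimg_cinv: "y \<in> cimg c ==> cinv c y \<in> cdom c" "y \<in> cimg c ==> cmap c (cinv c y) = y"
 by (simp_all add: cimg_def cinv_cdom)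

lemma cimg_cmap: "x \<in> cdom c ==> cmap c x \<in> cimg c"
 by (simp add: cimg_def)

lemma cimg_charts_at: "c \<in> atlas M ==> y \<in> cimg c ==> c \<in> charts_at M (cinv c y)"
 by (simp add: cimg_cinv charts_atI)

lemma cimg_points: "c \<in> atlas M ==> y \<in> cimg c ==> cinv c y \<in> points M"
 using charts_at_points cimg_charts_at by blast

lemma cmap_open: "c \<in> atlas M ==> openin (mtop M) U ==> open (cmap c ` (cdom c \<inter> U))"
 using cmap_open_image[of c U] by (simp add: model_UNIV)

lemma cmap_overlap_open: "c \<in> atlas M ==> d \<in> atlas M ==> open (cmap c ` (cdom c \<inter> cdom d))"
 using cmap_open cdom_open by blast

lemma linear_jac: "c \<in> charts_at M x ==> d \<in> charts_at M x ==> linear (jac c d x)"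
 by (rule linearI) (simp_all add: jac_add jac_scale)

lemma jac_inverse: "c \<in> charts_at M x ==> d \<in> charts_at M x ==> jac d c x (jac c d x u) = u"
 by (simp add: jac_jac jac_self)

text \<open>Smoothness of a quantity is tested in one chart around each point: the pull-back of an open
 set of coordinates to another chart is again open.\<close>

lemma chart_change_nbhd:
 assumes c: "c \<in> atlas M" and d: "d \<in> atlas M" and y: "y \<in> cimg d" "cinv d y \<in> cdom c"
  and V: "open V" "cmap c (cinv d y) \<in> V" "V \<subseteq> cimg c"
 obtains V' where "open V'" "y \<in> V'" "V' \<subseteq> cmap d ` (cdom d \<inter> cdom c)"
  "(%z. cmap c (cinv d z)) ` V' \<subseteq> V" "!!z. z \<in> V' ==> cinv d z = cinv c (cmap c (cinv d z))"
  "smooth_on V' (%z. cmap c (cinv d z))"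
proof -
 let ?S = "cmap d ` (cdom d \<inter> cdom c)"
 have S: "open ?S" by (rule cmap_overlap_open[OF d c])
 have sm: "smooth_on ?S (%z. cmap c (cinv d z))" by (rule transition_smooth[OF d c])
 have "open (?S \<inter> (%z. cmap c (cinv d z)) -` V)"
  by (rule continuous_open_preimage[OF smooth_on_continuous_on[OF sm] S V(1)])
 moreover have "y \<in> ?S" using y cimg_cinv by (metis IntI image_eqI)
 ultimately show thesis
  by (intro that[of "?S \<inter> (%z. cmap c (cinv d z)) -` V"])
   (use V(2) c d in \<open>auto intro: smooth_on_subset[OF sm]\<close>)
qed

subsection \<open>Vector fields\<close>

lemma field_tangent: "X \<in> vector_fields M ==> x \<in> points M ==> X x \<in> tangent_space M x"
 by (auto simp: vector_fields_def)

lemma field_off: "X \<in> vector_fields M ==> x \<notin> points M ==> X x = undefined"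
 by (auto simp: vector_fields_def)

lemma field_smooth: "X \<in> vector_fields M ==> c \<in> atlas M ==> smooth_on (cimg c) (%y. X (cinv c y) c)"
 by (auto simp: vector_fields_def cimg_def)

lemma field_eqI:
 "X \<in> vector_fields M ==> Y \<in> vector_fields M ==> (!!x. x \<in> points M ==> X x = Y x) ==> X = Y"
 using field_off by (metis ext)

lemma field_jac:
 "X \<in> vector_fields M ==> c \<in> charts_at M x ==> d \<in> charts_at M x ==> X x d = jac c d x (X x c)"
 using tangent_jac field_tangent charts_at_points by blast

lemma field_diff:
 assumes "X \<in> vector_fields M" "c \<in> charts_at M x"
 shows "(%y. X (cinv c y) c) differentiable (at (cmap c x))"
 by (rule smooth_on_diffble[OF field_smooth[OF assms(1) charts_atD(1)[OF assms(2)]] cimg_open[OF charts_atD(1)[OF assms(2)]]])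
  (use assms(2) cimg_cmap in blast)

lemma vector_fieldI:
 assumes ext: "X \<in> extensional (points M)" and tan: "!!x. x \<in> points M ==> X x \<in> tangent_space M x"
  and loc: "!!x. x \<in> points M ==> \<exists>c\<in>charts_at M x. \<exists>V. open V \<and> cmap c x \<in> V \<and> V \<subseteq> cimg c \<and>
   smooth_on V (%y. X (cinv c y) c)"
 shows "X \<in> vector_fields M"
proof -
 have "smooth_on (cimg d) (%y. X (cinv d y) d)" if d: "d \<in> atlas M" for d
 proof (rule smooth_on_local[OF cimg_open[OF d]])
  fix y assume y: "y \<in> cimg d"
  obtain c V where c: "c \<in> charts_at M (cinv d y)" and V: "open V" "cmap c (cinv d y) \<in> V" "V \<subseteq> cimg c"
   and sm: "smooth_on V (%y. X (cinv c y) c)"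
   using loc[OF cimg_points[OF d y]] by blast
  note ca = charts_atD[OF c]
  obtain V' where V': "open V'" "y \<in> V'" "V' \<subseteq> cmap d ` (cdom d \<inter> cdom c)"
   "(%z. cmap c (cinv d z)) ` V' \<subseteq> V" "!!z. z \<in> V' ==> cinv d z = cinv c (cmap c (cinv d z))"
   "smooth_on V' (%z. cmap c (cinv d z))"
   using chart_change_nbhd[OF ca(1) d y ca(2) V] by blast
  have "smooth_on V' (%z. ddir (%y. cmap d (cinv c y)) (cmap c (cinv d z)) (X (cinv c (cmap c (cinv d z))) c))"
  proof (rule smooth_on_ddir_apply[OF transition_smooth[OF ca(1) d] cmap_overlap_open[OF ca(1) d] V'(6)])
   show "(%z. cmap c (cinv d z)) ` V' \<subseteq> cmap c ` (cdom c \<inter> cdom d)" using V'(3) d by auto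
   show "smooth_on V' (%z. X (cinv c (cmap c (cinv d z))) c)"
    by (rule smooth_on_compose[OF V'(6) sm V'(4)])
  qed
  moreover have "X (cinv d z) d = ddir (%y. cmap d (cinv c y)) (cmap c (cinv d z)) (X (cinv c (cmap c (cinv d z))) c)"
   if z: "z \<in> V'" for z
  proof -
   have "cinv d z \<in> cdom d" "cinv d z \<in> cdom c" using z V'(3) d by auto
   then have cd: "c \<in> charts_at M (cinv d z)" "d \<in> charts_at M (cinv d z)" using ca d by (simp_all add: charts_atI)
   have "X (cinv d z) d = jac c d (cinv d z) (X (cinv d z) c)"
    by (rule tangent_jac[OF tan[OF charts_at_points[OF cd(1)]] cd])
   then show ?thesis using V'(5)[OF z] by (simp add: jac_def)
  qed
  ultimately have "smooth_on V' (%z. X (cinv d z) d)" using smooth_on_cong by (metis (no_types, lifting))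
  then have "smooth_on (cimg d \<inter> V') (%z. X (cinv d z) d)" by (rule smooth_on_subset) auto
  then show "\<exists>U. open U \<and> y \<in> U \<and> smooth_on (cimg d \<inter> U) (%y. X (cinv d y) d)" using V' by blast
 qed
 then show ?thesis using ext tan by (auto simp: vector_fields_def cimg_def PiE_iff)
qed

definition ext_field :: "('a => real) => ('a, 'e) chart => ('e => 'e) => 'a => ('a, 'e) tvec" where
 "ext_field h c e = (\<lambda>x\<in>points M. tscale (h x) (coord_vec M c (e (cmap c x)) x))"

text \<open>Extension of a coordinate expression to a global field that agrees with it near a given
  point; connections and involutivity speak of global fields. One cut-off \<open>h\<close> serves
  all \<open>e\<close>, so several expressions are extended consistently.\<close>

lemma extend_field:
 assumes c: "c \<in> atlas M" and V: "open V" "y0 \<in> V" "V \<subseteq> cimg c"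
 obtains V' h where "open V'" "y0 \<in> V'" "V' \<subseteq> V"
  "!!y. y \<in> V' ==> h (cinv c y) = 1" "!!x. h x \<noteq> 0 ==> x \<in> cdom c \<and> cmap c x \<in> V"
  "!!e. smooth_on V e ==> ext_field h c e \<in> vector_fields M"
proof -
 obtain r0 where r0: "r0 > 0" "cball y0 r0 \<subseteq> V" using V open_contains_cball by blast
 define r where "r = r0 / 2"
 have r: "r > 0" "cball y0 (2 * r) \<subseteq> V" using r0 by (auto simp: r_def)
 obtain f :: "'e => real" where f: "smooth_on UNIV f" "!!x. x \<in> ball y0 r ==> f x = 1"
  "!!x. x \<notin> ball y0 (2 * r) ==> f x = 0" using smooth_bump[OF r(1), of y0] by metis
 let ?K = "cball y0 (2 * r)"
 define h where "h x = (if x \<in> cdom c then f (cmap c x) else 0)" for x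
 have h0: "x \<in> cdom c \<and> cmap c x \<in> ?K" if "h x \<noteq> 0" for x
 proof -
  have "x \<in> cdom c" "f (cmap c x) \<noteq> 0" using that by (auto simp: h_def split: if_splits)
  then show ?thesis using f(3)[of "cmap c x"] ball_subset_cball[of y0 "2 * r"] by blast
 qed
 \<comment> \<open>The closed ball corresponds to a compact set, which is closed because
   \<open>M\<close> is Hausdorff. On its open complement the extended field is 0, which settles
   smoothness at points outside the chart domain.\<close>
 define C where "C = cinv c ` ?K"
 have Kc: "?K \<subseteq> cimg c" using r V by blast
 have "closedin (mtop M) C"
 proof -
  have img: "cmap c ` C = ?K" using Kc cimg_cinv(2)[of _ c] by (force simp: C_def image_image)
  have sub: "C \<subseteq> cdom c" using Kc cimg_cinv(1)[of _ c] by (auto simp: C_def)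
  have "compactin (top_of_set (cmap c ` cdom c)) ?K" using Kc by (auto simp: compactin_subtopology cimg_def)
  then have "compactin (subtopology (mtop M) (cdom c)) C"
   using homeomorphic_map_compactness[OF chart_homeo[OF c], of C] sub img topspace_cdom[OF c]
    cdom_points[OF c] by auto
  then have "compactin (mtop M) C" by (simp add: compactin_subtopology)
  then show ?thesis using compactin_imp_closedin[OF hausdorff] by blast
 qed
 then have Co: "openin (mtop M) (points M - C)" by (simp add: openin_diff)
 have ext: "ext_field h c e \<in> vector_fields M" if e: "smooth_on V e" for e
 proof (rule vector_fieldI)
  show "ext_field h c e \<in> extensional (points M)" by (simp add: ext_field_def)
  fix x assume x: "x \<in> points M"
  show "ext_field h c e x \<in> tangent_space M x"
  proof (cases "x \<in> cdom c")
   case True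
   then show ?thesis using x c by (simp add: ext_field_def tangent_scale coord_vec_tangent charts_atI)
  next
   case False
   then show ?thesis using x tangent_zero by (simp add: ext_field_def h_def)
  qed
  show "\<exists>c'\<in>charts_at M x. \<exists>V. open V \<and> cmap c' x \<in> V \<and> V \<subseteq> cimg c' \<and>
    smooth_on V (%y. ext_field h c e (cinv c' y) c')"
  proof (cases "x \<in> cdom c")
   case True
   have "smooth_on (cimg c) (%y. f y *\<^sub>R e y)"
    by (rule smooth_on_cutoff[OF V(1) e cimg_open[OF c] smooth_on_subset[OF f(1)] closed_cball r(2)])
     (use f(3) in \<open>auto simp: mem_ball mem_cball\<close>)
   moreover have "ext_field h c e (cinv c y) c = f y *\<^sub>R e y" if "y \<in> cimg c" for y
    using cimg_points[OF c that] cimg_cinv[OF that]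
    by (simp add: ext_field_def h_def coord_vec_self cimg_charts_at[OF c that])
   ultimately have "smooth_on (cimg c) (%y. ext_field h c e (cinv c y) c)"
    using smooth_on_cong by (metis (no_types, lifting))
   then show ?thesis
    using True c charts_atI[OF c True] cimg_open[OF c] cimg_cmap[OF True] by blast
  next
   case False
   obtain d where d: "d \<in> charts_at M x" using chart_exists[OF x] by blast
   note da = charts_atD[OF d]
   let ?V = "cmap d ` (cdom d \<inter> (points M - C))"
   have "C \<subseteq> cdom c" using Kc cimg_cinv(1)[of _ c] by (auto simp: C_def)
   then have xV: "cmap d x \<in> ?V" using x False da by auto
   have "ext_field h c e (cinv d y) d = 0" if "y \<in> ?V" for y
   proof -
    obtain z where z: "z \<in> cdom d" "z \<in> points M" "z \<notin> C" "y = cmap d z" using \<open>y \<in> ?V\<close> by blast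
    have "h z = 0"
    proof (rule ccontr)
     assume "h z \<noteq> 0"
     then have "z \<in> C" using h0[of z] cinv_cmap[OF c, of z] unfolding C_def by (metis image_eqI)
     then show False using z by blast
    qed
    then show ?thesis using z da by (simp add: ext_field_def)
   qed
   then have "smooth_on ?V (%y. ext_field h c e (cinv d y) d)"
    using smooth_on_cong[of ?V "%y. ext_field h c e (cinv d y) d" "%y. 0"] smooth_on_const by blast
   then show ?thesis using d xV cmap_open[OF da(1) Co] by (intro bexI[of _ d] exI[of _ ?V]) (auto simp: cimg_def)
  qed
 qed
 show thesis
 proof (rule that[of "ball y0 r" h])
  show "ball y0 r \<subseteq> V" using r by (auto simp: subset_iff mem_ball mem_cball)
  show "h (cinv c y) = 1" if "y \<in> ball y0 r" for y
  proof -
   have "y \<in> cimg c" using that r Kc by (auto simp: subset_iff mem_ball mem_cball)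
   then show ?thesis using cimg_cinv[of y c] f(2)[OF that] by (simp add: h_def)
  qed
  show "x \<in> cdom c \<and> cmap c x \<in> V" if "h x \<noteq> 0" for x using h0[OF that] r by blast
 qed (use ext r in auto)
qed

lemma ext_field_component:
 assumes "c \<in> atlas M" "y \<in> cimg c" "h (cinv c y) = 1" shows "ext_field h c e (cinv c y) c = e y"
 using assms cimg_points[OF assms(1,2)] cimg_cinv[OF assms(2)]
 by (simp add: ext_field_def coord_vec_self cimg_charts_at)

text \<open>Lets identities about fields be used for single vectors: extend the constant coordinate
  expression.\<close>

lemma field_through:
 assumes v: "v \<in> tangent_space M x" and x: "x \<in> points M"
 obtains X where "X \<in> vector_fields M" "X x = v"
proof -
 obtain c where c: "c \<in> charts_at M x" using chart_exists[OF x] by blast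
 note ca = charts_atD[OF c]
 obtain V' h where V': "cmap c x \<in> V'" and h: "!!y. y \<in> V' ==> h (cinv c y) = 1"
  and e: "!!e. smooth_on (cimg c) e ==> ext_field h c e \<in> vector_fields M"
  using extend_field[OF ca(1) cimg_open[OF ca(1)] cimg_cmap[OF ca(2)] order_refl] by metis
 have X: "ext_field h c (%y. v c) \<in> vector_fields M" by (rule e[OF smooth_on_const])
 have "ext_field h c (%y. v c) x c = v c"
  using ext_field_component[OF ca(1) cimg_cmap[OF ca(2)], of h] h[OF V'] ca by simp
 then have "ext_field h c (%y. v c) x = v" using tangent_eqI[OF field_tangent[OF X x] v c] by blast
 then show thesis using that X by blast
qed

lemma deriv_along_chart:
 assumes X: "X \<in> vector_fields M" and c: "c \<in> charts_at M x"
  and f: "(%y. f (cinv c y)) differentiable (at (cmap c x))"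
 shows "deriv_along M X f x = ddir (%y. f (cinv c y)) (cmap c x) (X x c)"
proof -
 define d where "d = chart_at M x"
 have d: "d \<in> charts_at M x" unfolding d_def by (rule chart_at[OF charts_at_points[OF c]])
 note ca = charts_atD[OF c] and da = charts_atD[OF d]
 let ?S = "cmap d ` (cdom d \<inter> cdom c)"
 have S: "open ?S" "cmap d x \<in> ?S" using cmap_overlap_open ca da by auto
 have "deriv_along M X f x = ddir (%y. f (cinv d y)) (cmap d x) (X x d)"
  by (simp add: deriv_along_def d_def Let_def o_def)
 also have "\<dots> = ddir (%y. f (cinv c (cmap c (cinv d y)))) (cmap d x) (X x d)"
  by (rule ddir_cong[OF S]) (use ca da in auto)
 also have "\<dots> = ddir (%y. f (cinv c y)) (cmap c (cinv d (cmap d x))) (ddir (%y. cmap c (cinv d y)) (cmap d x) (X x d))"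
  by (rule ddir_compose[where g = "%y. f (cinv c y)"])
   (use f da smooth_on_diffble[OF transition_smooth[OF da(1) ca(1)] S] in auto)
 also have "\<dots> = ddir (%y. f (cinv c y)) (cmap c x) (X x c)"
  using da field_jac[OF X d c] by (simp add: jac_def)
 finally show ?thesis .
qed

lemma bracket_component:
 "c \<in> charts_at M x ==> bracket M X Y x c =
   ddir (%y. Y (cinv c y) c) (cmap c x) (X x c) - ddir (%y. X (cinv c y) c) (cmap c x) (Y x c)"
 by (simp add: bracket_def)

text \<open>Transforming the two terms produces the second derivative of the transition map once in
  each order of \<open>X\<close> and \<open>Y\<close>; by symmetry these cancel and the Jacobian
  alone remains.\<close>

lemma bracket_tangent:
 assumes X: "X \<in> vector_fields M" and Y: "Y \<in> vector_fields M" and x: "x \<in> points M"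
 shows "bracket M X Y x \<in> tangent_space M x"
proof (rule tangentI)
 fix c d assume c: "c \<in> charts_at M x" and d: "d \<in> charts_at M x"
 note ca = charts_atD[OF c] and da = charts_atD[OF d]
 let ?S = "cmap c ` (cdom c \<inter> cdom d)" and ?t = "%y. cmap d (cinv c y)"
 have S: "open ?S" "cmap c x \<in> ?S" using cmap_overlap_open ca da by auto
 have t: "smooth_on ?S ?t" by (rule transition_smooth[OF ca(1) da(1)])
 have td: "?t differentiable (at (cmap c x))" by (rule smooth_on_diffble[OF t S])
 have tx: "?t (cmap c x) = cmap d x" using ca by simp
 have key: "ddir (%y. Z (cinv d y) d) (cmap d x) (W x d) =
   ddir (%z. ddir ?t z (Z x c)) (cmap c x) (W x c) + jac c d x (ddir (%y. Z (cinv c y) c) (cmap c x) (W x c))"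
  if Z: "Z \<in> vector_fields M" and W: "W \<in> vector_fields M" for Z W
 proof -
  have "ddir (%y. Z (cinv d y) d) (cmap d x) (W x d) =
    ddir (%y. Z (cinv d y) d) (?t (cmap c x)) (ddir ?t (cmap c x) (W x c))"
   using field_jac[OF W c d] tx by (simp add: jac_def)
  also have "\<dots> = ddir (%y. Z (cinv d (?t y)) d) (cmap c x) (W x c)"
   by (rule ddir_compose[symmetric, where g = "%y. Z (cinv d y) d", OF td])
    (use field_diff[OF Z d] tx in simp)
  also have "\<dots> = ddir (%y. ddir ?t y (Z (cinv c y) c)) (cmap c x) (W x c)"
  proof (rule ddir_cong[OF S])
   fix y assume "y \<in> ?S"
   then obtain z where z: "z \<in> cdom c" "z \<in> cdom d" "y = cmap c z" by blast
   have cd: "c \<in> charts_at M z" "d \<in> charts_at M z" using z ca da by (simp_all add: charts_atI)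
   show "Z (cinv d (?t y)) d = ddir ?t y (Z (cinv c y) c)"
    using field_jac[OF Z cd] z ca da by (simp add: jac_def)
  qed
  also have "\<dots> = ddir (%z. ddir ?t z (Z (cinv c (cmap c x)) c)) (cmap c x) (W x c)
    + ddir ?t (cmap c x) (ddir (%y. Z (cinv c y) c) (cmap c x) (W x c))"
  proof (rule ddir_apply[where S = ?S and F = "ddir ?t" and u = "%y. Z (cinv c y) c"])
   show "(%y. ddir ?t y v) differentiable (at (cmap c x))" for v
    by (rule smooth_on_diffble[OF smooth_on_ddir[OF t S(1)] S])
   show "linear (ddir ?t y)" if "y \<in> ?S" for y
    using bounded_linear_ddir[OF smooth_on_diffble[OF t S(1) that]] bounded_linear.linear by blast
  qed (use S field_diff[OF Z c] in auto)
  finally show ?thesis using ca by (simp add: jac_def)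
 qed
 have "ddir (%z. ddir ?t z (Y x c)) (cmap c x) (X x c) = ddir (%z. ddir ?t z (X x c)) (cmap c x) (Y x c)"
  by (rule ddir_commute[OF t S])
 then show "bracket M X Y x d = jac c d x (bracket M X Y x c)"
  using key[OF X Y] key[OF Y X]
  by (simp add: bracket_component[OF c] bracket_component[OF d] linear_diff[OF linear_jac[OF c d]])
qed (simp_all add: bracket_def)

lemma field_add:
 assumes X: "X \<in> vector_fields M" and Y: "Y \<in> vector_fields M"
 shows "vf_add M X Y \<in> vector_fields M"
proof -
 have "smooth_on (cimg c) (%y. vf_add M X Y (cinv c y) c)" if c: "c \<in> atlas M" for c
 proof -
  have "smooth_on (cimg c) (%y. X (cinv c y) c + Y (cinv c y) c)"
   by (intro smooth_on_add field_smooth X Y c)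
  then show ?thesis
   using smooth_on_cong[of "cimg c" "%y. vf_add M X Y (cinv c y) c" "%y. X (cinv c y) c + Y (cinv c y) c"]
    cimg_points[OF c] by (simp add: vf_add_def)
 qed
 then show ?thesis
  using field_tangent[OF X] field_tangent[OF Y] tangent_add by (auto simp: vector_fields_def vf_add_def cimg_def)
qed

lemma field_scale:
 assumes f: "!!c. c \<in> atlas M ==> smooth_on (cimg c) (%y. f (cinv c y))" and X: "X \<in> vector_fields M"
 shows "vf_scale M f X \<in> vector_fields M"
proof -
 have "smooth_on (cimg c) (%y. vf_scale M f X (cinv c y) c)" if c: "c \<in> atlas M" for c
 proof -
  have "smooth_on (cimg c) (%y. f (cinv c y) *\<^sub>R X (cinv c y) c)"
   by (intro smooth_on_scaleR field_smooth f X c)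
  then show ?thesis
   using smooth_on_cong[of "cimg c" "%y. vf_scale M f X (cinv c y) c" "%y. f (cinv c y) *\<^sub>R X (cinv c y) c"]
    cimg_points[OF c] by (simp add: vf_scale_def)
 qed
 then show ?thesis
  using field_tangent[OF X] tangent_scale by (auto simp: vector_fields_def vf_scale_def cimg_def)
qed

end

section \<open>Splittings of the tangent bundle\<close>

definition sections :: "('a, 'e::euclidean_space) mfd => ('a => ('a, 'e) tvec set) => ('a => ('a, 'e) tvec) set" where
 "sections M H = {X \<in> vector_fields M. \<forall>x\<in>points M. X x \<in> H x}"

context manifold
begin

lemma distribution_tangent: "smooth_distribution M H ==> x \<in> points M ==> v \<in> H x ==> v \<in> tangent_space M x"
 by (auto simp: smooth_distribution_def)

lemma distribution_local_frame:
 assumes H: "smooth_distribution M H" and x: "x \<in> points M"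
 obtains d V k and e :: "nat => 'e => 'e" where "d \<in> charts_at M x"
  "openin (mtop M) V" "x \<in> V" "V \<subseteq> cdom d" "\<forall>i<k. smooth_on (cmap d ` V) (e i)"
  "\<forall>z\<in>V. inj_on (%i. e i (cmap d z)) {..<k} \<and> independent ((%i. e i (cmap d z)) ` {..<k}) \<and>
   (%v. v d) ` H z = span ((%i. e i (cmap d z)) ` {..<k})"
 using H[unfolded smooth_distribution_def, THEN conjunct2, THEN conjunct2, THEN bspec, OF x]
 by (elim bexE exE conjE) (rule that)

lemma distribution_subspace:
 assumes H: "smooth_distribution M H" and x: "x \<in> points M" and c: "c \<in> charts_at M x"
 shows "subspace ((%v. v c) ` H x)"
proof -
 from distribution_local_frame[OF H x] obtain d V k and e :: "nat => 'e => 'e"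
  where d: "d \<in> charts_at M x" and "x \<in> V" and sp0:
  "\<forall>z\<in>V. inj_on (%i. e i (cmap d z)) {..<k} \<and> independent ((%i. e i (cmap d z)) ` {..<k}) \<and>
   (%v. v d) ` H z = span ((%i. e i (cmap d z)) ` {..<k})" .
 have sp: "(%v. v d) ` H z = span ((%i. e i (cmap d z)) ` {..<k})" if "z \<in> V" for z
  using sp0 that by blast
 have "(%v. v c) ` H x = jac d c x ` ((%v. v d) ` H x)"
  using tangent_jac[OF distribution_tangent[OF H x] d c] by (force simp: image_image)
 moreover have "subspace ((%v. v d) ` H x)" using sp[OF \<open>x \<in> V\<close>] by simp
 ultimately show ?thesis using linear_subspace_image[OF linear_jac[OF d c]] by simp
qed

lemma distribution_mem_iff:
 assumes H: "smooth_distribution M H" and x: "x \<in> points M" and c: "c \<in> charts_at M x" and v: "v \<in> tangent_space M x"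
 shows "v \<in> H x \<longleftrightarrow> v c \<in> (%v. v c) ` H x"
 using tangent_eqI[OF v distribution_tangent[OF H x] c] by auto

lemma distribution_add:
 assumes H: "smooth_distribution M H" and x: "x \<in> points M" and v: "v \<in> H x" "w \<in> H x"
 shows "tadd v w \<in> H x"
proof -
 obtain c where c: "c \<in> charts_at M x" using chart_exists[OF x] by blast
 have "tadd v w \<in> tangent_space M x" by (intro tangent_add distribution_tangent[OF H x] v)
 from distribution_mem_iff[OF H x c this] show ?thesis
  using subspace_add[OF distribution_subspace[OF H x c]] v by blast
qed

lemma distribution_scale:
 assumes H: "smooth_distribution M H" and x: "x \<in> points M" and v: "v \<in> H x"
 shows "tscale r v \<in> H x"
proof -
 obtain c where c: "c \<in> charts_at M x" using chart_exists[OF x] by blast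
 have "tscale r v \<in> tangent_space M x" by (intro tangent_scale distribution_tangent[OF H x] v)
 from distribution_mem_iff[OF H x c this] show ?thesis
  using subspace_scale[OF distribution_subspace[OF H x c]] v by blast
qed

lemma distribution_zero:
 assumes H: "smooth_distribution M H" and x: "x \<in> points M" shows "tzero \<in> H x"
proof -
 obtain c where c: "c \<in> charts_at M x" using chart_exists[OF x] by blast
 show ?thesis using distribution_mem_iff[OF H x c tangent_zero] subspace_0[OF distribution_subspace[OF H x c]] by blast
qed

text \<open>The frame of the definition lives in a chart of its own; the Jacobian, an isomorphism,
  moves it to a prescribed chart and preserves independence and spans.\<close>

lemma distribution_frame:
 assumes H: "smooth_distribution M H" and x: "x \<in> points M" and c: "c \<in> charts_at M x"
 obtains V k and e :: "nat => 'e => 'e" where "open V" "cmap c x \<in> V" "V \<subseteq> cimg c"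
  "!!i. i < k ==> smooth_on V (e i)"
  "!!y. y \<in> V ==> inj_on (%i. e i y) {..<k}" "!!y. y \<in> V ==> independent ((%i. e i y) ` {..<k})"
  "!!y. y \<in> V ==> (%v. v c) ` H (cinv c y) = span ((%i. e i y) ` {..<k})"
proof -
 from distribution_local_frame[OF H x] obtain d V0 k and e :: "nat => 'e => 'e" where d: "d \<in> charts_at M x"
  and V0: "openin (mtop M) V0" "x \<in> V0" "V0 \<subseteq> cdom d"
  and sm0: "\<forall>i<k. smooth_on (cmap d ` V0) (e i)"
  and fr0: "\<forall>z\<in>V0. inj_on (%i. e i (cmap d z)) {..<k} \<and> independent ((%i. e i (cmap d z)) ` {..<k}) \<and>
   (%v. v d) ` H z = span ((%i. e i (cmap d z)) ` {..<k})" .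
 note sm = sm0[rule_format] and fr = fr0[rule_format]
 note ca = charts_atD[OF c] and da = charts_atD[OF d]
 define V where "V = cmap c ` (cdom c \<inter> (cdom d \<inter> V0))"
 have oV: "open V" unfolding V_def by (intro cmap_open ca openin_Int cdom_open da V0)
 have Vz: "\<exists>z. z \<in> cdom c \<and> z \<in> cdom d \<and> z \<in> V0 \<and> y = cmap c z \<and> cinv c y = z" if "y \<in> V" for y
  using that ca unfolding V_def by auto
 define t where "t y = cmap d (cinv c y)" for y
 have tsm: "smooth_on V t" unfolding t_def
  by (rule smooth_on_subset[OF transition_smooth[OF ca(1) da(1)]]) (auto simp: V_def)
 define f where "f i y = ddir (%y. cmap c (cinv d y)) (t y) (e i (t y))" for i y
 have fj: "f i y = jac d c (cinv c y) (e i (t y))" for i y by (simp add: f_def jac_def t_def)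
 have fsm: "smooth_on V (f i)" if i: "i < k" for i
  unfolding f_def
 proof (rule smooth_on_ddir_apply[OF transition_smooth[OF da(1) ca(1)] cmap_overlap_open[OF da(1) ca(1)] tsm])
  show "t ` V \<subseteq> cmap d ` (cdom d \<inter> cdom c)" using Vz by (fastforce simp: t_def)
  show "smooth_on V (%y. e i (t y))"
   by (rule smooth_on_compose[OF tsm sm[OF i]]) (use Vz in \<open>fastforce simp: t_def\<close>)
 qed
 have at: "c \<in> charts_at M (cinv c y)" "d \<in> charts_at M (cinv c y)" "cinv c y \<in> V0" "cinv c y \<in> points M" if "y \<in> V" for y
  using Vz[OF that] ca da charts_atI charts_at_points by metis+
 have linj: "linear (jac d c (cinv c y))" "inj (jac d c (cinv c y))" if "y \<in> V" for y
  using linear_jac[OF at(2,1)[OF that]] jac_inverse[OF at(2,1)[OF that]] by (auto intro: inj_on_inverseI)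
 show thesis
 proof (rule that[of V k f])
  show "open V" by (rule oV)
  show "cmap c x \<in> V" using ca da V0 by (auto simp: V_def)
  show "V \<subseteq> cimg c" by (auto simp: V_def cimg_def)
  fix y assume y: "y \<in> V"
  have im: "(%i. f i y) ` {..<k} = jac d c (cinv c y) ` ((%i. e i (cmap d (cinv c y))) ` {..<k})"
   by (simp add: fj t_def image_image)
  note fr' = fr[OF at(3)[OF y]]
  show "inj_on (%i. f i y) {..<k}"
   using fr' linj(2)[OF y] by (auto simp: fj t_def inj_on_def dest: injD)
  show "independent ((%i. f i y) ` {..<k})"
   unfolding im using fr' linj[OF y]
   by (intro linear_independent_injective_image) (auto intro: inj_on_subset)
  have "(%v. v c) ` H (cinv c y) = jac d c (cinv c y) ` ((%v. v d) ` H (cinv c y))"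
   using tangent_jac[OF distribution_tangent[OF H at(4)[OF y]] at(2,1)[OF y]] by (force simp: image_image)
  also have "\<dots> = span ((%i. f i y) ` {..<k})"
   unfolding im linear_span_image[OF linj(1)[OF y]] using fr' by simp
  finally show "(%v. v c) ` H (cinv c y) = span ((%i. f i y) ` {..<k})" .
 qed (use fsm in auto)
qed

end

locale splitting = manifold M for M :: "('a, 'e::euclidean_space) mfd" +
 fixes H K :: "'a => ('a, 'e) tvec set"
 assumes H: "smooth_distribution M H" and K: "smooth_distribution M K"
  and sum: "!!x. x \<in> points M ==> tangent_space M x = {tadd v w | v w. v \<in> H x \<and> w \<in> K x}"
  and inter: "!!x. x \<in> points M ==> H x \<inter> K x = {tzero}"
  and H_nonzero: "!!x. x \<in> points M ==> H x \<noteq> {tzero}" and K_nonzero: "!!x. x \<in> points M ==> K x \<noteq> {tzero}"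
begin

lemma swap: "splitting M K H"
proof
 show "tangent_space M x = {tadd v w |v w. v \<in> K x \<and> w \<in> H x}" if "x \<in> points M" for x
 proof -
  have sw: "\<exists>v w. u = tadd v w \<and> v \<in> B \<and> w \<in> A" if ex: "\<exists>v w. u = tadd v w \<and> v \<in> A \<and> w \<in> B"
   for u and A B :: "('a, 'e) tvec set"
  proof -
   obtain v w where vw: "u = tadd v w" "v \<in> A" "w \<in> B" using ex by blast
   have "u = tadd w v" unfolding vw(1) by (simp add: add.commute)
   then show ?thesis using vw by blast
  qed
  have "(\<exists>v w. u = tadd v w \<and> v \<in> H x \<and> w \<in> K x) \<longleftrightarrow> (\<exists>v w. u = tadd v w \<and> v \<in> K x \<and> w \<in> H x)" for u
   using sw[of u "H x" "K x"] sw[of u "K x" "H x"] by (rule iffI)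
  then show ?thesis unfolding sum[OF that] by (rule Collect_cong)
 qed
 show "K x \<inter> H x = {tzero}" if "x \<in> points M" for x using inter[OF that] by blast
qed (use H K H_nonzero K_nonzero in auto)

lemmas H_tangent = distribution_tangent[OF H] and K_tangent = distribution_tangent[OF K]

definition hc :: "('a, 'e) chart => 'e => 'e set" where "hc c y = (%v. v c) ` H (cinv c y)"
definition kc :: "('a, 'e) chart => 'e => 'e set" where "kc c y = (%v. v c) ` K (cinv c y)"

definition prj :: "('a, 'e) chart => 'e => 'e => 'e" where
 "prj c y u = (THE a. a \<in> hc c y \<and> u - a \<in> kc c y)"

context
 fixes c y
 assumes c: "c \<in> atlas M" and y: "y \<in> cimg c"
begin

lemma subspace_hc: "subspace (hc c y)"
 unfolding hc_def by (rule distribution_subspace[OF H cimg_points[OF c y] cimg_charts_at[OF c y]])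

lemma subspace_kc: "subspace (kc c y)"
 unfolding kc_def by (rule distribution_subspace[OF K cimg_points[OF c y] cimg_charts_at[OF c y]])

lemma hc_kc: "hc c y \<inter> kc c y = {0}"
proof -
 note x = cimg_points[OF c y] and ch = cimg_charts_at[OF c y]
 have "v c = 0" if "v \<in> H (cinv c y)" "w \<in> K (cinv c y)" "v c = w c" for v w
 proof -
  have "v = w" using tangent_eqI[OF H_tangent[OF x] K_tangent[OF x] ch] that by blast
  then have "v \<in> H (cinv c y) \<inter> K (cinv c y)" using that by blast
  then have "v = tzero" unfolding inter[OF x] by blast
  then show ?thesis by simp
 qed
 then have "a = 0" if "a \<in> hc c y" "a \<in> kc c y" for a
  using that unfolding hc_def kc_def by blast
 moreover have "0 \<in> hc c y" "0 \<in> kc c y" using subspace_0[OF subspace_hc] subspace_0[OF subspace_kc] by blast+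
 ultimately show ?thesis by blast
qed

lemma hc_kc_decomp: "\<exists>a. a \<in> hc c y \<and> u - a \<in> kc c y"
proof -
 note x = cimg_points[OF c y] and ch = cimg_charts_at[OF c y]
 have "coord_vec M c u (cinv c y) \<in> tangent_space M (cinv c y)" by (rule coord_vec_tangent[OF ch]) simp
 then obtain v w where vw: "v \<in> H (cinv c y)" "w \<in> K (cinv c y)" "coord_vec M c u (cinv c y) = tadd v w"
  unfolding sum[OF x] by blast
 then have "u = v c + w c" using coord_vec_self[OF ch, of u] by simp
 then show ?thesis using vw by (intro exI[of _ "v c"]) (auto simp: hc_def kc_def)
qed

lemma prj_unique: "a \<in> hc c y ==> u - a \<in> kc c y ==> b \<in> hc c y ==> u - b \<in> kc c y ==> a = b"
proof -
 assume *: "a \<in> hc c y" "u - a \<in> kc c y" "b \<in> hc c y" "u - b \<in> kc c y"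
 have "a - b \<in> hc c y" using * subspace_diff[OF subspace_hc] by blast
 moreover have "(u - b) - (u - a) \<in> kc c y" using * subspace_diff[OF subspace_kc] by blast
 then have "a - b \<in> kc c y" by simp
 ultimately have "a - b \<in> {0}" using hc_kc by blast
 then show ?thesis by simp
qed

lemma prj_eqI: "a \<in> hc c y ==> u - a \<in> kc c y ==> prj c y u = a"
 unfolding prj_def using prj_unique by blast

lemma prj_mem: "prj c y u \<in> hc c y" "u - prj c y u \<in> kc c y"
 using hc_kc_decomp[of u] prj_eqI by metis+

lemma linear_prj: "linear (prj c y)"
proof (rule linearI)
 show "prj c y (u + v) = prj c y u + prj c y v" for u v
 proof (rule prj_eqI)
  show "prj c y u + prj c y v \<in> hc c y" using subspace_add[OF subspace_hc] prj_mem by blast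
  have "(u - prj c y u) + (v - prj c y v) \<in> kc c y" using subspace_add[OF subspace_kc] prj_mem by blast
  then show "u + v - (prj c y u + prj c y v) \<in> kc c y" by (simp add: algebra_simps)
 qed
 show "prj c y (r *\<^sub>R u) = r *\<^sub>R prj c y u" for r u
 proof (rule prj_eqI)
  show "r *\<^sub>R prj c y u \<in> hc c y" using subspace_scale[OF subspace_hc] prj_mem by blast
  have "r *\<^sub>R (u - prj c y u) \<in> kc c y" using subspace_scale[OF subspace_kc] prj_mem by blast
  then show "r *\<^sub>R u - r *\<^sub>R prj c y u \<in> kc c y" by (simp add: algebra_simps)
 qed
qed

lemma prj_eq_iff: "prj c y u = u \<longleftrightarrow> u \<in> hc c y"
 using prj_mem[of u] prj_eqI[of u u] subspace_0[OF subspace_kc] by auto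

lemma prj_zero_iff: "prj c y u = 0 \<longleftrightarrow> u \<in> kc c y"
 using prj_mem[of u] prj_eqI[of 0 u] subspace_0[OF subspace_hc] by auto

lemma prj_prj: "prj c y (prj c y u) = prj c y u"
 using prj_eq_iff prj_mem by blast

end

lemma hc_iff: "c \<in> charts_at M x ==> v \<in> tangent_space M x ==> v c \<in> hc c (cmap c x) \<longleftrightarrow> v \<in> H x"
 using distribution_mem_iff[OF H charts_at_points] charts_atD[of c M x] by (simp add: hc_def)

lemma kc_iff: "c \<in> charts_at M x ==> v \<in> tangent_space M x ==> v c \<in> kc c (cmap c x) \<longleftrightarrow> v \<in> K x"
 using distribution_mem_iff[OF K charts_at_points] charts_atD[of c M x] by (simp add: kc_def)

text \<open>With local frames \<open>e\<close> of \<open>H\<close> and \<open>f\<close> of \<open>K\<close>, let \<open>A y\<close> map an orthonormal basis to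
 \<open>e y\<close> and \<open>f y\<close>. The projection is \<open>A y\<close> after a constant projection after \<open>inverse (A y)\<close>.\<close>

lemma prj_smooth:
 assumes c: "c \<in> atlas M" shows "smooth_on (cimg c) (%y. prj c y u)"
proof (rule smooth_on_local[OF cimg_open[OF c]])
 fix y0 assume y0: "y0 \<in> cimg c"
 note x = cimg_points[OF c y0] and ch = cimg_charts_at[OF c y0]
 have cy0: "cmap c (cinv c y0) = y0" by (rule cimg_cinv(2)[OF y0])
 obtain V1 k and e :: "nat => 'e => 'e" where V1: "open V1" "y0 \<in> V1" "V1 \<subseteq> cimg c"
  and e: "!!i. i < k ==> smooth_on V1 (e i)"
  and e1: "!!y. y \<in> V1 ==> inj_on (%i. e i y) {..<k}" "!!y. y \<in> V1 ==> independent ((%i. e i y) ` {..<k})"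
  "!!y. y \<in> V1 ==> hc c y = span ((%i. e i y) ` {..<k})"
  using distribution_frame[OF H x ch] unfolding cy0 hc_def by metis
 obtain V2 l and f :: "nat => 'e => 'e" where V2: "open V2" "y0 \<in> V2" "V2 \<subseteq> cimg c"
  and f: "!!i. i < l ==> smooth_on V2 (f i)"
  and f1: "!!y. y \<in> V2 ==> inj_on (%i. f i y) {..<l}" "!!y. y \<in> V2 ==> independent ((%i. f i y) ` {..<l})"
  "!!y. y \<in> V2 ==> kc c y = span ((%i. f i y) ` {..<l})"
  using distribution_frame[OF K x ch] unfolding cy0 kc_def by metis
 define V where "V = V1 \<inter> V2"
 have V: "open V" "y0 \<in> V" "V \<subseteq> cimg c" using V1 V2 by (auto simp: V_def)
 have dim: "k + l = DIM('e)"
 proof -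
  have dk: "dim (hc c y0) = k"
   using e1[OF V1(2)] by (simp add: dim_eq_card_independent card_image)
  have dl: "dim (kc c y0) = l"
   using f1[OF V2(2)] by (simp add: dim_eq_card_independent card_image)
  have "{a + b | a b. a \<in> hc c y0 \<and> b \<in> kc c y0} = UNIV"
  proof (intro set_eqI iffI UNIV_I)
   fix u :: 'e
   show "u \<in> {a + b | a b. a \<in> hc c y0 \<and> b \<in> kc c y0}"
    using prj_mem[OF c y0, of u] by (intro CollectI exI[of _ "prj c y0 u"] exI[of _ "u - prj c y0 u"]) simp
  qed
  then show ?thesis
   using dim_sums_Int[OF subspace_hc[OF c y0] subspace_kc[OF c y0]] hc_kc[OF c y0] dk dl by simp
 qed
 obtain b :: "nat => 'e" where b: "bij_betw b {..<k + l} Basis"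
  using ex_bij_betw_nat_finite[of "Basis :: 'e set"] dim by (auto simp: lessThan_atLeast0)
 have bin: "b i \<bullet> b j = (if i = j then 1 else 0)" if "i < k + l" "j < k + l" for i j
 proof -
  have "b i \<in> Basis" "b j \<in> Basis" "b i = b j \<longleftrightarrow> i = j"
   using bij_betwE[OF b] that inj_on_eq_iff[OF bij_betw_imp_inj_on[OF b]] by auto
  then show ?thesis by (simp add: inner_Basis)
 qed
 define F where "F i = (if i < k then e i else f (i - k))" for i
 have F: "smooth_on V (F i)" if "i < k + l" for i
 proof (cases "i < k")
  case True
  then show ?thesis using smooth_on_subset[OF e[OF True], of V] by (simp add: F_def V_def)
 next
  case False
  then have "i - k < l" using that by linarith
  then show ?thesis using smooth_on_subset[OF f, of "i - k" V] False by (simp add: F_def V_def)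
 qed
 define A where "A y w = (\<Sum>i<k + l. (w \<bullet> b i) *\<^sub>R F i y)" for y w
 have A: "smooth_on V (%y. A y w)" for w unfolding A_def
  by (intro smooth_on_sum smooth_on_scaleR smooth_on_const F) auto
 have linA: "linear (A y)" for y unfolding A_def
  by (rule linearI) (simp_all add: inner_add_left algebra_simps sum.distrib scaleR_sum_right)
 have Ab: "A y (b j) = F j y" if "j < k + l" for y j
 proof -
  have "A y (b j) = (\<Sum>i<k + l. (if i = j then F i y else 0))"
   unfolding A_def by (rule sum.cong) (use that bin in auto)
  then show ?thesis using that by simp
 qed
 have surjA: "surj (A y)" if y: "y \<in> V" for y
 proof -
  have y': "y \<in> V1" "y \<in> V2" "y \<in> cimg c" using y V by (auto simp: V_def)
  have s: "subspace (range (A y))" using linear_subspace_image[OF linA subspace_UNIV] .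
  have "e i y \<in> range (A y)" if "i < k" for i using Ab[of i y] that by (metis F_def rangeI trans_less_add1)
  then have "span ((%i. e i y) ` {..<k}) \<subseteq> range (A y)" by (intro span_minimal s) auto
  moreover have "f i y \<in> range (A y)" if "i < l" for i
  proof -
   have "A y (b (k + i)) = f i y" using Ab[of "k + i" y] that by (simp add: F_def)
   then show ?thesis by (metis rangeI)
  qed
  then have "span ((%i. f i y) ` {..<l}) \<subseteq> range (A y)" by (intro span_minimal s) auto
  ultimately have hk: "hc c y \<subseteq> range (A y)" "kc c y \<subseteq> range (A y)" using e1(3)[OF y'(1)] f1(3)[OF y'(2)] by auto
  have "u \<in> range (A y)" for u
   using subspace_add[OF s subsetD[OF hk(1) prj_mem(1)[OF c y'(3), of u]] subsetD[OF hk(2) prj_mem(2)[OF c y'(3), of u]]]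
   by simp
  then show ?thesis by blast
 qed
 define R where "R y w = inv (A y) w" for y w
 have AR: "A y (R y w) = w" if "y \<in> V" for y w using surjA[OF that] by (simp add: R_def surj_f_inv_f)
 have R: "smooth_on V (%y. R y w)" for w
  by (rule smooth_on_inverse_family[where F = A, OF A linA AR])
 have "smooth_on V (%y. \<Sum>i<k. (R y u \<bullet> b i) *\<^sub>R e i y)"
  by (intro smooth_on_sum smooth_on_scaleR smooth_on_inner R smooth_on_const smooth_on_subset[OF e]) (auto simp: V_def)
 moreover have "prj c y u = (\<Sum>i<k. (R y u \<bullet> b i) *\<^sub>R e i y)" if y: "y \<in> V" for y
 proof (rule prj_eqI[OF c])
  have y': "y \<in> V1" "y \<in> V2" using y by (auto simp: V_def)
  show "y \<in> cimg c" using y V by blast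
  show "(\<Sum>i<k. (R y u \<bullet> b i) *\<^sub>R e i y) \<in> hc c y"
   unfolding e1(3)[OF y'(1)] by (intro span_sum span_scale span_base) auto
  have "u = A y (R y u)" using AR[OF y] by simp
  also have "\<dots> = (\<Sum>i<k. (R y u \<bullet> b i) *\<^sub>R F i y) + (\<Sum>i = k..<k + l. (R y u \<bullet> b i) *\<^sub>R F i y)"
   unfolding A_def by (subst sum.union_disjoint[symmetric]) (auto intro!: sum.cong)
  also have "(\<Sum>i<k. (R y u \<bullet> b i) *\<^sub>R F i y) = (\<Sum>i<k. (R y u \<bullet> b i) *\<^sub>R e i y)"
   by (rule sum.cong) (auto simp: F_def)
  finally have "u - (\<Sum>i<k. (R y u \<bullet> b i) *\<^sub>R e i y) = (\<Sum>i = k..<k + l. (R y u \<bullet> b i) *\<^sub>R F i y)"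
   by (simp only: diff_eq_eq add.commute)
  also have "\<dots> \<in> kc c y"
   unfolding f1(3)[OF y'(2)] by (intro span_sum span_scale span_base) (auto simp: F_def)
  finally show "u - (\<Sum>i<k. (R y u \<bullet> b i) *\<^sub>R e i y) \<in> kc c y" .
 qed
 ultimately have "smooth_on V (%y. prj c y u)" using smooth_on_cong by (metis (no_types, lifting))
 then show "\<exists>U. open U \<and> y0 \<in> U \<and> smooth_on (cimg c \<inter> U) (%y. prj c y u)"
  using V by (intro exI[of _ V]) (auto intro: smooth_on_subset)
qed

text \<open>Pointwise the components exist by \<open>sum\<close>. In a chart the first one is
  \<open>prj c y\<close> applied to the field, so smoothness of the projections makes both
  smooth.\<close>

lemma field_decomp:
 assumes X: "X \<in> vector_fields M"
 obtains X1 X2 where "X1 \<in> sections M H" "X2 \<in> sections M K" "X = vf_add M X1 X2"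
proof -
 have "\<exists>v w. v \<in> H x \<and> w \<in> K x \<and> X x = tadd v w" if "x \<in> points M" for x
  using field_tangent[OF X that] unfolding sum[OF that] by blast
 then obtain v w where vw: "!!x. x \<in> points M ==> v x \<in> H x \<and> w x \<in> K x \<and> X x = tadd (v x) (w x)"
  by metis
 have vt: "v x \<in> tangent_space M x" and wt: "w x \<in> tangent_space M x" if "x \<in> points M" for x
  using vw[OF that] H_tangent[OF that] K_tangent[OF that] by auto
 have pv: "v x c = prj c (cmap c x) (X x c)" if c: "c \<in> charts_at M x" for x c
 proof (rule prj_eqI[symmetric])
  note x = charts_at_points[OF c] and ca = charts_atD[OF c]
  show "c \<in> atlas M" "cmap c x \<in> cimg c" using ca cimg_cmap by auto
  show "v x c \<in> hc c (cmap c x)" using hc_iff[OF c vt[OF x]] vw[OF x] by blast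
  have "X x c - v x c = w x c" using vw[OF x] by simp
  then show "X x c - v x c \<in> kc c (cmap c x)" using kc_iff[OF c wt[OF x]] vw[OF x] by simp
 qed
 define X1 where "X1 = (\<lambda>x\<in>points M. v x)"
 define X2 where "X2 = (\<lambda>x\<in>points M. w x)"
 have sm1: "smooth_on (cimg c) (%y. X1 (cinv c y) c)" if c: "c \<in> atlas M" for c
 proof -
  have "smooth_on (cimg c) (%y. prj c y (X (cinv c y) c))"
   by (rule smooth_on_apply[where F = "prj c", OF prj_smooth[OF c] field_smooth[OF X c] linear_prj[OF c]])
  moreover have "X1 (cinv c y) c = prj c y (X (cinv c y) c)" if "y \<in> cimg c" for y
   using pv[OF cimg_charts_at[OF c that]] cimg_points[OF c that] cimg_cinv[OF that] by (simp add: X1_def)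
  ultimately show ?thesis using smooth_on_cong by (metis (no_types, lifting))
 qed
 have X1: "X1 \<in> vector_fields M" using sm1 vt by (auto simp: vector_fields_def cimg_def X1_def)
 have sm2: "smooth_on (cimg c) (%y. X2 (cinv c y) c)" if c: "c \<in> atlas M" for c
 proof -
  have "smooth_on (cimg c) (%y. X (cinv c y) c - X1 (cinv c y) c)"
   by (intro smooth_on_diff field_smooth X X1 c)
  moreover have "X2 (cinv c y) c = X (cinv c y) c - X1 (cinv c y) c" if "y \<in> cimg c" for y
   using vw[OF cimg_points[OF c that]] cimg_points[OF c that] by (simp add: X1_def X2_def)
  ultimately show ?thesis using smooth_on_cong by (metis (no_types, lifting))
 qed
 have X2: "X2 \<in> vector_fields M" using sm2 wt by (auto simp: vector_fields_def cimg_def X2_def)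
 have "X = vf_add M X1 X2"
  by (rule field_eqI[OF X field_add[OF X1 X2]]) (use vw in \<open>simp add: vf_add_def X1_def X2_def\<close>)
 moreover have "X1 \<in> sections M H" "X2 \<in> sections M K"
  using X1 X2 vw by (auto simp: sections_def X1_def X2_def)
 ultimately show thesis using that by blast
qed

text \<open>Extend \<open>v\<close> to any field and keep the component in \<open>H\<close>. At
  \<open>x\<close> the discarded component lies in \<open>H x\<close> as well as in
  \<open>K x\<close>, so it is 0 and the value \<open>v\<close> is kept.\<close>

lemma section_through:
 assumes x: "x \<in> points M" and v: "v \<in> H x"
 obtains X where "X \<in> sections M H" "X x = v"
proof -
 obtain X where X: "X \<in> vector_fields M" "X x = v" using field_through[OF H_tangent[OF x v] x] by blast
 obtain X1 X2 where X12: "X1 \<in> sections M H" "X2 \<in> sections M K" "X = vf_add M X1 X2"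
  using field_decomp[OF X(1)] by blast
 have m: "X1 x \<in> H x" "X2 x \<in> K x" using X12 x by (auto simp: sections_def)
 have e: "v = tadd (X1 x) (X2 x)" using X(2) X12(3) x by (simp add: vf_add_def)
 have "X2 x = tadd v (tscale (-1) (X1 x))" using e by (auto simp: fun_eq_iff)
 then have "X2 x \<in> H x" using distribution_add[OF H x v distribution_scale[OF H x m(1), of "-1"]] by simp
 then have "X2 x = tzero" using m inter[OF x] by blast
 then have "X1 x = v" using e by simp
 then show thesis using that X12 by blast
qed

lemma nonzero_section:
 assumes x: "x \<in> points M"
 obtains X where "X \<in> sections M H" "X x \<noteq> tzero"
proof -
 obtain v where "v \<in> H x" "v \<noteq> tzero" using H_nonzero[OF x] distribution_zero[OF H x] by blast
 then show thesis using section_through[OF x] that by metis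
qed

end

section \<open>The Weyl connection of a metric and a one-form\<close>

locale riemannian = manifold M for M :: "('a, 'e::euclidean_space) mfd" +
 fixes g :: "('a, 'e) metric"
 assumes metric: "riemannian_metric M g"
begin

context
 fixes x u v w
 assumes x: "x \<in> points M" and u: "u \<in> tangent_space M x" and v: "v \<in> tangent_space M x" and w: "w \<in> tangent_space M x"
begin

lemmas metric_at = metric[unfolded riemannian_metric_def, THEN conjunct1, THEN bspec, OF x, THEN bspec, OF u,
  THEN bspec, OF v, THEN bspec, OF w, THEN spec]

lemma metric_add: "g x (tadd u v) w = g x u w + g x v w"
 by (rule metric_at[THEN conjunct1])

lemma metric_scale: "g x (tscale r u) w = r * g x u w"
 by (rule metric_at[THEN conjunct2, THEN conjunct1])

lemma metric_sym: "g x u v = g x v u"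
 by (rule metric_at[THEN conjunct2, THEN conjunct2, THEN conjunct1])

lemma metric_pos: "u \<noteq> tzero ==> g x u u > 0"
 by (rule metric_at[THEN conjunct2, THEN conjunct2, THEN conjunct2, THEN mp])

end

definition gch :: "('a, 'e) chart => 'e => 'e => 'e => real" where
 "gch c y u v = g (cinv c y) (coord_vec M c u (cinv c y)) (coord_vec M c v (cinv c y))"

lemma gch_smooth: "c \<in> atlas M ==> smooth_on (cimg c) (%y. gch c y u v)"
 unfolding gch_def cimg_def
 by (rule metric[unfolded riemannian_metric_def, THEN conjunct2, THEN bspec, THEN bspec, THEN bspec]) simp_all

lemma metric_gch:
 assumes c: "c \<in> charts_at M x" and "v \<in> tangent_space M x" "w \<in> tangent_space M x"
 shows "g x v w = gch c (cmap c x) (v c) (w c)"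
 using assms charts_atD[OF c] by (simp add: gch_def tangent_coord_vec)

context
 fixes c y
 assumes c: "c \<in> atlas M" and y: "y \<in> cimg c"
begin

lemma cv_tangent: "coord_vec M c u (cinv c y) \<in> tangent_space M (cinv c y)"
 by (rule coord_vec_tangent[OF cimg_charts_at[OF c y]]) simp

lemma gch_sym: "gch c y u v = gch c y v u"
 unfolding gch_def by (rule metric_sym[OF cimg_points[OF c y] cv_tangent cv_tangent cv_tangent])

lemma gch_linear1: "linear (%u. gch c y u v)"
proof (rule linearI)
 note ch = cimg_charts_at[OF c y]
 show "gch c y (a + b) v = gch c y a v + gch c y b v" for a b
  using metric_add[OF cimg_points[OF c y] cv_tangent cv_tangent cv_tangent, of a b v]
  by (simp add: gch_def coord_vec_add[OF ch])
 show "gch c y (r *\<^sub>R a) v = r *\<^sub>R gch c y a v" for r a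
  using metric_scale[OF cimg_points[OF c y] cv_tangent cv_tangent cv_tangent, of r a v]
  by (simp add: gch_def coord_vec_scale[OF ch])
qed

lemma gch_linear2: "linear (gch c y u)"
proof -
 have "gch c y u = (%v. gch c y v u)" by (rule ext) (rule gch_sym)
 then show ?thesis using gch_linear1[of u] by simp
qed

lemma gch_pos: assumes "u \<noteq> 0" shows "gch c y u u > 0"
proof -
 have "coord_vec M c u (cinv c y) c = u" by (rule coord_vec_self[OF cimg_charts_at[OF c y]]) simp
 then have "coord_vec M c u (cinv c y) \<noteq> tzero" using assms by auto
 then show ?thesis unfolding gch_def by (rule metric_pos[OF cimg_points[OF c y] cv_tangent cv_tangent cv_tangent])
qed

lemma gch_nondegenerate:
 assumes "!!w. gch c y u w = gch c y v w" shows "u = v"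
proof (rule ccontr)
 assume "u \<noteq> v"
 then have "gch c y (u - v) (u - v) > 0" by (intro gch_pos) simp
 moreover have "gch c y (u - v) (u - v) = gch c y u (u - v) - gch c y v (u - v)"
  by (rule linear_diff[OF gch_linear1])
 ultimately show False using assms by simp
qed

lemmas gch_simps = linear_add[OF gch_linear1] linear_add[OF gch_linear2] linear_diff[OF gch_linear1]
 linear_diff[OF gch_linear2] linear_scale[OF gch_linear1] linear_scale[OF gch_linear2]

end

lemma smooth_on_gch:
 "c \<in> atlas M ==> S \<subseteq> cimg c ==> smooth_on S u ==> smooth_on S v ==> smooth_on S (%y. gch c y (u y) (v y))"
 by (rule smooth_on_apply2[where B = "gch c"])
  (auto intro: smooth_on_subset[OF gch_smooth] gch_linear1 gch_linear2)

lemma metric_fields_smooth: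
 assumes "X \<in> vector_fields M" "Y \<in> vector_fields M" "c \<in> atlas M"
 shows "smooth_on (cimg c) (%y. g (cinv c y) (X (cinv c y)) (Y (cinv c y)))"
proof -
 have "smooth_on (cimg c) (%y. gch c y (X (cinv c y) c) (Y (cinv c y) c))"
  by (intro smooth_on_gch field_smooth assms order_refl)
 moreover have "g (cinv c y) (X (cinv c y)) (Y (cinv c y)) = gch c y (X (cinv c y) c) (Y (cinv c y) c)" if y: "y \<in> cimg c" for y
  using metric_gch[OF cimg_charts_at[OF assms(3) y] field_tangent[OF assms(1)] field_tangent[OF assms(2)]]
   cimg_points[OF assms(3) y] cimg_cinv[OF y] by simp
 ultimately show ?thesis using smooth_on_cong by (metis (no_types, lifting))
qed

lemma deriv_metric:
 assumes X: "X \<in> vector_fields M" and Y: "Y \<in> vector_fields M" and Z: "Z \<in> vector_fields M" and c: "c \<in> charts_at M x"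
 shows "deriv_along M X (%z. g z (Y z) (Z z)) x =
  ddir (%y. gch c y (Y x c) (Z x c)) (cmap c x) (X x c) +
  gch c (cmap c x) (ddir (%y. Y (cinv c y) c) (cmap c x) (X x c)) (Z x c) +
  gch c (cmap c x) (Y x c) (ddir (%y. Z (cinv c y) c) (cmap c x) (X x c))"
proof -
 note ca = charts_atD[OF c]
 have S: "open (cimg c)" "cmap c x \<in> cimg c" using cimg_open ca cimg_cmap by auto
 have "deriv_along M X (%z. g z (Y z) (Z z)) x = ddir (%y. g (cinv c y) (Y (cinv c y)) (Z (cinv c y))) (cmap c x) (X x c)"
  by (rule deriv_along_chart[OF X c smooth_on_diffble[OF metric_fields_smooth[OF Y Z ca(1)] S]])
 also have "\<dots> = ddir (%y. gch c y (Y (cinv c y) c) (Z (cinv c y) c)) (cmap c x) (X x c)"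
 proof (rule ddir_cong[OF S])
  fix y assume y: "y \<in> cimg c"
  show "g (cinv c y) (Y (cinv c y)) (Z (cinv c y)) = gch c y (Y (cinv c y) c) (Z (cinv c y) c)"
   using metric_gch[OF cimg_charts_at[OF ca(1) y] field_tangent[OF Y] field_tangent[OF Z]]
    cimg_points[OF ca(1) y] cimg_cinv[OF y] by simp
 qed
 also have "\<dots> = ddir (%y. gch c y (Y (cinv c (cmap c x)) c) (Z (cinv c (cmap c x)) c)) (cmap c x) (X x c) +
  gch c (cmap c x) (ddir (%y. Y (cinv c y) c) (cmap c x) (X x c)) (Z (cinv c (cmap c x)) c) +
  gch c (cmap c x) (Y (cinv c (cmap c x)) c) (ddir (%y. Z (cinv c y) c) (cmap c x) (X x c))"
  by (rule ddir_apply2[where B = "gch c", OF S gch_smooth[OF ca(1)] field_smooth[OF Y ca(1)] field_smooth[OF Z ca(1)]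
     gch_linear1[OF ca(1)] gch_linear2[OF ca(1)]])
 finally show ?thesis using ca by simp
qed

lemma deriv_along_zero:
 assumes "!!z. z \<in> points M ==> f z = 0" "X \<in> vector_fields M" "x \<in> points M"
 shows "deriv_along M X f x = 0"
proof -
 define c where "c = chart_at M x"
 have c: "c \<in> charts_at M x" unfolding c_def by (rule chart_at[OF assms(3)])
 note ca = charts_atD[OF c]
 have "ddir (%y. f (cinv c y)) (cmap c x) (X x c) = ddir (%y. 0) (cmap c x) (X x c)"
  by (rule ddir_cong[OF cimg_open[OF ca(1)] cimg_cmap[OF ca(2)]]) (use assms(1) cimg_points[OF ca(1)] in auto)
 then show ?thesis by (simp add: deriv_along_def c_def[symmetric] Let_def o_def ddir_const)
qed

end

section \<open>Koszul formula and Christoffel symbols\<close>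

locale weyl_data = riemannian M g for M :: "('a, 'e::euclidean_space) mfd" and g +
 fixes \<theta> :: "'a => ('a, 'e) tvec => real"
 assumes form: "one_form M \<theta>"
begin

lemma form_add: "x \<in> points M ==> v \<in> tangent_space M x ==> w \<in> tangent_space M x ==> \<theta> x (tadd v w) = \<theta> x v + \<theta> x w"
 and form_scale: "x \<in> points M ==> v \<in> tangent_space M x ==> \<theta> x (tscale r v) = r * \<theta> x v"
 using form unfolding one_form_def by blast+

definition th :: "('a, 'e) chart => 'e => 'e => real" where
 "th c y u = \<theta> (cinv c y) (coord_vec M c u (cinv c y))"

lemma th_smooth: "c \<in> atlas M ==> smooth_on (cimg c) (%y. th c y u)"
 unfolding th_def cimg_def
 by (rule form[unfolded one_form_def, THEN conjunct2, THEN bspec, THEN bspec]) simp_all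

lemma form_th: "c \<in> charts_at M x ==> v \<in> tangent_space M x ==> \<theta> x v = th c (cmap c x) (v c)"
 using charts_atD[of c M x] by (simp add: th_def tangent_coord_vec)

lemma th_linear: assumes c: "c \<in> atlas M" and y: "y \<in> cimg c" shows "linear (th c y)"
proof (rule linearI)
 note ch = cimg_charts_at[OF c y]
 show "th c y (a + b) = th c y a + th c y b" for a b
  using form_add[OF cimg_points[OF c y] cv_tangent[OF c y] cv_tangent[OF c y], of a b] by (simp add: th_def coord_vec_add[OF ch])
 show "th c y (r *\<^sub>R a) = r *\<^sub>R th c y a" for r a
  using form_scale[OF cimg_points[OF c y] cv_tangent[OF c y], of r a] by (simp add: th_def coord_vec_scale[OF ch])
qed

text \<open>This is 2 g(D_X Y, Z) for torsion-free \<open>D\<close> with D g = \<theta> \<otimes> g: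
  add the equations for X g(Y, Z) and Y g(X, Z), subtract the one for Z g(X, Y), and replace
  differences of covariant derivatives by brackets.\<close>

definition koszul :: "('a => ('a, 'e) tvec) => ('a => ('a, 'e) tvec) => ('a => ('a, 'e) tvec) => 'a => real" where
 "koszul X Y Z x = deriv_along M X (%z. g z (Y z) (Z z)) x + deriv_along M Y (%z. g z (X z) (Z z)) x
   - deriv_along M Z (%z. g z (X z) (Y z)) x
   - \<theta> x (X x) * g x (Y x) (Z x) - \<theta> x (Y x) * g x (X x) (Z x) + \<theta> x (Z x) * g x (X x) (Y x)
   + g x (bracket M X Y x) (Z x) - g x (bracket M X Z x) (Y x) - g x (bracket M Y Z x) (X x)"

text \<open>\<open>koszul\<close> for fields with constant components \<open>u\<close>,
  \<open>v\<close>, \<open>w\<close>, whose brackets vanish: twice the Christoffel symbol with its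
  upper index lowered.\<close>

definition kz :: "('a, 'e) chart => 'e => 'e => 'e => 'e => real" where
 "kz c y u v w = ddir (%z. gch c z v w) y u + ddir (%z. gch c z u w) y v - ddir (%z. gch c z u v) y w
   - th c y u * gch c y v w - th c y v * gch c y u w + th c y w * gch c y u v"

text \<open>The metric as an operator with respect to the inner product of the model space. Its
  inverse raises indices and is smooth as the inverse of a smooth family.\<close>

definition gram :: "('a, 'e) chart => 'e => 'e => 'e" where
 "gram c y w = (\<Sum>b\<in>Basis. gch c y w b *\<^sub>R b)"

definition christoffel :: "('a, 'e) chart => 'e => 'e => 'e => 'e" where
 "christoffel c y u v = inv (gram c y) (\<Sum>b\<in>Basis. (kz c y u v b / 2) *\<^sub>R b)"

lemma ddir_gch_linear:
 assumes c: "c \<in> atlas M" and y: "y \<in> cimg c"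
 shows "linear (%u. ddir (%z. gch c z u v) y w)" "linear (%v. ddir (%z. gch c z u v) y w)"
proof -
 note S = cimg_open[OF c]
 have d: "(%z. gch c z u v) differentiable (at y)" for u v by (rule smooth_on_diffble[OF gch_smooth[OF c] S y])
 show "linear (%u. ddir (%z. gch c z u v) y w)"
 proof (rule linearI)
  show "ddir (%z. gch c z (a + b) v) y w = ddir (%z. gch c z a v) y w + ddir (%z. gch c z b v) y w" for a b
   unfolding ddir_add[OF d d, symmetric] by (rule ddir_cong[OF S y]) (simp add: gch_simps[OF c])
  show "ddir (%z. gch c z (r *\<^sub>R a) v) y w = r *\<^sub>R ddir (%z. gch c z a v) y w" for r a
   unfolding ddir_linear_comp[OF bounded_linear_scaleR_right d, symmetric]
   by (rule ddir_cong[OF S y]) (simp add: gch_simps[OF c])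
 qed
 show "linear (%v. ddir (%z. gch c z u v) y w)"
 proof (rule linearI)
  show "ddir (%z. gch c z u (a + b)) y w = ddir (%z. gch c z u a) y w + ddir (%z. gch c z u b) y w" for a b
   unfolding ddir_add[OF d d, symmetric] by (rule ddir_cong[OF S y]) (simp add: gch_simps[OF c])
  show "ddir (%z. gch c z u (r *\<^sub>R a)) y w = r *\<^sub>R ddir (%z. gch c z u a) y w" for r a
   unfolding ddir_linear_comp[OF bounded_linear_scaleR_right d, symmetric]
   by (rule ddir_cong[OF S y]) (simp add: gch_simps[OF c])
 qed
qed

lemma ddir_gch_linear3:
 assumes c: "c \<in> atlas M" and y: "y \<in> cimg c" shows "linear (ddir (%z. gch c z u v) y)"
 using bounded_linear_ddir[OF smooth_on_diffble[OF gch_smooth[OF c] cimg_open[OF c] y]] bounded_linear.linear by blast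

context
 fixes c y
 assumes c: "c \<in> atlas M" and y: "y \<in> cimg c"
begin

lemmas lin_simps = gch_simps[OF c y] linear_add[OF th_linear[OF c y]] linear_scale[OF th_linear[OF c y]]
 linear_add[OF ddir_gch_linear(1)[OF c y]] linear_scale[OF ddir_gch_linear(1)[OF c y]]
 linear_add[OF ddir_gch_linear(2)[OF c y]] linear_scale[OF ddir_gch_linear(2)[OF c y]]
 linear_add[OF ddir_gch_linear3[OF c y]] linear_scale[OF ddir_gch_linear3[OF c y]]

lemma kz_linear1: "linear (%u. kz c y u v w)"
 by (rule linearI) (simp_all add: kz_def lin_simps algebra_simps)

lemma kz_linear2: "linear (%v. kz c y u v w)"
 by (rule linearI) (simp_all add: kz_def lin_simps algebra_simps)

lemma kz_linear3: "linear (kz c y u v)"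
 by (rule linearI) (simp_all add: kz_def lin_simps algebra_simps)

text \<open>Inherited from the symmetry of \<open>gch\<close>; this makes the connection
  torsion-free.\<close>

lemma kz_sym: "kz c y u v w = kz c y v u w"
proof -
 have "ddir (%z. gch c z u v) y w = ddir (%z. gch c z v u) y w"
  by (rule ddir_cong[OF cimg_open[OF c] y]) (rule gch_sym[OF c])
 then show ?thesis using gch_sym[OF c y, of u v] by (simp add: kz_def)
qed

text \<open>The terms differentiated along \<open>v\<close> and \<open>w\<close> cancel, and so do
  those with \<theta> evaluated there. What remains expresses D g = \<theta> \<otimes> g in
  coordinates.\<close>

lemma kz_swap: "kz c y u v w + kz c y u w v = 2 * (ddir (%z. gch c z v w) y u - th c y u * gch c y v w)"
proof -
 have "ddir (%z. gch c z v w) y u = ddir (%z. gch c z w v) y u"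
  by (rule ddir_cong[OF cimg_open[OF c] y]) (rule gch_sym[OF c])
 then show ?thesis using gch_sym[OF c y, of v w] by (simp add: kz_def)
qed

lemma gram_linear: "linear (gram c y)"
 by (rule linearI) (simp_all add: gram_def gch_simps[OF c y] algebra_simps sum.distrib scaleR_sum_right)

lemma gram_inner: "gram c y u \<bullet> v = gch c y u v"
proof -
 have "gram c y u \<bullet> v = (\<Sum>b\<in>Basis. gch c y u b * (b \<bullet> v))" by (simp add: gram_def inner_sum_left)
 also have "\<dots> = (\<Sum>b\<in>Basis. (v \<bullet> b) *\<^sub>R gch c y u b)" by (simp add: inner_commute mult.commute)
 also have "\<dots> = gch c y u v" by (rule linear_on_Basis_sum[OF gch_linear2[OF c y], symmetric])
 finally show ?thesis .
qed

lemma gram_surj: "surj (gram c y)"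
proof -
 have "u = 0" if "gram c y u = 0" for u
  using gram_inner[of u u] gch_pos[OF c y, of u] that by (cases "u = 0") auto
 then have "inj (gram c y)" using linear_injective_0[OF gram_linear] by blast
 then show ?thesis using linear_injective_imp_surjective[OF gram_linear] by blast
qed

lemma christoffel_metric: "gch c y (christoffel c y u v) w = kz c y u v w / 2"
proof -
 have "gch c y (christoffel c y u v) w = (\<Sum>b\<in>Basis. (kz c y u v b / 2) *\<^sub>R b) \<bullet> w"
  unfolding gram_inner[symmetric] christoffel_def surj_f_inv_f[OF gram_surj] ..
 also have "\<dots> = (\<Sum>b\<in>Basis. (w \<bullet> b) *\<^sub>R kz c y u v b) / 2"
  by (simp add: inner_commute[of _ w] inner_sum_right mult.commute sum_divide_distrib)
 also have "\<dots> = kz c y u v w / 2" by (subst linear_on_Basis_sum[OF kz_linear3, of u v w]) (rule refl)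
 finally show ?thesis .
qed

lemma christoffel_linear1: "linear (%u. christoffel c y u v)"
 by (rule linearI; rule gch_nondegenerate[OF c y])
  (simp_all add: gch_simps[OF c y] christoffel_metric linear_add[OF kz_linear1] linear_scale[OF kz_linear1] add_divide_distrib)

lemma christoffel_linear2: "linear (christoffel c y u)"
 by (rule linearI; rule gch_nondegenerate[OF c y])
  (simp_all add: gch_simps[OF c y] christoffel_metric linear_add[OF kz_linear2] linear_scale[OF kz_linear2] add_divide_distrib)

lemma christoffel_sym: "christoffel c y u v = christoffel c y v u"
 by (rule gch_nondegenerate[OF c y]) (simp add: christoffel_metric kz_sym[of u v])

end

lemma christoffel_smooth:
 assumes c: "c \<in> atlas M" shows "smooth_on (cimg c) (%y. christoffel c y u v)"
 unfolding christoffel_def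
proof (rule smooth_on_apply[where F = "%y. inv (gram c y)"])
 note S = cimg_open[OF c]
 have "smooth_on (cimg c) (%y. kz c y u v b)" for b unfolding kz_def
  by (intro smooth_on_add smooth_on_diff smooth_on_mult smooth_on_ddir gch_smooth th_smooth c S)
 then show "smooth_on (cimg c) (%y. \<Sum>b\<in>Basis. (kz c y u v b / 2) *\<^sub>R b)"
  by (intro smooth_on_sum smooth_on_scaleR smooth_on_const smooth_on_divide) auto
 have gi: "gram c y (inv (gram c y) w) = w" if "y \<in> cimg c" for y w
  by (rule surj_f_inv_f[OF gram_surj[OF c that]])
 show "smooth_on (cimg c) (%y. inv (gram c y) w)" for w
 proof (rule smooth_on_inverse_family[where F = "gram c", OF _ gram_linear[OF c] gi])
  show "smooth_on (cimg c) (%y. gram c y v)" for v unfolding gram_def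
   by (intro smooth_on_sum smooth_on_scaleR smooth_on_const gch_smooth c)
 qed
 fix y assume y: "y \<in> cimg c"
 have inj: "inj (gram c y)"
  by (rule linear_surjective_imp_injective[OF gram_linear[OF c y] gram_surj[OF c y]]) simp
 show "linear (inv (gram c y))"
 proof (rule linearI)
  show "inv (gram c y) (a + b) = inv (gram c y) a + inv (gram c y) b" for a b
   by (rule injD[OF inj]) (simp add: linear_add[OF gram_linear[OF c y]] gi[OF y])
  show "inv (gram c y) (r *\<^sub>R a) = r *\<^sub>R inv (gram c y) a" for r a
   by (rule injD[OF inj]) (simp add: linear_scale[OF gram_linear[OF c y]] gi[OF y])
 qed
qed

definition cov :: "('a => ('a, 'e) tvec) => ('a => ('a, 'e) tvec) => 'a => ('a, 'e) tvec" where
 "cov X Y x = (%c. if c \<in> charts_at M x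
   then ddir (%y. Y (cinv c y) c) (cmap c x) (X x c) + christoffel c (cmap c x) (X x c) (Y x c) else 0)"

text \<open>The brackets cancel all derivatives of components of the fields except that of
  \<open>Y\<close> along \<open>X\<close>, which occurs twice; the rest is
  \<open>kz\<close>.\<close>

lemma koszul_cov:
 assumes X: "X \<in> vector_fields M" and Y: "Y \<in> vector_fields M" and Z: "Z \<in> vector_fields M" and c: "c \<in> charts_at M x"
 shows "koszul X Y Z x = 2 * gch c (cmap c x) (cov X Y x c) (Z x c)"
proof -
 note ca = charts_atD[OF c] and x = charts_at_points[OF c]
 have S: "cmap c x \<in> cimg c" using ca cimg_cmap by auto
 note t = field_tangent[OF X x] field_tangent[OF Y x] field_tangent[OF Z x]
  bracket_tangent[OF X Y x] bracket_tangent[OF X Z x] bracket_tangent[OF Y Z x]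
 show ?thesis
  unfolding koszul_def deriv_metric[OF X Y Z c] deriv_metric[OF Y X Z c] deriv_metric[OF Z X Y c]
   metric_gch[OF c t(2,3)] metric_gch[OF c t(1,3)] metric_gch[OF c t(1,2)]
   metric_gch[OF c t(4,3)] metric_gch[OF c t(5,2)] metric_gch[OF c t(6,1)]
   form_th[OF c t(1)] form_th[OF c t(2)] form_th[OF c t(3)] bracket_component[OF c]
  using c by (simp add: cov_def gch_simps[OF ca(1) S] christoffel_metric[OF ca(1) S] kz_def
    gch_sym[OF ca(1) S, of _ "X x c"] gch_sym[OF ca(1) S, of "Y x c" "ddir F p q" for F p q])
qed

text \<open>No transformation law of Christoffel symbols has to be computed: \<open>koszul\<close>
  does not refer to the chart \<open>c\<close>, and by nondegeneracy its values for all
  \<open>Z\<close> determine the component of \<open>cov\<close> in each chart.\<close>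

lemma cov_tangent:
 assumes X: "X \<in> vector_fields M" and Y: "Y \<in> vector_fields M" and x: "x \<in> points M"
 shows "cov X Y x \<in> tangent_space M x"
proof (rule tangentI)
 fix c d assume c: "c \<in> charts_at M x" and d: "d \<in> charts_at M x"
 note ca = charts_atD[OF c] and da = charts_atD[OF d]
 show "cov X Y x d = jac c d x (cov X Y x c)"
 proof (rule gch_nondegenerate[OF da(1) cimg_cmap[OF da(2)]])
  fix w
  obtain Z where Z: "Z \<in> vector_fields M" "Z x = coord_vec M d w x"
   using field_through[OF coord_vec_tangent[OF d] x, of w] by auto
  have Zd: "Z x d = w" using Z coord_vec_self[OF d, of w] by simp
  let ?v = "coord_vec M c (cov X Y x c) x"
  have v: "?v \<in> tangent_space M x" "?v c = cov X Y x c" "?v d = jac c d x (cov X Y x c)"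
   using coord_vec_tangent[OF c] coord_vec_self[OF c] coord_vec_component[OF d] by auto
  have "2 * gch d (cmap d x) (cov X Y x d) w = koszul X Y Z x"
   using koszul_cov[OF X Y Z(1) d] by (simp add: Zd)
  also have "\<dots> = 2 * gch c (cmap c x) (?v c) (Z x c)" using koszul_cov[OF X Y Z(1) c] by (simp add: v)
  also have "\<dots> = 2 * gch d (cmap d x) (?v d) (Z x d)"
   using metric_gch[OF c v(1) field_tangent[OF Z(1) x]] metric_gch[OF d v(1) field_tangent[OF Z(1) x]] by simp
  finally show "gch d (cmap d x) (cov X Y x d) w = gch d (cmap d x) (jac c d x (cov X Y x c)) w"
   by (simp add: v Zd)
 qed
qed (simp_all add: cov_def)

lemma koszul_eq:
 assumes "X \<in> vector_fields M" "Y \<in> vector_fields M" "Z \<in> vector_fields M" "x \<in> points M"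
 shows "koszul X Y Z x = 2 * g x (cov X Y x) (Z x)"
proof -
 obtain c where c: "c \<in> charts_at M x" using chart_exists[OF assms(4)] by blast
 show ?thesis
  using koszul_cov[OF assms(1-3) c] metric_gch[OF c cov_tangent[OF assms(1,2,4)] field_tangent[OF assms(3,4)]] by simp
qed

text \<open>Restricted to fields and to points because \<open>linear_connection\<close> asks for
  extensional functions; this convention also turns uniqueness into an equation between
  connections.\<close>

definition weyl_conn :: "('a, 'e) connection" where
 "weyl_conn = (\<lambda>X\<in>vector_fields M. \<lambda>Y\<in>vector_fields M. \<lambda>x\<in>points M. cov X Y x)"

lemma weyl_conn_at:
 "X \<in> vector_fields M ==> Y \<in> vector_fields M ==> x \<in> points M ==> weyl_conn X Y x = cov X Y x"
 by (simp add: weyl_conn_def)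

lemma weyl_conn_field:
 assumes X: "X \<in> vector_fields M" and Y: "Y \<in> vector_fields M"
 shows "weyl_conn X Y \<in> vector_fields M"
proof -
 have "smooth_on (cimg c) (%y. weyl_conn X Y (cinv c y) c)" if c: "c \<in> atlas M" for c
 proof -
  have "smooth_on (cimg c) (%y. ddir (%y. Y (cinv c y) c) y (X (cinv c y) c) + christoffel c y (X (cinv c y) c) (Y (cinv c y) c))"
  proof (rule smooth_on_add)
   show "smooth_on (cimg c) (%y. ddir (%y. Y (cinv c y) c) y (X (cinv c y) c))"
    by (rule smooth_on_ddir_apply[OF field_smooth[OF Y c] cimg_open[OF c] smooth_on_ident _ field_smooth[OF X c]]) auto
   show "smooth_on (cimg c) (%y. christoffel c y (X (cinv c y) c) (Y (cinv c y) c))"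
    by (rule smooth_on_apply2[where B = "christoffel c", OF christoffel_smooth[OF c] field_smooth[OF X c] field_smooth[OF Y c]
       christoffel_linear1[OF c] christoffel_linear2[OF c]])
  qed
  moreover have "weyl_conn X Y (cinv c y) c = ddir (%y. Y (cinv c y) c) y (X (cinv c y) c) + christoffel c y (X (cinv c y) c) (Y (cinv c y) c)"
   if y: "y \<in> cimg c" for y
   using weyl_conn_at[OF X Y cimg_points[OF c y]] cimg_charts_at[OF c y] cimg_cinv[OF y] by (simp add: cov_def)
  ultimately show ?thesis using smooth_on_cong by (metis (no_types, lifting))
 qed
 then show ?thesis using cov_tangent[OF X Y] X Y by (auto simp: vector_fields_def cimg_def weyl_conn_def)
qed

lemma smooth_fun_chart: "smooth_fun M f ==> c \<in> atlas M ==> smooth_on (cimg c) (%y. f (cinv c y))"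
 by (auto simp: smooth_fun_def cimg_def o_def)

lemma field_add_component: "x \<in> points M ==> vf_add M X Y x c = X x c + Y x c"
 by (simp add: vf_add_def)

lemma field_scale_component: "x \<in> points M ==> vf_scale M f X x c = f x *\<^sub>R X x c"
 by (simp add: vf_scale_def)

lemma weyl_conn_linear: "linear_connection M weyl_conn"
 unfolding linear_connection_def
proof (intro conjI ballI allI impI)
 show "weyl_conn \<in> vector_fields M \<rightarrow>\<^sub>E vector_fields M \<rightarrow>\<^sub>E vector_fields M"
  using weyl_conn_field by (auto simp: PiE_iff) (auto simp: weyl_conn_def extensional_def)
next
 fix X Y Z assume X: "X \<in> vector_fields M" and Y: "Y \<in> vector_fields M" and Z: "Z \<in> vector_fields M"
 note XY = field_add[OF X Y] and YZ = field_add[OF Y Z]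
 show "weyl_conn (vf_add M X Y) Z = vf_add M (weyl_conn X Z) (weyl_conn Y Z)"
 proof (rule field_eqI[OF weyl_conn_field[OF XY Z] field_add[OF weyl_conn_field[OF X Z] weyl_conn_field[OF Y Z]]])
  fix x assume x: "x \<in> points M"
  obtain c where c: "c \<in> charts_at M x" using chart_exists[OF x] by blast
  note ca = charts_atD[OF c]
  show "weyl_conn (vf_add M X Y) Z x = vf_add M (weyl_conn X Z) (weyl_conn Y Z) x"
   by (rule tangent_eqI[OF field_tangent[OF weyl_conn_field[OF XY Z] x]
      field_tangent[OF field_add[OF weyl_conn_field[OF X Z] weyl_conn_field[OF Y Z]] x] c])
    (simp add: field_add_component[OF x] weyl_conn_at[OF XY Z x] weyl_conn_at[OF X Z x] weyl_conn_at[OF Y Z x]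
     cov_def c linear_add[OF christoffel_linear1[OF ca(1) cimg_cmap[OF ca(2)]]]
     linear_add[OF bounded_linear.linear[OF bounded_linear_ddir[OF field_diff[OF Z c]]]])
 qed
 show "weyl_conn X (vf_add M Y Z) = vf_add M (weyl_conn X Y) (weyl_conn X Z)"
 proof (rule field_eqI[OF weyl_conn_field[OF X YZ] field_add[OF weyl_conn_field[OF X Y] weyl_conn_field[OF X Z]]])
  fix x assume x: "x \<in> points M"
  obtain c where c: "c \<in> charts_at M x" using chart_exists[OF x] by blast
  note ca = charts_atD[OF c]
  have "ddir (%y. vf_add M Y Z (cinv c y) c) (cmap c x) (X x c) = ddir (%y. Y (cinv c y) c + Z (cinv c y) c) (cmap c x) (X x c)"
   by (rule ddir_cong[OF cimg_open[OF ca(1)] cimg_cmap[OF ca(2)]]) (simp add: field_add_component cimg_points[OF ca(1)])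
  then have "ddir (%y. vf_add M Y Z (cinv c y) c) (cmap c x) (X x c) =
    ddir (%y. Y (cinv c y) c) (cmap c x) (X x c) + ddir (%y. Z (cinv c y) c) (cmap c x) (X x c)"
   by (simp add: ddir_add[OF field_diff[OF Y c] field_diff[OF Z c]])
  then show "weyl_conn X (vf_add M Y Z) x = vf_add M (weyl_conn X Y) (weyl_conn X Z) x"
   by (intro tangent_eqI[OF field_tangent[OF weyl_conn_field[OF X YZ] x]
      field_tangent[OF field_add[OF weyl_conn_field[OF X Y] weyl_conn_field[OF X Z]] x] c])
    (simp add: field_add_component[OF x] weyl_conn_at[OF X YZ x] weyl_conn_at[OF X Z x] weyl_conn_at[OF X Y x]
     cov_def c linear_add[OF christoffel_linear2[OF ca(1) cimg_cmap[OF ca(2)]]])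
 qed
next
 fix X Y f assume X: "X \<in> vector_fields M" and Y: "Y \<in> vector_fields M" and f: "smooth_fun M f"
 have fX: "vf_scale M f X \<in> vector_fields M" and fY: "vf_scale M f Y \<in> vector_fields M"
  and fXY: "vf_scale M f (weyl_conn X Y) \<in> vector_fields M"
  by (intro field_scale smooth_fun_chart[OF f] X Y weyl_conn_field; assumption)+
 show "weyl_conn (vf_scale M f X) Y = vf_scale M f (weyl_conn X Y)"
 proof (rule field_eqI[OF weyl_conn_field[OF fX Y] fXY])
  fix x assume x: "x \<in> points M"
  obtain c where c: "c \<in> charts_at M x" using chart_exists[OF x] by blast
  note ca = charts_atD[OF c]
  show "weyl_conn (vf_scale M f X) Y x = vf_scale M f (weyl_conn X Y) x"
   by (rule tangent_eqI[OF field_tangent[OF weyl_conn_field[OF fX Y] x] field_tangent[OF fXY x] c])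
    (simp add: field_scale_component[OF x] weyl_conn_at[OF fX Y x] weyl_conn_at[OF X Y x]
     cov_def c linear_scale[OF christoffel_linear1[OF ca(1) cimg_cmap[OF ca(2)]]] scaleR_add_right
     linear_scale[OF bounded_linear.linear[OF bounded_linear_ddir[OF field_diff[OF Y c]]]])
 qed
 have dXf: "smooth_on (cimg c) (%y. deriv_along M X f (cinv c y))" if c: "c \<in> atlas M" for c
 proof -
  have "smooth_on (cimg c) (%y. ddir (%y. f (cinv c y)) y (X (cinv c y) c))"
   by (rule smooth_on_ddir_apply[OF smooth_fun_chart[OF f c] cimg_open[OF c] smooth_on_ident _ field_smooth[OF X c]]) auto
  moreover have "deriv_along M X f (cinv c y) = ddir (%y. f (cinv c y)) y (X (cinv c y) c)" if y: "y \<in> cimg c" for y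
   using deriv_along_chart[OF X cimg_charts_at[OF c y], of f] cimg_cinv[OF y]
    smooth_on_diffble[OF smooth_fun_chart[OF f c] cimg_open[OF c] y] by simp
  ultimately show ?thesis using smooth_on_cong by (metis (no_types, lifting))
 qed
 have dY: "vf_scale M (deriv_along M X f) Y \<in> vector_fields M" by (rule field_scale[OF dXf Y])
 show "weyl_conn X (vf_scale M f Y) = vf_add M (vf_scale M (deriv_along M X f) Y) (vf_scale M f (weyl_conn X Y))"
 proof (rule field_eqI[OF weyl_conn_field[OF X fY] field_add[OF dY fXY]])
  fix x assume x: "x \<in> points M"
  obtain c where c: "c \<in> charts_at M x" using chart_exists[OF x] by blast
  note ca = charts_atD[OF c]
  have fd: "(%y. f (cinv c y)) differentiable (at (cmap c x))"
   by (rule smooth_on_diffble[OF smooth_fun_chart[OF f ca(1)] cimg_open[OF ca(1)] cimg_cmap[OF ca(2)]])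
  have "ddir (%y. vf_scale M f Y (cinv c y) c) (cmap c x) (X x c) = ddir (%y. f (cinv c y) *\<^sub>R Y (cinv c y) c) (cmap c x) (X x c)"
   by (rule ddir_cong[OF cimg_open[OF ca(1)] cimg_cmap[OF ca(2)]]) (simp add: field_scale_component cimg_points[OF ca(1)])
  also have "\<dots> = f x *\<^sub>R ddir (%y. Y (cinv c y) c) (cmap c x) (X x c) + deriv_along M X f x *\<^sub>R Y x c"
   unfolding deriv_along_chart[OF X c fd] ddir_bilinear[OF bounded_bilinear_scaleR fd field_diff[OF Y c]] using ca by simp
  finally show "weyl_conn X (vf_scale M f Y) x = vf_add M (vf_scale M (deriv_along M X f) Y) (vf_scale M f (weyl_conn X Y)) x"
   by (intro tangent_eqI[OF field_tangent[OF weyl_conn_field[OF X fY] x] field_tangent[OF field_add[OF dY fXY] x] c])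
    (simp add: field_add_component[OF x] field_scale_component[OF x] weyl_conn_at[OF X fY x] weyl_conn_at[OF X Y x]
     cov_def c linear_scale[OF christoffel_linear2[OF ca(1) cimg_cmap[OF ca(2)]]] scaleR_add_right)
 qed
qed

lemma weyl_conn_torsion_free: "torsion_free M weyl_conn"
 unfolding torsion_free_def
proof (intro ballI ext)
 fix X Y x c assume X: "X \<in> vector_fields M" and Y: "Y \<in> vector_fields M" and x: "x \<in> points M"
 show "weyl_conn X Y x c - weyl_conn Y X x c = bracket M X Y x c"
 proof (cases "c \<in> charts_at M x")
  case True
  note ca = charts_atD[OF True]
  show ?thesis
   using True christoffel_sym[OF ca(1) cimg_cmap[OF ca(2)], of "X x c" "Y x c"]
   by (simp add: weyl_conn_at[OF X Y x] weyl_conn_at[OF Y X x] cov_def bracket_component)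
 qed (simp add: weyl_conn_at[OF X Y x] weyl_conn_at[OF Y X x] cov_def bracket_def)
qed

lemma weyl_conn_metric:
 assumes X: "X \<in> vector_fields M" and Y: "Y \<in> vector_fields M" and Z: "Z \<in> vector_fields M" and x: "x \<in> points M"
 shows "deriv_along M X (%z. g z (Y z) (Z z)) x - g x (weyl_conn X Y x) (Z x) - g x (Y x) (weyl_conn X Z x)
  = \<theta> x (X x) * g x (Y x) (Z x)"
proof -
 obtain c where c: "c \<in> charts_at M x" using chart_exists[OF x] by blast
 note ca = charts_atD[OF c]
 note S = cimg_cmap[OF ca(2)]
 note t = field_tangent[OF X x] field_tangent[OF Y x] field_tangent[OF Z x] cov_tangent[OF X Y x] cov_tangent[OF X Z x]
 have "gch c (cmap c x) (Y x c) (christoffel c (cmap c x) (X x c) (Z x c)) = kz c (cmap c x) (X x c) (Z x c) (Y x c) / 2"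
  using gch_sym[OF ca(1) S] christoffel_metric[OF ca(1) S] by metis
 then show ?thesis
  unfolding weyl_conn_at[OF X Y x] weyl_conn_at[OF X Z x] deriv_metric[OF X Y Z c]
   metric_gch[OF c t(4,3)] metric_gch[OF c t(2,5)] metric_gch[OF c t(2,3)] form_th[OF c t(1)]
  using c kz_swap[OF ca(1) S, of "X x c" "Y x c" "Z x c"]
  by (simp add: cov_def gch_simps[OF ca(1) S] christoffel_metric[OF ca(1) S])
qed

end

section \<open>Conformal foliations and reducible Weyl structures\<close>

lemma conformal_rel_iff: "(g, g') \<in> conformal_rel M \<longleftrightarrow> riemannian_metric M g \<and> riemannian_metric M g' \<and>
  (\<exists>f. \<forall>x\<in>points M. f x > 0 \<and> (\<forall>v\<in>tangent_space M x. \<forall>w\<in>tangent_space M x. g' x v w = f x * g x v w))"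
 by (simp add: conformal_rel_def)

lemma conformal_class_rel:
 assumes C: "C \<in> conformal_structures M" and g: "g \<in> C" and g': "g' \<in> C"
 shows "(g, g') \<in> conformal_rel M"
proof -
 obtain g0 where C0: "C = conformal_rel M `` {g0}" using C by (auto simp: conformal_structures_def quotient_def)
 have r: "(g0, g) \<in> conformal_rel M" "(g0, g') \<in> conformal_rel M" using g g' by (auto simp: C0)
 obtain f1 where g1: "\<forall>x\<in>points M. f1 x > 0 \<and> (\<forall>v\<in>tangent_space M x. \<forall>w\<in>tangent_space M x. g x v w = f1 x * g0 x v w)"
  using r(1) unfolding conformal_rel_iff by blast
 obtain f2 where g2: "\<forall>x\<in>points M. f2 x > 0 \<and> (\<forall>v\<in>tangent_space M x. \<forall>w\<in>tangent_space M x. g' x v w = f2 x * g0 x v w)"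
  using r(2) unfolding conformal_rel_iff by blast
 have "f2 x / f1 x > 0 \<and> (\<forall>v\<in>tangent_space M x. \<forall>w\<in>tangent_space M x. g' x v w = f2 x / f1 x * g x v w)"
  if "x \<in> points M" for x
  using bspec[OF g1 that] bspec[OF g2 that] by simp
 then show ?thesis using r unfolding conformal_rel_iff by (intro conjI exI[of _ "%x. f2 x / f1 x"]) blast+
qed

lemma conformal_class_factor:
 assumes "C \<in> conformal_structures M" "g \<in> C" "g' \<in> C"
 obtains f where "\<forall>x\<in>points M. f x > 0 \<and> (\<forall>v\<in>tangent_space M x. \<forall>w\<in>tangent_space M x. g' x v w = f x * g x v w)"
 using conformal_class_rel[OF assms] unfolding conformal_rel_iff by blast

lemma conformal_class_metric:
 "C \<in> conformal_structures M ==> g \<in> C ==> riemannian_metric M g"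
 using conformal_class_rel[of C M g g] unfolding conformal_rel_iff by blast

lemma conformal_rel_refl: "riemannian_metric M g ==> (g, g) \<in> conformal_rel M"
 unfolding conformal_rel_iff by (auto intro!: exI[of _ "%x. 1"])

lemma conformal_class_nonempty: "C \<in> conformal_structures M ==> \<exists>g. g \<in> C"
 using conformal_rel_refl by (fastforce simp: conformal_structures_def quotient_def)

lemma conformal_class_of_metric: "riemannian_metric M g ==> conformal_rel M `` {g} \<in> conformal_structures M"
 by (auto simp: conformal_structures_def quotient_def)

definition involutive :: "('a, 'e::euclidean_space) mfd => ('a => ('a, 'e) tvec set) => bool" where
 "involutive M H \<longleftrightarrow> (\<forall>X\<in>sections M H. \<forall>Y\<in>sections M H. \<forall>x\<in>points M. bracket M X Y x \<in> H x)"

text \<open>The Lie derivative (L_Z g)(X, Y), by the Leibniz rule.\<close>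

definition lie_metric :: "('a, 'e::euclidean_space) mfd => ('a, 'e) metric => ('a => ('a, 'e) tvec) =>
  ('a => ('a, 'e) tvec) => ('a => ('a, 'e) tvec) => 'a => real" where
 "lie_metric M g Z X Y x =
   deriv_along M Z (%z. g z (X z) (Y z)) x - g x (bracket M Z X x) (Y x) - g x (X x) (bracket M Z Y x)"

text \<open>The order of the two distributions matters: the first one carries the flow, the second
  one is acted upon.\<close>

definition conformal_along :: "('a, 'e::euclidean_space) mfd => ('a, 'e) metric => ('a => ('a, 'e) tvec => real) =>
  ('a => ('a, 'e) tvec set) => ('a => ('a, 'e) tvec set) => bool" where
 "conformal_along M g \<theta> H K \<longleftrightarrow> (\<forall>Z\<in>sections M H. \<forall>X\<in>sections M K. \<forall>Y\<in>sections M K. \<forall>x\<in>points M.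
   lie_metric M g Z X Y x = \<theta> x (Z x) * g x (X x) (Y x))"

definition conformal_foliations :: "('a, 'e::euclidean_space) mfd => ('a, 'e) metric => ('a => ('a, 'e) tvec => real) =>
  ('a => ('a, 'e) tvec set) => ('a => ('a, 'e) tvec set) => bool" where
 "conformal_foliations M g \<theta> H K \<longleftrightarrow> one_form M \<theta> \<and> involutive M H \<and> involutive M K \<and>
   conformal_along M g \<theta> H K \<and> conformal_along M g \<theta> K H"

definition recurrent :: "('a, 'e::euclidean_space) mfd => ('a, 'e) metric => ('a => ('a, 'e) tvec => real) =>
  ('a, 'e) connection => bool" where
 "recurrent M g \<theta> D \<longleftrightarrow> (\<forall>X\<in>vector_fields M. \<forall>Y\<in>vector_fields M. \<forall>Z\<in>vector_fields M. \<forall>x\<in>points M.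
   deriv_along M X (%z. g z (Y z) (Z z)) x - g x (D X Y x) (Z x) - g x (Y x) (D X Z x) = \<theta> x (X x) * g x (Y x) (Z x))"

lemma recurrentD:
 "recurrent M g \<theta> D ==> X \<in> vector_fields M ==> Y \<in> vector_fields M ==> Z \<in> vector_fields M ==> x \<in> points M ==>
   deriv_along M X (%z. g z (Y z) (Z z)) x - g x (D X Y x) (Z x) - g x (Y x) (D X Z x) = \<theta> x (X x) * g x (Y x) (Z x)"
 unfolding recurrent_def by blast

lemma torsion_free_add:
 assumes tf: "torsion_free M D" and "A \<in> vector_fields M" "B \<in> vector_fields M" "x \<in> points M"
 shows "tadd (bracket M A B x) (D B A x) = D A B x"
proof -
 have "(%c. D A B x c - D B A x c) = bracket M A B x"
  by (rule tf[unfolded torsion_free_def, THEN bspec, THEN bspec, THEN bspec]) fact+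
 from this[symmetric] show ?thesis by simp
qed

lemma bracket_swap: "bracket M Y X x = tscale (-1) (bracket M X Y x)"
 by (auto simp: bracket_def fun_eq_iff)

lemma sectionD: "X \<in> sections M H ==> X \<in> vector_fields M" "X \<in> sections M H ==> x \<in> points M ==> X x \<in> H x"
 by (auto simp: sections_def)

locale orth_splitting = splitting M H K + riemannian M g
 for M :: "('a, 'e::euclidean_space) mfd" and H K g +
 assumes orth: "!!x v w. x \<in> points M ==> v \<in> H x ==> w \<in> K x ==> g x v w = 0"
begin

lemma orth': "x \<in> points M ==> w \<in> K x ==> v \<in> H x ==> g x w v = 0"
 using orth[of x v w] metric_sym[of x v w v] H_tangent K_tangent by simp

lemma orth_swap: "orth_splitting M K H g"
proof -
 interpret s: splitting M K H by (rule swap)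
 show ?thesis by unfold_locales (rule orth')
qed

text \<open>The component of \<open>v\<close> in \<open>K\<close>, tested against itself, has length
  0.\<close>

lemma orth_mem:
 assumes x: "x \<in> points M" and v: "v \<in> tangent_space M x" and o: "!!w. w \<in> K x ==> g x v w = 0"
 shows "v \<in> H x"
proof -
 obtain a b where ab: "v = tadd a b" "a \<in> H x" "b \<in> K x" using v unfolding sum[OF x] by blast
 note t = H_tangent[OF x ab(2)] K_tangent[OF x ab(3)]
 have "g x a b + g x b b = 0" using o[OF ab(3)] metric_add[OF x t t(2)] ab by simp
 then have "g x b b = 0" using orth[OF x ab(2,3)] by simp
 then have "b = tzero" using metric_pos[OF x t(2) t(2) t(2)] by (cases "b = tzero") auto
 then show ?thesis using ab by simp
qed

lemma bracket_metric_swap: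
 assumes "X \<in> vector_fields M" "Y \<in> vector_fields M" "x \<in> points M" "v \<in> tangent_space M x"
 shows "g x (bracket M Y X x) v = - g x (bracket M X Y x) v"
  "g x v (bracket M Y X x) = - g x v (bracket M X Y x)"
proof -
 note b = bracket_tangent[OF assms(1-3)]
 have 1: "g x (bracket M Y X x) w = - g x (bracket M X Y x) w" if "w \<in> tangent_space M x" for w
  using metric_scale[OF assms(3) b b that, of "-1"] unfolding bracket_swap[of M Y X x] by simp
 then show "g x (bracket M Y X x) v = - g x (bracket M X Y x) v" using assms(4) by blast
 show "g x v (bracket M Y X x) = - g x v (bracket M X Y x)"
  using 1[OF assms(4)] metric_sym[OF assms(3,4) b b]
   metric_sym[OF assms(3,4) bracket_tangent[OF assms(2,1,3)] b] by simp
qed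

end

locale weyl_splitting = orth_splitting M H K g + weyl_data M g \<theta>
 for M :: "('a, 'e::euclidean_space) mfd" and H K g \<theta>
begin

lemma deriv_orth_zero:
 assumes "X \<in> vector_fields M" "Y \<in> sections M H" "Z \<in> sections M K" "x \<in> points M"
 shows "deriv_along M X (%z. g z (Y z) (Z z)) x = 0" "deriv_along M X (%z. g z (Z z) (Y z)) x = 0"
 by (rule deriv_along_zero[OF orth[OF _ sectionD(2)[OF assms(2)] sectionD(2)[OF assms(3)]] assms(1,4)]
   deriv_along_zero[OF orth'[OF _ sectionD(2)[OF assms(3)] sectionD(2)[OF assms(2)]] assms(1,4)]; assumption)+

text \<open>Since [X, Y] lies in \<open>H\<close> and the functions g(X, Z) and g(Y, Z) vanish
  identically, only \<theta>(Z) g(X, Y) - (L_Z g)(X, Y) remains.\<close>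

lemma koszul_HH:
 assumes X: "X \<in> sections M H" and Y: "Y \<in> sections M H" and Z: "Z \<in> sections M K" and x: "x \<in> points M"
  and inv: "involutive M H" and conf: "conformal_along M g \<theta> K H"
 shows "koszul X Y Z x = 0"
proof -
 note XD = sectionD(1)[OF X] sectionD(1)[OF Y] sectionD(1)[OF Z] and at = sectionD(2)[OF X x] sectionD(2)[OF Y x] sectionD(2)[OF Z x]
 note t = field_tangent[OF XD(1) x] field_tangent[OF XD(2) x] field_tangent[OF XD(3) x]
 have l: "lie_metric M g Z X Y x = \<theta> x (Z x) * g x (X x) (Y x)" using conf X Y Z x by (simp add: conformal_along_def)
 have "bracket M X Y x \<in> H x" using inv X Y x by (simp add: involutive_def)
 then have "g x (bracket M X Y x) (Z x) = 0" by (rule orth[OF x _ at(3)])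
 moreover have "g x (bracket M Y Z x) (X x) = - g x (X x) (bracket M Z Y x)"
  using bracket_metric_swap(1)[OF XD(3,2) x t(1)] metric_sym[OF x t(1) bracket_tangent[OF XD(3,2) x] t(1)] by simp
 ultimately show ?thesis
  using l bracket_metric_swap(1)[OF XD(3,1) x t(2)] orth[OF x at(1,3)] orth[OF x at(2,3)]
  by (simp add: koszul_def lie_metric_def deriv_orth_zero[OF XD(1) Y Z x] deriv_orth_zero[OF XD(2) X Z x])
qed

text \<open>Here [X, Z] lies in \<open>K\<close>, and only (L_Y g)(X, Z) - \<theta>(Y) g(X, Z)
  remains.\<close>

lemma koszul_KH:
 assumes X: "X \<in> sections M K" and Y: "Y \<in> sections M H" and Z: "Z \<in> sections M K" and x: "x \<in> points M"
  and inv: "involutive M K" and conf: "conformal_along M g \<theta> H K"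
 shows "koszul X Y Z x = 0"
proof -
 note XD = sectionD(1)[OF X] sectionD(1)[OF Y] sectionD(1)[OF Z] and at = sectionD(2)[OF X x] sectionD(2)[OF Y x] sectionD(2)[OF Z x]
 note t = field_tangent[OF XD(1) x] field_tangent[OF XD(2) x] field_tangent[OF XD(3) x]
 have l: "lie_metric M g Y X Z x = \<theta> x (Y x) * g x (X x) (Z x)" using conf X Y Z x by (simp add: conformal_along_def)
 have "bracket M X Z x \<in> K x" using inv X Z x by (simp add: involutive_def)
 then have "g x (bracket M X Z x) (Y x) = 0" by (rule orth'[OF x _ at(2)])
 moreover have "g x (bracket M Y Z x) (X x) = g x (X x) (bracket M Y Z x)"
  by (rule metric_sym[OF x bracket_tangent[OF XD(2,3) x] t(1) t(1)])
 ultimately show ?thesis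
  using l bracket_metric_swap(1)[OF XD(2,1) x t(3)] orth'[OF x at(1,2)] orth[OF x at(2,3)]
  by (simp add: koszul_def lie_metric_def deriv_orth_zero[OF XD(1) Y Z x] deriv_orth_zero[OF XD(3) Y X x])
qed

text \<open>By \<open>orth_mem\<close> it suffices that g(D_X Y, Z) = 0 for Z in \<open>K\<close>.
  The field \<open>X\<close> is split along \<open>H\<close> and \<open>K\<close>, and the two mixed
  Koszul terms treat one component each.\<close>

lemma weyl_invariant:
 assumes fol: "conformal_foliations M g \<theta> H K"
 shows "invariant_distribution M weyl_conn H"
 unfolding invariant_distribution_def
proof (intro ballI impI)
 fix X Y x assume X: "X \<in> vector_fields M" and Y: "Y \<in> vector_fields M" and YH: "\<forall>x\<in>points M. Y x \<in> H x" and x: "x \<in> points M"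
 have YS: "Y \<in> sections M H" using Y YH by (simp add: sections_def)
 obtain X1 X2 where X12: "X1 \<in> sections M H" "X2 \<in> sections M K" "X = vf_add M X1 X2"
  using field_decomp[OF X] by blast
 note XD = sectionD(1)[OF X12(1)] sectionD(1)[OF X12(2)]
 have mem: "weyl_conn W Y x \<in> H x" if W: "W \<in> vector_fields M" and 0: "!!Z. Z \<in> sections M K ==> koszul W Y Z x = 0" for W
 proof (rule orth_mem[OF x field_tangent[OF weyl_conn_field[OF W Y] x]])
  fix w assume w: "w \<in> K x"
  obtain Z where Z: "Z \<in> sections M K" "Z x = w" using splitting.section_through[OF swap x w] by blast
  show "g x (weyl_conn W Y x) w = 0"
   using koszul_eq[OF W Y sectionD(1)[OF Z(1)] x] 0[OF Z(1)] by (simp add: weyl_conn_at[OF W Y x] Z(2))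
 qed
 have "weyl_conn X1 Y x \<in> H x"
  by (rule mem[OF XD(1)]) (use koszul_HH[OF X12(1) YS _ x] fol in \<open>simp add: conformal_foliations_def\<close>)
 moreover have "weyl_conn X2 Y x \<in> H x"
  by (rule mem[OF XD(2)]) (use koszul_KH[OF X12(2) YS _ x] fol in \<open>simp add: conformal_foliations_def\<close>)
 moreover have "weyl_conn X Y = vf_add M (weyl_conn X1 Y) (weyl_conn X2 Y)"
  using weyl_conn_linear XD Y unfolding X12(3) linear_connection_def by blast
 ultimately show "weyl_conn X Y x \<in> H x"
  using distribution_add[OF H x] x by (simp add: vf_add_def)
qed

end

context weyl_data
begin

lemma weyl_conn_funcset: "weyl_conn \<in> vector_fields M \<rightarrow> vector_fields M \<rightarrow> vector_fields M"
 using weyl_conn_field by blast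

lemma weyl_conn_recurrent: "recurrent M g \<theta> weyl_conn"
 unfolding recurrent_def using weyl_conn_metric by blast

text \<open>Three instances of the recurrence equation, with brackets expressed by torsion-freeness,
  give \<open>koszul X Y Z\<close> as 2 g(D_X Y, Z); nondegeneracy of the metric then leaves one
  choice.\<close>

lemma koszul_unique:
 assumes D: "D \<in> vector_fields M \<rightarrow> vector_fields M \<rightarrow> vector_fields M"
  and tf: "torsion_free M D"
  and met: "recurrent M g \<theta> D"
  and X: "X \<in> vector_fields M" and Y: "Y \<in> vector_fields M"
 shows "D X Y = weyl_conn X Y"
proof (rule field_eqI[OF funcset_mem[OF funcset_mem[OF D X] Y] weyl_conn_field[OF X Y]])
 fix x assume x: "x \<in> points M"
 note DD = funcset_mem[OF funcset_mem[OF D]]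
 have Dt: "D X Y x \<in> tangent_space M x" if "X \<in> vector_fields M" "Y \<in> vector_fields M" for X Y
  by (rule field_tangent[OF DD[OF that] x])
 have br: "g x (bracket M A B x) v = g x (D A B x) v - g x (D B A x) v"
  if A: "A \<in> vector_fields M" and B: "B \<in> vector_fields M" and v: "v \<in> tangent_space M x" for A B v
 proof -
  show ?thesis
   using torsion_free_add[OF tf A B x] metric_add[OF x bracket_tangent[OF A B x] Dt[OF B A] v] by simp
 qed
 have key: "koszul X Y Z x = 2 * g x (D X Y x) (Z x)" if Z: "Z \<in> vector_fields M" for Z
 proof -
  note t = field_tangent[OF X x] field_tangent[OF Y x] field_tangent[OF Z x]
  show ?thesis
   using recurrentD[OF met X Y Z x] recurrentD[OF met Y X Z x] recurrentD[OF met Z X Y x]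
    br[OF X Y t(3)] br[OF X Z t(2)] br[OF Y Z t(1)]
    metric_sym[OF x t(2) Dt[OF X Z] t(2)] metric_sym[OF x t(1) Dt[OF Y Z] t(1)] metric_sym[OF x t(1) Dt[OF Z Y] t(1)]
   by (simp add: koszul_def)
 qed
 obtain c where c: "c \<in> charts_at M x" using chart_exists[OF x] by blast
 note ca = charts_atD[OF c]
 have "D X Y x c = cov X Y x c"
 proof (rule gch_nondegenerate[OF ca(1) cimg_cmap[OF ca(2)]])
  fix w
  obtain Z where Z: "Z \<in> vector_fields M" "Z x = coord_vec M c w x"
   using field_through[OF coord_vec_tangent[OF c] x, of w] by auto
  have Zc: "Z x c = w" using Z coord_vec_self[OF c, of w] by simp
  show "gch c (cmap c x) (D X Y x c) w = gch c (cmap c x) (cov X Y x c) w"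
   using key[OF Z(1)] koszul_eq[OF X Y Z(1) x] metric_gch[OF c Dt[OF X Y] field_tangent[OF Z(1) x]]
    metric_gch[OF c cov_tangent[OF X Y x] field_tangent[OF Z(1) x]] by (simp add: Zc)
 qed
 then show "D X Y x = weyl_conn X Y x"
  unfolding weyl_conn_at[OF X Y x] using tangent_eqI[OF Dt[OF X Y] cov_tangent[OF X Y x] c] by blast
qed

end

section \<open>Change of metric within the conformal class\<close>

context manifold
begin

definition dform :: "('a => real) => 'a => ('a, 'e) tvec => real" where
 "dform f x v = ddir (%y. f (cinv (chart_at M x) y)) (cmap (chart_at M x) x) (v (chart_at M x))"

lemma deriv_along_dform: "deriv_along M X f x = dform f x (X x)"
 by (simp add: deriv_along_def dform_def Let_def o_def)

lemma dform_chart: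
 assumes f: "!!c. c \<in> atlas M ==> smooth_on (cimg c) (%y. f (cinv c y))"
  and c: "c \<in> charts_at M x" and v: "v \<in> tangent_space M x"
 shows "dform f x v = ddir (%y. f (cinv c y)) (cmap c x) (v c)"
proof -
 note ca = charts_atD[OF c]
 obtain X where X: "X \<in> vector_fields M" "X x = v" using field_through[OF v charts_at_points[OF c]] by blast
 show ?thesis
  using deriv_along_chart[OF X(1) c smooth_on_diffble[OF f[OF ca(1)] cimg_open[OF ca(1)] cimg_cmap[OF ca(2)]]]
  by (simp add: deriv_along_dform X(2))
qed

text \<open>The factor is given as a mere function, but it is the quotient of the two squared
  lengths of one basis vector.\<close>

lemma conformal_factor_smooth:
 assumes g: "riemannian_metric M g" and g': "riemannian_metric M g'"
  and f: "!!x v w. x \<in> points M ==> v \<in> tangent_space M x ==> w \<in> tangent_space M x ==> g' x v w = f x * g x v w"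
  and c: "c \<in> atlas M"
 shows "smooth_on (cimg c) (%y. f (cinv c y))"
proof -
 interpret g: riemannian M g by unfold_locales (rule g)
 interpret g': riemannian M g' by unfold_locales (rule g')
 define b where "b = (SOME b. b \<in> (Basis :: 'e set))"
 have b0: "b \<noteq> 0" unfolding b_def using some_in_eq[of "Basis :: 'e set"] nonempty_Basis nonzero_Basis by blast
 have "smooth_on (cimg c) (%y. g'.gch c y b b / g.gch c y b b)"
  by (intro smooth_on_divide g.gch_smooth g'.gch_smooth c) (use g.gch_pos[OF c _ b0] in force)
 moreover have "f (cinv c y) = g'.gch c y b b / g.gch c y b b" if y: "y \<in> cimg c" for y
  using f[OF cimg_points[OF c y] g.cv_tangent[OF c y] g.cv_tangent[OF c y]] g.gch_pos[OF c y b0]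
  by (simp add: g.gch_def g'.gch_def)
 ultimately show ?thesis using smooth_on_cong by (metis (no_types, lifting))
qed

text \<open>Passing from g to f g adds d log f to \<theta>. Preservation of the class can therefore
  be checked on a single metric.\<close>

lemma preserves_conformal_change:
 assumes g: "riemannian_metric M g" and g': "riemannian_metric M g'"
  and fac: "\<forall>x\<in>points M. f x > 0 \<and> (\<forall>v\<in>tangent_space M x. \<forall>w\<in>tangent_space M x. g' x v w = f x * g x v w)"
  and \<theta>: "one_form M \<theta>"
  and D: "D \<in> vector_fields M \<rightarrow> vector_fields M \<rightarrow> vector_fields M"
  and met: "recurrent M g \<theta> D"
 shows "\<exists>\<theta>'. one_form M \<theta>' \<and> (\<forall>X\<in>vector_fields M. \<forall>Y\<in>vector_fields M. \<forall>Z\<in>vector_fields M. \<forall>x\<in>points M.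
   deriv_along M X (%z. g' z (Y z) (Z z)) x - g' x (D X Y x) (Z x) - g' x (Y x) (D X Z x) = \<theta>' x (X x) * g' x (Y x) (Z x))"
proof (intro exI conjI ballI)
 note DD = funcset_mem[OF funcset_mem[OF D]]
 interpret g: weyl_data M g \<theta> by unfold_locales (rule g \<theta>)+
 let ?\<theta> = "%x v. \<theta> x v + dform f x v / f x"
 have fpos: "f x > 0" if "x \<in> points M" for x using fac that by blast
 have f: "g' x v w = f x * g x v w" if "x \<in> points M" "v \<in> tangent_space M x" "w \<in> tangent_space M x" for x v w
  using fac that by blast
 have fs: "smooth_on (cimg c) (%y. f (cinv c y))" if "c \<in> atlas M" for c
  by (rule conformal_factor_smooth[OF g g' _ that]) (rule f)
 show "one_form M ?\<theta>"
  unfolding one_form_def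
 proof (intro conjI ballI allI)
  fix x v w r assume x: "x \<in> points M" and v: "v \<in> tangent_space M x" and w: "w \<in> tangent_space M x"
  obtain c where c: "c \<in> charts_at M x" using chart_exists[OF x] by blast
  note ca = charts_atD[OF c]
  have l: "linear (ddir (%y. f (cinv c y)) (cmap c x))"
   using bounded_linear_ddir[OF smooth_on_diffble[OF fs[OF ca(1)] cimg_open[OF ca(1)] cimg_cmap[OF ca(2)]]]
    bounded_linear.linear by blast
  show "?\<theta> x (tadd v w) = ?\<theta> x v + ?\<theta> x w"
   using g.form_add[OF x v w] by (simp add: dform_chart[of f, OF fs c] v w tangent_add linear_add[OF l] add_divide_distrib)
  show "?\<theta> x (tscale r v) = r * ?\<theta> x v"
   using g.form_scale[OF x v] by (simp add: dform_chart[of f, OF fs c] v tangent_scale linear_scale[OF l] algebra_simps)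
 next
  fix c e assume c: "c \<in> atlas M"
  have "smooth_on (cimg c) (%y. g.th c y e + ddir (%y. f (cinv c y)) y e / f (cinv c y))"
   by (intro smooth_on_add g.th_smooth c smooth_on_divide smooth_on_ddir fs cimg_open)
    (use fpos[OF cimg_points[OF c]] in \<open>simp add: less_imp_neq[symmetric]\<close>)
  moreover have "?\<theta> (cinv c y) (coord_vec M c e (cinv c y)) = g.th c y e + ddir (%y. f (cinv c y)) y e / f (cinv c y)"
   if y: "y \<in> cimg c" for y
   using dform_chart[of f, OF fs cimg_charts_at[OF c y] g.cv_tangent[OF c y], of e] cimg_cinv[OF y]
   by (simp add: g.th_def coord_vec_self[OF cimg_charts_at[OF c y]])
  ultimately show "smooth_on (cmap c ` cdom c) (%y. ?\<theta> (cinv c y) (coord_vec M c e (cinv c y)))"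
   unfolding cimg_def using smooth_on_cong by (metis (no_types, lifting))
 qed
 fix X Y Z x assume X: "X \<in> vector_fields M" and Y: "Y \<in> vector_fields M" and Z: "Z \<in> vector_fields M" and x: "x \<in> points M"
 note t = field_tangent[OF X x] field_tangent[OF Y x] field_tangent[OF Z x] field_tangent[OF DD[OF X Y] x] field_tangent[OF DD[OF X Z] x]
 obtain c where c: "c \<in> charts_at M x" using chart_exists[OF x] by blast
 note ca = charts_atD[OF c] and S = cimg_open[OF charts_atD(1)[OF c]] cimg_cmap[OF charts_atD(2)[OF c]]
 have fd: "(%y. f (cinv c y)) differentiable (at (cmap c x))" by (rule smooth_on_diffble[OF fs[OF ca(1)] S])
 have gs: "smooth_on (cimg c) (%y. g (cinv c y) (Y (cinv c y)) (Z (cinv c y)))"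
  by (rule g.metric_fields_smooth[OF Y Z ca(1)])
 have gd: "(%y. g (cinv c y) (Y (cinv c y)) (Z (cinv c y))) differentiable (at (cmap c x))"
  by (rule smooth_on_diffble[OF gs S])
 have eq: "g' (cinv c y) (Y (cinv c y)) (Z (cinv c y)) = f (cinv c y) * g (cinv c y) (Y (cinv c y)) (Z (cinv c y))" if "y \<in> cimg c" for y
  using f[OF cimg_points[OF ca(1) that] field_tangent[OF Y] field_tangent[OF Z]] cimg_points[OF ca(1) that] by blast
 have gd': "(%y. g' (cinv c y) (Y (cinv c y)) (Z (cinv c y))) differentiable (at (cmap c x))"
  by (rule smooth_on_diffble[OF smooth_on_cong[OF eq, THEN iffD2] S])
   (assumption, rule smooth_on_mult[OF fs[OF ca(1)] gs])
 have "deriv_along M X (%z. g' z (Y z) (Z z)) x = ddir (%y. f (cinv c y) * g (cinv c y) (Y (cinv c y)) (Z (cinv c y))) (cmap c x) (X x c)"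
  unfolding deriv_along_chart[OF X c gd'] by (rule ddir_cong[OF S eq])
 also have "\<dots> = f x * deriv_along M X (%z. g z (Y z) (Z z)) x + dform f x (X x) * g x (Y x) (Z x)"
  unfolding ddir_bilinear[OF bounded_bilinear_mult fd gd] deriv_along_chart[OF X c gd]
  using dform_chart[of f, OF fs c t(1)] ca by simp
 finally have d: "deriv_along M X (%z. g' z (Y z) (Z z)) x = f x * deriv_along M X (%z. g z (Y z) (Z z)) x + dform f x (X x) * g x (Y x) (Z x)" .
 have "f x * (deriv_along M X (%z. g z (Y z) (Z z)) x - g x (D X Y x) (Z x) - g x (Y x) (D X Z x)) = f x * (\<theta> x (X x) * g x (Y x) (Z x))"
  by (simp only: recurrentD[OF met X Y Z x])
 then show "deriv_along M X (%z. g' z (Y z) (Z z)) x - g' x (D X Y x) (Z x) - g' x (Y x) (D X Z x) = ?\<theta> x (X x) * g' x (Y x) (Z x)"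
  using fpos[OF x] by (simp add: d f[OF x t(4,3)] f[OF x t(2,5)] f[OF x t(2,3)] algebra_simps)
qed

lemma orthogonal_splittingD:
 assumes C: "C \<in> conformal_structures M" and S: "orthogonal_splitting M C (H, K)" and g: "g \<in> C"
 shows "orth_splitting M H K g"
proof
 show "riemannian_metric M g" by (rule conformal_class_metric[OF C g])
qed (use S g in \<open>auto simp: orthogonal_splitting_def\<close>)

lemma orthogonal_splittingI:
 assumes C: "C \<in> conformal_structures M" and ext: "H \<in> extensional (points M)" "K \<in> extensional (points M)"
  and g: "g \<in> C" and o: "orth_splitting M H K g"
 shows "orthogonal_splitting M C (H, K)"
proof -
 interpret orth_splitting M H K g by (rule o)
 have "g' x v w = 0" if g': "g' \<in> C" and x: "x \<in> points M" and v: "v \<in> H x" and w: "w \<in> K x" for g' x v w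
 proof -
  obtain f where "\<forall>x\<in>points M. f x > 0 \<and> (\<forall>v\<in>tangent_space M x. \<forall>w\<in>tangent_space M x. g' x v w = f x * g x v w)"
   using conformal_class_factor[OF C g g'] .
  then show ?thesis using H_tangent[OF x v] K_tangent[OF x w] x orth[OF x v w] by simp
 qed
 then show ?thesis
  unfolding orthogonal_splitting_def using H K sum inter H_nonzero K_nonzero by simp
qed

theorem conformal_foliations_weyl:
 assumes C: "C \<in> conformal_structures M" and S: "orthogonal_splitting M C (H, K)" and g: "g \<in> C"
  and fol: "conformal_foliations M g \<theta> H K"
 shows "\<exists>D. weyl_structure M C D \<and> reduction M C D (H, K)"
proof -
 interpret s: orth_splitting M H K g by (rule orthogonal_splittingD[OF C S g])
 interpret w: weyl_splitting M H K g \<theta> by unfold_locales (use fol in \<open>simp add: conformal_foliations_def\<close>)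
 interpret s': orth_splitting M K H g by (rule s.orth_swap)
 interpret w': weyl_splitting M K H g \<theta> ..
 have pc: "preserves_conformal M C w.weyl_conn"
  unfolding preserves_conformal_def
 proof
  fix g' assume g': "g' \<in> C"
  obtain f where f: "\<forall>x\<in>points M. f x > 0 \<and> (\<forall>v\<in>tangent_space M x. \<forall>w\<in>tangent_space M x. g' x v w = f x * g x v w)"
   using conformal_class_factor[OF C g g'] .
  show "\<exists>\<theta>'. one_form M \<theta>' \<and> (\<forall>X\<in>vector_fields M. \<forall>Y\<in>vector_fields M. \<forall>Z\<in>vector_fields M. \<forall>x\<in>points M.
   deriv_along M X (%z. g' z (Y z) (Z z)) x - g' x (w.weyl_conn X Y x) (Z x) - g' x (Y x) (w.weyl_conn X Z x) = \<theta>' x (X x) * g' x (Y x) (Z x))"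
   by (rule preserves_conformal_change[OF s.metric conformal_class_metric[OF C g'] f w.form w.weyl_conn_funcset w.weyl_conn_recurrent])
 qed
 have fol': "conformal_foliations M g \<theta> K H" using fol by (simp add: conformal_foliations_def)
 show ?thesis
  using pc w.weyl_conn_linear w.weyl_conn_torsion_free w.weyl_invariant[OF fol] w'.weyl_invariant[OF fol'] S
  by (intro exI[of _ w.weyl_conn]) (simp add: weyl_structure_def reduction_def)
qed

lemma weyl_structureD:
 assumes "weyl_structure M C D" "g \<in> C"
 obtains \<theta> where "one_form M \<theta>" "torsion_free M D"
  "D \<in> vector_fields M \<rightarrow> vector_fields M \<rightarrow> vector_fields M"
  "recurrent M g \<theta> D"
proof -
 obtain \<theta> where \<theta>: "one_form M \<theta>" "recurrent M g \<theta> D"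
  using assms unfolding weyl_structure_def preserves_conformal_def recurrent_def by blast
 have "D \<in> vector_fields M \<rightarrow>\<^sub>E vector_fields M \<rightarrow>\<^sub>E vector_fields M"
  using assms unfolding weyl_structure_def linear_connection_def by blast
 then have "D \<in> vector_fields M \<rightarrow> vector_fields M \<rightarrow> vector_fields M" by (auto simp: PiE_iff)
 then show thesis using that \<theta> assms(1) unfolding weyl_structure_def by blast
qed

end

section \<open>From Weyl structures to conformal foliations, and uniqueness\<close>

context orth_splitting
begin

text \<open>As [X, Y] = D_X Y - D_Y X, invariance of \<open>H\<close> gives involutivity. For Z in
  \<open>H\<close> and X in \<open>K\<close>, the part D_X Z of [Z, X] lies in \<open>H\<close>,
  orthogonal to \<open>K\<close>; therefore L_Z g and D_Z g agree on \<open>K\<close>.\<close>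

lemma weyl_conformal_along:
 assumes tf: "torsion_free M D"
  and D: "D \<in> vector_fields M \<rightarrow> vector_fields M \<rightarrow> vector_fields M"
  and met: "recurrent M g \<theta> D"
  and inv: "invariant_distribution M D H"
 shows "involutive M H" "conformal_along M g \<theta> H K"
proof -
 note add = torsion_free_add[OF tf] and DD = funcset_mem[OF funcset_mem[OF D]]
 have DH: "D X Y x \<in> H x" if "X \<in> vector_fields M" "Y \<in> sections M H" "x \<in> points M" for X Y x
  using inv that unfolding invariant_distribution_def sections_def by blast
 show "involutive M H" unfolding involutive_def
 proof (intro ballI)
  fix X Y x assume X: "X \<in> sections M H" and Y: "Y \<in> sections M H" and x: "x \<in> points M"
  have "bracket M X Y x = tadd (D X Y x) (tscale (-1) (D Y X x))"
   using add[OF sectionD(1)[OF X] sectionD(1)[OF Y] x] by (auto simp: fun_eq_iff algebra_simps)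
  then show "bracket M X Y x \<in> H x"
   using distribution_add[OF H x DH[OF sectionD(1)[OF X] Y x] distribution_scale[OF H x DH[OF sectionD(1)[OF Y] X x], of "-1"]] by simp
 qed
 show "conformal_along M g \<theta> H K" unfolding conformal_along_def
 proof (intro ballI)
  fix Z X Y x assume Z: "Z \<in> sections M H" and X: "X \<in> sections M K" and Y: "Y \<in> sections M K" and x: "x \<in> points M"
  note ZD = sectionD(1)[OF Z] and XD = sectionD(1)[OF X] and YD = sectionD(1)[OF Y]
  note t = field_tangent[OF XD x] field_tangent[OF YD x]
  have b: "g x (bracket M Z A x) v = g x (D Z A x) v" if A: "A \<in> vector_fields M" and v: "v \<in> K x" for A v
  proof -
   have "g x (D A Z x) v = 0" by (rule orth[OF x DH[OF A Z x] v])
   then show ?thesis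
    using metric_add[OF x bracket_tangent[OF ZD A x] field_tangent[OF DD[OF A ZD] x] K_tangent[OF x v]] add[OF ZD A x] by simp
  qed
  have "g x (X x) (bracket M Z Y x) = g x (X x) (D Z Y x)"
   using b[OF YD sectionD(2)[OF X x]] metric_sym[OF x t(1) bracket_tangent[OF ZD YD x] t(1)]
    metric_sym[OF x t(1) field_tangent[OF DD[OF ZD YD] x] t(1)] by simp
  then show "lie_metric M g Z X Y x = \<theta> x (Z x) * g x (X x) (Y x)"
   using b[OF XD sectionD(2)[OF Y x]] recurrentD[OF met ZD XD YD x] by (simp add: lie_metric_def)
 qed
qed

text \<open>Take a section \<open>X\<close> of \<open>K\<close> that is nonzero at \<open>x\<close>:
  the two equations for L_Z g differ by a multiple of g(X, X), which is positive there.\<close>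

lemma conformal_along_unique:
 assumes "one_form M \<theta>" "one_form M \<theta>'" and c: "conformal_along M g \<theta> H K" and c': "conformal_along M g \<theta>' H K"
  and x: "x \<in> points M" and v: "v \<in> H x"
 shows "\<theta> x v = \<theta>' x v"
proof -
 obtain Z where Z: "Z \<in> sections M H" "Z x = v" using section_through[OF x v] by blast
 obtain X where X: "X \<in> sections M K" "X x \<noteq> tzero" using splitting.nonzero_section[OF swap x] by blast
 have t: "X x \<in> tangent_space M x" by (rule field_tangent[OF sectionD(1)[OF X(1)] x])
 have "\<theta> x v * g x (X x) (X x) = \<theta>' x v * g x (X x) (X x)"
  using c c' Z X x unfolding conformal_along_def by metis
 then show ?thesis using metric_pos[OF x t t t X(2)] by simp
qed

end

context manifold
begin

theorem weyl_conformal_foliations: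
 assumes C: "C \<in> conformal_structures M" and g: "g \<in> C" and D: "weyl_structure M C D" and S: "reduction M C D (H, K)"
 shows "\<exists>\<theta>. conformal_foliations M g \<theta> H K"
proof -
 have os: "orthogonal_splitting M C (H, K)" and inv: "invariant_distribution M D H" "invariant_distribution M D K"
  using S by (auto simp: reduction_def)
 interpret s: orth_splitting M H K g by (rule orthogonal_splittingD[OF C os g])
 interpret s': orth_splitting M K H g by (rule s.orth_swap)
 obtain \<theta> where \<theta>: "one_form M \<theta>" and d: "torsion_free M D"
  "D \<in> vector_fields M \<rightarrow> vector_fields M \<rightarrow> vector_fields M"
  "recurrent M g \<theta> D"
  using weyl_structureD[OF D g] .
 show ?thesis
  using \<theta> s.weyl_conformal_along[OF d inv(1)] s'.weyl_conformal_along[OF d inv(2)]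
  unfolding conformal_foliations_def by blast
qed

text \<open>Invariance of \<open>H\<close> fixes the one-form on \<open>H\<close>, invariance of
  \<open>K\<close> fixes it on \<open>K\<close>, so both connections have the same one-form and the
  Koszul formula identifies their values; extensionality then gives equality of functions.\<close>

theorem weyl_unique:
 assumes C: "C \<in> conformal_structures M" and D: "weyl_structure M C D" "reduction M C D (H, K)"
  and D': "weyl_structure M C D'" "reduction M C D' (H, K)"
 shows "D = D'"
proof -
 obtain g where g: "g \<in> C" using conformal_class_nonempty[OF C] by blast
 have os: "orthogonal_splitting M C (H, K)" and inv: "invariant_distribution M D H" "invariant_distribution M D K"
  and inv': "invariant_distribution M D' H" "invariant_distribution M D' K"
  using D D' by (auto simp: reduction_def)
 interpret s: orth_splitting M H K g by (rule orthogonal_splittingD[OF C os g])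
 interpret s': orth_splitting M K H g by (rule s.orth_swap)
 obtain \<theta> where \<theta>: "one_form M \<theta>" and d: "torsion_free M D"
  "D \<in> vector_fields M \<rightarrow> vector_fields M \<rightarrow> vector_fields M"
  "recurrent M g \<theta> D"
  using weyl_structureD[OF D(1) g] .
 obtain \<theta>' where \<theta>': "one_form M \<theta>'" and d': "torsion_free M D'"
  "D' \<in> vector_fields M \<rightarrow> vector_fields M \<rightarrow> vector_fields M"
  "recurrent M g \<theta>' D'"
  using weyl_structureD[OF D'(1) g] .
 interpret w: weyl_data M g \<theta> by unfold_locales (rule \<theta>)
 interpret w': weyl_data M g \<theta>' by unfold_locales (rule \<theta>')
 have eq: "\<theta>' x v = \<theta> x v" if x: "x \<in> points M" and v: "v \<in> tangent_space M x" for x v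
 proof -
  obtain a b where ab: "v = tadd a b" "a \<in> H x" "b \<in> K x" using v unfolding s.sum[OF x] by blast
  have "\<theta> x a = \<theta>' x a"
   by (rule s.conformal_along_unique[OF \<theta> \<theta>' s.weyl_conformal_along(2)[OF d inv(1)] s.weyl_conformal_along(2)[OF d' inv'(1)] x ab(2)])
  moreover have "\<theta> x b = \<theta>' x b"
   by (rule s'.conformal_along_unique[OF \<theta> \<theta>' s'.weyl_conformal_along(2)[OF d inv(2)] s'.weyl_conformal_along(2)[OF d' inv'(2)] x ab(3)])
  ultimately show ?thesis
   using w.form_add[OF x s.H_tangent[OF x ab(2)] s.K_tangent[OF x ab(3)]]
    w'.form_add[OF x s.H_tangent[OF x ab(2)] s.K_tangent[OF x ab(3)]] ab(1) by simp
 qed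
 have rec: "recurrent M g \<theta> D'"
  using d'(3) unfolding recurrent_def by (simp add: eq field_tangent)
 have DX: "D X Y = D' X Y" if X: "X \<in> vector_fields M" and Y: "Y \<in> vector_fields M" for X Y
 proof -
  have "D' X Y = w.weyl_conn X Y"
   by (rule w.koszul_unique[OF d'(2,1) rec X Y])
  then show ?thesis using w.koszul_unique[OF d(2,1,3) X Y] by simp
 qed
 have DE: "D \<in> vector_fields M \<rightarrow>\<^sub>E vector_fields M \<rightarrow>\<^sub>E vector_fields M" "D' \<in> vector_fields M \<rightarrow>\<^sub>E vector_fields M \<rightarrow>\<^sub>E vector_fields M"
  using D(1) D'(1) unfolding weyl_structure_def linear_connection_def by blast+
 show ?thesis
 proof (rule PiE_ext[OF DE])
  fix X assume X: "X \<in> vector_fields M"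
  show "D X = D' X"
   by (rule PiE_ext[OF PiE_mem[OF DE(1) X] PiE_mem[OF DE(2) X]]) (rule DX[OF X])
 qed
qed

end

section \<open>From local products to conformal foliations\<close>

text \<open>Half of a product chart on the domain \<open>V\<close> of the chart \<open>c\<close>: \<open>f\<close> and \<open>h\<close> are the coordinate maps to the two
 factors, \<open>H\<close> is tangent to the first factor, \<open>E\<close> is its model space, and \<open>B\<close> is its metric pulled
 back by \<open>f\<close>.\<close>

locale half_product_chart = riemannian M g for M :: "('a, 'e::euclidean_space) mfd" and g +
 fixes c V H E and B :: "'e => 'e => 'e => real" and f h :: "'e => 'e"
 assumes c: "c \<in> atlas M" and V: "open V" and V_cimg: "V \<subseteq> cimg c" and E: "subspace E" and dim_E: "dim E \<ge> 1"
  and f: "smooth_on V f" and h: "smooth_on V h" and f_E: "!!y u. y \<in> V ==> ddir f y u \<in> E"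
  and inj: "!!y u. y \<in> V ==> ddir f y u = 0 ==> ddir h y u = 0 ==> u = 0"
  and lift: "!!e. e \<in> E ==> \<exists>s. smooth_on V s \<and> (\<forall>y\<in>V. ddir f y (s y) = e \<and> ddir h y (s y) = 0)"
  and H_eq: "!!y. y \<in> V ==> H (cinv c y) = {v \<in> tangent_space M (cinv c y). ddir h y (v c) = 0}"
  and B: "!!a b. smooth_on V (%y. B y a b)"
  and B_linear1: "!!y a. y \<in> V ==> linear (%b. B y b a)" and B_linear2: "!!y a. y \<in> V ==> linear (B y a)"
  and B_const: "!!y v a b. y \<in> V ==> ddir f y v = 0 ==> ddir (%y. B y a b) y v = 0"
  and B_metric: "!!y. y \<in> V ==> \<exists>m>0. \<forall>u\<in>H (cinv c y). \<forall>w\<in>H (cinv c y).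
   g (cinv c y) u w = m * B y (ddir f y (u c)) (ddir f y (w c))"
begin

lemma lin_f: "y \<in> V ==> linear (ddir f y)" and lin_h: "y \<in> V ==> linear (ddir h y)"
 using bounded_linear_ddir[OF smooth_on_diffble[OF f V]] bounded_linear_ddir[OF smooth_on_diffble[OF h V]]
  bounded_linear.linear by blast+

lemma at: "y \<in> V ==> c \<in> charts_at M (cinv c y)" "y \<in> V ==> cinv c y \<in> points M" "y \<in> V ==> cmap c (cinv c y) = y"
 using V_cimg cimg_charts_at[OF c] cimg_points[OF c] cimg_cinv(2) by blast+

lemma H_component: "y \<in> V ==> (%v. v c) ` H (cinv c y) = {u. ddir h y u = 0}"
proof -
 assume y: "y \<in> V"
 have "u \<in> (%v. v c) ` H (cinv c y)" if "ddir h y u = 0" for u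
 proof (rule image_eqI[where x = "coord_vec M c u (cinv c y)"])
  show uc: "u = coord_vec M c u (cinv c y) c" using coord_vec_self[OF at(1)[OF y]] by simp
  show "coord_vec M c u (cinv c y) \<in> H (cinv c y)"
   using coord_vec_tangent[OF at(1)[OF y]] that uc[symmetric] by (simp add: H_eq[OF y])
 qed
 then show ?thesis by (auto simp: H_eq[OF y])
qed

text \<open>Lifts of a basis of \<open>E\<close>. They are independent since \<open>ddir f y\<close>
  maps them to that basis, and they span since a vector is determined by its images under the
  derivatives of \<open>f\<close> and \<open>h\<close>.\<close>

lemma frame:
 obtains k and e :: "nat => 'e => 'e" where "!!i. i < k ==> smooth_on V (e i)"
  "!!y. y \<in> V ==> inj_on (%i. e i y) {..<k}" "!!y. y \<in> V ==> independent ((%i. e i y) ` {..<k})"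
  "!!y. y \<in> V ==> (%v. v c) ` H (cinv c y) = span ((%i. e i y) ` {..<k})"
proof -
 obtain b0 where b0: "b0 \<subseteq> E" "independent b0" "span b0 = E"
  using orthonormal_basis_subspace[OF E] by metis
 obtain b :: "nat => 'e" where b: "bij_betw b {..<card b0} b0"
  using ex_bij_betw_nat_finite[OF independent_imp_finite[OF b0(2)]] by (auto simp: lessThan_atLeast0)
 let ?k = "card b0"
 have bE: "b i \<in> E" if "i < ?k" for i using bij_betwE[OF b] b0 that by auto
 have "\<exists>e. \<forall>i<?k. smooth_on V (e i) \<and> (\<forall>y\<in>V. ddir f y (e i y) = b i \<and> ddir h y (e i y) = 0)"
  using lift[OF bE] by metis
 then obtain e where e: "!!i. i < ?k ==> smooth_on V (e i)"
  and ef: "!!i y. i < ?k ==> y \<in> V ==> ddir f y (e i y) = b i"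
  and eh: "!!i y. i < ?k ==> y \<in> V ==> ddir h y (e i y) = 0" by metis
 show thesis
 proof (rule that[of ?k e, OF e])
  fix y assume y: "y \<in> V"
  have im: "ddir f y ` ((%i. e i y) ` {..<?k}) = b0"
   using b ef[OF _ y] by (auto simp: bij_betw_def image_image)
  show injf: "inj_on (%i. e i y) {..<?k}"
  proof (rule inj_onI)
   fix i j assume "i \<in> {..<?k}" "j \<in> {..<?k}" "e i y = e j y"
   then show "i = j" using ef[of i y] ef[of j y] y bij_betw_imp_inj_on[OF b] by (auto simp: inj_on_def)
  qed
  show "independent ((%i. e i y) ` {..<?k})" (is "independent ?S")
  proof (rule card_le_dim_spanning[where V = "span ?S"])
   have "card ?S = dim (ddir f y ` ?S)" using injf b0(2) by (simp add: im card_image dim_eq_card_independent)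
   also have "\<dots> \<le> dim ?S" by (rule dim_image_le[OF lin_f[OF y]])
   finally show "card ?S \<le> dim (span ?S)" by simp
  qed (auto intro: span_base)
  show "(%v. v c) ` H (cinv c y) = span ((%i. e i y) ` {..<?k})"
  proof
   have "subspace {u. ddir h y u = 0}" by (rule linear_subspace_kernel[OF lin_h[OF y]])
   then show "span ((%i. e i y) ` {..<?k}) \<subseteq> (%v. v c) ` H (cinv c y)"
    unfolding H_component[OF y] by (intro span_minimal) (auto simp: eh y)
   show "(%v. v c) ` H (cinv c y) \<subseteq> span ((%i. e i y) ` {..<?k})"
    unfolding H_component[OF y]
   proof
    fix u assume "u \<in> {u. ddir h y u = 0}"
    then have u: "ddir h y u = 0" by simp
    have "ddir f y u \<in> ddir f y ` span ((%i. e i y) ` {..<?k})"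
     using f_E[OF y, of u] linear_span_image[OF lin_f[OF y], of "(%i. e i y) ` {..<?k}"] im b0(3) by simp
    then obtain w where w: "w \<in> span ((%i. e i y) ` {..<?k})" "ddir f y w = ddir f y u" by auto
    have hw: "w \<in> {u. ddir h y u = 0}"
    proof (rule subsetD[OF span_minimal w(1)])
     show "(%i. e i y) ` {..<?k} \<subseteq> {u. ddir h y u = 0}" using eh[OF _ y] by blast
    qed fact
    have "ddir f y (u - w) = 0" using w(2) by (simp add: linear_diff[OF lin_f[OF y]])
    moreover have "ddir h y (u - w) = 0" using u hw by (simp add: linear_diff[OF lin_h[OF y]])
    ultimately have "u - w = 0" by (rule inj[OF y])
    then show "u \<in> span ((%i. e i y) ` {..<?k})" using w(1) by simp
   qed
  qed
 qed
qed

lemma nonzero: "y \<in> V ==> H (cinv c y) \<noteq> {tzero}"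
proof
 assume y: "y \<in> V" and "H (cinv c y) = {tzero}"
 then have 0: "{u. ddir h y u = 0} = {0}" using H_component[OF y] by simp
 obtain e where "e \<in> E" "e \<noteq> 0" using dim_E dim_eq_0[of E] by (metis not_one_le_zero singletonI subsetI)
 then obtain s where s: "ddir f y (s y) = e" "ddir h y (s y) = 0" using lift y by blast
 then have "s y = 0" using 0 by blast
 then show False using s(1) \<open>e \<noteq> 0\<close> linear_0[OF lin_f[OF y]] by simp
qed

lemma H_section:
 "X \<in> sections M H ==> y \<in> V ==> ddir h y (X (cinv c y) c) = 0"
 using sectionD(2)[OF _ at(2)] H_eq by blast

text \<open>Differentiating \<open>dp(X) = 0\<close> in the direction \<open>W\<close>; the second derivative of \<open>p\<close> is symmetric.\<close>

lemma ddir_apply_field: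
 assumes p: "smooth_on V p" and X: "X \<in> vector_fields M" and y: "y \<in> V"
 shows "ddir (%z. ddir p z (X (cinv c z) c)) y w =
  ddir (%z. ddir p z (X (cinv c y) c)) y w + ddir p y (ddir (%z. X (cinv c z) c) y w)"
proof (rule ddir_apply[where S = V and F = "ddir p"])
 show "(%z. ddir p z v) differentiable (at y)" for v
  by (rule smooth_on_diffble[OF smooth_on_ddir[OF p V] V y])
 show "(%z. X (cinv c z) c) differentiable (at y)"
  using field_diff[OF X at(1)[OF y]] at(3)[OF y] by simp
 show "linear (ddir p z)" if "z \<in> V" for z
  using bounded_linear_ddir[OF smooth_on_diffble[OF p V that]] bounded_linear.linear by blast
qed (use V y in auto)

text \<open>The second derivatives of \<open>p\<close> cancel. With \<open>p = h\<close> this yields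
  involutivity, with \<open>p = f\<close> the behaviour of brackets under projection to the
  factor.\<close>

lemma ddir_bracket:
 fixes p :: "'e => 'e"
 assumes p: "smooth_on V p" and X: "X \<in> vector_fields M" and Y: "Y \<in> vector_fields M" and y: "y \<in> V"
 shows "ddir p y (bracket M X Y (cinv c y) c) =
  ddir (%z. ddir p z (Y (cinv c z) c)) y (X (cinv c y) c) - ddir (%z. ddir p z (X (cinv c z) c)) y (Y (cinv c y) c)"
proof -
 have l: "linear (ddir p y)"
  using bounded_linear_ddir[OF smooth_on_diffble[OF p V y]] bounded_linear.linear by blast
 show ?thesis
  unfolding ddir_apply_field[OF p X y] ddir_apply_field[OF p Y y] bracket_component[OF at(1)[OF y]] at(3)[OF y] linear_diff[OF l]
  using ddir_commute[OF p V y, of "X (cinv c y) c" "Y (cinv c y) c"] by simp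
qed

lemma ddir_zero_on: "(!!z. z \<in> V ==> F z = (0::'e)) ==> y \<in> V ==> ddir F y w = 0"
 using ddir_cong[OF V, of y F "%z. 0" w] by (simp add: ddir_const)

lemma bracket_H:
 assumes X: "X \<in> sections M H" and Y: "Y \<in> sections M H" and y: "y \<in> V"
 shows "bracket M X Y (cinv c y) \<in> H (cinv c y)"
proof -
 have "ddir h y (bracket M X Y (cinv c y) c) = 0"
  unfolding ddir_bracket[OF h sectionD(1)[OF X] sectionD(1)[OF Y] y]
  using ddir_zero_on[OF H_section[OF Y] y] ddir_zero_on[OF H_section[OF X] y] by simp
 then show ?thesis
  using bracket_tangent[OF sectionD(1)[OF X] sectionD(1)[OF Y] at(2)[OF y]] by (simp add: H_eq[OF y])
qed

text \<open>The conformal factor of \<open>g\<close> on \<open>H\<close> relative to the metric of the factor is a quotient of smooth functions.\<close>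

lemma conformal_factor:
 obtains m where "smooth_on V m" "!!y. y \<in> V ==> m y > 0"
  "!!y u w. y \<in> V ==> u \<in> H (cinv c y) ==> w \<in> H (cinv c y) ==>
   g (cinv c y) u w = m y * B y (ddir f y (u c)) (ddir f y (w c))"
proof -
 obtain m where m: "!!y. y \<in> V ==> m y > (0::real)"
  "!!y u w. y \<in> V ==> u \<in> H (cinv c y) ==> w \<in> H (cinv c y) ==>
   g (cinv c y) u w = m y * B y (ddir f y (u c)) (ddir f y (w c))"
  using B_metric by metis
 obtain e where e: "e \<in> E" "e \<noteq> 0" using dim_E dim_eq_0[of E] by (metis not_one_le_zero singletonI subsetI)
 obtain s where s: "smooth_on V s" "!!y. y \<in> V ==> ddir f y (s y) = e" "!!y. y \<in> V ==> ddir h y (s y) = 0"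
  using lift[OF e(1)] by blast
 have ms: "gch c y (s y) (s y) = m y * B y e e" "gch c y (s y) (s y) > 0" if y: "y \<in> V" for y
 proof -
  let ?v = "coord_vec M c (s y) (cinv c y)"
  have yc: "y \<in> cimg c" using y V_cimg by blast
  have v: "?v \<in> tangent_space M (cinv c y)" by (rule cv_tangent[OF c yc])
  have vc: "?v c = s y" using coord_vec_self[OF at(1)[OF y]] by simp
  then have "?v \<in> H (cinv c y)" using v s(3)[OF y] by (simp add: H_eq[OF y])
  then show "gch c y (s y) (s y) = m y * B y e e" using m(2)[OF y] vc s(2)[OF y] by (simp add: gch_def)
  have "s y \<noteq> 0" using s(2)[OF y] e(2) linear_0[OF lin_f[OF y]] by auto
  then show "gch c y (s y) (s y) > 0" by (rule gch_pos[OF c yc])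
 qed
 have "smooth_on V (%y. gch c y (s y) (s y) / B y e e)"
 proof (intro smooth_on_divide smooth_on_gch c V_cimg s B)
  show "B y e e \<noteq> 0" if "y \<in> V" for y using ms[OF that] by auto
 qed
 moreover have "m y = gch c y (s y) (s y) / B y e e" if "y \<in> V" for y
 proof -
  have "B y e e \<noteq> 0" using ms[OF that] by auto
  then show ?thesis using ms(1)[OF that] by simp
 qed
 ultimately have "smooth_on V m" using smooth_on_cong by (metis (no_types, lifting))
 then show thesis using that m by blast
qed

end

lemma ddir_zero: "ddir F y 0 = 0"
 by (simp add: ddir_def)

text \<open>The second half exchanges \<open>f\<close> and \<open>h\<close>, so that each
  distribution is the kernel of the coordinate map to the other factor.\<close>

locale product_chart = half_product_chart M g c V H E B f h + K: half_product_chart M g c V K F A h f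
 for M :: "('a, 'e::euclidean_space) mfd" and g c V H K E B F A f h +
 assumes orth_V: "!!y v w. y \<in> V ==> v \<in> H (cinv c y) ==> w \<in> K (cinv c y) ==> g (cinv c y) v w = 0"
begin

text \<open>Lift the \<open>f\<close>-component of \<open>v\<close> to \<open>H\<close>; the
  difference is killed by the derivative of \<open>f\<close> and thus lies in
  \<open>K\<close>.\<close>

lemma decomp:
 assumes y: "y \<in> V" and v: "v \<in> tangent_space M (cinv c y)"
 obtains u w where "u \<in> H (cinv c y)" "w \<in> K (cinv c y)" "v = tadd u w"
proof -
 obtain s where s: "ddir f y (s y) = ddir f y (v c)" "ddir h y (s y) = 0"
  using lift[OF f_E[OF y, of "v c"]] y by metis
 let ?u = "coord_vec M c (s y) (cinv c y)"
 have u: "?u \<in> tangent_space M (cinv c y)" by (rule coord_vec_tangent[OF at(1)[OF y]]) simp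
 have uc: "?u c = s y" using coord_vec_self[OF at(1)[OF y]] by simp
 let ?w = "tadd v (tscale (-1) ?u)"
 have w: "?w \<in> tangent_space M (cinv c y)" by (intro tangent_add tangent_scale v u)
 show thesis
 proof (rule that[of ?u ?w])
  show "?u \<in> H (cinv c y)" using u uc s by (simp add: H_eq[OF y])
  show "?w \<in> K (cinv c y)" using w uc s by (simp add: K.H_eq[OF y] linear_diff[OF lin_f[OF y]])
  show "v = tadd ?u ?w" by simp
 qed
qed

lemma inter_V: assumes y: "y \<in> V" shows "H (cinv c y) \<inter> K (cinv c y) = {tzero}"
proof -
 have "v = tzero" if "v \<in> H (cinv c y)" "v \<in> K (cinv c y)" for v
 proof -
  have v: "v \<in> tangent_space M (cinv c y)" "v c = 0" using that inj[OF y] by (auto simp: H_eq[OF y] K.H_eq[OF y])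
  show ?thesis by (rule tangent_eqI[OF v(1) tangent_zero at(1)[OF y]]) (simp add: v)
 qed
 moreover have "tzero \<in> H (cinv c y) \<inter> K (cinv c y)"
  using tangent_zero linear_0[OF lin_f[OF y]] linear_0[OF lin_h[OF y]] by (simp add: H_eq[OF y] K.H_eq[OF y])
 ultimately show ?thesis by blast
qed

text \<open>On \<open>H\<close> the metric is \<open>m\<close> times the pull-back of
  \<open>B\<close>. Along Z in \<open>K\<close> the coefficients of \<open>B\<close> are constant,
  and the \<open>f\<close>-image of [Z, X] is the derivative along Z of the \<open>f\<close>-image
  of X. Hence the bracket terms cancel the derivatives of the arguments of \<open>B\<close>, and
  only the derivative of \<open>m\<close> survives.\<close>

lemma lie_metric_ratio:
 assumes m: "smooth_on V m" "!!y. y \<in> V ==> m y > 0"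
  and mg: "!!y u w. y \<in> V ==> u \<in> H (cinv c y) ==> w \<in> H (cinv c y) ==>
   g (cinv c y) u w = m y * B y (ddir f y (u c)) (ddir f y (w c))"
  and Z: "Z \<in> sections M K" and X: "X \<in> sections M H" and Y: "Y \<in> sections M H" and y: "y \<in> V"
 shows "lie_metric M g Z X Y (cinv c y) =
  ddir m y (Z (cinv c y) c) / m y * g (cinv c y) (X (cinv c y)) (Y (cinv c y))"
proof -
 note ZD = sectionD(1)[OF Z] and XD = sectionD(1)[OF X] and YD = sectionD(1)[OF Y]
 let ?x = "cinv c y" and ?z = "Z (cinv c y) c"
 note x = at(2)[OF y] and ch = at(1)[OF y] and S = V y
 define \<xi> where "\<xi> z = ddir f z (X (cinv c z) c)" for z
 define \<eta> where "\<eta> z = ddir f z (Y (cinv c z) c)" for z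
 have \<xi>: "smooth_on V \<xi>" and \<eta>: "smooth_on V \<eta>" unfolding \<xi>_def \<eta>_def
  by (intro smooth_on_ddir_apply[OF f V smooth_on_ident _ smooth_on_subset[OF field_smooth[OF XD c] V_cimg]]
    smooth_on_ddir_apply[OF f V smooth_on_ident _ smooth_on_subset[OF field_smooth[OF YD c] V_cimg]]; simp)+
 have Bs: "smooth_on V (%z. B z (\<xi> z) (\<eta> z))"
  by (rule smooth_on_apply2[where B = B, OF B \<xi> \<eta> B_linear1 B_linear2])
 have gz: "g (cinv c z) (X (cinv c z)) (Y (cinv c z)) = m z * B z (\<xi> z) (\<eta> z)" if "z \<in> V" for z
  unfolding \<xi>_def \<eta>_def by (rule mg[OF that sectionD(2)[OF X at(2)[OF that]] sectionD(2)[OF Y at(2)[OF that]]])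
 have fz: "ddir f y ?z = 0" by (rule K.H_section[OF Z y])
 have br: "ddir f y (bracket M Z W ?x c) = ddir (%z. ddir f z (W (cinv c z) c)) y ?z" if W: "W \<in> vector_fields M" for W
  unfolding ddir_bracket[OF f ZD W y] using ddir_zero_on[OF K.H_section[OF Z] y] by simp
 have half1: "g ?x (bracket M Z W ?x) (W' ?x) = m y * B y (ddir (%z. ddir f z (W (cinv c z) c)) y ?z) (ddir f y (W' ?x c))"
  if W: "W \<in> vector_fields M" and W': "W' \<in> sections M H" for W W'
 proof -
  have bt: "bracket M Z W ?x \<in> tangent_space M ?x" by (rule bracket_tangent[OF ZD W x])
  obtain u w where uw: "u \<in> H ?x" "w \<in> K ?x" "bracket M Z W ?x = tadd u w" using decomp[OF y bt] by blast
  have ut: "u \<in> tangent_space M ?x" and wt: "w \<in> tangent_space M ?x" and wf: "ddir f y (w c) = 0"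
   using uw by (auto simp: H_eq[OF y] K.H_eq[OF y])
  note W'H = sectionD(2)[OF W' x] and W't = field_tangent[OF sectionD(1)[OF W'] x]
  have "g ?x (bracket M Z W ?x) (W' ?x) = g ?x u (W' ?x) + g ?x w (W' ?x)"
   unfolding uw(3) by (rule metric_add[OF x ut wt W't])
  also have "g ?x w (W' ?x) = 0" using orth_V[OF y W'H uw(2)] metric_sym[OF x wt W't wt] by simp
  also have "g ?x u (W' ?x) = m y * B y (ddir f y (u c)) (ddir f y (W' ?x c))" by (rule mg[OF y uw(1) W'H])
  also have "ddir f y (u c) = ddir f y (bracket M Z W ?x c)"
   unfolding uw(3) using wf by (simp add: linear_add[OF lin_f[OF y]])
  finally show ?thesis by (simp add: br[OF W])
 qed
 have b1: "g ?x (bracket M Z X ?x) (Y ?x) = m y * B y (ddir \<xi> y ?z) (\<eta> y)"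
  using half1[OF XD Y] by (simp add: \<xi>_def[abs_def] \<eta>_def)
 \<comment> \<open>Symmetry of \<open>B\<close> on \<open>E\<close> is inherited from
   \<open>g\<close>, by lifting both arguments to \<open>H\<close>.\<close>
 have Bsym: "B y (\<xi> y) (ddir \<eta> y ?z) = B y (ddir \<eta> y ?z) (\<xi> y)"
 proof -
  have "B y a b = B y b a" if a: "a \<in> E" and b: "b \<in> E" for a b
  proof -
   obtain s where s: "ddir f y (s y) = a" "ddir h y (s y) = 0" using lift[OF a] y by blast
   obtain t where t: "ddir f y (t y) = b" "ddir h y (t y) = 0" using lift[OF b] y by blast
   have yc: "y \<in> cimg c" using y V_cimg by blast
   have mem: "coord_vec M c w ?x \<in> H ?x" "coord_vec M c w ?x c = w" if "ddir h y w = 0" for w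
    using that cv_tangent[OF c yc] coord_vec_self[OF ch] by (auto simp: H_eq[OF y])
   have "m y * B y a b = m y * B y b a"
    using mg[OF y mem(1)[OF s(2)] mem(1)[OF t(2)]] mg[OF y mem(1)[OF t(2)] mem(1)[OF s(2)]]
     gch_sym[OF c yc, of "s y" "t y"] mem(2)[OF s(2)] mem(2)[OF t(2)] s t by (simp add: gch_def)
   then show ?thesis using m(2)[OF y] by simp
  qed
  moreover have "\<xi> y \<in> E" unfolding \<xi>_def by (rule f_E[OF y])
  moreover have "ddir \<eta> y ?z \<in> E"
   using br[OF YD] f_E[OF y, of "bracket M Z Y ?x c"] by (simp add: \<eta>_def[abs_def])
  ultimately show ?thesis by blast
 qed
 have b2: "g ?x (X ?x) (bracket M Z Y ?x) = m y * B y (\<xi> y) (ddir \<eta> y ?z)"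
 proof -
  have "g ?x (X ?x) (bracket M Z Y ?x) = g ?x (bracket M Z Y ?x) (X ?x)"
   by (rule metric_sym[OF x field_tangent[OF XD x] bracket_tangent[OF ZD YD x] field_tangent[OF XD x]])
  then show ?thesis using half1[OF YD X] Bsym by (simp add: \<eta>_def[abs_def] \<xi>_def)
 qed
 have md: "m differentiable (at y)" by (rule smooth_on_diffble[OF m(1) S])
 have gs: "(%z. g (cinv c z) (X (cinv c z)) (Y (cinv c z))) differentiable (at (cmap c ?x))"
  using smooth_on_diffble[OF metric_fields_smooth[OF XD YD c] cimg_open[OF c], of y] y V_cimg at(3)[OF y] by auto
 have "deriv_along M Z (%z. g z (X z) (Y z)) ?x = ddir (%z. g (cinv c z) (X (cinv c z)) (Y (cinv c z))) y ?z"
  using deriv_along_chart[where f = "%z. g z (X z) (Y z)", OF ZD ch gs] at(3)[OF y] by simp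
 also have "\<dots> = ddir (%z. m z * B z (\<xi> z) (\<eta> z)) y ?z" by (rule ddir_cong[OF S gz])
 also have "\<dots> = m y * ddir (%z. B z (\<xi> z) (\<eta> z)) y ?z + ddir m y ?z * B y (\<xi> y) (\<eta> y)"
  by (rule ddir_bilinear[OF bounded_bilinear_mult md smooth_on_diffble[OF Bs S]])
 also have "ddir (%z. B z (\<xi> z) (\<eta> z)) y ?z = ddir (%z. B z (\<xi> y) (\<eta> y)) y ?z + B y (ddir \<xi> y ?z) (\<eta> y) + B y (\<xi> y) (ddir \<eta> y ?z)"
  by (rule ddir_apply2[where B = B, OF S B \<xi> \<eta> B_linear1 B_linear2])
 also have "ddir (%z. B z (\<xi> y) (\<eta> y)) y ?z = 0" by (rule B_const[OF y fz])
 finally have "lie_metric M g Z X Y ?x = ddir m y ?z * B y (\<xi> y) (\<eta> y)"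
  unfolding lie_metric_def b1 b2 by (simp add: algebra_simps)
 then show ?thesis using gz[OF y] m(2)[OF y] by simp
qed

lemma swap: "product_chart M g c V K H F A E B h f"
proof
 fix y v w assume y: "y \<in> V" and v: "v \<in> K (cinv c y)" and w: "w \<in> H (cinv c y)"
 have t: "v \<in> tangent_space M (cinv c y)" "w \<in> tangent_space M (cinv c y)"
  using v w by (simp_all add: H_eq[OF y] K.H_eq[OF y])
 show "g (cinv c y) v w = 0"
  using orth_V[OF y w v] metric_sym[OF at(2)[OF y] t(2) t(1) t(1)] by simp
qed

end

section \<open>Gluing the local logarithmic forms\<close>

context orth_splitting
begin

text \<open>The one-form of a conformal foliation: in a product chart it is \<open>d log m\<close> on \<open>K\<close> and \<open>d log n\<close> on \<open>H\<close>, where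
 \<open>m\<close> and \<open>n\<close> are the conformal factors of \<open>g\<close> on \<open>H\<close> and \<open>K\<close>. As it is determined by \<open>g\<close>, the local forms agree.\<close>

definition ratios :: "'a => ('a, 'e) tvec => real => real => bool" where
 "ratios x v a b \<longleftrightarrow> (\<forall>Z\<in>sections M K. \<forall>Z'\<in>sections M H. v = tadd (Z' x) (Z x) \<longrightarrow>
   (\<forall>X\<in>sections M H. \<forall>Y\<in>sections M H. lie_metric M g Z X Y x = a * g x (X x) (Y x)) \<and>
   (\<forall>X\<in>sections M K. \<forall>Y\<in>sections M K. lie_metric M g Z' X Y x = b * g x (X x) (Y x)))"

definition glued :: "'a => ('a, 'e) tvec => real" where
 "glued x v = (THE r. \<exists>a b. ratios x v a b \<and> r = a + b)"

text \<open>Sections of \<open>H\<close> and \<open>K\<close> that are nonzero at \<open>x\<close>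
  allow both factors to be cancelled, so the definite description has a single candidate.\<close>

lemma glued_eq:
 assumes x: "x \<in> points M" and v: "v \<in> tangent_space M x" and r: "ratios x v a b"
 shows "glued x v = a + b"
proof -
 interpret s': orth_splitting M K H g by (rule orth_swap)
 have cancel: "a = b" if X: "X \<in> vector_fields M" "X x \<noteq> tzero" "a * g x (X x) (X x) = b * g x (X x) (X x)" for X and a b :: real
  using metric_pos[OF x field_tangent[OF X(1) x] field_tangent[OF X(1) x] field_tangent[OF X(1) x] X(2)] X(3) by simp
 obtain p q where "p \<in> H x" "q \<in> K x" and pq: "v = tadd p q" using v unfolding sum[OF x] by blast
 then obtain Z Z' where Z: "Z \<in> sections M K" "Z x = q" and Z': "Z' \<in> sections M H" "Z' x = p"
  using section_through[OF x] s'.section_through[OF x] by metis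
 obtain X where X: "X \<in> sections M H" "X x \<noteq> tzero" using nonzero_section[OF x] by blast
 obtain Y where Y: "Y \<in> sections M K" "Y x \<noteq> tzero" using s'.nonzero_section[OF x] by blast
 have l: "lie_metric M g Z X X x = a * g x (X x) (X x) \<and> lie_metric M g Z' Y Y x = b * g x (Y x) (Y x)" if "ratios x v a b" for a b
  using that Z Z' X(1) Y(1) pq unfolding ratios_def by blast
 have "a' = a \<and> b' = b" if "ratios x v a' b'" for a' b'
  using l[OF that] l[OF r] cancel[OF sectionD(1)[OF X(1)] X(2)] cancel[OF sectionD(1)[OF Y(1)] Y(2)] by metis
 then show ?thesis unfolding glued_def using r by (intro the_equality) blast+
qed

text \<open>\<open>v c - prj c y (v c)\<close> is the component in \<open>K\<close>, along which
  \<open>m\<close> is differentiated; \<open>n\<close> is differentiated along the component in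
  \<open>H\<close>.\<close>

definition log_forms :: "('a, 'e) chart => 'e set => ('e => real) => ('e => real) => bool" where
 "log_forms c V m n \<longleftrightarrow> open V \<and> V \<subseteq> cimg c \<and> smooth_on V m \<and> smooth_on V n \<and> (\<forall>y\<in>V. m y > 0 \<and> n y > 0) \<and>
   (\<forall>y\<in>V. \<forall>v\<in>tangent_space M (cinv c y).
    glued (cinv c y) v = ddir m y (v c - prj c y (v c)) / m y + ddir n y (prj c y (v c)) / n y) \<and>
   (\<forall>y\<in>V. \<forall>v. ratios (cinv c y) v (ddir m y (v c - prj c y (v c)) / m y) (ddir n y (prj c y (v c)) / n y))"

lemma log_formsD:
 assumes "log_forms c V m n"
 shows "open V" "V \<subseteq> cimg c" "smooth_on V m" "smooth_on V n" "!!y. y \<in> V ==> m y \<noteq> 0" "!!y. y \<in> V ==> n y \<noteq> 0"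
  "!!y v. y \<in> V ==> v \<in> tangent_space M (cinv c y) ==>
   glued (cinv c y) v = ddir m y (v c - prj c y (v c)) / m y + ddir n y (prj c y (v c)) / n y"
  "!!y v. y \<in> V ==> ratios (cinv c y) v (ddir m y (v c - prj c y (v c)) / m y) (ddir n y (prj c y (v c)) / n y)"
 using assms unfolding log_forms_def by (blast | force)+

lemma log_forms_exist:
 assumes c: "c \<in> atlas M" and p: "product_chart M g c V H K E B F A f h"
 shows "\<exists>m n. log_forms c V m n"
proof -
 interpret p: product_chart M g c V H K E B F A f h by (rule p)
 interpret p': product_chart M g c V K H F A E B h f by (rule p.swap)
 obtain m where m: "smooth_on V m" "!!y. y \<in> V ==> m y > 0"
  "!!y u w. y \<in> V ==> u \<in> H (cinv c y) ==> w \<in> H (cinv c y) ==>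
   g (cinv c y) u w = m y * B y (ddir f y (u c)) (ddir f y (w c))"
  using p.conformal_factor by metis
 obtain n where n: "smooth_on V n" "!!y. y \<in> V ==> n y > 0"
  "!!y u w. y \<in> V ==> u \<in> K (cinv c y) ==> w \<in> K (cinv c y) ==>
   g (cinv c y) u w = n y * A y (ddir h y (u c)) (ddir h y (w c))"
  using p.K.conformal_factor by metis
 have r: "ratios (cinv c y) v (ddir m y (v c - prj c y (v c)) / m y) (ddir n y (prj c y (v c)) / n y)" if y: "y \<in> V" for y v
  unfolding ratios_def
 proof (intro ballI impI)
  fix Z Z' assume Z: "Z \<in> sections M K" and Z': "Z' \<in> sections M H" and v: "v = tadd (Z' (cinv c y)) (Z (cinv c y))"
  have yc: "y \<in> cimg c" using y p.V_cimg by blast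
  have "prj c y (v c) = Z' (cinv c y) c"
   by (rule prj_eqI[OF c yc]) (use sectionD(2)[OF Z' p.at(2)[OF y]] sectionD(2)[OF Z p.at(2)[OF y]] in \<open>auto simp: v hc_def kc_def\<close>)
  then have "v c - prj c y (v c) = Z (cinv c y) c" "prj c y (v c) = Z' (cinv c y) c" by (simp_all add: v)
  then show "(\<forall>X\<in>sections M H. \<forall>Y\<in>sections M H. lie_metric M g Z X Y (cinv c y) =
     ddir m y (v c - prj c y (v c)) / m y * g (cinv c y) (X (cinv c y)) (Y (cinv c y))) \<and>
    (\<forall>X\<in>sections M K. \<forall>Y\<in>sections M K. lie_metric M g Z' X Y (cinv c y) =
     ddir n y (prj c y (v c)) / n y * g (cinv c y) (X (cinv c y)) (Y (cinv c y)))"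
   using p.lie_metric_ratio[where m = m, OF m Z _ _ y] p'.lie_metric_ratio[where m = n, OF n Z' _ _ y] by simp
 qed
 then have "log_forms c V m n"
  unfolding log_forms_def using p.V p.V_cimg m(1,2) n(1,2) glued_eq[OF p.at(2) _ r] by simp
 then show ?thesis by blast
qed

lemma conformal_foliations_glued:
 assumes pc: "!!x c. x \<in> points M ==> c \<in> charts_at M x ==>
   \<exists>V E B F A f h. cmap c x \<in> V \<and> product_chart M g c V H K E B F A f h"
 shows "conformal_foliations M g glued H K"
proof -
 have loc: "\<exists>V m n. cmap c x \<in> V \<and> log_forms c V m n" if x: "x \<in> points M" and c: "c \<in> charts_at M x" for x c
  using pc[OF x c] log_forms_exist[OF charts_atD(1)[OF c]] by metis
 have of: "one_form M glued"
  unfolding one_form_def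
 proof (intro conjI ballI allI)
  fix x v w r assume x: "x \<in> points M" and v: "v \<in> tangent_space M x" and w: "w \<in> tangent_space M x"
  obtain c where c: "c \<in> charts_at M x" using chart_exists[OF x] by blast
  note ca = charts_atD[OF c]
  obtain V m n where xV: "cmap c x \<in> V" and fc: "log_forms c V m n" using loc[OF x c] by blast
  note D = log_formsD[OF fc]
  note gl = D(7)[OF xV, unfolded cinv_cmap[OF ca]]
  have lm: "linear (ddir m (cmap c x))" and ln: "linear (ddir n (cmap c x))"
   using bounded_linear_ddir[OF smooth_on_diffble[OF D(3,1) xV]] bounded_linear_ddir[OF smooth_on_diffble[OF D(4,1) xV]]
    bounded_linear.linear by blast+
  note lp = linear_prj[OF ca(1) cimg_cmap[OF ca(2)]]
  show "glued x (tadd v w) = glued x v + glued x w"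
   by (simp add: gl v w tangent_add linear_add[OF lm] linear_add[OF ln] linear_add[OF lp] linear_diff[OF lm] add_divide_distrib diff_divide_distrib)
  show "glued x (tscale r v) = r * glued x v"
   by (simp add: gl v tangent_scale linear_scale[OF lm] linear_scale[OF ln] linear_scale[OF lp] linear_diff[OF lm] algebra_simps diff_divide_distrib)
 next
  fix c e assume c: "c \<in> atlas M"
  show "smooth_on (cmap c ` cdom c) (%y. glued (cinv c y) (coord_vec M c e (cinv c y)))"
   unfolding cimg_def[symmetric]
  proof (rule smooth_on_local[OF cimg_open[OF c]])
   fix y0 assume y0: "y0 \<in> cimg c"
   obtain V m n where y0V: "y0 \<in> V" and fc: "log_forms c V m n"
    using loc[OF cimg_points[OF c y0] cimg_charts_at[OF c y0]] cimg_cinv(2)[OF y0] by auto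
   note D = log_formsD[OF fc]
   have ps: "smooth_on V (%y. prj c y e)" by (rule smooth_on_subset[OF prj_smooth[OF c] D(2)])
   have "smooth_on V (%y. ddir m y (e - prj c y e) / m y + ddir n y (prj c y e) / n y)"
    by (intro smooth_on_add smooth_on_divide D(3-6) smooth_on_ddir_apply[OF D(3,1) smooth_on_ident]
      smooth_on_ddir_apply[OF D(4,1) smooth_on_ident] smooth_on_diff smooth_on_const ps) auto
   moreover have "glued (cinv c y) (coord_vec M c e (cinv c y)) = ddir m y (e - prj c y e) / m y + ddir n y (prj c y e) / n y"
    if y: "y \<in> V" for y
    using D(7)[OF y cv_tangent[OF c subsetD[OF D(2) y]]] coord_vec_self[OF cimg_charts_at[OF c subsetD[OF D(2) y]], of e] by simp
   ultimately have "smooth_on V (%y. glued (cinv c y) (coord_vec M c e (cinv c y)))"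
    using smooth_on_cong by (metis (no_types, lifting))
   then show "\<exists>U. open U \<and> y0 \<in> U \<and> smooth_on (cimg c \<inter> U) (%y. glued (cinv c y) (coord_vec M c e (cinv c y)))"
    using D(1) y0V by (intro exI[of _ V]) (auto intro: smooth_on_subset)
  qed
 qed
 have br: "(X \<in> sections M H \<longrightarrow> Y \<in> sections M H \<longrightarrow> bracket M X Y x \<in> H x) \<and>
   (X \<in> sections M K \<longrightarrow> Y \<in> sections M K \<longrightarrow> bracket M X Y x \<in> K x)" if x: "x \<in> points M" for X Y x
 proof -
  obtain c where c: "c \<in> charts_at M x" using chart_exists[OF x] by blast
  obtain V E B F A f h where xV: "cmap c x \<in> V" and p: "product_chart M g c V H K E B F A f h" using pc[OF x c] by blast
  interpret p: product_chart M g c V H K E B F A f h by (rule p)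
  show ?thesis using p.bracket_H[OF _ _ xV] p.K.bracket_H[OF _ _ xV] charts_atD[OF c] by simp
 qed
 \<comment> \<open>A vector of \<open>K\<close> has projection 0 to \<open>H\<close>, so the term of
   \<open>n\<close> vanishes; for a vector of \<open>H\<close> it is the term of
   \<open>m\<close>.\<close>
 have ev: "\<exists>a b. ratios x v a b \<and> glued x v = a + b \<and> (v \<in> K x \<longrightarrow> b = 0) \<and> (v \<in> H x \<longrightarrow> a = 0)"
  if x: "x \<in> points M" and v: "v \<in> tangent_space M x" for x v
 proof -
  obtain c where c: "c \<in> charts_at M x" using chart_exists[OF x] by blast
  note ca = charts_atD[OF c]
  obtain V m n where xV: "cmap c x \<in> V" and fc: "log_forms c V m n" using loc[OF x c] by blast
  note D = log_formsD(7,8)[OF fc xV, unfolded cinv_cmap[OF ca]]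
  have "v \<in> H x \<longleftrightarrow> prj c (cmap c x) (v c) = v c" "v \<in> K x \<longleftrightarrow> prj c (cmap c x) (v c) = 0"
   using hc_iff[OF c v] kc_iff[OF c v] prj_eq_iff[OF ca(1) cimg_cmap[OF ca(2)]] prj_zero_iff[OF ca(1) cimg_cmap[OF ca(2)]] by simp_all
  then show ?thesis using D(1)[OF v] D(2)[of v]
   by (intro exI[of _ "ddir m (cmap c x) (v c - prj c (cmap c x) (v c)) / m (cmap c x)"]
     exI[of _ "ddir n (cmap c x) (prj c (cmap c x) (v c)) / n (cmap c x)"]) (auto simp: ddir_zero)
 qed
 interpret s': orth_splitting M K H g by (rule orth_swap)
 have "conformal_along M g glued K H"
  unfolding conformal_along_def
 proof (intro ballI)
  fix Z X Y x assume Z: "Z \<in> sections M K" and XY: "X \<in> sections M H" "Y \<in> sections M H" and x: "x \<in> points M"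
  \<comment> \<open>\<open>ratios\<close> speaks of decompositions by values of sections; the
    missing component of \<open>Z x\<close> is provided by a section vanishing at
    \<open>x\<close>.\<close>
  obtain Z' where Z': "Z' \<in> sections M H" "Z' x = tzero" using section_through[OF x distribution_zero[OF H x]] by blast
  obtain a where "ratios x (Z x) a 0" "glued x (Z x) = a"
   using ev[OF x field_tangent[OF sectionD(1)[OF Z] x]] sectionD(2)[OF Z x] by auto
  then show "lie_metric M g Z X Y x = glued x (Z x) * g x (X x) (Y x)"
   using Z Z' XY unfolding ratios_def by (metis (no_types, lifting) add_0)
 qed
 moreover have "conformal_along M g glued H K"
  unfolding conformal_along_def
 proof (intro ballI)
  fix Z X Y x assume Z: "Z \<in> sections M H" and XY: "X \<in> sections M K" "Y \<in> sections M K" and x: "x \<in> points M"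
  obtain Z' where Z': "Z' \<in> sections M K" "Z' x = tzero" using s'.section_through[OF x distribution_zero[OF K x]] by blast
  obtain b where "ratios x (Z x) 0 b" "glued x (Z x) = b"
   using ev[OF x field_tangent[OF sectionD(1)[OF Z] x]] sectionD(2)[OF Z x] by auto
  then show "lie_metric M g Z X Y x = glued x (Z x) * g x (X x) (Y x)"
   using Z Z' XY unfolding ratios_def by (metis (no_types, lifting) add_0_right)
 qed
 ultimately show ?thesis using of br by (simp add: conformal_foliations_def involutive_def)
qed

end

context riemannian
begin

lemma half_product_distribution:
 assumes ext: "H \<in> extensional (points M)"
  and hp: "!!x c. x \<in> points M ==> c \<in> charts_at M x ==>
   \<exists>V E B f h. cmap c x \<in> V \<and> half_product_chart M g c V H E B f h"
 shows "smooth_distribution M H"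
 unfolding smooth_distribution_def
proof (intro conjI ballI ext)
 fix x assume x: "x \<in> points M"
 obtain c where ch: "c \<in> charts_at M x" using chart_exists[OF x] by blast
 note ca = charts_atD[OF ch]
 obtain V E B f h where xV: "cmap c x \<in> V" and p: "half_product_chart M g c V H E B f h" using hp[OF x ch] by blast
 interpret half_product_chart M g c V H E B f h by (rule p)
 have cx: "cinv c (cmap c x) = x" using ca by simp
 show "H x \<subseteq> tangent_space M x" using H_eq[OF xV] cx by auto
 obtain k and e :: "nat => 'e => 'e" where e: "!!i. i < k ==> smooth_on V (e i)"
  and e1: "!!y. y \<in> V ==> inj_on (%i. e i y) {..<k}" and e2: "!!y. y \<in> V ==> independent ((%i. e i y) ` {..<k})"
  and e3: "!!y. y \<in> V ==> (%v. v c) ` H (cinv c y) = span ((%i. e i y) ` {..<k})"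
  by (rule frame, rule that)
 let ?W = "cinv c ` V"
 have W: "openin (mtop M) ?W"
  using cinv_open_image[OF ca(1), of V] V V_cimg by (simp add: model_UNIV cimg_def)
 have im: "cmap c ` ?W = V" using at(3) by (force simp: image_image)
 have fr: "inj_on (%i. e i (cmap c z)) {..<k} \<and> independent ((%i. e i (cmap c z)) ` {..<k}) \<and>
   (%v. v c) ` H z = span ((%i. e i (cmap c z)) ` {..<k})" if z: "z \<in> ?W" for z
 proof -
  obtain y where y: "y \<in> V" "z = cinv c y" using z by blast
  then show ?thesis using e1[OF y(1)] e2[OF y(1)] e3[OF y(1)] at(3)[OF y(1)] by simp
 qed
 have "?W \<subseteq> cdom c" using V_cimg cimg_cinv(1) by blast
 moreover have "x \<in> ?W" using xV cx by force
 moreover have "\<forall>i<k. smooth_on (cmap c ` ?W) (e i)" unfolding im using e by blast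
 moreover have "\<forall>z\<in>?W. inj_on (%i. e i (cmap c z)) {..<k} \<and> independent ((%i. e i (cmap c z)) ` {..<k}) \<and>
   (%v. v c) ` H z = span ((%i. e i (cmap c z)) ` {..<k})" by (intro ballI fr)
 ultimately show "\<exists>c\<in>charts_at M x. \<exists>V k. \<exists>e :: nat => 'e => 'e.
    openin (mtop M) V \<and> x \<in> V \<and> V \<subseteq> cdom c \<and>
    (\<forall>i<k. smooth_on (cmap c ` V) (e i)) \<and>
    (\<forall>z\<in>V. inj_on (%i. e i (cmap c z)) {..<k} \<and>
        independent ((%i. e i (cmap c z)) ` {..<k}) \<and>
        (%v. v c) ` H z = span ((%i. e i (cmap c z)) ` {..<k}))"
  using W by - (rule bexI[OF _ ch], rule exI[of _ ?W], rule exI[of _ k], rule exI[of _ e], intro conjI)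
qed

lemma product_charts_splitting:
 assumes ext: "H \<in> extensional (points M)" "K \<in> extensional (points M)"
  and pc: "!!x c. x \<in> points M ==> c \<in> charts_at M x ==>
   \<exists>V E B F A f h. cmap c x \<in> V \<and> product_chart M g c V H K E B F A f h"
 shows "orth_splitting M H K g"
proof -
 have hp: "\<exists>V E B f h. cmap c x \<in> V \<and> half_product_chart M g c V H E B f h"
  "\<exists>V E B f h. cmap c x \<in> V \<and> half_product_chart M g c V K E B f h"
  if x: "x \<in> points M" and c: "c \<in> charts_at M x" for x c
  using pc[OF that] unfolding product_chart_def by blast+
 have pw: "tangent_space M x = {tadd v w | v w. v \<in> H x \<and> w \<in> K x}" "H x \<inter> K x = {tzero}" "H x \<noteq> {tzero}" "K x \<noteq> {tzero}"
  "!!v w. v \<in> H x ==> w \<in> K x ==> g x v w = 0" if x: "x \<in> points M" for x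
 proof -
  obtain c where c: "c \<in> charts_at M x" using chart_exists[OF x] by blast
  obtain V E B F A f h where xV: "cmap c x \<in> V" and p: "product_chart M g c V H K E B F A f h" using pc[OF x c] by blast
  interpret p: product_chart M g c V H K E B F A f h by (rule p)
  have cx: "cinv c (cmap c x) = x" using charts_atD[OF c] by simp
  show "H x \<inter> K x = {tzero}" "H x \<noteq> {tzero}" "K x \<noteq> {tzero}" using p.inter_V[OF xV] p.nonzero[OF xV] p.K.nonzero[OF xV] cx by simp_all
  show "!!v w. v \<in> H x ==> w \<in> K x ==> g x v w = 0" using p.orth_V[OF xV] cx by simp
  show "tangent_space M x = {tadd v w | v w. v \<in> H x \<and> w \<in> K x}"
  proof
   show "tangent_space M x \<subseteq> {tadd v w | v w. v \<in> H x \<and> w \<in> K x}"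
   proof
    fix v assume "v \<in> tangent_space M x"
    then obtain a b where "a \<in> H x" "b \<in> K x" "v = tadd a b" using p.decomp[OF xV, of v] cx by auto
    then show "v \<in> {tadd v w | v w. v \<in> H x \<and> w \<in> K x}" by blast
   qed
   have "H x \<subseteq> tangent_space M x" "K x \<subseteq> tangent_space M x" using p.H_eq[OF xV] p.K.H_eq[OF xV] cx by auto
   then show "{tadd v w | v w. v \<in> H x \<and> w \<in> K x} \<subseteq> tangent_space M x" by (auto intro!: tangent_add)
  qed
 qed
 show ?thesis
 proof
  show "smooth_distribution M H" "smooth_distribution M K"
   using half_product_distribution[OF ext(1) hp(1)] half_product_distribution[OF ext(2) hp(2)] by blast+
 qed (fact pw)+
qed

end

section \<open>Product manifolds\<close>

lemma smooth_on_ddir_subspace: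
 fixes f :: "'e::euclidean_space => 'f::real_normed_vector"
 assumes E: "subspace E" and S: "openin (top_of_set E) S" and f: "smooth_on S f" and e: "e \<in> E"
 shows "smooth_on S (%y. ddir f y e)"
 unfolding smooth_on_def
proof
 fix k
 have "Ck_on (Suc k) S f" using f smooth_on_imp_Ck by blast
 from Ck_on_SucE[OF this] obtain f' where f': "!!x. x \<in> S ==> (f has_derivative f' x) (at x within S)"
  and k: "!!v. Ck_on k S (%x. f' x v)" by metis
 have "ddir f y e = f' y e" if "y \<in> S" for y by (rule ddir_eq_subspace[OF f'[OF that] E S that e])
 then show "Ck_on k S (%y. ddir f y e)" using k[of e] Ck_on_cong[of S "%y. ddir f y e" "%y. f' y e"] by simp
qed

lemma subspace_projection:
 fixes E :: "'e::euclidean_space set"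
 assumes "subspace E"
 obtains \<pi> where "linear \<pi>" "!!u. \<pi> u \<in> E" "!!u. u \<in> E ==> \<pi> u = u"
 using linear_exists_left_inverse_on[OF linear_ident assms] by (auto simp: image_subset_iff)

definition pchart :: "('a, 'e) chart => ('b, 'f) chart => ('a \<times> 'b, 'e \<times> 'f) chart" where
 "pchart c d = (cdom c \<times> cdom d, map_prod (cmap c) (cmap d))"

lemma atlas_prod: "atlas (prod_mfd M N) = {pchart c d | c d. c \<in> atlas M \<and> d \<in> atlas N}"
 and model_prod: "model (prod_mfd M N) = model M \<times> model N"
 and mtop_prod: "mtop (prod_mfd M N) = prod_topology (mtop M) (mtop N)"
 by (simp_all add: prod_mfd_def pchart_def)

lemma pchart_atlas: "c \<in> atlas M ==> d \<in> atlas N ==> pchart c d \<in> atlas (prod_mfd M N)"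
 unfolding atlas_prod by blast

lemma cdom_pchart: "cdom (pchart c d) = cdom c \<times> cdom d"
 and cmap_pchart: "cmap (pchart c d) = map_prod (cmap c) (cmap d)"
 by (simp_all add: pchart_def)

lemma cinv_pchart:
 assumes "inj_on (cmap c) (cdom c)" "inj_on (cmap d) (cdom d)" "y \<in> cmap c ` cdom c" "z \<in> cmap d ` cdom d"
 shows "cinv (pchart c d) (y, z) = (cinv c y, cinv d z)"
 unfolding cinv_def cdom_pchart cmap_pchart
 by (rule inv_into_f_eq) (use assms in \<open>auto simp: inv_into_into f_inv_into_f intro!: map_prod_inj_on\<close>)

lemma charted_prod:
 assumes "charted M" "charted N" shows "charted (prod_mfd M N)"
proof -
 interpret M: charted_space M by unfold_locales (rule assms)
 interpret N: charted_space N by unfold_locales (rule assms)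
 have inv: "cinv (pchart c d) (y, z) = (cinv c y, cinv d z)" if "c \<in> atlas M" "d \<in> atlas N" "y \<in> cmap c ` cdom c" "z \<in> cmap d ` cdom d" for c d y z
  by (rule cinv_pchart[OF M.cmap_inj N.cmap_inj]) (fact that)+
 show ?thesis
  unfolding charted_def
 proof (intro conjI ballI)
  show "subspace (model (prod_mfd M N))" by (simp add: model_prod subspace_Times M.model N.model)
  show "(\<Union>c\<in>atlas (prod_mfd M N). cdom c) = points (prod_mfd M N)"
  proof -
   have "(\<Union>c\<in>atlas (prod_mfd M N). cdom c) = (\<Union>c\<in>atlas M. cdom c) \<times> (\<Union>d\<in>atlas N. cdom d)"
    unfolding atlas_prod by (auto simp: pchart_def) blast
   then show ?thesis using assms by (simp add: charted_def mtop_prod)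
  qed
  fix p assume "p \<in> atlas (prod_mfd M N)"
  then obtain c d where p: "p = pchart c d" and c: "c \<in> atlas M" and d: "d \<in> atlas N" unfolding atlas_prod by blast
  show "openin (mtop (prod_mfd M N)) (cdom p)"
   using M.cdom_open[OF c] N.cdom_open[OF d] by (simp add: p cdom_pchart mtop_prod openin_prod_Times_iff)
  have im: "cmap p ` cdom p = (cmap c ` cdom c) \<times> (cmap d ` cdom d)"
   by (simp add: p cdom_pchart cmap_pchart map_prod_surj_on)
  show "openin (top_of_set (model (prod_mfd M N))) (cmap p ` cdom p)"
   unfolding im model_prod by (rule openin_Times[OF M.cimage_open[OF c] N.cimage_open[OF d]])
  obtain c' d' where cd: "homeomorphic_maps (subtopology (mtop M) (cdom c)) (top_of_set (cmap c ` cdom c)) (cmap c) c'"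
   "homeomorphic_maps (subtopology (mtop N) (cdom d)) (top_of_set (cmap d ` cdom d)) (cmap d) d'"
   using M.chart_homeo[OF c] N.chart_homeo[OF d] unfolding homeomorphic_map_maps by blast
  have "homeomorphic_maps (prod_topology (subtopology (mtop M) (cdom c)) (subtopology (mtop N) (cdom d)))
    (prod_topology (top_of_set (cmap c ` cdom c)) (top_of_set (cmap d ` cdom d)))
    (%(x, y). (cmap c x, cmap d y)) (%(x, y). (c' x, d' y))"
   unfolding homeomorphic_maps_prod using cd by blast
  moreover have "(%(x, y). (cmap c x, cmap d y)) = cmap p" by (auto simp: p cmap_pchart)
  ultimately show "homeomorphic_map (subtopology (mtop (prod_mfd M N)) (cdom p)) (top_of_set (cmap p ` cdom p)) (cmap p)"
   unfolding homeomorphic_map_maps im by (auto simp: p cdom_pchart mtop_prod subtopology_Times)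
  fix p' assume "p' \<in> atlas (prod_mfd M N)"
  then obtain c' d' where p': "p' = pchart c' d'" and c': "c' \<in> atlas M" and d': "d' \<in> atlas N" unfolding atlas_prod by blast
  let ?S = "(cmap c ` (cdom c \<inter> cdom c')) \<times> (cmap d ` (cdom d \<inter> cdom d'))"
  have S: "cmap p ` (cdom p \<inter> cdom p') = ?S"
   by (simp add: p p' cdom_pchart cmap_pchart Times_Int_Times map_prod_surj_on)
  have "smooth_on ?S (%y. (cmap c' (cinv c (fst y)), cmap d' (cinv d (snd y))))"
   by (intro smooth_on_Pair smooth_on_compose[OF smooth_on_fst[OF smooth_on_ident] M.transition_smooth[OF c c']]
     smooth_on_compose[OF smooth_on_snd[OF smooth_on_ident] N.transition_smooth[OF d d']]) auto
  moreover have "(cmap p' \<circ> cinv p) y = (cmap c' (cinv c (fst y)), cmap d' (cinv d (snd y)))" if y: "y \<in> ?S" for y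
  proof -
   obtain u v where uv: "y = (u, v)" "u \<in> cmap c ` (cdom c \<inter> cdom c')" "v \<in> cmap d ` (cdom d \<inter> cdom d')" using y by blast
   then have "cinv (pchart c d) (u, v) = (cinv c u, cinv d v)" by (intro inv c d) auto
   then show ?thesis by (simp add: uv(1) p p' cmap_pchart)
  qed
  ultimately show "smooth_on (cmap p ` (cdom p \<inter> cdom p')) (cmap p' \<circ> cinv p)"
   unfolding S using smooth_on_cong[of ?S "cmap p' \<circ> cinv p"] by simp
 qed
qed

section \<open>Product charts of a local conformal product\<close>

text \<open>The embedding is read backwards: \<psi> expresses the coordinates of the product by
  those of \<open>M\<close>, as the maps \<open>f\<close> and \<open>h\<close> of a half product
  chart require.\<close>

locale embedded_chart = riemannian M g + P: charted_space P
 for M :: "('a, 'e::euclidean_space) mfd" and g and P :: "('b, 'f::euclidean_space) mfd" +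
 fixes \<Phi> c d
 assumes emb: "open_embedding P M \<Phi>" and c: "c \<in> atlas M" and d: "d \<in> atlas P"
begin

abbreviation \<Psi> where "\<Psi> \<equiv> inv_into (points P) \<Phi>"

lemma \<Phi>_smooth: "smooth_map_on P (points P) M \<Phi>" and \<Psi>_smooth: "smooth_map_on M (\<Phi> ` points P) P \<Psi>"
 and \<Phi>_inj: "inj_on \<Phi> (points P)"
 using emb by (auto simp: open_embedding_def)

sublocale phi: charted_map P M "points P" \<Phi> by unfold_locales (rule \<Phi>_smooth)
sublocale psi: charted_map M P "\<Phi> ` points P" \<Psi> by unfold_locales (rule \<Psi>_smooth)

definition V where "V = psi.rdom c d"
definition \<psi> where "\<psi> y = cmap d (\<Psi> (cinv c y))"
definition \<phi> where "\<phi> z = cmap c (\<Phi> (cinv d z))"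

lemma V: "open V" "V \<subseteq> cimg c"
proof -
 show "open V" using psi.rdom_open[OF c d] by (simp add: V_def model_UNIV)
 show "V \<subseteq> cimg c" unfolding V_def psi.rdom_def cimg_def by blast
qed

lemma V_point:
 assumes "y \<in> V"
 shows "cinv c y \<in> \<Phi> ` points P" "\<Psi> (cinv c y) \<in> cdom d" "\<Psi> (cinv c y) \<in> points P" "\<Phi> (\<Psi> (cinv c y)) = cinv c y"
  "c \<in> charts_at M (cinv c y)" "d \<in> charts_at P (\<Psi> (cinv c y))" "cmap c (cinv c y) = y" "\<psi> y \<in> cmap d ` cdom d"
  "cinv d (\<psi> y) = \<Psi> (cinv c y)"
proof -
 show *: "cinv c y \<in> \<Phi> ` points P" "\<Psi> (cinv c y) \<in> cdom d" "cmap c (cinv c y) = y"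
  using assms psi.rdom_cinv[OF c, of y d] by (auto simp: V_def)
 show "\<Psi> (cinv c y) \<in> points P" "\<Phi> (\<Psi> (cinv c y)) = cinv c y" using *(1) by (simp_all add: inv_into_into f_inv_into_f)
 show "c \<in> charts_at M (cinv c y)" using assms V(2) cimg_charts_at[OF c] by blast
 show "d \<in> charts_at P (\<Psi> (cinv c y))" by (rule charts_atI[OF d *(2)])
 show "\<psi> y \<in> cmap d ` cdom d" "cinv d (\<psi> y) = \<Psi> (cinv c y)" using *(2) d by (auto simp: \<psi>_def)
qed

lemma V_mem:
 assumes "q \<in> cdom d" "\<Phi> q \<in> cdom c" shows "cmap c (\<Phi> q) \<in> V"
proof -
 have q: "q \<in> points P" using assms(1) P.cdom_points[OF d] by blast
 then have "\<Psi> (\<Phi> q) = q" using \<Phi>_inj by simp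
 then show ?thesis unfolding V_def using assms q by (intro psi.cmap_rdom) auto
qed

lemma \<psi>: "smooth_on V \<psi>"
 using psi.rep_smooth[OF c d] by (simp add: V_def \<psi>_def[abs_def])

lemma \<psi>_model: "y \<in> V ==> \<psi> y \<in> model P"
 using V_point(6) P.cmap_model unfolding \<psi>_def by blast

lemma ddir_\<psi>_model: assumes y: "y \<in> V" shows "ddir \<psi> y u \<in> model P"
 by (rule ddir_mem_subspace[OF subspace_UNIV _ \<psi> y _ P.model]) (use V \<psi>_model in auto)

lemma ddir_linear_\<psi>: "bounded_linear L ==> y \<in> V ==> ddir (%y. L (\<psi> y)) y u = L (ddir \<psi> y u)"
 by (rule ddir_linear_comp[OF _ smooth_on_diffble[OF \<psi> V(1)]])

lemma d\<Psi>_component: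
 "y \<in> V ==> v \<in> tangent_space M (cinv c y) ==> differential M P \<Psi> (cinv c y) v d = ddir \<psi> y (v c)"
 using psi.differential_component[OF V_point(1) _ V_point(5,6)] V_point(7) by (simp add: \<psi>_def[abs_def])

lemma d\<Psi>_d\<Phi>:
 "q \<in> points P ==> w \<in> tangent_space P q ==> differential M P \<Psi> (\<Phi> q) (differential P M \<Phi> q w) = w"
 by (rule differential_inverse[OF P.charted charted \<Phi>_smooth \<Psi>_smooth]) (use \<Phi>_inj in auto)

lemma d\<Phi>_d\<Psi>:
 assumes x: "x \<in> \<Phi> ` points P" and v: "v \<in> tangent_space M x"
 shows "differential P M \<Phi> (\<Psi> x) (differential M P \<Psi> x v) = v"
 by (rule differential_inverse[OF charted P.charted \<Psi>_smooth \<Phi>_smooth x _ _ v]) (use x in \<open>auto simp: inv_into_into f_inv_into_f\<close>)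

lemma ddir_d\<Phi>:
 assumes y: "y \<in> V" and w: "w \<in> tangent_space P (\<Psi> (cinv c y))"
 shows "ddir \<psi> y (differential P M \<Phi> (\<Psi> (cinv c y)) w c) = w d"
 using d\<Psi>_d\<Phi>[OF V_point(3)[OF y] w] d\<Psi>_component[OF y] phi.differential_tangent[OF V_point(3)[OF y] w] V_point(4)[OF y]
 by metis

text \<open>\<psi> represents the inverse \<Psi> of the embedding, whose differential has that of
  \<Phi> as a left inverse.\<close>

lemma inj_\<psi>: assumes y: "y \<in> V" and 0: "ddir \<psi> y u = 0" shows "u = 0"
proof -
 let ?v = "coord_vec M c u (cinv c y)"
 note ch = V_point(5)[OF y]
 have v: "?v \<in> tangent_space M (cinv c y)" by (rule coord_vec_tangent[OF ch]) simp
 have vc: "?v c = u" by (rule coord_vec_self[OF ch]) simp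
 have "differential M P \<Psi> (cinv c y) ?v = tzero"
  by (rule P.tangent_eqI[OF psi.differential_tangent[OF V_point(1)[OF y] v] P.tangent_zero V_point(6)[OF y]])
   (simp add: d\<Psi>_component[OF y v] vc 0)
 then have "?v = differential P M \<Phi> (\<Psi> (cinv c y)) tzero" using d\<Phi>_d\<Psi>[OF V_point(1)[OF y] v] by simp
 also have "\<dots> = tzero" using phi.differential_scale[OF V_point(3)[OF y] P.tangent_zero, of 0] by simp
 finally show ?thesis using vc by metis
qed

text \<open>The constant field \<open>w\<close> of the product, pushed forward to \<open>M\<close>;
  it supplies the smooth lifts demanded of a half product chart.\<close>

definition \<sigma> where "\<sigma> w y = ddir \<phi> (\<psi> y) w"

lemma \<sigma>:
 assumes w: "w \<in> model P"
 shows "smooth_on V (\<sigma> w)" "y \<in> V ==> ddir \<psi> y (\<sigma> w y) = w"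
proof -
 have im: "\<psi> y \<in> phi.rdom d c" if "y \<in> V" for y
  using V_point[OF that] phi.cmap_rdom[of "\<Psi> (cinv c y)" d c] charts_atD[of c M "cinv c y"] by (simp add: \<psi>_def)
 have sm: "smooth_on (phi.rdom d c) \<phi>" unfolding \<phi>_def[abs_def] by (rule phi.rep_smooth[OF d c])
 show "smooth_on V (\<sigma> w)"
  unfolding \<sigma>_def[abs_def]
  by (rule smooth_on_compose[OF \<psi> smooth_on_ddir_subspace[OF P.model phi.rdom_open[OF d c] sm w]]) (use im in blast)
 assume y: "y \<in> V"
 let ?q = "\<Psi> (cinv c y)" and ?w = "coord_vec P d w (\<Psi> (cinv c y))"
 note ch = V_point(6)[OF y]
 have wt: "?w \<in> tangent_space P ?q" by (rule P.coord_vec_tangent[OF ch w])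
 have "c \<in> charts_at M (\<Phi> ?q)" using V_point(4,5)[OF y] by simp
 then have "differential P M \<Phi> ?q ?w c = \<sigma> w y"
  using phi.differential_component[OF V_point(3)[OF y] wt ch] P.coord_vec_self[OF ch w] by (simp add: \<sigma>_def \<phi>_def[abs_def] \<psi>_def)
 then show "ddir \<psi> y (\<sigma> w y) = w" using ddir_d\<Phi>[OF y wt] P.coord_vec_self[OF ch w] by simp
qed

end

text \<open>In charts where the projection is linear it is its own derivative.\<close>

lemma differential_linear_component:
 fixes N :: "('c, 'n::euclidean_space) mfd"
 assumes P: "charted P" and N: "charted N" and p: "smooth_map_on P (points P) N p"
  and d: "d \<in> atlas P" and e: "e \<in> atlas N" and L: "bounded_linear L"
  and rep: "!!q. q \<in> cdom d ==> p q \<in> cdom e \<and> cmap e (p q) = L (cmap d q)"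
  and q: "q \<in> cdom d" and v: "v \<in> tangent_space P q"
 shows "differential P N p q v e = L (v d)"
proof -
 interpret charted_map P N "points P" p by unfold_locales (rule P N p)+
 have ch: "d \<in> charts_at P q" "e \<in> charts_at N (p q)" using rep[OF q] d e q by (simp_all add: charts_at_def)
 have "differential P N p q v e = ddir (%y. cmap e (p (cinv d y))) (cmap d q) (v d)"
  by (rule differential_component[OF M.charts_at_points[OF ch(1)] v ch])
 also have "\<dots> = ddir L (cmap d q) (v d)"
 proof (rule ddir_cong_subspace[OF M.model M.cimage_open[OF d]])
  show "cmap e (p (cinv d z)) = L z" if "z \<in> cmap d ` cdom d" for z
   using rep[OF M.cinv_cdom[OF that]] M.cmap_cinv[OF that] by simp
 qed (use q M.tangent_model[OF v ch(1)] in auto)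
 finally show ?thesis by (simp add: ddir_bounded_linear[OF L])
qed

lemma ker_differential_linear:
 fixes N :: "('c, 'n::euclidean_space) mfd"
 assumes P: "charted P" and N: "charted N" and p: "smooth_map_on P (points P) N p"
  and d: "d \<in> atlas P" and e: "e \<in> atlas N" and L: "bounded_linear L"
  and rep: "!!q. q \<in> cdom d ==> p q \<in> cdom e \<and> cmap e (p q) = L (cmap d q)"
  and q: "q \<in> cdom d"
 shows "ker_differential P N p q = {v \<in> tangent_space P q. L (v d) = 0}"
proof -
 interpret charted_map P N "points P" p by unfold_locales (rule P N p)+
 have ch: "e \<in> charts_at N (p q)" using rep[OF q] e by (simp add: charts_at_def)
 have qP: "q \<in> points P" using q M.cdom_points[OF d] by blast
 have "differential P N p q v = tzero \<longleftrightarrow> L (v d) = 0" if v: "v \<in> tangent_space P q" for v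
  using differential_linear_component[OF assms v] N.tangent_eqI[OF differential_tangent[OF qP v] N.tangent_zero ch] by metis
 then show ?thesis unfolding ker_differential_def by blast
qed

text \<open>One factor \<open>N\<close> of a product, \<open>N'\<close> being the other one: in the chart \<open>d\<close> the projections
 to \<open>N\<close> and \<open>N'\<close> are the linear maps \<open>L\<close> and \<open>L'\<close>.\<close>

locale embedded_factor = embedded_chart M g P \<Phi> c d + N: charted_space N + N': charted_space N'
 for M :: "('a, 'e::euclidean_space) mfd" and g and P :: "('b, 'f::euclidean_space) mfd" and \<Phi> c d
  and N :: "('c, 'e) mfd" and N' :: "('c, 'e) mfd" +
 fixes H and p p' e e' and L L' :: "'f => 'e" and g1
 assumes p: "smooth_map_on P (points P) N p" and p': "smooth_map_on P (points P) N' p'"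
  and e: "e \<in> atlas N" and e': "e' \<in> atlas N'" and L: "bounded_linear L" and L': "bounded_linear L'"
  and rep: "!!q. q \<in> cdom d ==> p q \<in> cdom e \<and> cmap e (p q) = L (cmap d q)"
  and rep': "!!q. q \<in> cdom d ==> p' q \<in> cdom e' \<and> cmap e' (p' q) = L' (cmap d q)"
  and L_inj: "!!u. L u = 0 ==> L' u = 0 ==> u = 0" and L_model: "!!u. u \<in> model P ==> L u \<in> model N"
  and L_lift: "!!a. a \<in> model N ==> \<exists>w\<in>model P. L w = a \<and> L' w = 0" and dim_N: "dim (model N) \<ge> 1"
  and H_image: "!!q. q \<in> points P ==> H (\<Phi> q) = differential P M \<Phi> q ` ker_differential P N' p' q"
  and g1: "riemannian_metric N g1"
  and conf: "!!q. q \<in> points P ==> \<exists>l>0. \<forall>v\<in>ker_differential P N' p' q. \<forall>w\<in>ker_differential P N' p' q.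
   g1 (p q) (differential P N p q v) (differential P N p q w) = l * pullback P M \<Phi> g q v w"
begin

definition f where "f y = L (\<psi> y)"
definition h where "h y = L' (\<psi> y)"

lemma ddir_f: "y \<in> V ==> ddir f y u = L (ddir \<psi> y u)"
 unfolding f_def[abs_def] by (rule ddir_linear_\<psi>[OF L])

lemma ddir_h: "y \<in> V ==> ddir h y u = L' (ddir \<psi> y u)"
 unfolding h_def[abs_def] by (rule ddir_linear_\<psi>[OF L'])

lemma ker': "q \<in> cdom d ==> ker_differential P N' p' q = {v \<in> tangent_space P q. L' (v d) = 0}"
 by (rule ker_differential_linear[OF P.charted N'.charted p' d e' L' rep'])

lemma H_V:
 assumes y: "y \<in> V" shows "H (cinv c y) = {v \<in> tangent_space M (cinv c y). ddir h y (v c) = 0}"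
proof -
 let ?q = "\<Psi> (cinv c y)"
 note q = V_point(3)[OF y] and qx = V_point(4)[OF y]
 have H: "H (cinv c y) = differential P M \<Phi> ?q ` {w \<in> tangent_space P ?q. L' (w d) = 0}"
  using H_image[OF q] ker'[OF V_point(2)[OF y]] qx by simp
 show ?thesis
 proof (intro equalityI subsetI)
  fix v assume "v \<in> H (cinv c y)"
  then obtain w where w: "w \<in> tangent_space P ?q" "L' (w d) = 0" "v = differential P M \<Phi> ?q w" unfolding H by blast
  have "v \<in> tangent_space M (cinv c y)" using phi.differential_tangent[OF q w(1)] w(3) qx by simp
  then show "v \<in> {v \<in> tangent_space M (cinv c y). ddir h y (v c) = 0}"
   using ddir_d\<Phi>[OF y w(1)] w(2,3) by (simp add: ddir_h[OF y])
 next
  fix v assume "v \<in> {v \<in> tangent_space M (cinv c y). ddir h y (v c) = 0}"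
  then have v: "v \<in> tangent_space M (cinv c y)" "L' (ddir \<psi> y (v c)) = 0" by (auto simp: ddir_h[OF y])
  let ?w = "differential M P \<Psi> (cinv c y) v"
  have "?w \<in> tangent_space P ?q" by (rule psi.differential_tangent[OF V_point(1)[OF y] v(1)])
  moreover have "L' (?w d) = 0" using v(2) by (simp add: d\<Psi>_component[OF y v(1)])
  moreover have "v = differential P M \<Phi> ?q ?w" using d\<Phi>_d\<Psi>[OF V_point(1)[OF y] v(1)] by simp
  ultimately show "v \<in> H (cinv c y)" unfolding H by blast
 qed
qed

lemma H_lift:
 assumes y: "y \<in> V" and v: "v \<in> H (cinv c y)"
 obtains w where "w \<in> ker_differential P N' p' (\<Psi> (cinv c y))" "v = differential P M \<Phi> (\<Psi> (cinv c y)) w"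
  "differential P N p (\<Psi> (cinv c y)) w = coord_vec N e (ddir f y (v c)) (cinv e (f y))"
proof -
 let ?q = "\<Psi> (cinv c y)"
 note q = V_point(2,3)[OF y]
 obtain w where w: "w \<in> ker_differential P N' p' ?q" "v = differential P M \<Phi> ?q w"
  using v H_image[OF q(2)] V_point(4)[OF y] by auto
 have wt: "w \<in> tangent_space P ?q" using w(1) by (simp add: ker_differential_def)
 interpret p: charted_map P N "points P" p by unfold_locales (rule p)
 have ch: "e \<in> charts_at N (p ?q)" using rep[OF q(1)] e by (simp add: charts_at_def)
 have fy: "cinv e (f y) = p ?q" using rep[OF q(1)] N.cinv_cmap[OF e, of "p ?q"] by (simp add: f_def \<psi>_def)
 have "differential P N p ?q w e = ddir f y (v c)"
  using differential_linear_component[OF P.charted N.charted p d e L rep q(1) wt] ddir_d\<Phi>[OF y wt]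
  by (simp add: w(2) ddir_f[OF y])
 then have "differential P N p ?q w = coord_vec N e (ddir f y (v c)) (cinv e (f y))"
  using N.tangent_coord_vec[OF p.differential_tangent[OF q(2) wt] ch] fy by simp
 then show thesis using that w by blast
qed

lemma half_product: "\<exists>B. half_product_chart M g c V H (model N) B f h"
proof -
 \<comment> \<open>The metric of the factor is bilinear on vectors of \<open>model N\<close>;
   composing with a linear projection onto this subspace gives a form that is bilinear on the whole
   space, as \<open>B\<close> has to be.\<close>
 obtain \<pi> :: "'e => 'e" where \<pi>: "linear \<pi>" "!!u. \<pi> u \<in> model N" "!!u. u \<in> model N ==> \<pi> u = u"
  by (rule subspace_projection[OF N.model]) blast
 define Q where "Q a b z = g1 (cinv e z) (coord_vec N e (\<pi> a) (cinv e z)) (coord_vec N e (\<pi> b) (cinv e z))" for a b z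
 let ?B = "%y a b. Q a b (f y)"
 have Qs: "smooth_on (cmap e ` cdom e) (Q a b)" for a b
  using g1 e \<pi>(2) unfolding riemannian_metric_def Q_def[abs_def] by blast
 have fs: "smooth_on V f" "smooth_on V h"
  unfolding f_def[abs_def] h_def[abs_def] by (intro smooth_on_linear_comp[OF L \<psi>] smooth_on_linear_comp[OF L' \<psi>])+
 have f_cdom: "f y \<in> cmap e ` cdom e" if y: "y \<in> V" for y
  using rep[OF V_point(2)[OF y]] by (auto simp: f_def \<psi>_def intro!: image_eqI[of _ _ "p (\<Psi> (cinv c y))"])
 have fN: "ddir f y u \<in> model N" if "y \<in> V" for y u
  using L_model ddir_\<psi>_model[OF that] by (simp add: ddir_f[OF that])
 have lin: "linear (%a. ?B y a b)" "linear (?B y a)" if y: "y \<in> V" for y a b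
 proof -
  let ?z = "cinv e (f y)"
  have ch: "e \<in> charts_at N ?z" using N.cinv_cdom[OF f_cdom[OF y]] e by (simp add: charts_at_def)
  have t: "coord_vec N e (\<pi> a) ?z \<in> tangent_space N ?z" for a by (rule N.coord_vec_tangent[OF ch \<pi>(2)])
  have z: "?z \<in> points N" by (rule N.charts_at_points[OF ch])
  note r = g1[unfolded riemannian_metric_def, THEN conjunct1, THEN bspec, OF z, THEN bspec, OF t, THEN bspec, OF t,
   THEN bspec, OF t]
  have sym: "Q a b (f y) = Q b a (f y)" for a b unfolding Q_def using r by blast
  have add: "Q (a + a') b (f y) = Q a b (f y) + Q a' b (f y)" for a a' b
   unfolding Q_def linear_add[OF \<pi>(1)] N.coord_vec_add[OF ch \<pi>(2) \<pi>(2)] using r by blast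
  have scale: "Q (s *\<^sub>R a) b (f y) = s * Q a b (f y)" for s a b
   unfolding Q_def linear_scale[OF \<pi>(1)] N.coord_vec_scale[OF ch \<pi>(2)] using r by blast
  show 1: "linear (%a. ?B y a b)" for b by (rule linearI) (simp_all add: add scale)
  show "linear (?B y a)" using 1[of a] by (simp add: sym[of a])
 qed
 have const: "ddir (%y. ?B y a b) y v = 0" if y: "y \<in> V" and v: "ddir f y v = 0" for y v a b
 proof -
  have "ddir (%y. Q a b (f y)) y v = ddir (Q a b) (f y) (ddir f y v)"
   by (rule ddir_chain_subspace[OF subspace_UNIV _ fs(1) y _ N.model N.cimage_open[OF e] Qs])
    (use V f_cdom in auto)
  then show ?thesis by (simp add: v ddir_zero)
 qed
 have met: "\<exists>m>0. \<forall>u\<in>H (cinv c y). \<forall>w\<in>H (cinv c y). g (cinv c y) u w = m * ?B y (ddir f y (u c)) (ddir f y (w c))"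
  if y: "y \<in> V" for y
 proof -
  let ?q = "\<Psi> (cinv c y)"
  obtain l where l: "l > 0" "!!v w. v \<in> ker_differential P N' p' ?q ==> w \<in> ker_differential P N' p' ?q ==>
   g1 (p ?q) (differential P N p ?q v) (differential P N p ?q w) = l * pullback P M \<Phi> g ?q v w"
   using conf[OF V_point(3)[OF y]] by blast
  have fy: "cinv e (f y) = p ?q" using rep[OF V_point(2)[OF y]] N.cinv_cmap[OF e, of "p ?q"] by (simp add: f_def \<psi>_def)
  \<comment> \<open>\<open>l\<close> is the factor by which the projection scales the metric; read
    in the other direction, \<open>g\<close> on \<open>H\<close> is 1/l times the metric of the
    factor.\<close>
  have "g (cinv c y) u w = inverse l * ?B y (ddir f y (u c)) (ddir f y (w c))"
   if u: "u \<in> H (cinv c y)" and w: "w \<in> H (cinv c y)" for u w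
  proof -
   obtain u' where u': "u' \<in> ker_differential P N' p' ?q" "u = differential P M \<Phi> ?q u'"
    "differential P N p ?q u' = coord_vec N e (ddir f y (u c)) (cinv e (f y))" by (rule H_lift[OF y u])
   obtain w' where w': "w' \<in> ker_differential P N' p' ?q" "w = differential P M \<Phi> ?q w'"
    "differential P N p ?q w' = coord_vec N e (ddir f y (w c)) (cinv e (f y))" by (rule H_lift[OF y w])
   have "?B y (ddir f y (u c)) (ddir f y (w c)) = l * g (cinv c y) u w"
    using l(2)[OF u'(1) w'(1)] V_point(4)[OF y]
    by (simp add: Q_def \<pi>(3) fN[OF y] u'(2)[symmetric] w'(2)[symmetric] u'(3) w'(3) fy pullback_def)
   then show ?thesis using l(1) by simp
  qed
  then show ?thesis using l(1) by (intro exI[of _ "inverse l"]) auto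
 qed
 have lift: "\<exists>s. smooth_on V s \<and> (\<forall>y\<in>V. ddir f y (s y) = a \<and> ddir h y (s y) = 0)" if a: "a \<in> model N" for a
 proof -
  obtain w where w: "w \<in> model P" "L w = a" "L' w = 0" using L_lift[OF a] by blast
  then show ?thesis using \<sigma>[OF w(1)] by (intro exI[of _ "\<sigma> w"]) (simp add: ddir_f ddir_h)
 qed
 have Bs: "smooth_on V (%y. ?B y a b)" for a b
  by (rule smooth_on_compose[OF fs(1) Qs]) (use f_cdom in blast)
 have inj: "u = 0" if "y \<in> V" "ddir f y u = 0" "ddir h y u = 0" for y u
  using that L_inj inj_\<psi> by (simp add: ddir_f ddir_h)
 show ?thesis
 proof (rule exI[of _ ?B], rule half_product_chart.intro[OF riemannian_axioms half_product_chart_axioms.intro])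
  show "u = 0" if "y \<in> V" "ddir f y u = 0" "ddir h y u = 0" for y u using inj that by blast
 qed (assumption | rule c V N.model dim_N fs fN lift H_V Bs lin const met)+
qed

end

context manifold
begin

lemma local_product_chart:
 assumes C: "C \<in> conformal_structures M" and g: "g \<in> C" and lp: "local_conformal_product M C (H, K)"
  and x: "x \<in> points M" and c: "c \<in> charts_at M x"
 shows "\<exists>V E B F A f h. cmap c x \<in> V \<and> product_chart M g c V H K E B F A f h"
proof -
 interpret riemannian M g by unfold_locales (rule conformal_class_metric[OF C g])
 note ca = charts_atD[OF c]
 obtain M1 c1 M2 c2 c' \<Phi> where cp: "conformal_product (M1 :: ('e, 'e) mfd) c1 (M2 :: ('e, 'e) mfd) c2 c'"
  and emb: "open_embedding (prod_mfd M1 M2) M \<Phi>" and "x \<in> \<Phi> ` points (prod_mfd M1 M2)"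
  and pb: "\<forall>g\<in>C. pullback (prod_mfd M1 M2) M \<Phi> g \<in> c'"
  and HK: "\<forall>q\<in>points (prod_mfd M1 M2).
      H (\<Phi> q) = differential (prod_mfd M1 M2) M \<Phi> q ` ker_differential (prod_mfd M1 M2) M2 snd q \<and>
      K (\<Phi> q) = differential (prod_mfd M1 M2) M \<Phi> q ` ker_differential (prod_mfd M1 M2) M1 fst q"
  using lp[unfolded local_conformal_product_def prod.case, THEN conjunct2, THEN conjunct2, THEN bspec, OF x]
  by (elim exE conjE) (rule that)
 then obtain q0 where q0: "q0 \<in> points (prod_mfd M1 M2)" "x = \<Phi> q0" by blast
 let ?P = "prod_mfd M1 M2" and ?\<gamma> = "pullback (prod_mfd M1 M2) M \<Phi> g"
 have ch: "charted M1" "charted M2" "charted ?P"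
  using cp charted_prod smooth_manifold_charted unfolding conformal_product_def by blast+
 interpret M1: charted_space M1 by unfold_locales (rule ch)
 interpret M2: charted_space M2 by unfold_locales (rule ch)
 interpret P: charted_space ?P by unfold_locales (rule ch)
 have dims: "dim (model M1) \<ge> 1" "dim (model M2) \<ge> 1"
  and cs: "c1 \<in> conformal_structures M1" "c2 \<in> conformal_structures M2" "c' \<in> conformal_structures ?P"
  and sub: "conformal_submersion ?P c' M1 c1 fst" "conformal_submersion ?P c' M2 c2 snd"
  and orth0: "!!q v w. q \<in> points ?P ==> v \<in> ker_differential ?P M1 fst q ==> w \<in> ker_differential ?P M2 snd q ==> ?\<gamma> q v w = 0"
  using cp pb g unfolding conformal_product_def by blast+
 have \<gamma>: "?\<gamma> \<in> c'" "riemannian_metric ?P ?\<gamma>" using pb g conformal_class_metric[OF cs(3)] by blast+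
 have orth1: "?\<gamma> q w v = 0" if "q \<in> points ?P" "v \<in> ker_differential ?P M1 fst q" "w \<in> ker_differential ?P M2 snd q" for q v w
 proof -
  have "v \<in> tangent_space ?P q" "w \<in> tangent_space ?P q" using that by (auto simp: ker_differential_def)
  then have "?\<gamma> q w v = ?\<gamma> q v w" using \<gamma>(2) that(1) unfolding riemannian_metric_def by blast
  then show ?thesis using orth0[OF that] by simp
 qed
 obtain g1 g2 where g12: "g1 \<in> c1" "g2 \<in> c2" using conformal_class_nonempty cs by metis
 obtain a b where ab: "q0 = (a, b)" "a \<in> points M1" "b \<in> points M2" using q0(1) by (auto simp: mtop_prod)
 obtain d1 d2 where d12: "d1 \<in> charts_at M1 a" "d2 \<in> charts_at M2 b" using M1.chart_exists M2.chart_exists ab by metis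
 note d1 = charts_atD[OF d12(1)] and d2 = charts_atD[OF d12(2)]
 let ?d = "pchart d1 d2"
 have d: "?d \<in> atlas ?P" by (rule pchart_atlas[OF d1(1) d2(1)])
 have conf: "\<exists>l>0. \<forall>v\<in>ker_differential ?P M2 snd q. \<forall>w\<in>ker_differential ?P M2 snd q.
   g1 (fst q) (differential ?P M1 fst q v) (differential ?P M1 fst q w) = l * ?\<gamma> q v w"
  "\<exists>l>0. \<forall>v\<in>ker_differential ?P M1 fst q. \<forall>w\<in>ker_differential ?P M1 fst q.
   g2 (snd q) (differential ?P M2 snd q v) (differential ?P M2 snd q w) = l * ?\<gamma> q v w"
  if q: "q \<in> points ?P" for q
 proof -
  \<comment> \<open>The kernels are orthogonal, so each of them is horizontal for the projection
    whose kernel is the other one, and the conformality of that submersion applies to it.\<close>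
  have hor: "ker_differential ?P M2 snd q \<subseteq> {v \<in> tangent_space ?P q. \<forall>w\<in>ker_differential ?P M1 fst q. ?\<gamma> q v w = 0}"
   "ker_differential ?P M1 fst q \<subseteq> {v \<in> tangent_space ?P q. \<forall>w\<in>ker_differential ?P M2 snd q. ?\<gamma> q v w = 0}"
   using orth0[OF q] orth1[OF q] by (auto simp: ker_differential_def)
  show "\<exists>l>0. \<forall>v\<in>ker_differential ?P M2 snd q. \<forall>w\<in>ker_differential ?P M2 snd q.
    g1 (fst q) (differential ?P M1 fst q v) (differential ?P M1 fst q w) = l * ?\<gamma> q v w"
   using sub(1) \<gamma>(1) g12(1) q hor(1) unfolding conformal_submersion_def Let_def by (meson subsetD)
  show "\<exists>l>0. \<forall>v\<in>ker_differential ?P M1 fst q. \<forall>w\<in>ker_differential ?P M1 fst q.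
    g2 (snd q) (differential ?P M2 snd q v) (differential ?P M2 snd q w) = l * ?\<gamma> q v w"
   using sub(2) \<gamma>(1) g12(2) q hor(2) unfolding conformal_submersion_def Let_def by (meson subsetD)
 qed
 interpret F1: embedded_factor M g ?P \<Phi> c ?d M1 M2 H fst snd d1 d2 fst snd g1
 proof
  show "\<exists>K. \<forall>x::'e \<times> 'e. norm (fst x) \<le> norm x * K" "\<exists>K. \<forall>x::'e \<times> 'e. norm (snd x) \<le> norm x * K"
   by (rule bounded_linear.bounded[OF bounded_linear_fst] bounded_linear.bounded[OF bounded_linear_snd])+
  show "smooth_map_on ?P (points ?P) M1 fst" "smooth_map_on ?P (points ?P) M2 snd"
   using sub by (simp_all add: conformal_submersion_def)
  show "\<exists>w\<in>model ?P. fst w = a \<and> snd w = 0" if "a \<in> model M1" for a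
   using that subspace_0[OF M2.model] by (intro bexI[of _ "(a, 0)"]) (simp_all add: model_prod)
  show "riemannian_metric M1 g1" by (rule conformal_class_metric[OF cs(1) g12(1)])
 qed (use emb ca d d1 d2 dims HK conf in \<open>auto simp: cdom_pchart cmap_pchart model_prod prod_eq_iff\<close>)
 interpret F2: embedded_factor M g ?P \<Phi> c ?d M2 M1 K snd fst d2 d1 snd fst g2
 proof
  show "\<exists>K. \<forall>x::'e \<times> 'e. norm (fst x) \<le> norm x * K" "\<exists>K. \<forall>x::'e \<times> 'e. norm (snd x) \<le> norm x * K"
   by (rule bounded_linear.bounded[OF bounded_linear_fst] bounded_linear.bounded[OF bounded_linear_snd])+
  show "smooth_map_on ?P (points ?P) M1 fst" "smooth_map_on ?P (points ?P) M2 snd"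
   using sub by (simp_all add: conformal_submersion_def)
  show "\<exists>w\<in>model ?P. snd w = a \<and> fst w = 0" if "a \<in> model M2" for a
   using that subspace_0[OF M1.model] by (intro bexI[of _ "(0, a)"]) (simp_all add: model_prod)
  show "riemannian_metric M2 g2" by (rule conformal_class_metric[OF cs(2) g12(2)])
 qed (use d1 d2 dims HK conf in \<open>auto simp: cdom_pchart cmap_pchart model_prod prod_eq_iff\<close>)
 \<comment> \<open>Both instances use the same charts and thus the same \<psi>; exchanging the
   projections exchanges \<open>f\<close> and \<open>h\<close>.\<close>
 have fh: "F2.f = F1.h" "F2.h = F1.f" by (simp_all add: fun_eq_iff F1.f_def F1.h_def F2.f_def F2.h_def)
 obtain B where B: "half_product_chart M g c F1.V H (model M1) B F1.f F1.h" using F1.half_product by blast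
 obtain A where A: "half_product_chart M g c F1.V K (model M2) A F1.h F1.f" using F2.half_product unfolding fh by blast
 have "product_chart M g c F1.V H K (model M1) B (model M2) A F1.f F1.h"
 proof (rule product_chart.intro[OF B A product_chart_axioms.intro])
  fix y v w assume y: "y \<in> F1.V" and v: "v \<in> H (cinv c y)" and w: "w \<in> K (cinv c y)"
  obtain v' where v': "v' \<in> ker_differential ?P M2 snd (F1.\<Psi> (cinv c y))" "v = differential ?P M \<Phi> (F1.\<Psi> (cinv c y)) v'"
   using F1.H_lift[OF y v] by metis
  obtain w' where w': "w' \<in> ker_differential ?P M1 fst (F1.\<Psi> (cinv c y))" "w = differential ?P M \<Phi> (F1.\<Psi> (cinv c y)) w'"
   using F2.H_lift[OF y w] by metis
  show "g (cinv c y) v w = 0"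
   using orth1[OF F1.V_point(3)[OF y] w'(1) v'(1)] F1.V_point(4)[OF y] by (simp add: pullback_def v'(2) w'(2))
 qed
 moreover have "cmap c x \<in> F1.V"
  using F1.V_mem[of q0] ca d1 d2 q0 by (simp add: ab cdom_pchart)
 ultimately show ?thesis by blast
qed

theorem local_product_conformal_foliations:
 assumes C: "C \<in> conformal_structures M" and g: "g \<in> C" and lp: "local_conformal_product M C (H, K)"
 shows "orthogonal_splitting M C (H, K) \<and> (\<exists>\<theta>. conformal_foliations M g \<theta> H K)"
proof -
 interpret riemannian M g by unfold_locales (rule conformal_class_metric[OF C g])
 have ext: "H \<in> extensional (points M)" "K \<in> extensional (points M)" using lp by (simp_all add: local_conformal_product_def)
 note pc = local_product_chart[OF C g lp]
 have o: "orth_splitting M H K g" by (rule product_charts_splitting[OF ext pc])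
 interpret orth_splitting M H K g by (rule o)
 have "conformal_foliations M g glued H K"
  by (rule conformal_foliations_glued[OF pc])
 then show ?thesis using orthogonal_splittingI[OF C ext g o] by blast
qed

end

section \<open>Straightening conformal foliations\<close>

context manifold
begin

text \<open>One cut-off serves all coordinate expressions. Multiplying by it keeps the values in
  \<open>H\<close>, so local sections of a distribution extend to global sections.\<close>

lemma local_section:
 assumes c: "c \<in> atlas M" and V: "open V" "y0 \<in> V" "V \<subseteq> cimg c"
 obtains V' X where "open V'" "y0 \<in> V'" "V' \<subseteq> V"
  "!!e. smooth_on V e ==> X e \<in> vector_fields M" "!!e y. y \<in> V' ==> X e (cinv c y) c = e y"
  "!!e H. smooth_on V e ==> smooth_distribution M H ==>
   (!!y. y \<in> V ==> coord_vec M c (e y) (cinv c y) \<in> H (cinv c y)) ==> X e \<in> sections M H"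
proof -
 obtain V' h where V': "open V'" "y0 \<in> V'" "V' \<subseteq> V" and h1: "!!y. y \<in> V' ==> h (cinv c y) = 1"
  and h0: "!!x. h x \<noteq> 0 ==> x \<in> cdom c \<and> cmap c x \<in> V"
  and vf: "!!e. smooth_on V e ==> ext_field h c e \<in> vector_fields M"
  using extend_field[OF c V] by metis
 show thesis
 proof (rule that[of V' "ext_field h c", OF V' vf])
  show "ext_field h c e (cinv c y) c = e y" if "y \<in> V'" for e y
   using ext_field_component[OF c, of y h e] h1[OF that] that V'(3) V(3) by blast
  fix e H assume e: "smooth_on V e" and H: "smooth_distribution M H"
   and mem: "!!y. y \<in> V ==> coord_vec M c (e y) (cinv c y) \<in> H (cinv c y)"
  have "ext_field h c e x \<in> H x" if x: "x \<in> points M" for x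
  proof (cases "h x = 0")
   case True
   then show ?thesis using distribution_zero[OF H x] x by (simp add: ext_field_def)
  next
   case False
   then have *: "x \<in> cdom c" "cmap c x \<in> V" using h0 by blast+
   have "coord_vec M c (e (cmap c x)) x \<in> H x" using mem[OF *(2)] cinv_cmap[OF c *(1)] by simp
   then show ?thesis using distribution_scale[OF H x] x by (simp add: ext_field_def)
  qed
  then show "ext_field h c e \<in> sections M H" using vf[OF e] by (simp add: sections_def)
 qed
qed

lemma local_bracket:
 assumes c: "c \<in> atlas M" and V: "open V" "V \<subseteq> cimg c" and y: "y \<in> V"
  and X: "!!z. z \<in> V ==> X (cinv c z) c = a z" and Y: "!!z. z \<in> V ==> Y (cinv c z) c = b z"
 shows "bracket M X Y (cinv c y) c = ddir b y (a y) - ddir a y (b y)"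
proof -
 have yc: "y \<in> cimg c" using y V by blast
 show ?thesis
  using ddir_cong[OF V(1) y X] ddir_cong[OF V(1) y Y] X[OF y] Y[OF y]
  by (simp add: bracket_component[OF cimg_charts_at[OF c yc]] cimg_cinv(2)[OF yc])
qed

text \<open>\<open>involutive\<close> quantifies over global sections; local ones are cut off around
  the point, which leaves the bracket there unchanged.\<close>

lemma involutive_local:
 assumes H: "smooth_distribution M H" and inv: "involutive M H" and c: "c \<in> atlas M"
  and W: "open W" "W \<subseteq> cimg c" and X: "smooth_on W X" and Y: "smooth_on W Y"
  and XH: "!!z. z \<in> W ==> X z \<in> (%v. v c) ` H (cinv c z)" and YH: "!!z. z \<in> W ==> Y z \<in> (%v. v c) ` H (cinv c z)"
  and y: "y \<in> W"
 shows "ddir Y y (X y) - ddir X y (Y y) \<in> (%v. v c) ` H (cinv c y)"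
proof -
 obtain V' F where V': "open V'" "y \<in> V'" "V' \<subseteq> W" and Fc: "!!e z. z \<in> V' ==> F e (cinv c z) c = e z"
  and FH: "!!e. smooth_on W e ==> (!!y. y \<in> W ==> coord_vec M c (e y) (cinv c y) \<in> H (cinv c y)) ==> F e \<in> sections M H"
  using local_section[OF c W(1) y W(2)] H by metis
 have mem: "coord_vec M c u (cinv c z) \<in> H (cinv c z)" if zW: "z \<in> W" and u: "u \<in> (%v. v c) ` H (cinv c z)" for z u
 proof -
  have z: "z \<in> cimg c" using zW W by blast
  obtain v where v: "v \<in> H (cinv c z)" "u = v c" using u by blast
  have "v \<in> tangent_space M (cinv c z)" by (rule distribution_tangent[OF H cimg_points[OF c z] v(1)])
  then have "coord_vec M c u (cinv c z) = v" using tangent_coord_vec[OF _ cimg_charts_at[OF c z]] v(2) by simp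
  then show ?thesis using v(1) by simp
 qed
 have s: "F X \<in> sections M H" "F Y \<in> sections M H"
  by (rule FH[OF X], blast intro: mem XH, rule FH[OF Y], blast intro: mem YH)
 have "bracket M (F X) (F Y) (cinv c y) \<in> H (cinv c y)"
  using inv s cimg_points[OF c] y W(2) unfolding involutive_def by blast
 moreover have "bracket M (F X) (F Y) (cinv c y) c = ddir Y y (X y) - ddir X y (Y y)"
  by (rule local_bracket[where X = "F X" and Y = "F Y" and a = X and b = Y, OF c V'(1) order_trans[OF V'(3) W(2)] V'(2) Fc Fc])
 ultimately show ?thesis by (metis imageI)
qed

end

text \<open>\<open>G\<close> are coordinates on \<open>V\<close>, with inverse \<open>\<gamma>\<close>, which map \<open>H\<close> and \<open>K\<close> to the constant
 distributions \<open>E\<close> and \<open>F\<close>.\<close>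

locale straightened = orth_splitting M H K g
 for M :: "('a, 'e::euclidean_space) mfd" and H K g +
 fixes c V W and G \<gamma> :: "'e => 'e" and E F
 assumes c: "c \<in> atlas M" and V: "open V" "V \<subseteq> cimg c" and W: "open W"
  and homeo: "homeomorphism V W G \<gamma>" and G: "smooth_on V G" and \<gamma>: "smooth_on W \<gamma>"
  and E: "subspace E" and F: "subspace F"
  and H_iff: "!!y v. y \<in> V ==> v \<in> tangent_space M (cinv c y) ==> v \<in> H (cinv c y) \<longleftrightarrow> ddir G y (v c) \<in> E"
  and K_iff: "!!y v. y \<in> V ==> v \<in> tangent_space M (cinv c y) ==> v \<in> K (cinv c y) \<longleftrightarrow> ddir G y (v c) \<in> F"
begin

lemma swap': "straightened M K H g c V W G \<gamma> F E"
proof -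
 interpret s: orth_splitting M K H g by (rule orth_swap)
 show ?thesis by unfold_locales (fact c V W homeo G \<gamma> E F K_iff H_iff)+
qed

lemma G_W: "y \<in> V ==> G y \<in> W" and \<gamma>_V: "w \<in> W ==> \<gamma> w \<in> V"
 and \<gamma>_G: "y \<in> V ==> \<gamma> (G y) = y" and G_\<gamma>: "w \<in> W ==> G (\<gamma> w) = w"
 using homeo by (auto simp: homeomorphism_def)

lemma V_at: "y \<in> V ==> y \<in> cimg c" "y \<in> V ==> c \<in> charts_at M (cinv c y)" "y \<in> V ==> cinv c y \<in> points M" "y \<in> V ==> cmap c (cinv c y) = y"
 using V(2) cimg_charts_at[OF c] cimg_points[OF c] cimg_cinv(2) by blast+

lemma dG: "y \<in> V ==> G differentiable (at y)" and d\<gamma>: "w \<in> W ==> \<gamma> differentiable (at w)"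
 using smooth_on_diffble[OF G V(1)] smooth_on_diffble[OF \<gamma> W] by blast+

lemma linear_d\<gamma>: "w \<in> W ==> linear (ddir \<gamma> w)"
 using bounded_linear_ddir[OF d\<gamma>] bounded_linear.linear by blast

lemma dG_d\<gamma>: assumes y: "y \<in> V" shows "ddir G y (ddir \<gamma> (G y) a) = a"
proof -
 have "ddir G y (ddir \<gamma> (G y) a) = ddir (%w. G (\<gamma> w)) (G y) a"
  using ddir_compose[OF d\<gamma>[OF G_W[OF y]], of G a] dG[OF y] by (simp add: \<gamma>_G[OF y])
 also have "\<dots> = ddir (%w. w) (G y) a" by (rule ddir_cong[OF W G_W[OF y] G_\<gamma>])
 finally show ?thesis by (simp add: ddir_bounded_linear[OF bounded_linear_ident])
qed

text \<open>The coefficients of \<open>g\<close> in the straightened coordinates.\<close>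

definition k where "k w a b = gch c (\<gamma> w) (ddir \<gamma> w a) (ddir \<gamma> w b)"

lemma k_smooth: "smooth_on W (%w. k w a b)"
 unfolding k_def
proof (rule smooth_on_apply2[where B = "%w. gch c (\<gamma> w)"])
 show "smooth_on W (%w. gch c (\<gamma> w) u v)" for u v
  by (rule smooth_on_compose[OF \<gamma> gch_smooth[OF c]]) (use \<gamma>_V V_at(1) in blast)
 show "linear (%u. gch c (\<gamma> w) u v)" "linear (gch c (\<gamma> w) v)" if "w \<in> W" for w v
  using gch_linear1[OF c V_at(1)[OF \<gamma>_V[OF that]]] gch_linear2[OF c V_at(1)[OF \<gamma>_V[OF that]]] by blast+
qed (rule smooth_on_ddir[OF \<gamma> W])+

lemma k_linear1: assumes w: "w \<in> W" shows "linear (%a. k w a b)"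
 unfolding k_def using linear_compose[OF linear_d\<gamma>[OF w] gch_linear1[OF c V_at(1)[OF \<gamma>_V[OF w]]]] by (simp add: o_def)

lemma k_sym: "w \<in> W ==> k w a b = k w b a"
 unfolding k_def by (rule gch_sym[OF c V_at(1)[OF \<gamma>_V]])

lemma d\<gamma>_nonzero: assumes w: "w \<in> W" and a: "a \<noteq> 0" shows "ddir \<gamma> w a \<noteq> 0"
 using dG_d\<gamma>[OF \<gamma>_V[OF w], of a] a by (auto simp: G_\<gamma>[OF w] ddir_zero)

lemma k_pos: "w \<in> W ==> a \<noteq> 0 ==> k w a a > 0"
 unfolding k_def by (rule gch_pos[OF c V_at(1)[OF \<gamma>_V] d\<gamma>_nonzero])

lemma straight_mem:
 assumes y: "y \<in> V"
 shows "a \<in> E ==> coord_vec M c (ddir \<gamma> (G y) a) (cinv c y) \<in> H (cinv c y)"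
  "a \<in> F ==> coord_vec M c (ddir \<gamma> (G y) a) (cinv c y) \<in> K (cinv c y)"
 using H_iff[OF y cv_tangent[OF c V_at(1)[OF y]]] K_iff[OF y cv_tangent[OF c V_at(1)[OF y]]]
  coord_vec_self[OF V_at(2)[OF y]] dG_d\<gamma>[OF y] by simp_all

lemma k_orth: assumes w: "w \<in> W" and a: "a \<in> E" and b: "b \<in> F" shows "k w a b = 0"
 using orth[OF V_at(3) straight_mem(1)[OF _ a] straight_mem(2)[OF _ b], OF \<gamma>_V[OF w] \<gamma>_V[OF w] \<gamma>_V[OF w]]
 by (simp add: k_def gch_def G_\<gamma>[OF w])

text \<open>Constant vectors of the straightened coordinates give commuting fields; behind this is
  the symmetry of the second derivative of \<gamma>.\<close>

lemma straight_commute: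
 assumes y: "y \<in> V"
 shows "ddir (%z. ddir \<gamma> (G z) b) y (ddir \<gamma> (G y) a) = ddir (%z. ddir \<gamma> (G z) a) y (ddir \<gamma> (G y) b)"
proof -
 have "ddir (%z. ddir \<gamma> (G z) b) y (ddir \<gamma> (G y) a) = ddir (%w. ddir \<gamma> w b) (G y) a" for a b
  using ddir_compose[OF dG[OF y] smooth_on_diffble[OF smooth_on_ddir[OF \<gamma> W] W G_W[OF y]], of b "ddir \<gamma> (G y) a"]
  by (simp add: dG_d\<gamma>[OF y])
 then show ?thesis using ddir_commute[OF \<gamma> W G_W[OF y], of b a] by simp
qed

text \<open>Apply the hypothesis to the coordinate fields of \<open>e\<close>, \<open>a\<close> and
  \<open>b\<close>, cut off to global sections. Their brackets vanish, so the Lie derivative reduces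
  to the derivative of a coefficient of \<open>g\<close>.\<close>

lemma k_conformal:
 assumes conf: "conformal_along M g \<theta> K H" and w: "w \<in> W" and a: "a \<in> E" and b: "b \<in> E" and e: "e \<in> F"
 shows "ddir (%w. k w a b) w e = \<theta> (cinv c (\<gamma> w)) (coord_vec M c (ddir \<gamma> w e) (cinv c (\<gamma> w))) * k w a b"
proof -
 define y where "y = \<gamma> w"
 have y: "y \<in> V" and Gy: "G y = w" using \<gamma>_V[OF w] G_\<gamma>[OF w] by (simp_all add: y_def)
 define s where "s a z = ddir \<gamma> (G z) a" for a z
 have sV: "smooth_on V (s a)" for a
  unfolding s_def[abs_def] by (rule smooth_on_compose[OF G smooth_on_ddir[OF \<gamma> W]]) (use G_W in blast)
 obtain V' X where V': "open V'" "y \<in> V'" "V' \<subseteq> V" and Xc: "!!e z. z \<in> V' ==> X e (cinv c z) c = e z"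
  and XH: "!!e H. smooth_on V e ==> smooth_distribution M H ==>
   (!!y. y \<in> V ==> coord_vec M c (e y) (cinv c y) \<in> H (cinv c y)) ==> X e \<in> sections M H"
  by (rule local_section[OF c V(1) y V(2)]) blast
 have A: "X (s a) \<in> sections M H" by (rule XH[OF sV H]) (use straight_mem(1)[OF _ a] in \<open>simp add: s_def\<close>)
 have B: "X (s b) \<in> sections M H" by (rule XH[OF sV H]) (use straight_mem(1)[OF _ b] in \<open>simp add: s_def\<close>)
 have Z: "X (s e) \<in> sections M K" by (rule XH[OF sV K]) (use straight_mem(2)[OF _ e] in \<open>simp add: s_def\<close>)
 let ?x = "cinv c y"
 have V'c: "V' \<subseteq> cimg c" using V' V by blast
 note x = V_at(3)[OF y] and ch = V_at(2)[OF y] and cx = V_at(4)[OF y]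
 have br: "bracket M (X (s e)) (X (s u)) ?x = tzero" if "X (s u) \<in> vector_fields M" for u
 proof (rule tangent_eqI[OF bracket_tangent[OF sectionD(1)[OF Z] that x] tangent_zero ch])
  have "bracket M (X (s e)) (X (s u)) ?x c = ddir (s u) y (s e y) - ddir (s e) y (s u y)"
   by (rule local_bracket[where X = "X (s e)" and Y = "X (s u)", OF c V'(1) V'c V'(2) Xc Xc])
  then show "bracket M (X (s e)) (X (s u)) ?x c = 0" using straight_commute[OF y, of u e] by (simp add: s_def[abs_def])
 qed
 have zero: "g ?x tzero v = 0" "g ?x v tzero = 0" if "v \<in> tangent_space M ?x" for v
 proof -
  show 1: "g ?x tzero v = 0" using metric_scale[OF x that that that, of 0] by simp
  show "g ?x v tzero = 0" using metric_sym[OF x that tangent_zero that] 1 by simp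
 qed
 have gk: "g (cinv c z) (X (s a) (cinv c z)) (X (s b) (cinv c z)) = k (G z) a b" if z: "z \<in> V'" for z
 proof -
  have zV: "z \<in> V" using z V' by blast
  show ?thesis
   using metric_gch[OF V_at(2)[OF zV] field_tangent[OF sectionD(1)[OF A] V_at(3)[OF zV]] field_tangent[OF sectionD(1)[OF B] V_at(3)[OF zV]]]
   by (simp add: Xc[OF z] V_at(4)[OF zV] k_def s_def \<gamma>_G[OF zV])
 qed
 have "deriv_along M (X (s e)) (%z. g z (X (s a) z) (X (s b) z)) ?x =
   ddir (%z. g (cinv c z) (X (s a) (cinv c z)) (X (s b) (cinv c z))) y (s e y)"
 proof -
  have "(%z. g (cinv c z) (X (s a) (cinv c z)) (X (s b) (cinv c z))) differentiable (at (cmap c ?x))"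
   using smooth_on_diffble[OF metric_fields_smooth[OF sectionD(1)[OF A] sectionD(1)[OF B] c] cimg_open[OF c] V_at(1)[OF y]]
   by (simp add: cx)
  from deriv_along_chart[where f = "%z. g z (X (s a) z) (X (s b) z)", OF sectionD(1)[OF Z] ch this]
  show ?thesis by (simp add: cx Xc[OF V'(2)])
 qed
 also have "\<dots> = ddir (%z. k (G z) a b) y (s e y)" by (rule ddir_cong[OF V'(1,2) gk])
 also have "\<dots> = ddir (%w. k w a b) w e"
  using ddir_compose[OF dG[OF y] smooth_on_diffble[OF k_smooth W G_W[OF y]], of a b "s e y"]
  by (simp add: Gy s_def dG_d\<gamma>[OF y, unfolded Gy])
 finally have "lie_metric M g (X (s e)) (X (s a)) (X (s b)) ?x = ddir (%w. k w a b) w e"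
  unfolding lie_metric_def using br sectionD(1)[OF A] sectionD(1)[OF B] field_tangent[OF _ x] by (simp add: zero)
 moreover have "lie_metric M g (X (s e)) (X (s a)) (X (s b)) ?x = \<theta> ?x (X (s e) ?x) * g ?x (X (s a) ?x) (X (s b) ?x)"
  using conf Z A B x unfolding conformal_along_def by blast
 moreover have "X (s e) ?x = coord_vec M c (ddir \<gamma> w e) ?x"
  using tangent_coord_vec[OF field_tangent[OF sectionD(1)[OF Z] x] ch] Xc[OF V'(2), of "s e"] by (simp add: s_def Gy)
 ultimately show ?thesis using gk[OF V'(2)] by (simp add: Gy flip: y_def)
qed

text \<open>Along the segment all coefficients on \<open>E\<close> satisfy the same linear equation,
  whose factor \<theta> is independent of \<open>a\<close> and \<open>b\<close>; so their quotients
  have derivative 0. \<open>a0\<close> supplies a denominator that stays positive.\<close>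

lemma k_ratio:
 assumes conf: "conformal_along M g \<theta> K H" and seg: "closed_segment w w' \<subseteq> W" and d: "w' - w \<in> F"
  and a0: "a0 \<in> E" "a0 \<noteq> 0"
 shows "\<exists>l>0. \<forall>a\<in>E. \<forall>b\<in>E. k w' a b = l * k w a b"
proof -
 have ww: "w \<in> W" "w' \<in> W" using seg by auto
 have "k w' a b / k w' a0 a0 = k w a b / k w a0 a0" if a: "a \<in> E" and b: "b \<in> E" for a b
 proof -
  let ?p = "%t. w + t *\<^sub>R (w' - w)"
  have pW: "?p t \<in> W" if "t \<in> {0..1}" for t
  proof -
   have "?p t = (1 - t) *\<^sub>R w + t *\<^sub>R w'" by (simp add: algebra_simps)
   then have "?p t \<in> closed_segment w w'" using that by (auto simp: closed_segment_def)
   then show ?thesis using seg by blast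
  qed
  have der: "((%t. k (?p t) u v) has_real_derivative \<theta> (cinv c (\<gamma> (?p t))) (coord_vec M c (ddir \<gamma> (?p t) (w' - w)) (cinv c (\<gamma> (?p t)))) * k (?p t) u v) (at t within {0..1})"
   if t: "t \<in> {0..1}" and u: "u \<in> E" and v: "v \<in> E" for t u v
  proof -
   have 1: "(?p has_derivative (%s. s *\<^sub>R (w' - w))) (at t within {0..1})" by (auto intro!: derivative_eq_intros)
   have "((%t. k (?p t) u v) has_derivative (%s. ddir (%w. k w u v) (?p t) (s *\<^sub>R (w' - w)))) (at t within {0..1})"
    by (rule has_derivative_compose[OF 1 smooth_on_has_derivative[OF k_smooth W pW[OF t]]])
   moreover have "ddir (%w. k w u v) (?p t) (s *\<^sub>R (w' - w)) = s * ddir (%w. k w u v) (?p t) (w' - w)" for s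
    using linear_scale[OF bounded_linear.linear[OF bounded_linear_ddir[OF smooth_on_diffble[OF k_smooth W pW[OF t]]]]] by simp
   ultimately have "((%t. k (?p t) u v) has_derivative (%s. s * ddir (%w. k w u v) (?p t) (w' - w))) (at t within {0..1})" by simp
   moreover have "(%s. s * r) = (*) r" for r :: real by (simp add: fun_eq_iff mult.commute)
   ultimately show ?thesis
    unfolding has_field_derivative_def k_conformal[OF conf pW[OF t] u v d] by simp
  qed
  have "((%t. k (?p t) a b / k (?p t) a0 a0) has_real_derivative 0) (at t within {0..1})" if t: "t \<in> {0..1}" for t
  proof -
   have "k (?p t) a0 a0 \<noteq> 0" using k_pos[OF pW[OF t] a0(2)] by simp
   from DERIV_divide[OF der[OF t a b] der[OF t a0(1) a0(1)] this] show ?thesis by (simp add: algebra_simps)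
  qed
  then have "k (?p 1) a b / k (?p 1) a0 a0 = k (?p 0) a b / k (?p 0) a0 a0"
   using has_field_derivative_zero_constant[of "{0..1::real}" "%t. k (?p t) a b / k (?p t) a0 a0"]
   by (metis (no_types, lifting) atLeastAtMost_iff convex_real_interval(5) order_refl zero_le_one)
  then show ?thesis by simp
 qed
 moreover have "k w' a0 a0 > 0" "k w a0 a0 > 0" using k_pos ww a0 by blast+
 ultimately show ?thesis
  by (intro exI[of _ "k w' a0 a0 / k w a0 a0"]) (simp add: field_simps)
qed

end

context orth_splitting
begin

text \<open>The projections \<open>prj c y\<close> bring the splitting into the form of
  \<open>frobenius_pair\<close>; the constant subspaces are the fibres at the centre
  \<open>y0\<close>.\<close>

lemma straightening:
 assumes inv: "involutive M H" "involutive M K" and c: "c \<in> atlas M" and y0: "y0 \<in> cimg c"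
 obtains V W G \<gamma> where "y0 \<in> V" "straightened M H K g c V W G \<gamma> (hc c y0) (kc c y0)"
proof -
 have e: "prj c y u = u \<longleftrightarrow> u \<in> hc c y" "prj c y u = 0 \<longleftrightarrow> u \<in> kc c y" if "y \<in> cimg c" for y u
  using prj_eq_iff[OF c that] prj_zero_iff[OF c that] by blast+
 have i1: "prj c y (ddir Y y (X y) - ddir X y (Y y)) = ddir Y y (X y) - ddir X y (Y y)"
  if W: "open W" "W \<subseteq> cimg c" and XY: "smooth_on W X" "smooth_on W Y"
   and *: "!!z. z \<in> W ==> prj c z (X z) = X z" "!!z. z \<in> W ==> prj c z (Y z) = Y z" and y: "y \<in> W" for W X Y y
 proof -
  have "ddir Y y (X y) - ddir X y (Y y) \<in> (%v. v c) ` H (cinv c y)"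
   by (rule involutive_local[OF H inv(1) c W XY _ _ y]) (use *(1) *(2) e(1) W(2) in \<open>simp_all add: subset_iff flip: hc_def\<close>)
  then show ?thesis using e(1)[of y] y W(2) by (auto simp: hc_def)
 qed
 have i2: "prj c y (ddir Y y (X y) - ddir X y (Y y)) = 0"
  if W: "open W" "W \<subseteq> cimg c" and XY: "smooth_on W X" "smooth_on W Y"
   and *: "!!z. z \<in> W ==> prj c z (X z) = 0" "!!z. z \<in> W ==> prj c z (Y z) = 0" and y: "y \<in> W" for W X Y y
 proof -
  have "ddir Y y (X y) - ddir X y (Y y) \<in> (%v. v c) ` K (cinv c y)"
   by (rule involutive_local[OF K inv(2) c W XY _ _ y]) (use *(1) *(2) e(2) W(2) in \<open>simp_all add: subset_iff flip: kc_def\<close>)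
  then show ?thesis using e(2)[of y] y W(2) by (auto simp: kc_def)
 qed
 have "\<exists>V W G \<gamma>. open V \<and> y0 \<in> V \<and> V \<subseteq> cimg c \<and> open W \<and> homeomorphism V W G \<gamma> \<and> smooth_on V G \<and> smooth_on W \<gamma> \<and>
   (\<forall>y\<in>V. \<forall>u. (prj c y u = u \<longleftrightarrow> prj c y0 (ddir G y u) = ddir G y u) \<and> (prj c y u = 0 \<longleftrightarrow> prj c y0 (ddir G y u) = 0))"
 proof (rule frobenius_pair[of "cimg c" y0 "prj c"])
  show "open (cimg c)" "y0 \<in> cimg c" by (rule cimg_open[OF c] y0)+
  show "smooth_on (cimg c) (%y. prj c y v)" for v by (rule prj_smooth[OF c])
  show "linear (prj c y)" if "y \<in> cimg c" for y by (rule linear_prj[OF c that])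
  show "prj c y (prj c y v) = prj c y v" if "y \<in> cimg c" for y v by (rule prj_prj[OF c that])
  fix V W G \<gamma> assume *: "open V" "y0 \<in> V" "V \<subseteq> cimg c" "open W" "homeomorphism V W G \<gamma>" "smooth_on V G" "smooth_on W \<gamma>"
   "!!y u. y \<in> V ==> prj c y u = u \<longleftrightarrow> prj c y0 (ddir G y u) = ddir G y u"
   "!!y u. y \<in> V ==> prj c y u = 0 \<longleftrightarrow> prj c y0 (ddir G y u) = 0"
  show ?thesis
   by (intro exI[of _ V] exI[of _ W] exI[of _ G] exI[of _ \<gamma>] conjI ballI allI) (fact * | erule *)+
 qed (rule i1 i2; assumption)+
 then obtain V W G \<gamma> where V: "open V" "y0 \<in> V" "V \<subseteq> cimg c" and W: "open W" and h: "homeomorphism V W G \<gamma>"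
  and G: "smooth_on V G" and \<gamma>: "smooth_on W \<gamma>"
  and iff: "!!y u. y \<in> V ==> prj c y u = u \<longleftrightarrow> prj c y0 (ddir G y u) = ddir G y u"
  "!!y u. y \<in> V ==> prj c y u = 0 \<longleftrightarrow> prj c y0 (ddir G y u) = 0" by metis
 have "straightened M H K g c V W G \<gamma> (hc c y0) (kc c y0)"
 proof
  fix y v assume y: "y \<in> V" and v: "v \<in> tangent_space M (cinv c y)"
  have yc: "y \<in> cimg c" using y V by blast
  have "v \<in> H (cinv c y) \<longleftrightarrow> v c \<in> hc c y" "v \<in> K (cinv c y) \<longleftrightarrow> v c \<in> kc c y"
   using hc_iff[OF cimg_charts_at[OF c yc] v] kc_iff[OF cimg_charts_at[OF c yc] v] cimg_cinv(2)[OF yc] by simp_all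
  then show "v \<in> H (cinv c y) \<longleftrightarrow> ddir G y (v c) \<in> hc c y0" "v \<in> K (cinv c y) \<longleftrightarrow> ddir G y (v c) \<in> kc c y0"
   using iff[OF y, of "v c"] e[OF yc, of "v c"] e[OF y0, of "ddir G y (v c)"] by simp_all
 qed (fact c V W h G \<gamma> subspace_hc[OF c y0] subspace_kc[OF c y0])+
 then show thesis using that V(2) by blast
qed

end

section \<open>Open subsets of subspaces as manifolds\<close>

definition flat :: "'e::euclidean_space set => 'e set => ('e, 'e) mfd" where
 "flat E S = \<lparr> mtop = top_of_set S, model = E, atlas = {(S, id)} \<rparr>"

lemma flat_simps: "mtop (flat E S) = top_of_set S" "model (flat E S) = E" "atlas (flat E S) = {(S, id)}" "points (flat E S) = S"
 by (simp_all add: flat_def)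

lemma cinv_flat: "y \<in> S ==> cinv (S, id) y = y"
 using inv_into_f_f[of id S y] by (simp add: cinv_def)

lemma smooth_manifold_flat:
 assumes "subspace E" "openin (top_of_set E) S" shows "smooth_manifold (flat E S)"
proof -
 have "second_countable (euclidean :: 'a topology)"
 proof -
  obtain B :: "'a set set" where B: "countable B" "!!C. C \<in> B ==> open C" "!!S. open S ==> \<exists>U. U \<subseteq> B \<and> S = \<Union>U"
   using univ_second_countable by blast
  have "\<exists>V\<in>B. x \<in> V \<and> V \<subseteq> U" if U: "open U" "x \<in> U" for U x
   using B(3)[OF U(1)] U(2) by blast
  then show ?thesis unfolding second_countable_def using B(1,2) by (intro exI[of _ B]) simp
 qed
 moreover have "smooth_on S (id \<circ> cinv (S, id))"
  using smooth_on_ident[of S] smooth_on_cong[of S "id \<circ> cinv (S, id)" "%x. x"] cinv_flat[of _ S] by simp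
 ultimately show ?thesis
  using assms by (simp add: smooth_manifold_def flat_simps Hausdorff_space_subtopology second_countable_subtopology
    subtopology_subtopology homeomorphic_map_id)
qed

text \<open>The map \<open>L\<close> is there for products, where the form is evaluated at the sum
  of the two components; injectivity on the model space then preserves positivity.\<close>

lemma chart_metric:
 assumes N: "charted N" and at: "atlas N = {e}"
  and g: "!!x v w. x \<in> points N ==> v \<in> tangent_space N x ==> w \<in> tangent_space N x ==> g x v w = B (cmap e x) (L (v e)) (L (w e))"
  and L: "linear L" "!!u. u \<in> model N ==> L u = 0 ==> u = 0"
  and B: "!!y a. y \<in> cmap e ` cdom e ==> linear (%b. B y b a)" "!!y a b. y \<in> cmap e ` cdom e ==> B y a b = B y b a"
   "!!y a. y \<in> cmap e ` cdom e ==> a \<noteq> 0 ==> B y a a > (0::real)" "!!a b. smooth_on (cmap e ` cdom e) (%y. B y a b)"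
 shows "riemannian_metric N g"
proof -
 interpret charted_space N by unfold_locales (rule N)
 have ch: "e \<in> charts_at N x" if "x \<in> points N" for x using chart_exists[OF that] at by (auto simp: charts_at_def)
 have im: "cmap e x \<in> cmap e ` cdom e" if "x \<in> points N" for x using charts_atD(2)[OF ch[OF that]] by blast
 show ?thesis
  unfolding riemannian_metric_def
 proof (intro conjI ballI allI impI)
  fix x u v w r assume x: "x \<in> points N" and t: "u \<in> tangent_space N x" "v \<in> tangent_space N x" "w \<in> tangent_space N x"
  note l = B(1)[OF im[OF x]]
  show "g x (tadd u v) w = g x u w + g x v w"
   using t by (simp add: g x tangent_add linear_add[OF L(1)] linear_add[OF l])
  show "g x (tscale r u) w = r * g x u w"
   using t by (simp add: g x tangent_scale linear_scale[OF L(1)] linear_scale[OF l])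
  show "g x u v = g x v u" using t B(2)[OF im[OF x]] by (simp add: g x)
  assume "u \<noteq> tzero"
  then have "u e \<noteq> 0" using tangent_eqI[OF t(1) tangent_zero ch[OF x]] by blast
  then show "g x u u > 0" using t L(2)[OF tangent_model[OF t(1) ch[OF x]]] B(3)[OF im[OF x]] by (auto simp: g x)
 next
  fix c a b assume "c \<in> atlas N" and a: "a \<in> model N" and b: "b \<in> model N"
  then have c: "c = e" using at by simp
  have "g (cinv c y) (coord_vec N c a (cinv c y)) (coord_vec N c b (cinv c y)) = B y (L a) (L b)" if y: "y \<in> cmap e ` cdom e" for y
  proof -
   have x: "cinv e y \<in> points N" using cinv_cdom[OF y] cdom_points[of e] at by auto
   show ?thesis
    using a b cmap_cinv[OF y] by (simp add: c g x coord_vec_tangent ch coord_vec_self)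
  qed
  then show "smooth_on (cmap c ` cdom c) (%y. g (cinv c y) (coord_vec N c a (cinv c y)) (coord_vec N c b (cinv c y)))"
   using B(4)[of "L a" "L b"] smooth_on_cong[of "cmap e ` cdom e"] unfolding c by (metis (no_types, lifting))
 qed
qed

text \<open>In the charts \<open>p\<close> is the linear map \<open>L\<close>, and the horizontal
  space is read as the fixed subspace \<open>A\<close>, which \<open>L\<close> maps bijectively. It
  suffices to test one metric of each class.\<close>

lemma linear_conformal_submersion:
 assumes P: "charted P" and N: "charted N" and p: "smooth_map_on P (points P) N p"
  and d: "d \<in> atlas P" "points P = cdom d" and e: "e \<in> atlas N" and L: "bounded_linear L"
  and rep: "!!q. q \<in> cdom d ==> p q \<in> cdom e \<and> cmap e (p q) = L (cmap d q)"
  and C: "C \<in> conformal_structures P" "g \<in> C" and C': "C' \<in> conformal_structures N" "g' \<in> C'"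
  and A: "A \<subseteq> model P" "bij_betw L A (model N)"
  and hor: "!!q v. q \<in> points P ==> v \<in> tangent_space P q ==>
   (\<forall>w\<in>tangent_space P q. L (w d) = 0 \<longrightarrow> g q v w = 0) \<longleftrightarrow> v d \<in> A"
  and conf: "!!q. q \<in> points P ==> \<exists>l>0. \<forall>v\<in>tangent_space P q. \<forall>w\<in>tangent_space P q. v d \<in> A \<longrightarrow> w d \<in> A \<longrightarrow>
   g' (p q) (differential P N p q v) (differential P N p q w) = l * g q v w"
 shows "conformal_submersion P C N C' p"
 unfolding conformal_submersion_def
proof (intro conjI ballI p, unfold Let_def, goal_cases)
 case (1 h h' q)
 interpret charted_map P N "points P" p by unfold_locales (rule P N p)+
 note q = \<open>q \<in> points P\<close>
 have qd: "q \<in> cdom d" using q d by simp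
 have ch: "d \<in> charts_at P q" "e \<in> charts_at N (p q)" using rep[OF qd] qd d e by (simp_all add: charts_at_def)
 obtain f where f: "f > 0" "!!v w. v \<in> tangent_space P q ==> w \<in> tangent_space P q ==> h q v w = f * g q v w"
  using conformal_class_factor[OF C \<open>h \<in> C\<close>] q by metis
 obtain f' where f': "f' > 0" "!!v w. v \<in> tangent_space N (p q) ==> w \<in> tangent_space N (p q) ==> h' (p q) v w = f' * g' (p q) v w"
  using conformal_class_factor[OF C' \<open>h' \<in> C'\<close>] map_points[OF q] by metis
 have comp: "differential P N p q v e = L (v d)" if "v \<in> tangent_space P q" for v
  by (rule differential_linear_component[OF P N p d(1) e L rep qd that])
 have ker: "ker_differential P N p q = {v \<in> tangent_space P q. L (v d) = 0}"
  by (rule ker_differential_linear[OF P N p d(1) e L rep qd])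
 have eq: "{v \<in> tangent_space P q. \<forall>w\<in>ker_differential P N p q. h q v w = 0} = {v \<in> tangent_space P q. v d \<in> A}"
 proof -
  have "(\<forall>w\<in>ker_differential P N p q. h q v w = 0) \<longleftrightarrow> v d \<in> A" if v: "v \<in> tangent_space P q" for v
   using hor[OF q v] f v unfolding ker by auto
  then show ?thesis by blast
 qed
 show ?case
  unfolding eq
 proof
  show "bij_betw (differential P N p q) {v \<in> tangent_space P q. v d \<in> A} (tangent_space N (p q))"
   unfolding bij_betw_def
  proof (intro conjI inj_onI equalityI subsetI)
   fix v w assume v: "v \<in> {v \<in> tangent_space P q. v d \<in> A}" and w: "w \<in> {v \<in> tangent_space P q. v d \<in> A}"
    and eq: "differential P N p q v = differential P N p q w"
   have "L (v d) = L (w d)" using comp[of v] comp[of w] v w eq by simp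
   then have "v d = w d" using A(2) v w by (auto simp: bij_betw_def inj_on_def)
   then show "v = w" using M.tangent_eqI[OF _ _ ch(1)] v w by blast
  next
   fix u assume u: "u \<in> tangent_space N (p q)"
   have "u e \<in> L ` A" using A(2) N.tangent_model[OF u ch(2)] by (simp add: bij_betw_def)
   then obtain a where a: "a \<in> A" "u e = L a" by blast
   let ?v = "coord_vec P d a q"
   have am: "a \<in> model P" using a A(1) by blast
   have v: "?v \<in> tangent_space P q" "?v d = a" by (rule M.coord_vec_tangent[OF ch(1) am]) (rule M.coord_vec_self[OF ch(1) am])
   have "u = differential P N p q ?v"
    by (rule N.tangent_eqI[OF u differential_tangent[OF q v(1)] ch(2)]) (simp add: comp[OF v(1)] v(2) a(2))
   then show "u \<in> differential P N p q ` {v \<in> tangent_space P q. v d \<in> A}" using v a(1) by (intro image_eqI[of _ _ ?v]) simp_all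
  qed (use differential_tangent[OF q] in blast)
  obtain l where l: "l > 0" "!!v w. v \<in> tangent_space P q ==> w \<in> tangent_space P q ==> v d \<in> A ==> w d \<in> A ==>
   g' (p q) (differential P N p q v) (differential P N p q w) = l * g q v w"
   using conf[OF q] by blast
  \<comment> \<open>Passing to \<open>h\<close> and \<open>h'\<close> multiplies the two metrics by
    \<open>f\<close> and \<open>f'\<close>, which turns \<open>l\<close> into
    \<open>f' * l / f\<close>.\<close>
  show "\<exists>l>0. \<forall>v\<in>{v \<in> tangent_space P q. v d \<in> A}. \<forall>w\<in>{v \<in> tangent_space P q. v d \<in> A}.
    h' (p q) (differential P N p q v) (differential P N p q w) = l * h q v w"
   using f l f' differential_tangent[OF q] by (intro exI[of _ "f' * l / f"]) simp
 qed
qed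

section \<open>Conformal foliations are local conformal products\<close>

definition sum_map :: "('a, 'e::euclidean_space) chart => ('e => 'e) => 'e \<times> 'e => 'a" where
 "sum_map c \<gamma> z = cinv c (\<gamma> (fst z + snd z))"

text \<open>\<open>S\<close> and \<open>T\<close> will be balls in the subspaces around the
  components \<open>p0\<close>, \<open>q0\<close> of a point. Convexity keeps the segments along
  which coefficients are compared inside \<open>W\<close>.\<close>

locale product_box = straightened M H K g c V W G \<gamma> E F
 for M :: "('a, 'e::euclidean_space) mfd" and H K g c V W G \<gamma> E F +
 fixes \<pi> S T p0 q0
 assumes \<pi>: "linear \<pi>" "!!u. \<pi> u \<in> E" "!!u. u - \<pi> u \<in> F" and EF: "E \<inter> F = {0}"
  and S: "openin (top_of_set E) S" "convex S" "p0 \<in> S" and T: "openin (top_of_set F) T" "convex T" "q0 \<in> T"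
  and ST: "!!p q. p \<in> S ==> q \<in> T ==> p + q \<in> W" and dims: "dim E \<ge> 1" "dim F \<ge> 1"
begin

abbreviation "M1 \<equiv> flat E S"
abbreviation "M2 \<equiv> flat F T"
abbreviation "Q \<equiv> prod_mfd (flat E S) (flat F T)"
abbreviation "\<kappa> \<equiv> pchart (S, id) (T, id) :: ('e \<times> 'e, 'e \<times> 'e) chart"
abbreviation "\<Phi> \<equiv> sum_map c \<gamma>"

lemma factors: "smooth_manifold M1" "smooth_manifold M2"
 using smooth_manifold_flat E F S T by blast+

lemma charted_Q: "charted Q"
 using charted_prod smooth_manifold_charted factors by blast

lemma Q_simps: "points Q = S \<times> T" "mtop Q = top_of_set (S \<times> T)" "model Q = E \<times> F" "atlas Q = {\<kappa>}" "cdom \<kappa> = S \<times> T" "cmap \<kappa> z = z"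
 by (auto simp: mtop_prod model_prod atlas_prod flat_simps cdom_pchart cmap_pchart map_prod_def split: prod.split)

lemma cmap_\<kappa>: "cmap \<kappa> ` A = A"
 by (simp add: Q_simps(6))

lemma cinv_\<kappa>: "z \<in> S \<times> T ==> cinv \<kappa> z = z"
 using cinv_pchart[of "(S, id)" "(T, id)" "fst z" "snd z"] cinv_flat[of "fst z" S] cinv_flat[of "snd z" T] by auto

lemma split_unique: "p \<in> E ==> q \<in> F ==> \<pi> (p + q) = p"
proof -
 assume p: "p \<in> E" and q: "q \<in> F"
 have "p - \<pi> (p + q) = (p + q - \<pi> (p + q)) - q" by simp
 then have "p - \<pi> (p + q) \<in> F" using subspace_diff[OF F \<pi>(3)[of "p + q"] q] by simp
 then have "p - \<pi> (p + q) \<in> E \<inter> F" using subspace_diff[OF E p \<pi>(2)[of "p + q"]] by (rule IntI[rotated])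
 then show ?thesis unfolding EF by simp
qed

lemma S_E: "S \<subseteq> E" and T_F: "T \<subseteq> F"
 using openin_imp_subset S(1) T(1) by blast+

lemma sum_W: "z \<in> S \<times> T ==> fst z + snd z \<in> W"
 using ST by auto

lemma \<Phi>_V:
 assumes "z \<in> S \<times> T"
 shows "\<gamma> (fst z + snd z) \<in> V" "\<Phi> z \<in> cdom c" "\<Phi> z \<in> points M" "cmap c (\<Phi> z) = \<gamma> (fst z + snd z)" "c \<in> charts_at M (\<Phi> z)"
 unfolding sum_map_def using \<gamma>_V[OF sum_W[OF assms]] V_at charts_atD(2) by blast+

definition unsum where "unsum x = (\<pi> (G (cmap c x)), G (cmap c x) - \<pi> (G (cmap c x)))"

lemma unsum_\<Phi>: "z \<in> S \<times> T ==> unsum (\<Phi> z) = z"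
proof -
 assume z: "z \<in> S \<times> T"
 then have "fst z \<in> E" "snd z \<in> F" using S_E T_F by auto
 from split_unique[OF this] show ?thesis
  by (simp add: unsum_def \<Phi>_V(4)[OF z] G_\<gamma>[OF sum_W[OF z]] prod_eq_iff)
qed

lemma inj_\<Phi>: "inj_on \<Phi> (points Q)"
 by (rule inj_on_inverseI[of _ unsum]) (simp add: Q_simps unsum_\<Phi>)

lemma inv_\<Phi>: "x \<in> \<Phi> ` (S \<times> T) ==> inv_into (points Q) \<Phi> x = unsum x"
 using inv_into_f_f[OF inj_\<Phi>] by (auto simp: Q_simps unsum_\<Phi>)

text \<open>In coordinates the image is a preimage under splitting \<open>G y\<close> along
  \<open>E\<close> and \<open>F\<close>, so openness of the embedding follows from
  continuity.\<close>

lemma \<Phi>_image: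
 "\<Phi> ` (S \<times> T \<inter> O') = cinv c ` {y \<in> V. (\<pi> (G y), G y - \<pi> (G y)) \<in> S \<times> T \<inter> O'}"
proof (intro equalityI subsetI)
 fix x assume "x \<in> \<Phi> ` (S \<times> T \<inter> O')"
 then obtain z where z: "z \<in> S \<times> T" "z \<in> O'" "x = \<Phi> z" by blast
 have "(\<pi> (G (\<gamma> (fst z + snd z))), G (\<gamma> (fst z + snd z)) - \<pi> (G (\<gamma> (fst z + snd z)))) = z"
  using unsum_\<Phi>[OF z(1)] by (simp add: unsum_def \<Phi>_V(4)[OF z(1)])
 then show "x \<in> cinv c ` {y \<in> V. (\<pi> (G y), G y - \<pi> (G y)) \<in> S \<times> T \<inter> O'}"
  using z \<Phi>_V(1)[OF z(1)] by (intro image_eqI[of _ _ "\<gamma> (fst z + snd z)"]) (auto simp: sum_map_def)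
next
 fix x assume "x \<in> cinv c ` {y \<in> V. (\<pi> (G y), G y - \<pi> (G y)) \<in> S \<times> T \<inter> O'}"
 then obtain y where y: "y \<in> V" "(\<pi> (G y), G y - \<pi> (G y)) \<in> S \<times> T \<inter> O'" "x = cinv c y" by blast
 then show "x \<in> \<Phi> ` (S \<times> T \<inter> O')"
  by (intro image_eqI[OF _ y(2)]) (simp add: sum_map_def \<gamma>_G)
qed

lemma bounded_\<pi>: "bounded_linear \<pi>"
 using \<pi>(1) linear_linear by blast

lemma unsum_smooth: "smooth_on V (%y. (\<pi> (G y), G y - \<pi> (G y)))"
 by (intro smooth_on_Pair smooth_on_diff smooth_on_linear_comp[OF bounded_\<pi>] G)

lemma \<Phi>_open: assumes O: "open O'" shows "openin (mtop M) (\<Phi> ` (S \<times> T \<inter> O'))"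
proof -
 obtain S' T' where S': "open S'" "S = E \<inter> S'" and T': "open T'" "T = F \<inter> T'"
  using S(1) T(1) unfolding openin_open by blast
 have "{y \<in> V. (\<pi> (G y), G y - \<pi> (G y)) \<in> S \<times> T \<inter> O'} = V \<inter> (%y. (\<pi> (G y), G y - \<pi> (G y))) -` (S' \<times> T' \<inter> O')"
  using S'(2) T'(2) \<pi>(2,3) by auto
 moreover have "open \<dots>"
  by (rule continuous_open_preimage[OF smooth_on_continuous_on[OF unsum_smooth] V(1)]) (intro open_Int open_Times S' T' O)
 ultimately show ?thesis
  unfolding \<Phi>_image using cinv_open_image[OF c, of "{y \<in> V. (\<pi> (G y), G y - \<pi> (G y)) \<in> S \<times> T \<inter> O'}"] V(2)
  by (auto simp: model_UNIV cimg_def)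
qed

lemma sum_smooth: "smooth_on (S \<times> T) (%z. \<gamma> (fst z + snd z))"
 by (rule smooth_on_compose[OF smooth_on_add[OF smooth_on_fst[OF smooth_on_ident] smooth_on_snd[OF smooth_on_ident]] \<gamma>])
  (use sum_W in blast)

lemma \<Phi>_smooth: "smooth_map_on Q (points Q) M \<Phi>"
 unfolding smooth_map_on_def
proof (intro conjI ballI openin_topspace)
 show "continuous_map (subtopology (mtop Q) (points Q)) (mtop M) \<Phi>"
  unfolding continuous_map_def
 proof (intro conjI allI impI)
  show "\<Phi> \<in> topspace (subtopology (mtop Q) (points Q)) \<rightarrow> points M" using \<Phi>_V(3) by (simp add: Q_simps)
  fix U assume U: "openin (mtop M) U"
  have "{z \<in> S \<times> T. \<Phi> z \<in> U} = S \<times> T \<inter> (%z. \<gamma> (fst z + snd z)) -` (cmap c ` (cdom c \<inter> U))"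
  proof (intro equalityI subsetI)
   fix z assume "z \<in> {z \<in> S \<times> T. \<Phi> z \<in> U}"
   then have z: "z \<in> S \<times> T" "\<Phi> z \<in> U" by auto
   show "z \<in> S \<times> T \<inter> (%z. \<gamma> (fst z + snd z)) -` (cmap c ` (cdom c \<inter> U))"
    using z \<Phi>_V(2)[OF z(1)] \<Phi>_V(4)[OF z(1), symmetric] by (auto intro!: image_eqI[of _ _ "\<Phi> z"])
  next
   fix z assume "z \<in> S \<times> T \<inter> (%z. \<gamma> (fst z + snd z)) -` (cmap c ` (cdom c \<inter> U))"
   then obtain x where z: "z \<in> S \<times> T" "x \<in> cdom c" "x \<in> U" "\<gamma> (fst z + snd z) = cmap c x" by auto
   then show "z \<in> {z \<in> S \<times> T. \<Phi> z \<in> U}" using cinv_cmap[OF c z(2)] by (simp add: sum_map_def)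
  qed
  moreover have "openin (top_of_set (S \<times> T)) \<dots>"
   by (rule continuous_openin_preimage_gen[OF smooth_on_continuous_on[OF sum_smooth] cmap_open[OF c U]])
  ultimately show "openin (subtopology (mtop Q) (points Q)) {x \<in> topspace (subtopology (mtop Q) (points Q)). \<Phi> x \<in> U}"
   by (simp add: Q_simps subtopology_subtopology)
 qed
 fix c' d assume "c' \<in> atlas Q" and d: "d \<in> atlas M"
 then have c': "c' = \<kappa>" by (simp add: Q_simps)
 let ?A = "cdom \<kappa> \<inter> points Q \<inter> \<Phi> -` cdom d"
 have "smooth_on ?A (%z. cmap d (cinv c (\<gamma> (fst z + snd z))))"
 proof (rule smooth_on_compose[OF smooth_on_subset[OF sum_smooth] transition_smooth[OF c d]])
  show "?A \<subseteq> S \<times> T" by (auto simp: Q_simps)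
  show "(%z. \<gamma> (fst z + snd z)) ` ?A \<subseteq> cmap c ` (cdom c \<inter> cdom d)"
  proof
   fix y assume "y \<in> (%z. \<gamma> (fst z + snd z)) ` ?A"
   then obtain z where z: "z \<in> S \<times> T" "\<Phi> z \<in> cdom d" "y = \<gamma> (fst z + snd z)" by (auto simp: Q_simps)
   then show "y \<in> cmap c ` (cdom c \<inter> cdom d)" using \<Phi>_V(2,4)[OF z(1)] by (intro image_eqI[of _ _ "\<Phi> z"]) auto
  qed
 qed
 moreover have "(cmap d \<circ> \<Phi> \<circ> cinv \<kappa>) z = cmap d (cinv c (\<gamma> (fst z + snd z)))" if "z \<in> ?A" for z
  using that cinv_\<kappa>[of z] by (simp add: Q_simps sum_map_def)
 ultimately show "smooth_on (cmap c' ` (cdom c' \<inter> points Q \<inter> \<Phi> -` cdom d)) (cmap d \<circ> \<Phi> \<circ> cinv c')"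
  unfolding c' cmap_\<kappa> using smooth_on_cong[of ?A "cmap d \<circ> \<Phi> \<circ> cinv \<kappa>"] by simp
qed

lemma \<Psi>_smooth: "smooth_map_on M (\<Phi> ` points Q) Q (inv_into (points Q) \<Phi>)"
 unfolding smooth_map_on_def Q_simps(1)
proof (intro conjI ballI)
 let ?U = "\<Phi> ` (S \<times> T)"
 show U: "openin (mtop M) ?U" using \<Phi>_open[of UNIV] by simp
 have UM: "?U \<subseteq> points M" by (rule openin_subset[OF U])
 have inv: "inv_into (S \<times> T) \<Phi> x = unsum x" if "x \<in> ?U" for x using inv_\<Phi>[OF that] by (simp add: Q_simps)
 show "continuous_map (subtopology (mtop M) ?U) (mtop Q) (inv_into (S \<times> T) \<Phi>)"
  unfolding continuous_map_def
 proof (intro conjI allI impI)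
  show "inv_into (S \<times> T) \<Phi> \<in> topspace (subtopology (mtop M) ?U) \<rightarrow> points Q"
   by (auto simp: Q_simps(1) inv_into_into)
  fix O'' assume "openin (mtop Q) O''"
  then obtain O' where O': "open O'" "O'' = S \<times> T \<inter> O'" unfolding Q_simps openin_open by blast
  have "{x \<in> topspace (subtopology (mtop M) ?U). inv_into (S \<times> T) \<Phi> x \<in> O''} = \<Phi> ` (S \<times> T \<inter> O')"
   using UM by (auto simp: inv unsum_\<Phi> O'(2))
  then show "openin (subtopology (mtop M) ?U) {x \<in> topspace (subtopology (mtop M) ?U). inv_into (S \<times> T) \<Phi> x \<in> O''}"
   using \<Phi>_open[OF O'(1)] openin_open_subtopology[OF U] by auto
 qed
 fix d c' assume d: "d \<in> atlas M" and "c' \<in> atlas Q"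
 then have c': "c' = \<kappa>" by (simp add: Q_simps)
 let ?A = "cmap d ` (cdom d \<inter> ?U \<inter> inv_into (S \<times> T) \<Phi> -` cdom \<kappa>)"
 have A: "cinv d y \<in> ?U" "cmap c (cinv d y) \<in> V" "y \<in> cmap d ` (cdom d \<inter> cdom c)" if "y \<in> ?A" for y
 proof -
  obtain x where x: "x \<in> cdom d" "x \<in> ?U" "y = cmap d x" using \<open>y \<in> ?A\<close> by blast
  have dx: "cinv d y = x" using cinv_cmap[OF d x(1)] x(3) by simp
  show "cinv d y \<in> ?U" using dx x by simp
  obtain z where z: "z \<in> S \<times> T" "x = \<Phi> z" using x(2) by blast
  show "cmap c (cinv d y) \<in> V" using dx \<Phi>_V(1,4)[OF z(1)] z(2) by simp
  show "y \<in> cmap d ` (cdom d \<inter> cdom c)" using x(1,3) \<Phi>_V(2)[OF z(1)] z(2) by (intro image_eqI[of _ _ x]) simp_all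
 qed
 have "smooth_on ?A (%y. unsum (cinv d y))"
  unfolding unsum_def
  by (rule smooth_on_compose[OF smooth_on_subset[OF transition_smooth[OF d c]] unsum_smooth]) (use A in blast)+
 moreover have "(cmap \<kappa> \<circ> inv_into (S \<times> T) \<Phi> \<circ> cinv d) y = unsum (cinv d y)" if "y \<in> ?A" for y
  using inv[OF A(1)[OF that]] by (simp add: Q_simps)
 ultimately show "smooth_on (cmap d ` (cdom d \<inter> ?U \<inter> inv_into (S \<times> T) \<Phi> -` cdom c')) (cmap c' \<circ> inv_into (S \<times> T) \<Phi> \<circ> cinv d)"
  unfolding c' using smooth_on_cong[of ?A "cmap \<kappa> \<circ> inv_into (S \<times> T) \<Phi> \<circ> cinv d"] by simp
qed

lemma embedding: "open_embedding Q M \<Phi>"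
 unfolding open_embedding_def using \<Phi>_smooth \<Psi>_smooth inj_\<Phi> by blast

sublocale emb: embedded_chart M g Q \<Phi> c \<kappa>
 by unfold_locales (use charted_Q embedding c in \<open>auto simp: Q_simps\<close>)

lemma \<kappa>_at: "z \<in> S \<times> T ==> \<kappa> \<in> charts_at Q z"
 by (simp add: charts_at_def Q_simps)

lemma d\<Phi>_component:
 assumes z: "z \<in> S \<times> T" and v: "v \<in> tangent_space Q z"
 shows "differential Q M \<Phi> z v c = ddir \<gamma> (fst z + snd z) (fst (v \<kappa>) + snd (v \<kappa>))"
proof -
 let ?s = "%z::'e \<times> 'e. fst z + snd z"
 have s: "bounded_linear ?s" by (intro bounded_linear_add bounded_linear_fst bounded_linear_snd)
 have "differential Q M \<Phi> z v c = ddir (%y. cmap c (\<Phi> (cinv \<kappa> y))) z (v \<kappa>)"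
  using emb.phi.differential_component[OF _ v \<kappa>_at[OF z] \<Phi>_V(5)[OF z]] z by (simp add: Q_simps)
 also have "\<dots> = ddir (%y. \<gamma> (?s y)) z (v \<kappa>)"
 proof (rule ddir_cong_subspace)
  show "subspace (E \<times> F)" using subspace_Times E F by blast
  show "openin (top_of_set (E \<times> F)) (S \<times> T)" by (rule openin_Times[OF S(1) T(1)])
  show "v \<kappa> \<in> E \<times> F" using emb.P.tangent_model[OF v \<kappa>_at[OF z]] by (simp add: Q_simps)
  show "cmap c (\<Phi> (cinv \<kappa> y)) = \<gamma> (?s y)" if "y \<in> S \<times> T" for y using cinv_\<kappa>[OF that] \<Phi>_V(4)[OF that] by simp
 qed (rule z)
 also have "\<dots> = ddir \<gamma> (?s z) (ddir ?s z (v \<kappa>))"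
  by (rule ddir_compose[OF bounded_linear_imp_differentiable[OF s] d\<gamma>[OF sum_W[OF z]]])
 finally show ?thesis by (simp add: ddir_bounded_linear[OF s])
qed

lemma pullback_k:
 assumes z: "z \<in> S \<times> T" and v: "v \<in> tangent_space Q z" and w: "w \<in> tangent_space Q z"
 shows "pullback Q M \<Phi> g z v w = k (fst z + snd z) (fst (v \<kappa>) + snd (v \<kappa>)) (fst (w \<kappa>) + snd (w \<kappa>))"
proof -
 have zQ: "z \<in> points Q" using z by (simp add: Q_simps)
 show ?thesis
  unfolding pullback_def metric_gch[OF \<Phi>_V(5)[OF z] emb.phi.differential_tangent[OF zQ v] emb.phi.differential_tangent[OF zQ w]]
  by (simp add: d\<Phi>_component[OF z] v w \<Phi>_V(4)[OF z] k_def)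
qed

lemma tangent_Q: "z \<in> S \<times> T ==> v \<in> tangent_space Q z ==> fst (v \<kappa>) \<in> E \<and> snd (v \<kappa>) \<in> F"
 using emb.P.tangent_model[OF _ \<kappa>_at] by (auto simp: Q_simps mem_Times_iff)

lemma pullback_metric: "riemannian_metric Q (pullback Q M \<Phi> g)"
proof (rule chart_metric[where e = \<kappa> and L = "%u. fst u + snd u" and B = "%z. k (fst z + snd z)", OF charted_Q Q_simps(4)])
 show "linear (%u::'e \<times> 'e. fst u + snd u)" by (intro linear_compose_add linear_fst linear_snd)
 show "u = 0" if "u \<in> model Q" "fst u + snd u = 0" for u
 proof -
  have u: "fst u \<in> E" "snd u \<in> F" using that by (auto simp: Q_simps)
  have "fst u = - snd u" using that(2) by (simp add: add_eq_0_iff2)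
  then have "fst u \<in> E \<inter> F" using u(1) subspace_neg[OF F u(2)] by simp
  then have "fst u = 0" unfolding EF by simp
  then show ?thesis using that(2) by (simp add: prod_eq_iff)
 qed
 show "smooth_on (cmap \<kappa> ` cdom \<kappa>) (%z. k (fst z + snd z) a b)" for a b
  unfolding cmap_\<kappa> Q_simps
  by (rule smooth_on_compose[OF smooth_on_add[OF smooth_on_fst[OF smooth_on_ident] smooth_on_snd[OF smooth_on_ident]] k_smooth])
   (use sum_W in blast)
 show "pullback Q M \<Phi> g x v w = k (fst (cmap \<kappa> x) + snd (cmap \<kappa> x)) (fst (v \<kappa>) + snd (v \<kappa>)) (fst (w \<kappa>) + snd (w \<kappa>))"
  if "x \<in> points Q" "v \<in> tangent_space Q x" "w \<in> tangent_space Q x" for x v w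
  using pullback_k that by (simp only: Q_simps(1,6))
qed (use k_linear1[OF sum_W] k_sym[OF sum_W] k_pos[OF sum_W] in \<open>simp_all only: cmap_\<kappa> Q_simps\<close>)

text \<open>The metrics induced on the slices S + q0 and p0 + T. Parallel slices carry conformal
  metrics by \<open>k_ratio\<close>, so the choice of slice does not affect the conformal
  class.\<close>

definition "g1 x v w = k (x + q0) (v (S, id)) (w (S, id))"
definition "g2 x v w = k (p0 + x) (v (T, id)) (w (T, id))"

lemma factor_metrics: "riemannian_metric M1 g1" "riemannian_metric M2 g2"
proof -
 have W1: "x + q0 \<in> W" if "x \<in> S" for x using ST[OF that T(3)] .
 show "riemannian_metric M1 g1"
 proof (rule chart_metric[where e = "(S, id)" and L = "%u. u" and B = "%x. k (x + q0)", OF smooth_manifold_charted[OF factors(1)] flat_simps(3)])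
  show "smooth_on (cmap (S, id) ` cdom (S, id)) (%x. k (x + q0) a b)" for a b
   using smooth_on_compose[OF smooth_on_add[OF smooth_on_ident[of S] smooth_on_const[of S q0]] k_smooth] W1 by auto
 qed (use k_linear1[OF W1] k_sym[OF W1] k_pos[OF W1] in \<open>simp_all add: g1_def linear_ident\<close>)
 have W2: "p0 + x \<in> W" if "x \<in> T" for x using ST[OF S(3) that] .
 show "riemannian_metric M2 g2"
 proof (rule chart_metric[where e = "(T, id)" and L = "%u. u" and B = "%x. k (p0 + x)", OF smooth_manifold_charted[OF factors(2)] flat_simps(3)])
  show "smooth_on (cmap (T, id) ` cdom (T, id)) (%x. k (p0 + x) a b)" for a b
   using smooth_on_compose[OF smooth_on_add[OF smooth_on_const[of T p0] smooth_on_ident[of T]] k_smooth] W2 by auto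
 qed (use k_linear1[OF W2] k_sym[OF W2] k_pos[OF W2] in \<open>simp_all add: g2_def linear_ident\<close>)
qed

end

section \<open>Horizontal spaces and conformality of the projections\<close>

context product_box
begin

lemma sum_mem: assumes "a \<in> E" "b \<in> F" shows "a + b \<in> E \<longleftrightarrow> b = 0" "a + b \<in> F \<longleftrightarrow> a = 0"
proof -
 have "b \<in> E \<inter> F" if "a + b \<in> E" using subspace_diff[OF E that assms(1)] assms(2) by simp
 then show "a + b \<in> E \<longleftrightarrow> b = 0" using assms(1) by (auto simp: EF)
 have "a \<in> E \<inter> F" if "a + b \<in> F" using subspace_diff[OF F that assms(2)] assms(1) by simp
 then show "a + b \<in> F \<longleftrightarrow> a = 0" using assms(2) by (auto simp: EF)
qed

lemma d\<Phi>_mem: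
 assumes z: "z \<in> S \<times> T" and u: "u \<in> tangent_space Q z"
 shows "differential Q M \<Phi> z u \<in> H (\<Phi> z) \<longleftrightarrow> snd (u \<kappa>) = 0" "differential Q M \<Phi> z u \<in> K (\<Phi> z) \<longleftrightarrow> fst (u \<kappa>) = 0"
proof -
 let ?y = "\<gamma> (fst z + snd z)" and ?v = "differential Q M \<Phi> z u"
 have zQ: "z \<in> points Q" using z by (simp add: Q_simps)
 have y: "?y \<in> V" "G ?y = fst z + snd z" using \<Phi>_V(1)[OF z] G_\<gamma>[OF sum_W[OF z]] by blast+
 have v: "?v \<in> tangent_space M (cinv c ?y)" using emb.phi.differential_tangent[OF zQ u] by (simp add: sum_map_def)
 have "ddir G ?y (?v c) = fst (u \<kappa>) + snd (u \<kappa>)" using dG_d\<gamma>[OF y(1)] by (simp add: d\<Phi>_component[OF z u] y(2))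
 then show "?v \<in> H (\<Phi> z) \<longleftrightarrow> snd (u \<kappa>) = 0" "?v \<in> K (\<Phi> z) \<longleftrightarrow> fst (u \<kappa>) = 0"
  using H_iff[OF y(1) v] K_iff[OF y(1) v] sum_mem tangent_Q[OF z u] by (simp_all add: sum_map_def)
qed

text \<open>The differential of an open embedding is onto, and \<open>d\<Phi>_mem\<close> recognizes
  the vectors of \<open>H\<close> and \<open>K\<close> by their components in the product.\<close>

lemma HK_image:
 assumes z: "z \<in> S \<times> T"
 shows "H (\<Phi> z) = differential Q M \<Phi> z ` {u \<in> tangent_space Q z. snd (u \<kappa>) = 0}"
  "K (\<Phi> z) = differential Q M \<Phi> z ` {u \<in> tangent_space Q z. fst (u \<kappa>) = 0}"
proof -
 have zQ: "z \<in> points Q" using z by (simp add: Q_simps)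
 have "\<exists>u\<in>tangent_space Q z. v = differential Q M \<Phi> z u" if v: "v \<in> tangent_space M (\<Phi> z)" for v
 proof -
  have x: "\<Phi> z \<in> \<Phi> ` points Q" using zQ by blast
  have inv: "emb.\<Psi> (\<Phi> z) = z" using inv_into_f_f[OF inj_\<Phi> zQ] .
  show ?thesis using emb.d\<Phi>_d\<Psi>[OF x v] emb.psi.differential_tangent[OF x v] unfolding inv by metis
 qed
 then show "H (\<Phi> z) = differential Q M \<Phi> z ` {u \<in> tangent_space Q z. snd (u \<kappa>) = 0}"
  "K (\<Phi> z) = differential Q M \<Phi> z ` {u \<in> tangent_space Q z. fst (u \<kappa>) = 0}"
  using d\<Phi>_mem[OF z] H_tangent[OF \<Phi>_V(3)[OF z]] K_tangent[OF \<Phi>_V(3)[OF z]] by blast+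
qed

lemma projections_smooth: "smooth_map_on Q (points Q) M1 fst" "smooth_map_on Q (points Q) M2 snd"
proof -
 have s: "smooth_on A (id \<circ> fst \<circ> cinv \<kappa>)" "smooth_on A (id \<circ> snd \<circ> cinv \<kappa>)" if "A \<subseteq> S \<times> T" for A
  using smooth_on_cong[of A "id \<circ> fst \<circ> cinv \<kappa>" fst] smooth_on_cong[of A "id \<circ> snd \<circ> cinv \<kappa>" snd] cinv_\<kappa> that
   smooth_on_fst[OF smooth_on_ident[of A]] smooth_on_snd[OF smooth_on_ident[of A]] by (auto simp: subset_iff)
 show "smooth_map_on Q (points Q) M1 fst"
  unfolding smooth_map_on_def
 proof (intro conjI ballI openin_topspace)
  show "continuous_map (subtopology (mtop Q) (points Q)) (mtop M1) fst"
   by (simp only: subtopology_topspace mtop_prod continuous_map_fst)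
  show "smooth_on (cmap c' ` (cdom c' \<inter> points Q \<inter> fst -` cdom d)) (cmap d \<circ> fst \<circ> cinv c')"
   if "c' \<in> atlas Q" "d \<in> atlas M1" for c' d
  proof -
   have "c' = \<kappa>" "d = (S, id)" using that by (simp_all add: Q_simps(4) flat_simps)
   then show ?thesis by (simp only: cmap_\<kappa> snd_conv) (rule s(1), auto simp: Q_simps)
  qed
 qed
 show "smooth_map_on Q (points Q) M2 snd"
  unfolding smooth_map_on_def
 proof (intro conjI ballI openin_topspace)
  show "continuous_map (subtopology (mtop Q) (points Q)) (mtop M2) snd"
   by (simp only: subtopology_topspace mtop_prod continuous_map_snd)
  show "smooth_on (cmap c' ` (cdom c' \<inter> points Q \<inter> snd -` cdom d)) (cmap d \<circ> snd \<circ> cinv c')"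
   if "c' \<in> atlas Q" "d \<in> atlas M2" for c' d
  proof -
   have "c' = \<kappa>" "d = (T, id)" using that by (simp_all add: Q_simps(4) flat_simps)
   then show ?thesis by (simp only: cmap_\<kappa> snd_conv) (rule s(2), auto simp: Q_simps)
  qed
 qed
qed

lemma rep: "z \<in> cdom \<kappa> ==> fst z \<in> cdom (S, id) \<and> cmap (S, id) (fst z) = fst (cmap \<kappa> z)"
 "z \<in> cdom \<kappa> ==> snd z \<in> cdom (T, id) \<and> cmap (T, id) (snd z) = snd (cmap \<kappa> z)"
 by (auto simp: Q_simps)

lemma charted_factors: "charted M1" "charted M2"
 using smooth_manifold_charted factors by blast+

lemma \<kappa>_atlas: "\<kappa> \<in> atlas Q" and S_atlas: "(S, id) \<in> atlas M1" and T_atlas: "(T, id) \<in> atlas M2"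
 by (simp_all add: Q_simps(4) flat_simps)

lemma kernels:
 assumes z: "z \<in> S \<times> T"
 shows "ker_differential Q M1 fst z = {v \<in> tangent_space Q z. fst (v \<kappa>) = 0}"
  "ker_differential Q M2 snd z = {v \<in> tangent_space Q z. snd (v \<kappa>) = 0}"
proof -
 have zc: "z \<in> cdom \<kappa>" using z by (simp add: Q_simps)
 show "ker_differential Q M1 fst z = {v \<in> tangent_space Q z. fst (v \<kappa>) = 0}"
  by (rule ker_differential_linear[OF charted_Q charted_factors(1) projections_smooth(1) \<kappa>_atlas S_atlas bounded_linear_fst rep(1) zc])
 show "ker_differential Q M2 snd z = {v \<in> tangent_space Q z. snd (v \<kappa>) = 0}"
  by (rule ker_differential_linear[OF charted_Q charted_factors(2) projections_smooth(2) \<kappa>_atlas T_atlas bounded_linear_snd rep(2) zc])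
qed

text \<open>A vector orthogonal to one factor is tested against its own component in that factor,
  which positivity forces to be 0; the converse is \<open>k_orth\<close>.\<close>

lemma horizontal:
 assumes z: "z \<in> S \<times> T" and v: "v \<in> tangent_space Q z"
 shows "(\<forall>w\<in>tangent_space Q z. fst (w \<kappa>) = 0 \<longrightarrow> pullback Q M \<Phi> g z v w = 0) \<longleftrightarrow> v \<kappa> \<in> E \<times> {0}"
  "(\<forall>w\<in>tangent_space Q z. snd (w \<kappa>) = 0 \<longrightarrow> pullback Q M \<Phi> g z v w = 0) \<longleftrightarrow> v \<kappa> \<in> {0} \<times> F"
proof -
 let ?w = "fst z + snd z"
 note w = sum_W[OF z] and ab = tangent_Q[OF z v]
 have kE: "k ?w (a + b) a' = k ?w a a'" if "a' \<in> E" "b \<in> F" for a a' b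
  using k_orth[OF w that] k_sym[OF w, of b a'] by (simp add: linear_add[OF k_linear1[OF w]])
 have kF: "k ?w (a + b) b' = k ?w b b'" if "a \<in> E" "b' \<in> F" for a b b'
  using k_orth[OF w that] by (simp add: linear_add[OF k_linear1[OF w]])
 have cv: "coord_vec Q \<kappa> u z \<in> tangent_space Q z" "coord_vec Q \<kappa> u z \<kappa> = u" if "u \<in> E \<times> F" for u
  using emb.P.coord_vec_tangent[OF \<kappa>_at[OF z]] emb.P.coord_vec_self[OF \<kappa>_at[OF z]] that by (simp_all add: Q_simps(3))
 note pk = pullback_k[OF z v]
 show "(\<forall>w\<in>tangent_space Q z. fst (w \<kappa>) = 0 \<longrightarrow> pullback Q M \<Phi> g z v w = 0) \<longleftrightarrow> v \<kappa> \<in> E \<times> {0}"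
 proof
  assume h: "\<forall>w\<in>tangent_space Q z. fst (w \<kappa>) = 0 \<longrightarrow> pullback Q M \<Phi> g z v w = 0"
  have m: "(0, snd (v \<kappa>)) \<in> E \<times> F" using ab subspace_0[OF E] by simp
  have "k ?w (snd (v \<kappa>)) (snd (v \<kappa>)) = 0"
   using h[rule_format, OF cv(1)[OF m]] pk[OF cv(1)[OF m]] cv(2)[OF m] ab by (simp add: kF)
  then have "snd (v \<kappa>) = 0" using k_pos[OF w, of "snd (v \<kappa>)"] by force
  then show "v \<kappa> \<in> E \<times> {0}" using ab by (simp add: mem_Times_iff)
 qed (use pk tangent_Q[OF z] in \<open>auto simp: mem_Times_iff k_orth[OF w]\<close>)
 show "(\<forall>w\<in>tangent_space Q z. snd (w \<kappa>) = 0 \<longrightarrow> pullback Q M \<Phi> g z v w = 0) \<longleftrightarrow> v \<kappa> \<in> {0} \<times> F"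
 proof
  assume h: "\<forall>w\<in>tangent_space Q z. snd (w \<kappa>) = 0 \<longrightarrow> pullback Q M \<Phi> g z v w = 0"
  have m: "(fst (v \<kappa>), 0) \<in> E \<times> F" using ab subspace_0[OF F] by simp
  have "k ?w (fst (v \<kappa>)) (fst (v \<kappa>)) = 0"
   using h[rule_format, OF cv(1)[OF m]] pk[OF cv(1)[OF m]] cv(2)[OF m] ab by (simp add: kE)
  then have "fst (v \<kappa>) = 0" using k_pos[OF w, of "fst (v \<kappa>)"] by force
  then show "v \<kappa> \<in> {0} \<times> F" using ab by (simp add: mem_Times_iff)
 next
  assume v0: "v \<kappa> \<in> {0} \<times> F"
  have "k ?w (snd (v \<kappa>)) a = 0" if "a \<in> E" for a
   using k_orth[OF w that, of "snd (v \<kappa>)"] k_sym[OF w] v0 by auto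
  then show "\<forall>w\<in>tangent_space Q z. snd (w \<kappa>) = 0 \<longrightarrow> pullback Q M \<Phi> g z v w = 0"
   using pk tangent_Q[OF z] v0 by (auto simp: mem_Times_iff)
 qed
qed

lemma nonzero_vector: assumes "dim (X :: 'e set) \<ge> 1" obtains a where "a \<in> X" "a \<noteq> 0"
 using assms dim_eq_0[of X] by (metis not_one_le_zero singletonI subsetI)

text \<open>Projecting to the first factor compares the metric at \<open>z\<close> with that at the
  point (fst z, q0). A segment in direction \<open>F\<close> joins the two, and along it the
  coefficients on \<open>E\<close> change by a common factor; the second factor is treated in the
  same way along \<open>E\<close>.\<close>

lemma product:
 assumes conf: "conformal_along M g \<theta> K H" "conformal_along M g \<theta>' H K"
 shows "conformal_product M1 (conformal_rel M1 `` {g1}) M2 (conformal_rel M2 `` {g2}) (conformal_rel Q `` {pullback Q M \<Phi> g})"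
proof -
 interpret s': straightened M K H g c V W G \<gamma> F E by (rule swap')
 let ?C = "conformal_rel Q `` {pullback Q M \<Phi> g}"
 note cls = conformal_class_of_metric[OF pullback_metric] conformal_class_of_metric[OF factor_metrics(1)] conformal_class_of_metric[OF factor_metrics(2)]
 have mem: "pullback Q M \<Phi> g \<in> ?C" "g1 \<in> conformal_rel M1 `` {g1}" "g2 \<in> conformal_rel M2 `` {g2}"
  using conformal_rel_refl pullback_metric factor_metrics by blast+
 have d: "points Q = cdom \<kappa>" by (simp only: Q_simps(1,5))
 have add: "p + u \<in> W" if "closed_segment q q' \<subseteq> T" "p \<in> S" "u \<in> closed_segment q q'" for p u q q'
  using ST that by blast
 have "\<exists>l>0. \<forall>v\<in>tangent_space Q z. \<forall>w\<in>tangent_space Q z. v \<kappa> \<in> E \<times> {0} \<longrightarrow> w \<kappa> \<in> E \<times> {0} \<longrightarrow>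
   g1 (fst z) (differential Q M1 fst z v) (differential Q M1 fst z w) = l * pullback Q M \<Phi> g z v w" if "z \<in> points Q" for z
 proof -
  have z: "z \<in> S \<times> T" and zc: "z \<in> cdom \<kappa>" using that by (simp_all only: Q_simps(1,5))
  have pq: "fst z \<in> S" "snd z \<in> T" using z by auto
  obtain a0 where a0: "a0 \<in> E" "a0 \<noteq> 0" using nonzero_vector[OF dims(1)] by blast
  have "closed_segment (fst z + snd z) (fst z + q0) = (+) (fst z) ` closed_segment (snd z) q0"
   by (rule closed_segment_translation)
  then have "closed_segment (fst z + snd z) (fst z + q0) \<subseteq> W"
   using closed_segment_subset[OF pq(2) T(3,2)] ST[OF pq(1)] by auto
  moreover have "fst z + q0 - (fst z + snd z) \<in> F" using subspace_diff[OF F] pq T(3) T_F by auto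
  ultimately obtain l where l: "l > 0" "!!a b. a \<in> E ==> b \<in> E ==> k (fst z + q0) a b = l * k (fst z + snd z) a b"
   using k_ratio[OF conf(1) _ _ a0] by metis
  have "differential Q M1 fst z v (S, id) = fst (v \<kappa>)" if "v \<in> tangent_space Q z" for v
   by (rule differential_linear_component[OF charted_Q charted_factors(1) projections_smooth(1) \<kappa>_atlas S_atlas bounded_linear_fst rep(1) zc that])
  then show ?thesis using l by (intro exI[of _ l]) (auto simp: g1_def pullback_k[OF z] mem_Times_iff)
 qed
 from linear_conformal_submersion[OF charted_Q charted_factors(1) projections_smooth(1) \<kappa>_atlas d S_atlas bounded_linear_fst rep(1)
   cls(1) mem(1) cls(2) mem(2) _ _ _ this]
 have 1: "conformal_submersion Q ?C M1 (conformal_rel M1 `` {g1}) fst"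
  using horizontal(1) subspace_0[OF F] by (force simp: Q_simps(1,3) flat_simps bij_betw_def inj_on_def)
 have "\<exists>l>0. \<forall>v\<in>tangent_space Q z. \<forall>w\<in>tangent_space Q z. v \<kappa> \<in> {0} \<times> F \<longrightarrow> w \<kappa> \<in> {0} \<times> F \<longrightarrow>
   g2 (snd z) (differential Q M2 snd z v) (differential Q M2 snd z w) = l * pullback Q M \<Phi> g z v w" if "z \<in> points Q" for z
 proof -
  have z: "z \<in> S \<times> T" and zc: "z \<in> cdom \<kappa>" using that by (simp_all only: Q_simps(1,5))
  have pq: "fst z \<in> S" "snd z \<in> T" using z by auto
  obtain b0 where b0: "b0 \<in> F" "b0 \<noteq> 0" using nonzero_vector[OF dims(2)] by blast
  have "closed_segment (snd z + fst z) (snd z + p0) = (+) (snd z) ` closed_segment (fst z) p0"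
   by (rule closed_segment_translation)
  then have "closed_segment (fst z + snd z) (p0 + snd z) \<subseteq> W"
   using closed_segment_subset[OF pq(1) S(3,2)] ST[OF _ pq(2)] by (auto simp: add.commute)
  moreover have "p0 + snd z - (fst z + snd z) \<in> E" using subspace_diff[OF E] pq S(3) S_E by auto
  ultimately obtain l where l: "l > 0" "!!a b. a \<in> F ==> b \<in> F ==> k (p0 + snd z) a b = l * k (fst z + snd z) a b"
   using s'.k_ratio[OF conf(2) _ _ b0] by metis
  have "differential Q M2 snd z v (T, id) = snd (v \<kappa>)" if "v \<in> tangent_space Q z" for v
   by (rule differential_linear_component[OF charted_Q charted_factors(2) projections_smooth(2) \<kappa>_atlas T_atlas bounded_linear_snd rep(2) zc that])
  then show ?thesis using l by (intro exI[of _ l]) (auto simp: g2_def pullback_k[OF z] mem_Times_iff)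
 qed
 from linear_conformal_submersion[OF charted_Q charted_factors(2) projections_smooth(2) \<kappa>_atlas d T_atlas bounded_linear_snd rep(2)
   cls(1) mem(1) cls(3) mem(3) _ _ _ this]
 have 2: "conformal_submersion Q ?C M2 (conformal_rel M2 `` {g2}) snd"
  using horizontal(2) subspace_0[OF E] by (force simp: Q_simps(1,3) flat_simps bij_betw_def inj_on_def)
 have "h z v w = 0" if h: "h \<in> ?C" and z: "z \<in> points Q" and v: "v \<in> ker_differential Q M1 fst z" and w: "w \<in> ker_differential Q M2 snd z" for h z v w
 proof -
  have zS: "z \<in> S \<times> T" using z by (simp only: Q_simps(1))
  have t: "v \<in> tangent_space Q z" "w \<in> tangent_space Q z" "fst (v \<kappa>) = 0" "snd (w \<kappa>) = 0" using v w by (auto simp: kernels[OF zS])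
  have "v \<kappa> \<in> {0} \<times> F" using t tangent_Q[OF zS t(1)] by (simp add: mem_Times_iff)
  from horizontal(2)[OF zS t(1), THEN iffD2, OF this, rule_format, OF t(2,4)]
  have "pullback Q M \<Phi> g z v w = 0" .
  moreover obtain f where "\<forall>x\<in>points Q. f x > 0 \<and> (\<forall>v\<in>tangent_space Q x. \<forall>w\<in>tangent_space Q x. h x v w = f x * pullback Q M \<Phi> g x v w)"
   by (rule conformal_class_factor[OF cls(1) mem(1) h])
  ultimately show ?thesis using z t by simp
 qed
 then show ?thesis
  unfolding conformal_product_def using factors dims cls 1 2 by (simp add: flat_simps)
qed

end

context manifold
begin

theorem conformal_foliations_local_product:
 assumes C: "C \<in> conformal_structures M" and S: "orthogonal_splitting M C (H, K)" and g: "g \<in> C"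
  and fol: "conformal_foliations M g \<theta> H K"
 shows "local_conformal_product M C (H, K)"
 unfolding local_conformal_product_def prod.case
proof (intro conjI ballI)
 interpret s: orth_splitting M H K g by (rule orthogonal_splittingD[OF C S g])
 note fol' = fol[unfolded conformal_foliations_def]
 show "H \<in> extensional (points M)" "K \<in> extensional (points M)"
  using s.H s.K by (simp_all add: smooth_distribution_def)
 fix x0 assume x0: "x0 \<in> points M"
 obtain c where ch: "c \<in> charts_at M x0" using chart_exists[OF x0] by blast
 note c = charts_atD[OF ch]
 define y0 where "y0 = cmap c x0"
 have y0: "y0 \<in> cimg c" "cinv c y0 = x0" using cimg_cmap[OF c(2)] cinv_cmap[OF c] by (simp_all add: y0_def)
 let ?E = "s.hc c y0" and ?F = "s.kc c y0" and ?\<pi> = "s.prj c y0"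
 obtain V W G \<gamma> where yV: "y0 \<in> V" and st: "straightened M H K g c V W G \<gamma> ?E ?F"
  using s.straightening[OF _ _ c(1) y0(1)] fol' by metis
 interpret st: straightened M H K g c V W G \<gamma> ?E ?F by (rule st)
 define w0 where "w0 = G y0"
 have w0: "w0 \<in> W" unfolding w0_def by (rule st.G_W[OF yV])
 obtain r where r: "r > 0" "ball w0 r \<subseteq> W" using st.W w0 open_contains_ball by blast
 define p0 where "p0 = ?\<pi> w0"
 define q0 where "q0 = w0 - p0"
 have pq0: "p0 \<in> ?E" "q0 \<in> ?F" unfolding p0_def q0_def using s.prj_mem[OF c(1) y0(1)] by blast+
 \<comment> \<open>Since p0 + q0 = w0, errors below r/2 in both components add up to less than
   \<open>r\<close>, so sums stay in \<open>W\<close>.\<close>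
 define S where "S = ?E \<inter> ball p0 (r / 2)"
 define T where "T = ?F \<inter> ball q0 (r / 2)"
 have ST: "p + q \<in> W" if "p \<in> S" "q \<in> T" for p q
 proof -
  have "dist w0 (p + q) = norm ((p0 - p) + (q0 - q))" by (simp add: dist_norm q0_def algebra_simps)
  also have "\<dots> \<le> norm (p0 - p) + norm (q0 - q)" by (rule norm_triangle_ineq)
  also have "\<dots> < r" using that by (simp add: S_def T_def dist_norm)
  finally show ?thesis using r(2) by auto
 qed
 have dims: "dim ?E \<ge> 1" "dim ?F \<ge> 1"
 proof -
  have d1: "dim X \<ge> 1" if "\<exists>u\<in>X. u \<noteq> 0" for X :: "'e set"
  proof (rule ccontr)
   assume "\<not> dim X \<ge> 1"
   then have "dim X = 0" by linarith
   then have "X \<subseteq> {0}" by (rule dim_eq_0[THEN iffD1])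
   then show False using that by blast
  qed
  have "\<exists>u\<in>X c. u \<noteq> 0" if X: "!!v. v \<in> X' ==> v \<in> tangent_space M x0 \<and> v c \<in> X c" "tzero \<in> X'" "X' \<noteq> {tzero}" for X X'
  proof -
   obtain v where v: "v \<in> X'" "v \<noteq> tzero" using X(2,3) by blast
   then have "v c \<noteq> 0" using tangent_eqI[OF _ tangent_zero ch, of v] X(1) by auto
   then show ?thesis using X(1) v(1) by blast
  qed
  note nz = this
  have "\<exists>u\<in>?E. u \<noteq> 0"
   by (rule nz[of "H x0" "%c. ?E"]) (use s.H_tangent[OF x0] distribution_zero[OF s.H x0] s.H_nonzero[OF x0] in \<open>auto simp: s.hc_def y0(2)\<close>)
  then show "dim ?E \<ge> 1" by (rule d1)
  have "\<exists>u\<in>?F. u \<noteq> 0"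
   by (rule nz[of "K x0" "%c. ?F"]) (use s.K_tangent[OF x0] distribution_zero[OF s.K x0] s.K_nonzero[OF x0] in \<open>auto simp: s.kc_def y0(2)\<close>)
  then show "dim ?F \<ge> 1" by (rule d1)
 qed
 \<comment> \<open>The straightened coordinates do not depend on the metric, so one box serves all
   metrics of the class. This makes the pull-back of each of them Riemannian, as membership in the
   class of the product requires.\<close>
 have box: "product_box M H K h c V W G \<gamma> ?E ?F ?\<pi> S T p0 q0" if h: "h \<in> C" for h
 proof -
  interpret h: orth_splitting M H K h by (rule orthogonal_splittingD[OF C S h])
  interpret h: straightened M H K h c V W G \<gamma> ?E ?F
   by unfold_locales (fact st.c st.V st.W st.homeo st.G st.\<gamma> st.E st.F st.H_iff st.K_iff)+
  show ?thesis
  proof unfold_locales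
   note l = s.linear_prj[OF c(1) y0(1)]
   show "?\<pi> (a + b) = ?\<pi> a + ?\<pi> b" "?\<pi> (x *\<^sub>R a) = x *\<^sub>R ?\<pi> a" for a b x by (rule linear_add[OF l] linear_scale[OF l])+
   show "?\<pi> u \<in> ?E" "u - ?\<pi> u \<in> ?F" for u using s.prj_mem[OF c(1) y0(1)] by blast+
   show "?E \<inter> ?F = {0}" by (rule s.hc_kc[OF c(1) y0(1)])
   show "openin (top_of_set ?E) S" "openin (top_of_set ?F) T" unfolding S_def T_def by (rule openin_open_Int[OF open_ball])+
   show "convex S" "convex T" unfolding S_def T_def
    by (intro convex_Int subspace_imp_convex convex_ball st.E st.F)+
   show "p0 \<in> S" "q0 \<in> T" unfolding S_def T_def using pq0 r(1) by simp_all
  qed (fact ST dims)+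
 qed
 interpret b: product_box M H K g c V W G \<gamma> ?E ?F ?\<pi> S T p0 q0 by (rule box[OF g])
 let ?Q = "prod_mfd (flat ?E S) (flat ?F T)" and ?\<Phi> = "sum_map c \<gamma>"
 have cp: "conformal_product (flat ?E S) (conformal_rel (flat ?E S) `` {b.g1}) (flat ?F T) (conformal_rel (flat ?F T) `` {b.g2})
   (conformal_rel ?Q `` {pullback ?Q M ?\<Phi> g})"
  using b.product fol' by blast
 moreover have "open_embedding ?Q M ?\<Phi>" by (rule b.embedding)
 moreover have "x0 \<in> ?\<Phi> ` points ?Q"
 proof (rule image_eqI)
  show "x0 = ?\<Phi> (p0, q0)" using st.\<gamma>_G[OF yV] y0(2) by (simp add: sum_map_def q0_def w0_def)
  show "(p0, q0) \<in> points ?Q" using b.S(3) b.T(3) by (simp add: b.Q_simps(1))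
 qed
 moreover have "\<forall>h\<in>C. pullback ?Q M ?\<Phi> h \<in> conformal_rel ?Q `` {pullback ?Q M ?\<Phi> g}"
 proof
  fix h assume h: "h \<in> C"
  interpret h: product_box M H K h c V W G \<gamma> ?E ?F ?\<pi> S T p0 q0 by (rule box[OF h])
  obtain f where f: "\<forall>x\<in>points M. f x > 0 \<and> (\<forall>v\<in>tangent_space M x. \<forall>w\<in>tangent_space M x. h x v w = f x * g x v w)"
   by (rule conformal_class_factor[OF C g h])
  have "f (?\<Phi> z) > 0 \<and> (\<forall>v\<in>tangent_space ?Q z. \<forall>w\<in>tangent_space ?Q z. pullback ?Q M ?\<Phi> h z v w = f (?\<Phi> z) * pullback ?Q M ?\<Phi> g z v w)"
   if z: "z \<in> points ?Q" for z
   using f b.\<Phi>_V(3)[of z] b.emb.phi.differential_tangent[OF z] z by (simp add: pullback_def b.Q_simps(1))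
  then have "(pullback ?Q M ?\<Phi> g, pullback ?Q M ?\<Phi> h) \<in> conformal_rel ?Q"
   unfolding conformal_rel_iff using b.pullback_metric h.pullback_metric by (intro conjI exI[of _ "%z. f (?\<Phi> z)"]) blast+
  then show "pullback ?Q M ?\<Phi> h \<in> conformal_rel ?Q `` {pullback ?Q M ?\<Phi> g}" by blast
 qed
 moreover have "\<forall>z\<in>points ?Q. H (?\<Phi> z) = differential ?Q M ?\<Phi> z ` ker_differential ?Q (flat ?F T) snd z \<and>
   K (?\<Phi> z) = differential ?Q M ?\<Phi> z ` ker_differential ?Q (flat ?E S) fst z"
 proof
  fix z assume "z \<in> points ?Q"
  then have z: "z \<in> S \<times> T" by (simp only: b.Q_simps(1))
  show "H (?\<Phi> z) = differential ?Q M ?\<Phi> z ` ker_differential ?Q (flat ?F T) snd z \<and>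
   K (?\<Phi> z) = differential ?Q M ?\<Phi> z ` ker_differential ?Q (flat ?E S) fst z"
   unfolding b.kernels[OF z] using b.HK_image[OF z] by blast
 qed
 ultimately show "\<exists>(M1 :: ('e, 'e) mfd) c1 (M2 :: ('e, 'e) mfd) c2 c' \<Phi>.
    conformal_product M1 c1 M2 c2 c' \<and>
    open_embedding (prod_mfd M1 M2) M \<Phi> \<and>
    x0 \<in> \<Phi> ` points (prod_mfd M1 M2) \<and>
    (\<forall>g\<in>C. pullback (prod_mfd M1 M2) M \<Phi> g \<in> c') \<and>
    (\<forall>q\<in>points (prod_mfd M1 M2).
      H (\<Phi> q) = differential (prod_mfd M1 M2) M \<Phi> q ` ker_differential (prod_mfd M1 M2) M2 snd q \<and>
      K (\<Phi> q) = differential (prod_mfd M1 M2) M \<Phi> q ` ker_differential (prod_mfd M1 M2) M1 fst q)"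
  by - (rule exI[of _ "flat ?E S"], rule exI, rule exI[of _ "flat ?F T"], rule exI, rule exI, rule exI, intro conjI; assumption)
qed

end

theorem theorem4p3:
  fixes M :: "('a, 'e::euclidean_space) mfd"
    and c :: "('a, 'e) metric set"
  assumes "smooth_manifold M" and "model M = UNIV"
    and "c \<in> conformal_structures M"
  shows "((\<exists>S. local_conformal_product M c S) \<longleftrightarrow>
           (\<exists>D. weyl_structure M c D \<and> reducible_holonomy M c D)) \<and>
         bij_betw snd
           {(D, S). weyl_structure M c D \<and> reduction M c D S}
           {S. local_conformal_product M c S}"
proof -
 interpret manifold M
  using assms by unfold_locales (auto simp: smooth_manifold_charted smooth_manifold_def)
 \<comment> \<open>\<open>conformal_foliations\<close> refers to one metric, the notions of the
   theorem to the class; any representative can mediate between them.\<close>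
 obtain g where g: "g \<in> c" using conformal_class_nonempty[OF assms(3)] by blast
 have forward: "\<exists>D. weyl_structure M c D \<and> reduction M c D S" if "local_conformal_product M c S" for S
 proof -
  obtain H K where S: "S = (H, K)" by (cases S)
  show ?thesis
   using local_product_conformal_foliations[OF assms(3) g that[unfolded S]] conformal_foliations_weyl[OF assms(3) _ g] S by blast
 qed
 have backward: "local_conformal_product M c S" if D: "weyl_structure M c D" and R: "reduction M c D S" for D S
 proof -
  obtain H K where S: "S = (H, K)" by (cases S)
  obtain \<theta> where "conformal_foliations M g \<theta> H K"
   using weyl_conformal_foliations[OF assms(3) g D R[unfolded S]] by blast
  moreover have "orthogonal_splitting M c (H, K)" using R by (simp add: S reduction_def)
  ultimately show ?thesis using conformal_foliations_local_product[OF assms(3) _ g] S by blast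
 qed
 \<comment> \<open>With the pair of distributions fixed, the Weyl structure has no freedom left,
   which is the injectivity of \<open>snd\<close>; its image is described by \<open>forward\<close>
   and \<open>backward\<close>.\<close>
 have unique: "D = D'" if "weyl_structure M c D" "reduction M c D S" "weyl_structure M c D'" "reduction M c D' S" for D D' S
  using weyl_unique[OF assms(3)] that by (cases S) blast
 have "bij_betw snd {(D, S). weyl_structure M c D \<and> reduction M c D S} {S. local_conformal_product M c S}"
 proof (rule bij_betw_imageI)
  show "inj_on snd {(D, S). weyl_structure M c D \<and> reduction M c D S}"
   by (rule inj_onI) (auto intro: unique)
  show "snd ` {(D, S). weyl_structure M c D \<and> reduction M c D S} = {S. local_conformal_product M c S}"
  proof (intro equalityI subsetI)
   fix S assume "S \<in> {S. local_conformal_product M c S}"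
   then obtain D where "weyl_structure M c D \<and> reduction M c D S" using forward by blast
   then show "S \<in> snd ` {(D, S). weyl_structure M c D \<and> reduction M c D S}" by (intro image_eqI[of _ _ "(D, S)"]) auto
  qed (use backward in auto)
 qed
 moreover have "(\<exists>S. local_conformal_product M c S) \<longleftrightarrow> (\<exists>D. weyl_structure M c D \<and> reducible_holonomy M c D)"
  unfolding reducible_holonomy_def using forward backward by blast
 ultimately show ?thesis by blast
qed

end
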